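(* Assume $\tau_1=\tau_2=\lambda_1$. There exists $\beta_0>0$ such that for every $\beta>\beta_0$ the numbers $c,e,c'$ satisfy $c\le e<c'$.
   Context: Let $\Omega\subset\mathbb R^N$ ($N\le3$) be a bounded smooth domain, $\mu_1,\mu_2>0$, $\beta>0$, $\lambda_1>0$ the principal Dirichlet eigenvalue of $-\Delta$ with eigenfunction $\varphi_1$, and $\tau_1=\tau_2=\lambda_1$. $\mathbf H=H^1_0(\Omega)\times H^1_0(\Omega)$, $\tilde{\mathbf H}=\{(t_1\varphi_1,t_2\varphi_1):t_1,t_2\in\mathbb R\}$, $I(\mathbf u)=\frac12\sum_{i=1}^2\int_\Omega(|\nabla u_i|^2-\lambda_1u_i^2)-\frac14\int_\Omega(\mu_1u_1^4+\mu_2u_2^4+2\beta u_1^2u_2^2)$, whose critical points are weak solutions of system (P): $-\Delta u_1-\lambda_1u_1=\mu_1u_1^3+\beta u_1u_2^2$, $-\Delta u_2-\lambda_1u_2=\mu_2u_2^3+\beta u_1^2u_2$, $u_1=u_2=0$ on $\partial\Omega$. $\mathcal N=\{\mathbf u\in\mathbf H\setminus\tilde{\mathbf H}:I'(\mathbf u)\mathbf u=0,\ I'(\mathbf u)\mathbf v=0\ \forall\mathbf v\in\tilde{\mathbf H}\}$, $c=\inf_{\mathcal N}I$; $\mathcal N'=\{\mathbf u\in\mathbf H\setminus\tilde{\mathbf H}:I(\mathbf u)\ge I(t\mathbf u+\mathbf v)\ \forall t\ge0,\mathbf v\in\tilde{\mathbf H}\}$, $c'=\inf_{\mathcal N'}I$;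 $\mathcal K=\{\mathbf u\in\mathbf H\setminus\tilde{\mathbf H}:I'(\mathbf u)=0\}$, $e=\inf_{\mathcal K}I$. *)

theory Defs
  imports "HOL-Analysis.Analysis"
begin

fun Ck_on :: "nat \<Rightarrow> 'a::euclidean_space set \<Rightarrow> ('a \<Rightarrow> real) \<Rightarrow> bool" where
  "Ck_on 0 S f = continuous_on S f"
| "Ck_on (Suc k) S f =
     ((\<forall>x\<in>S. f differentiable (at x)) \<and>
      (\<forall>b\<in>Basis. Ck_on k S (\<lambda>x. frechet_derivative f (at x) b)))"

definition smooth_on :: "'a::euclidean_space set \<Rightarrow> ('a \<Rightarrow> real) \<Rightarrow> bool" where
  "smooth_on S f \<longleftrightarrow> (\<forall>k. Ck_on k S f)"

definition grad :: "('a::euclidean_space \<Rightarrow> real) \<Rightarrow> 'a \<Rightarrow> 'a" where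
  "grad f x = (\<Sum>b\<in>Basis. frechet_derivative f (at x) b *\<^sub>R b)"

definition test_fun :: "'a::euclidean_space set \<Rightarrow> ('a \<Rightarrow> real) \<Rightarrow> bool" where
  "test_fun \<Omega> \<phi> \<longleftrightarrow> smooth_on UNIV \<phi> \<and> compact (closure {x. \<phi> x \<noteq> 0})
      \<and> closure {x. \<phi> x \<noteq> 0} \<subseteq> \<Omega>"

(* bounded smooth domain: open, bounded, connected, boundary locally the graph of a
   C^infinity function *)
definition smooth_bounded_domain :: "'a::euclidean_space set \<Rightarrow> bool" where
  "smooth_bounded_domain \<Omega> \<longleftrightarrow> open \<Omega> \<and> bounded \<Omega> \<and> connected \<Omega> \<and> \<Omega> \<noteq> {} \<and>
     (\<forall>p\<in>frontier \<Omega>. \<exists>r>0. \<exists>e h. norm e = 1 \<and> smooth_on UNIV h \<and>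
        (\<forall>y. h y = h (y - (y \<bullet> e) *\<^sub>R e)) \<and>
        (\<forall>x\<in>ball p r. x \<in> \<Omega> \<longleftrightarrow> (x - p) \<bullet> e < h (x - p)))"

(* an element of H^1_0(Omega) is represented by a pair (u, weak gradient of u);
   H^1_0(Omega) = closure of C_c^infinity(Omega) in the H^1 norm *)
type_synonym 'a h1 = "('a \<Rightarrow> real) \<times> ('a \<Rightarrow> 'a)"

definition H10 :: "'a::euclidean_space set \<Rightarrow> 'a h1 set" where
  "H10 \<Omega> = {(u, g). u \<in> borel_measurable lebesgue \<and> g \<in> borel_measurable lebesgue \<and>
      (\<exists>\<phi>. (\<forall>n. test_fun \<Omega> (\<phi> n)) \<and>
        (\<lambda>n. \<integral>\<^sup>+ x. ennreal ((\<phi> n x - u x)\<^sup>2 + (norm (grad (\<phi> n) x - g x))\<^sup>2) \<partial>lebesgue)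
          \<longlonglongrightarrow> 0)}"

definition integ :: "'a::euclidean_space set \<Rightarrow> ('a \<Rightarrow> real) \<Rightarrow> real" where
  "integ \<Omega> f = (LINT x:\<Omega>|lebesgue. f x)"

definition dirichlet_eigen :: "'a::euclidean_space set \<Rightarrow> real \<Rightarrow> 'a h1 \<Rightarrow> bool" where
  "dirichlet_eigen \<Omega> lam U \<longleftrightarrow> U \<in> H10 \<Omega> \<and> \<not> (AE x in lebesgue. x \<in> \<Omega> \<longrightarrow> fst U x = 0) \<and>
     (\<forall>V\<in>H10 \<Omega>. integ \<Omega> (\<lambda>x. snd U x \<bullet> snd V x) = lam * integ \<Omega> (\<lambda>x. fst U x * fst V x))"

definition principal_eigen :: "'a::euclidean_space set \<Rightarrow> real \<Rightarrow> 'a h1 \<Rightarrow> bool" where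
  "principal_eigen \<Omega> lam1 \<phi>1 \<longleftrightarrow> dirichlet_eigen \<Omega> lam1 \<phi>1 \<and>
     (\<forall>lam U. dirichlet_eigen \<Omega> lam U \<longrightarrow> lam1 \<le> lam)"

type_synonym 'a hh = "'a h1 \<times> 'a h1"

definition hadd :: "'a::euclidean_space hh \<Rightarrow> 'a hh \<Rightarrow> 'a hh" where
  "hadd U V = (((\<lambda>x. fst (fst U) x + fst (fst V) x), (\<lambda>x. snd (fst U) x + snd (fst V) x)),
               ((\<lambda>x. fst (snd U) x + fst (snd V) x), (\<lambda>x. snd (snd U) x + snd (snd V) x)))"

definition hscale :: "real \<Rightarrow> 'a::euclidean_space hh \<Rightarrow> 'a hh" where
  "hscale t U = (((\<lambda>x. t * fst (fst U) x), (\<lambda>x. t *\<^sub>R snd (fst U) x)),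
                 ((\<lambda>x. t * fst (snd U) x), (\<lambda>x. t *\<^sub>R snd (snd U) x)))"

definition HH :: "'a::euclidean_space set \<Rightarrow> 'a hh set" where
  "HH \<Omega> = H10 \<Omega> \<times> H10 \<Omega>"

definition tvec :: "'a::euclidean_space h1 \<Rightarrow> real \<Rightarrow> real \<Rightarrow> 'a hh" where
  "tvec \<phi>1 t1 t2 = (((\<lambda>x. t1 * fst \<phi>1 x), (\<lambda>x. t1 *\<^sub>R snd \<phi>1 x)),
                    ((\<lambda>x. t2 * fst \<phi>1 x), (\<lambda>x. t2 *\<^sub>R snd \<phi>1 x)))"

definition in_Ht :: "'a::euclidean_space set \<Rightarrow> 'a h1 \<Rightarrow> 'a hh \<Rightarrow> bool" where
  "in_Ht \<Omega> \<phi>1 U \<longleftrightarrow> (\<exists>t1 t2. AE x in lebesgue. x \<in> \<Omega> \<longrightarrow>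
      fst (fst U) x = fst (fst (tvec \<phi>1 t1 t2)) x \<and> snd (fst U) x = snd (fst (tvec \<phi>1 t1 t2)) x \<and>
      fst (snd U) x = fst (snd (tvec \<phi>1 t1 t2)) x \<and> snd (snd U) x = snd (snd (tvec \<phi>1 t1 t2)) x)"

(* the energy functional I (with tau_1 = tau_2 = lam1) *)
definition energy :: "'a::euclidean_space set \<Rightarrow> real \<Rightarrow> real \<Rightarrow> real \<Rightarrow> real \<Rightarrow> 'a hh \<Rightarrow> real" where
  "energy \<Omega> lam1 \<mu>1 \<mu>2 \<beta> U =
     1/2 * (integ \<Omega> (\<lambda>x. (norm (snd (fst U) x))\<^sup>2 - lam1 * (fst (fst U) x)\<^sup>2)
          + integ \<Omega> (\<lambda>x. (norm (snd (snd U) x))\<^sup>2 - lam1 * (fst (snd U) x)\<^sup>2))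
     - 1/4 * integ \<Omega> (\<lambda>x. \<mu>1 * (fst (fst U) x) ^ 4 + \<mu>2 * (fst (snd U) x) ^ 4
                          + 2 * \<beta> * (fst (fst U) x)\<^sup>2 * (fst (snd U) x)\<^sup>2)"

definition dI :: "'a::euclidean_space set \<Rightarrow> real \<Rightarrow> real \<Rightarrow> real \<Rightarrow> real \<Rightarrow> 'a hh \<Rightarrow> 'a hh \<Rightarrow> real \<Rightarrow> bool" where
  "dI \<Omega> lam1 \<mu>1 \<mu>2 \<beta> U V D \<longleftrightarrow>
     ((\<lambda>s. energy \<Omega> lam1 \<mu>1 \<mu>2 \<beta> (hadd U (hscale s V))) has_real_derivative D) (at 0)"

definition NehariN :: "'a::euclidean_space set \<Rightarrow> real \<Rightarrow> 'a h1 \<Rightarrow> real \<Rightarrow> real \<Rightarrow> real \<Rightarrow> 'a hh set" where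
  "NehariN \<Omega> lam1 \<phi>1 \<mu>1 \<mu>2 \<beta> = {U \<in> HH \<Omega>. \<not> in_Ht \<Omega> \<phi>1 U \<and> dI \<Omega> lam1 \<mu>1 \<mu>2 \<beta> U U 0 \<and>
      (\<forall>t1 t2. dI \<Omega> lam1 \<mu>1 \<mu>2 \<beta> U (tvec \<phi>1 t1 t2) 0)}"

definition NehariN' :: "'a::euclidean_space set \<Rightarrow> real \<Rightarrow> 'a h1 \<Rightarrow> real \<Rightarrow> real \<Rightarrow> real \<Rightarrow> 'a hh set" where
  "NehariN' \<Omega> lam1 \<phi>1 \<mu>1 \<mu>2 \<beta> = {U \<in> HH \<Omega>. \<not> in_Ht \<Omega> \<phi>1 U \<and>
      (\<forall>t\<ge>0. \<forall>t1 t2. energy \<Omega> lam1 \<mu>1 \<mu>2 \<beta> (hadd (hscale t U) (tvec \<phi>1 t1 t2))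
                        \<le> energy \<Omega> lam1 \<mu>1 \<mu>2 \<beta> U)}"

definition CritK :: "'a::euclidean_space set \<Rightarrow> real \<Rightarrow> 'a h1 \<Rightarrow> real \<Rightarrow> real \<Rightarrow> real \<Rightarrow> 'a hh set" where
  "CritK \<Omega> lam1 \<phi>1 \<mu>1 \<mu>2 \<beta> = {U \<in> HH \<Omega>. \<not> in_Ht \<Omega> \<phi>1 U \<and>
      (\<forall>V\<in>HH \<Omega>. dI \<Omega> lam1 \<mu>1 \<mu>2 \<beta> U V 0)}"

(* infima, taken in the extended reals (inf of the empty set = +infinity) *)
definition inf_level :: "'a::euclidean_space set \<Rightarrow> real \<Rightarrow> real \<Rightarrow> real \<Rightarrow> real \<Rightarrow> 'a hh set \<Rightarrow> ereal" where
  "inf_level \<Omega> lam1 \<mu>1 \<mu>2 \<beta> A = (INF U\<in>A. ereal (energy \<Omega> lam1 \<mu>1 \<mu>2 \<beta> U))"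

end

theory Submission
  imports Defs "HOL-Complex_Analysis.Great_Picard" "HOL-Library.Function_Algebras" "HOL-Library.Diagonal_Subsequence"
begin

text \<open>Let $Q(u) = \int |\nabla u|^2 - \lambda_1 u^2$. Modulo the eigenspace, the scalar ground state $w$ minimises
  $Q(u)$ relative to the squared $L^4$ distance of $u$ to the line $\mathbf{R} \varphi_1$; call the minimum $\kappa$.
  For large $\beta$ a synchronized pair $(a w, b w)$ is critical, and its energy is asymptotic to $\kappa^2 / (2 \beta)$.
  A point of the set defining $c'$ maximises the energy over all shifts by $\varphi_1$ in the two components
  separately. Cauchy-Schwarz bounds its energy below by the same asymptotic value, and equality would force
  both components to be the same ground state up to sign; but then shifting them in opposite directions
  strictly decreases the coupling term. By compactness this gain is uniform, so $e < c'$ for large $\beta$.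

  No weak topology is needed: minimising sequences that converge in $L^4$ converge in $H^1$ by the parallelogram law.\<close>

text \<open>Two analytic facts carry the argument. The first is compactness in L^4, obtained from
  means over balls of radius h = 16^-k. Two such means commute, so the fourth power of the L^4 norm
  of the difference of successive means is of order h^(4-N) times the squared Dirichlet integral; N
  <= 3 makes this at most of order h, and the differences sum geometrically. The second is that
  \<open>Q\<close> vanishes only on multiples of the eigenfunction; otherwise \<kappa> could be 0.
  It follows from a strong maximum principle, proved by bounding the gradient of log(f + \<delta>)
  uniformly in \<delta> and comparing translates. The gain is measured at total quadratic energy
  Q(P) + Q(R) = 2, where two equal scaled ground states make \<kappa>^2 times the coupling integral
  equal to 1; some bounded shift brings it down to 1 - \<delta>. The terms with \<mu>1 and \<mu>2
  then stay below a constant m, and the comparison is between 1/(m + 2 \<beta> (1 -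
  \<delta>)/\<kappa>^2) and a quotient asymptotic to \<kappa>^2/(2 \<beta>), so any \<delta> > 0
  decides it for large \<beta>.\<close>

instantiation "fun" :: (type, real_vector) real_vector
begin
text \<open>With pointwise operations the pairs (function, gradient), and pairs of such pairs, are
  real vectors, so \<open>subspace\<close> and the vector laws apply to \<open>H10\<close> and to
  the arguments of the energy.\<close>

definition scaleR_fun_def: "scaleR r f = (\<lambda>x. r *\<^sub>R f x)"
instance
  by standard (simp_all add: scaleR_fun_def plus_fun_def scaleR_add_right scaleR_add_left)
end

lemma scaleR_fun_apply [simp]: "(r *\<^sub>R f) x = r *\<^sub>R f x"
  by (simp add: scaleR_fun_def)

section \<open>Smooth functions and test functions\<close>

text \<open>The recursion of \<open>Ck_on\<close> speaks of \<open>frechet_derivative\<close>;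
  uniqueness of the derivative lets every closure proof below supply an explicit formula
  instead.\<close>

lemma Ck_SucI:
  assumes "\<And>x. (f has_derivative f' x) (at x)" "\<And>b. b \<in> Basis \<Longrightarrow> Ck_on k UNIV (\<lambda>x. f' x b)"
  shows "Ck_on (Suc k) UNIV f"
proof -
  have "frechet_derivative f (at x) = f' x" for x
    using assms(1) frechet_derivative_at by metis
  then show ?thesis
    using assms by (auto simp: differentiable_def)
qed

lemma Ck_SucD:
  assumes "Ck_on (Suc k) UNIV f"
  shows "(f has_derivative frechet_derivative f (at x)) (at x)"
    and "b \<in> Basis \<Longrightarrow> Ck_on k UNIV (\<lambda>x. frechet_derivative f (at x) b)"
  using assms by (auto simp: frechet_derivative_works[symmetric])

lemma Ck_mono: "Ck_on (Suc k) UNIV f \<Longrightarrow> Ck_on k UNIV f"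
proof (induction k arbitrary: f)
  case 0
  then show ?case
    by (auto intro!: continuous_at_imp_continuous_on differentiable_imp_continuous_within)
next
  case (Suc k)
  then show ?case by (metis Ck_on.simps(2))
qed

lemma Ck_continuous: "Ck_on k UNIV f \<Longrightarrow> continuous_on UNIV f"
proof (induction k)
  case (Suc k)
  then show ?case using Ck_mono by blast
qed auto

lemma Ck_const: "Ck_on k UNIV (\<lambda>x. c)"
proof (induction k arbitrary: c)
  case (Suc k)
  show ?case by (rule Ck_SucI[where f' = "\<lambda>x h. 0"]) (auto intro: Suc derivative_intros)
qed auto

lemma Ck_inner: "Ck_on k UNIV (\<lambda>x. x \<bullet> c)"
proof (induction k)
  case (Suc k)
  show ?case by (rule Ck_SucI[where f' = "\<lambda>x h. h \<bullet> c"]) (auto intro: Ck_const derivative_intros)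
qed (auto intro: continuous_intros)

lemma Ck_add: "Ck_on k UNIV f \<Longrightarrow> Ck_on k UNIV g \<Longrightarrow> Ck_on k UNIV (\<lambda>x. f x + g x)"
proof (induction k arbitrary: f g)
  case (Suc k)
  show ?case
    by (rule Ck_SucI[where f' = "\<lambda>x h. frechet_derivative f (at x) h + frechet_derivative g (at x) h"])
      (use Suc in \<open>auto intro!: has_derivative_add Ck_SucD simp del: Ck_on.simps\<close>)
qed (auto intro: continuous_intros)

lemma Ck_mult: "Ck_on k UNIV f \<Longrightarrow> Ck_on k UNIV g \<Longrightarrow> Ck_on k UNIV (\<lambda>x. f x * g x)"
proof (induction k arbitrary: f g)
  case (Suc k)
  show ?case
    by (rule Ck_SucI[where f' = "\<lambda>x h. f x * frechet_derivative g (at x) h + frechet_derivative f (at x) h * g x"])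
      (use Suc in \<open>auto intro!: has_derivative_mult Ck_SucD Ck_add Suc.IH intro: Ck_mono simp del: Ck_on.simps\<close>)
qed (auto intro: continuous_intros)

lemma Ck_cmult: "Ck_on k UNIV f \<Longrightarrow> Ck_on k UNIV (\<lambda>x. c * f x)"
  by (intro Ck_mult Ck_const)

lemma Ck_sum: "(\<And>i. i \<in> I \<Longrightarrow> Ck_on k UNIV (f i)) \<Longrightarrow> Ck_on k UNIV (\<lambda>x. \<Sum>i\<in>I. f i x)"
  by (induction I rule: infinite_finite_induct) (auto intro: Ck_const Ck_add)

text \<open>The derivative of 1/f contains 1/f itself, so the induction step needs the reciprocal at
  level k first; \<open>Ck_mono\<close> makes the induction hypothesis available for it.\<close>

lemma Ck_inverse:
  assumes nz: "\<And>x. f x \<noteq> 0"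
  shows "Ck_on k UNIV f \<Longrightarrow> Ck_on k UNIV (\<lambda>x. inverse (f x))"
proof (induction k)
  case 0
  then show ?case using nz by (auto intro!: continuous_intros)
next
  case (Suc k)
  then have IH: "Ck_on k UNIV (\<lambda>x. inverse (f x))"
    using Ck_mono by blast
  show ?case
  proof (rule Ck_SucI[where f' = "\<lambda>x h. (-1) * ((inverse (f x) * inverse (f x)) * frechet_derivative f (at x) h)"])
    show "((\<lambda>x. inverse (f x)) has_derivative
           (\<lambda>h. (-1) * ((inverse (f x) * inverse (f x)) * frechet_derivative f (at x) h))) (at x)" for x
      by (rule derivative_eq_intros Ck_SucD(1)[OF Suc.prems] nz refl)+ (simp add: fun_eq_iff)
  qed (intro Ck_cmult Ck_mult IH Ck_SucD(2)[OF Suc.prems])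
qed

lemma Ck_sqrt:
  assumes pos: "\<And>x. f x > 0"
  shows "Ck_on k UNIV f \<Longrightarrow> Ck_on k UNIV (\<lambda>x. sqrt (f x))"
proof (induction k)
  case 0
  then show ?case by (auto intro!: continuous_intros)
next
  case (Suc k)
  then have IH: "Ck_on k UNIV (\<lambda>x. sqrt (f x))"
    using Ck_mono by blast
  show ?case
  proof (rule Ck_SucI[where f' = "\<lambda>x h. (1/2) * (inverse (sqrt (f x)) * frechet_derivative f (at x) h)"])
    show "((\<lambda>x. sqrt (f x)) has_derivative
           (\<lambda>h. (1/2) * (inverse (sqrt (f x)) * frechet_derivative f (at x) h))) (at x)" for x
      by (rule derivative_eq_intros Ck_SucD(1)[OF Suc.prems] pos refl)+ (simp add: fun_eq_iff field_simps)
    have "sqrt (f x) \<noteq> 0" for x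
      using pos[of x] by simp
    then show "Ck_on k UNIV (\<lambda>x. (1/2) * (inverse (sqrt (f x)) * frechet_derivative f (at x) b))"
      if "b \<in> Basis" for b
      by (intro Ck_cmult Ck_mult Ck_inverse IH Ck_SucD(2)[OF Suc.prems] that)
  qed
qed

section \<open>A smooth function that is flat at the origin\<close>

definition bump_fun :: "nat \<Rightarrow> real \<Rightarrow> real" where
  "bump_fun m t = (if t > 0 then (1/t) ^ m * exp (- (1/t)) else 0)"

lemma bump_fun_tendsto_0: "(bump_fun m \<longlongrightarrow> 0) (at_right 0)"
proof -
  have "((\<lambda>s::real. s ^ m / exp s) \<longlongrightarrow> 0) at_top"
    by (rule tendsto_power_div_exp_0)
  moreover have "filterlim (\<lambda>t::real. 1/t) at_top (at_right 0)"
    using filterlim_inverse_at_top_right by (simp add: inverse_eq_divide)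
  ultimately have "((\<lambda>t::real. (1/t) ^ m / exp (1/t)) \<longlongrightarrow> 0) (at_right 0)"
    by (rule filterlim_compose)
  moreover have "\<forall>\<^sub>F t in at_right (0::real). (1/t) ^ m / exp (1/t) = bump_fun m t"
    by (auto simp: eventually_at_filter bump_fun_def exp_minus field_simps)
  ultimately show ?thesis
    by (rule Lim_transform_eventually)
qed

text \<open>The powers of 1/t in front of exp(-1/t) close the family under differentiation: each
  derivative is a combination of the members with index m+1 and m+2. This is why
  \<open>Ck_bump_fun\<close> can go by induction with m arbitrary.\<close>

lemma has_real_derivative_bump_fun:
  "(bump_fun m has_real_derivative (bump_fun (m+2) t - m * bump_fun (m+1) t)) (at t)"
proof -
  consider "t > 0" | "t < 0" | "t = 0" by linarith
  then show ?thesis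
  proof cases
    case 1
    have "((\<lambda>t. (1/t) ^ m * exp (- (1/t))) has_real_derivative
            (bump_fun (m+2) t - m * bump_fun (m+1) t)) (at t)"
    proof (cases m)
      case (Suc n)
      have "t * t ^ (n - Suc 0) = t ^ n" if "n \<noteq> 0"
        using that by (cases n) auto
      then show ?thesis
        using 1 Suc by (cases "n = 0") (auto intro!: derivative_eq_intros simp: bump_fun_def power2_eq_square field_simps)
    qed (use 1 in \<open>auto intro!: derivative_eq_intros simp: bump_fun_def power2_eq_square field_simps\<close>)
    moreover have "\<forall>\<^sub>F s in nhds t. (1/s) ^ m * exp (- (1/s)) = bump_fun m s"
      using 1 eventually_nhds_in_open[of "{0<..}" t] by (auto simp: bump_fun_def elim!: eventually_mono)
    ultimately show ?thesis
      using DERIV_cong_ev[OF refl _ refl] by fast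
  next
    case 2
    have "((\<lambda>t. 0) has_real_derivative (bump_fun (m+2) t - m * bump_fun (m+1) t)) (at t)"
      using 2 by (simp add: bump_fun_def)
    moreover have "\<forall>\<^sub>F s in nhds t. 0 = bump_fun m s"
      using 2 eventually_nhds_in_open[of "{..<0}" t] by (auto simp: bump_fun_def elim!: eventually_mono)
    ultimately show ?thesis
      using DERIV_cong_ev[OF refl _ refl] by fast
  next
    case 3
    \<comment> \<open>From the right, the difference quotient at 0 is the next member
      \<open>bump_fun (Suc m)\<close>, which tends to 0; from the left it vanishes.\<close>
    have "((\<lambda>h. bump_fun m h / h) \<longlongrightarrow> 0) (at_right 0)"
    proof (rule Lim_transform_eventually[OF bump_fun_tendsto_0[of "Suc m"]])
      show "\<forall>\<^sub>F h in at_right 0. bump_fun (Suc m) h = bump_fun m h / h"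
        by (auto simp: eventually_at_filter bump_fun_def)
    qed
    moreover have "((\<lambda>h. bump_fun m h / h) \<longlongrightarrow> 0) (at_left 0)"
      by (rule tendsto_eventually) (auto simp: eventually_at_filter bump_fun_def)
    ultimately have "((\<lambda>h. bump_fun m h / h) \<longlongrightarrow> 0) (at 0)"
      by (simp add: filterlim_split_at)
    then show ?thesis
      using 3 by (simp add: DERIV_def bump_fun_def)
  qed
qed

lemma Ck_bump_fun: "smooth_on UNIV f \<Longrightarrow> Ck_on k UNIV (\<lambda>x. bump_fun m (f x))"
proof (induction k arbitrary: m)
  case 0
  have "continuous_on UNIV (bump_fun m)"
    using has_real_derivative_bump_fun DERIV_isCont continuous_at_imp_continuous_on by blast
  moreover have "continuous_on UNIV f"
    using 0 unfolding smooth_on_def by (metis Ck_on.simps(1))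
  ultimately show ?case
    by (auto intro: continuous_on_compose2)
next
  case (Suc k)
  have C: "Ck_on j UNIV f" for j
    using Suc.prems by (simp add: smooth_on_def)
  let ?d = "\<lambda>x. bump_fun (m+2) (f x) + (- real m) * bump_fun (m+1) (f x)"
  show ?case
  proof (rule Ck_SucI[where f' = "\<lambda>x h. ?d x * frechet_derivative f (at x) h"])
    show "((\<lambda>x. bump_fun m (f x)) has_derivative (\<lambda>h. ?d x * frechet_derivative f (at x) h)) (at x)" for x
      using has_derivative_compose[OF Ck_SucD(1)[OF C] has_real_derivative_bump_fun[of m "f x", unfolded has_field_derivative_def]]
      by simp
  qed (intro Ck_mult Ck_add Ck_cmult Suc Ck_SucD(2)[OF C])
qed

section \<open>Test functions, their gradients and cutoffs\<close>

lemma test_fun_smooth: "test_fun \<Omega> \<phi> \<Longrightarrow> Ck_on k UNIV \<phi>"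
  by (simp add: test_fun_def smooth_on_def)

lemma test_fun_supportI:
  assumes "test_fun \<Omega> \<psi>" "\<And>k. Ck_on k UNIV \<phi>" "\<And>x. \<phi> x \<noteq> 0 \<Longrightarrow> \<psi> x \<noteq> 0"
  shows "test_fun \<Omega> \<phi>"
proof -
  have *: "closure {x. \<phi> x \<noteq> 0} \<subseteq> closure {x. \<psi> x \<noteq> 0}"
    using assms(3) by (intro closure_mono) auto
  then have "compact (closure {x. \<phi> x \<noteq> 0})"
    using assms(1) by (metis test_fun_def compact_closure bounded_subset compact_imp_bounded closure_subset closure_closure)
  then show ?thesis
    using assms * by (auto simp: test_fun_def smooth_on_def)
qed

lemma test_fun_add:
  assumes "test_fun \<Omega> \<phi>" "test_fun \<Omega> \<psi>"
  shows "test_fun \<Omega> (\<lambda>x. \<phi> x + \<psi> x)"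
proof -
  have "closure {x. \<phi> x + \<psi> x \<noteq> 0} \<subseteq> closure ({x. \<phi> x \<noteq> 0} \<union> {x. \<psi> x \<noteq> 0})"
    by (intro closure_mono) auto
  then have *: "closure {x. \<phi> x + \<psi> x \<noteq> 0} \<subseteq> closure {x. \<phi> x \<noteq> 0} \<union> closure {x. \<psi> x \<noteq> 0}"
    by simp
  moreover have "compact (closure {x. \<phi> x \<noteq> 0} \<union> closure {x. \<psi> x \<noteq> 0})"
    using assms by (auto simp: test_fun_def)
  ultimately have "compact (closure {x. \<phi> x + \<psi> x \<noteq> 0})"
    by (meson bounded_subset compact_eq_bounded_closed closed_closure)
  then show ?thesis
    using assms * by (auto simp: test_fun_def smooth_on_def intro: Ck_add)
qed

lemma test_fun_cmult: "test_fun \<Omega> \<phi> \<Longrightarrow> test_fun \<Omega> (\<lambda>x. c * \<phi> x)"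
  by (rule test_fun_supportI) (auto intro: Ck_cmult test_fun_smooth)

lemma test_fun_mult: "test_fun \<Omega> \<phi> \<Longrightarrow> (\<And>k. Ck_on k UNIV f) \<Longrightarrow> test_fun \<Omega> (\<lambda>x. \<phi> x * f x)"
  by (rule test_fun_supportI) (auto intro: Ck_mult test_fun_smooth)

lemma test_fun_zero: "test_fun \<Omega> (\<lambda>x. 0)"
  by (auto simp: test_fun_def smooth_on_def Ck_const)

lemma has_derivative_grad:
  assumes "(f has_derivative f') (at x)"
  shows "f' h = grad f x \<bullet> h"
proof -
  interpret bounded_linear f' using assms by (rule has_derivative_bounded_linear)
  have "frechet_derivative f (at x) = f'"
    using assms frechet_derivative_at by metis
  then have "grad f x = (\<Sum>b\<in>Basis. f' b *\<^sub>R b)"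
    by (simp add: grad_def)
  moreover have "f' h = f' (\<Sum>b\<in>Basis. (h \<bullet> b) *\<^sub>R b)"
    by (simp add: euclidean_representation)
  ultimately show ?thesis
    by (simp add: sum scaleR inner_sum_left inner_commute[of h] mult.commute)
qed

lemma grad_eqI:
  assumes "(f has_derivative (\<lambda>h. g \<bullet> h)) (at x)"
  shows "grad f x = g"
proof -
  have "\<forall>h. h \<bullet> grad f x = h \<bullet> g"
    using has_derivative_grad[OF assms] by (metis inner_commute)
  then show ?thesis by (simp only: vector_eq_ldot)
qed

lemma Ck_has_grad:
  assumes "Ck_on (Suc k) UNIV f"
  shows "(f has_derivative (\<lambda>h. grad f x \<bullet> h)) (at x)"
proof -
  have "(f has_derivative frechet_derivative f (at x)) (at x)"
    by (rule Ck_SucD(1)[OF assms])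
  moreover from this have "frechet_derivative f (at x) = (\<lambda>h. grad f x \<bullet> h)"
    by (intro ext has_derivative_grad)
  ultimately show ?thesis by simp
qed

lemma continuous_on_grad: "Ck_on (Suc k) UNIV f \<Longrightarrow> continuous_on UNIV (grad f)"
  unfolding grad_def
  by (intro continuous_intros) (auto dest: Ck_SucD(2) Ck_continuous simp del: Ck_on.simps)

lemmas test_fun_has_grad = Ck_has_grad[OF test_fun_smooth]
lemmas test_fun_continuous = Ck_continuous[OF test_fun_smooth]
lemmas test_fun_continuous_grad = continuous_on_grad[OF test_fun_smooth]

lemma grad_add:
  assumes "test_fun \<Omega> \<phi>" "test_fun \<Omega> \<psi>"
  shows "grad (\<lambda>x. \<phi> x + \<psi> x) x = grad \<phi> x + grad \<psi> x"
  using has_derivative_add[OF test_fun_has_grad[OF assms(1)] test_fun_has_grad[OF assms(2)]]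
  by (intro grad_eqI) (simp add: inner_add_left)

lemma grad_cmult:
  assumes "test_fun \<Omega> \<phi>"
  shows "grad (\<lambda>x. c * \<phi> x) x = c *\<^sub>R grad \<phi> x"
  using has_derivative_mult_right[OF test_fun_has_grad[OF assms], of c]
  by (intro grad_eqI) simp

lemma test_fun_outside:
  fixes \<phi> :: "'a::euclidean_space \<Rightarrow> real"
  assumes "test_fun \<Omega> \<phi>" "x \<notin> \<Omega>"
  shows "\<phi> x = 0" "grad \<phi> x = 0"
proof -
  let ?S = "closure {x. \<phi> x \<noteq> 0}"
  have x: "x \<in> - ?S" using assms by (auto simp: test_fun_def)
  have z: "y \<in> - ?S \<Longrightarrow> \<phi> y = 0" for y
    using closure_subset[of "{x. \<phi> x \<noteq> 0}"] by auto
  show "\<phi> x = 0" using z[OF x] .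
  have "((\<lambda>x. 0) has_derivative (\<lambda>h::'a. 0 \<bullet> h)) (at x)" by simp
  then have "(\<phi> has_derivative (\<lambda>h. 0 \<bullet> h)) (at x)"
    by (rule has_derivative_transform_within_open[OF _ open_Compl[OF closed_closure] x])
      (rule z[symmetric])
  then show "grad \<phi> x = 0" by (rule grad_eqI)
qed

lemma test_fun_support_bounded:
  assumes "test_fun \<Omega> \<phi>"
  obtains K where "compact K" "K \<subseteq> \<Omega>" "\<And>x. x \<notin> K \<Longrightarrow> \<phi> x = 0" "\<And>x. x \<notin> K \<Longrightarrow> grad \<phi> x = 0"
proof
  let ?S = "closure {x. \<phi> x \<noteq> 0}"
  show "compact ?S" "?S \<subseteq> \<Omega>" using assms by (auto simp: test_fun_def)
  have "test_fun ?S \<phi>" using assms by (auto simp: test_fun_def)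
  then show "x \<notin> ?S \<Longrightarrow> \<phi> x = 0" "x \<notin> ?S \<Longrightarrow> grad \<phi> x = 0" for x
    by (auto dest: test_fun_outside)
qed

lemma cball_cutoff:
  fixes a :: "'a::euclidean_space"
  assumes "cball a r \<subseteq> \<Omega>" "open \<Omega>" "0 < r"
  obtains \<psi> where "test_fun \<Omega> \<psi>" "\<And>x. x \<in> ball a r \<Longrightarrow> \<psi> x > 0"
proof
  let ?q = "\<lambda>x::'a. r^2 - (norm (x - a))^2"
  let ?\<psi> = "\<lambda>x. bump_fun 0 (?q x)"
  \<comment> \<open>The squared norm is expanded in coordinates, so that only sums and products of
    inner products with fixed vectors remain and the \<open>Ck\<close> closure rules apply.\<close>
  have q: "?q = (\<lambda>x. (r^2 - a \<bullet> a) + ((-1) * (\<Sum>b\<in>Basis. (x \<bullet> b) * (x \<bullet> b)) + 2 * (x \<bullet> a)))"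
  proof
    show "?q x = (r^2 - a \<bullet> a) + ((-1) * (\<Sum>b\<in>Basis. (x \<bullet> b) * (x \<bullet> b)) + 2 * (x \<bullet> a))" for x
      by (subst euclidean_inner[of x x, symmetric])
        (simp add: power2_norm_eq_inner algebra_simps inner_commute)
  qed
  have "smooth_on UNIV ?q"
    unfolding smooth_on_def q by (intro allI Ck_add Ck_const Ck_cmult Ck_sum Ck_mult Ck_inner)
  then have "smooth_on UNIV ?\<psi>"
    by (simp add: smooth_on_def[of UNIV ?\<psi>] Ck_bump_fun)
  moreover have "norm (x - a) < r" if "?\<psi> x \<noteq> 0" for x
    using that assms(3) by (auto simp: bump_fun_def split: if_splits intro: power2_less_imp_less)
  then have "{x. ?\<psi> x \<noteq> 0} \<subseteq> cball a r"
    by (auto simp: dist_norm norm_minus_commute less_imp_le)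
  then have "closure {x. ?\<psi> x \<noteq> 0} \<subseteq> cball a r"
    by (simp add: closure_minimal)
  ultimately show "test_fun \<Omega> ?\<psi>"
    using assms(1) unfolding test_fun_def
    by (meson bounded_subset bounded_cball compact_eq_bounded_closed closed_closure order_trans)
  show "?\<psi> x > 0" if "x \<in> ball a r" for x
  proof -
    have "norm (x - a) < r" using that by (simp add: dist_norm norm_minus_commute)
    then have "(norm (x - a))^2 < r^2" by (intro power_strict_mono) auto
    then show ?thesis by (simp add: bump_fun_def)
  qed
qed

section \<open>Translation and averaging estimates\<close>

text \<open>Nonnegativity of the variance, once finiteness of the second moment has made f
  integrable; an infinite right-hand side leaves nothing to prove.\<close>

lemma jensen_square:
  fixes f :: "'b \<Rightarrow> real"
  assumes M: "emeasure M (space M) = 1" and [measurable]: "f \<in> borel_measurable M"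
  shows "ennreal ((LINT x|M. f x)\<^sup>2) \<le> (\<integral>\<^sup>+x. ennreal ((f x)\<^sup>2) \<partial>M)"
proof (cases "(\<integral>\<^sup>+x. ennreal ((f x)\<^sup>2) \<partial>M) = \<infinity>")
  case False
  interpret finite_measure M by standard (simp add: M)
  have 2: "integrable M (\<lambda>x. (f x)\<^sup>2)"
    using False by (intro integrableI_nonneg) (auto simp: top.not_eq_extremum)
  have "\<bar>y\<bar> \<le> 1 + y\<^sup>2" for y :: real
    using sum_squares_bound[of 1 "\<bar>y\<bar>"] by (simp add: power2_eq_square)
  then have 1: "integrable M f"
    using 2 by (intro Bochner_Integration.integrable_bound[of M "\<lambda>x. 1 + (f x)\<^sup>2" f]) auto
  define c where "c = (LINT x|M. f x)"
  have "0 \<le> (LINT x|M. (f x - c)\<^sup>2)" by simp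
  also have "\<dots> = (LINT x|M. (f x)\<^sup>2 - 2 * c * f x + c\<^sup>2)"
    by (simp add: power2_diff algebra_simps)
  also have "\<dots> = (LINT x|M. (f x)\<^sup>2) - 2 * c * c + c\<^sup>2"
    using 1 2 M by (simp add: c_def measure_def)
  finally have "c\<^sup>2 \<le> (LINT x|M. (f x)\<^sup>2)" by (simp add: power2_eq_square)
  then show ?thesis
    using 2 by (subst nn_integral_eq_integral) (auto simp: c_def intro: ennreal_leI)
qed simp

lemma nn_integral_lborel_translate:
  fixes f :: "'a::euclidean_space \<Rightarrow> ennreal"
  assumes [measurable]: "f \<in> borel_measurable borel"
  shows "(\<integral>\<^sup>+x. f (x + z) \<partial>lborel) = (\<integral>\<^sup>+x. f x \<partial>lborel)"
proof -
  have "(\<integral>\<^sup>+x. f x \<partial>lborel) = (\<integral>\<^sup>+x. f x \<partial>distr lborel borel ((+) z))"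
    by (simp add: lborel_distr_plus)
  also have "\<dots> = (\<integral>\<^sup>+x. f (z + x) \<partial>lborel)"
    by (subst nn_integral_distr) auto
  finally show ?thesis by (simp add: add.commute)
qed

text \<open>The increment is the integral of the directional derivative along the segment. Jensen on
  the unit interval handles the square, and Cauchy-Schwarz splits off the length of z.\<close>

lemma translation_estimate_pointwise:
  fixes f :: "'a::euclidean_space \<Rightarrow> real"
  assumes df: "\<And>x. (f has_derivative (\<lambda>h. g x \<bullet> h)) (at x)" and cg: "continuous_on UNIV g"
  shows "ennreal ((f (x + z) - f x)\<^sup>2)
    \<le> (\<integral>\<^sup>+t. ennreal (indicator {0..1::real} t) * ennreal ((norm z)\<^sup>2 * (norm (g (x + t *\<^sub>R z)))\<^sup>2) \<partial>lborel)"
proof -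
  define M where "M = density lborel (\<lambda>t. ennreal (indicator {0..1::real} t))"
  define p where "p t = g (x + t *\<^sub>R z) \<bullet> z" for t
  have cp: "continuous_on UNIV p"
    unfolding p_def by (intro continuous_intros continuous_on_compose2[OF cg]) auto
  then have [measurable]: "p \<in> borel_measurable borel"
    by (rule borel_measurable_continuous_onI)
  have [measurable]: "g \<in> borel_measurable borel"
    by (rule borel_measurable_continuous_onI[OF cg])
  have M1: "emeasure M (space M) = 1"
    by (simp add: M_def emeasure_density ennreal_indicator)
  have "((\<lambda>t. f (x + t *\<^sub>R z)) has_real_derivative p t) (at t)" for t
  proof -
    have "((\<lambda>t. x + t *\<^sub>R z) has_derivative (\<lambda>h. h *\<^sub>R z)) (at t)"
      by (auto intro!: derivative_eq_intros)
    from has_derivative_compose[OF this df]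
    have "((\<lambda>t. f (x + t *\<^sub>R z)) has_derivative (\<lambda>h. h * p t)) (at t)"
      by (simp add: p_def)
    moreover have "(\<lambda>h. h * p t) = (*) (p t)"
      by (simp add: fun_eq_iff)
    ultimately show ?thesis
      unfolding has_field_derivative_def by simp
  qed
  then have "(\<integral>t. indicator {0..1} t *\<^sub>R p t \<partial>lborel) = f (x + 1 *\<^sub>R z) - f (x + 0 *\<^sub>R z)"
    by (intro integral_FTC_atLeastAtMost)
      (auto simp: has_real_derivative_iff_has_vector_derivative[symmetric] has_field_derivative_at_within
        intro: continuous_on_subset[OF cp])
  then have "f (x + z) - f x = (LINT t|M. p t)"
    by (simp add: M_def integral_density)
  then have "ennreal ((f (x + z) - f x)\<^sup>2) \<le> (\<integral>\<^sup>+t. ennreal ((p t)\<^sup>2) \<partial>M)"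
    using jensen_square[OF M1, of p] by (simp add: M_def)
  also have "\<dots> \<le> (\<integral>\<^sup>+t. ennreal ((norm z)\<^sup>2 * (norm (g (x + t *\<^sub>R z)))\<^sup>2) \<partial>M)"
  proof (intro nn_integral_mono ennreal_leI)
    fix t
    have "\<bar>p t\<bar> \<le> norm (g (x + t *\<^sub>R z)) * norm z"
      unfolding p_def by (rule Cauchy_Schwarz_ineq2)
    then have "\<bar>p t\<bar>\<^sup>2 \<le> (norm (g (x + t *\<^sub>R z)) * norm z)\<^sup>2"
      by (intro power_mono) auto
    then show "(p t)\<^sup>2 \<le> (norm z)\<^sup>2 * (norm (g (x + t *\<^sub>R z)))\<^sup>2"
      by (simp add: power_mult_distrib mult.commute)
  qed
  also have "\<dots> = (\<integral>\<^sup>+t. ennreal (indicator {0..1::real} t) * ennreal ((norm z)\<^sup>2 * (norm (g (x + t *\<^sub>R z)))\<^sup>2) \<partial>lborel)"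
    unfolding M_def by (subst nn_integral_density) auto
  finally show ?thesis .
qed

text \<open>Integrate the pointwise bound over x, exchange the integrals, and use translation
  invariance for each t. Convexity keeps the whole segment in S, so only the gradient on S is
  charged; this local form is later applied to logarithms on a ball.\<close>

lemma translation_estimate:
  fixes f :: "'a::euclidean_space \<Rightarrow> real"
  assumes df: "\<And>x. (f has_derivative (\<lambda>h. g x \<bullet> h)) (at x)" and cg: "continuous_on UNIV g"
    and S: "convex S" and [measurable]: "S \<in> sets borel"
  shows "(\<integral>\<^sup>+x. indicator {x. x \<in> S \<and> x + z \<in> S} x * ennreal ((f (x + z) - f x)\<^sup>2) \<partial>lborel)
    \<le> ennreal ((norm z)\<^sup>2) * (\<integral>\<^sup>+x. indicator S x * ennreal ((norm (g x))\<^sup>2) \<partial>lborel)"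
proof -
  have [measurable]: "g \<in> borel_measurable borel"
    by (rule borel_measurable_continuous_onI[OF cg])
  let ?G = "\<lambda>x. indicator S x * ennreal ((norm (g x))\<^sup>2) :: ennreal"
  have "(\<integral>\<^sup>+x. indicator {x. x \<in> S \<and> x + z \<in> S} x * ennreal ((f (x + z) - f x)\<^sup>2) \<partial>lborel)
    \<le> (\<integral>\<^sup>+x. (\<integral>\<^sup>+t. ennreal (indicator {0..1::real} t) * (ennreal ((norm z)\<^sup>2) * ?G (x + t *\<^sub>R z)) \<partial>lborel) \<partial>lborel)"
  proof (rule nn_integral_mono)
    fix x
    show "indicator {x. x \<in> S \<and> x + z \<in> S} x * ennreal ((f (x + z) - f x)\<^sup>2)
      \<le> (\<integral>\<^sup>+t. ennreal (indicator {0..1::real} t) * (ennreal ((norm z)\<^sup>2) * ?G (x + t *\<^sub>R z)) \<partial>lborel)"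
    proof (cases "x \<in> S \<and> x + z \<in> S")
      case True
      have "x + t *\<^sub>R z \<in> S" if "t \<in> {0..1}" for t
        using convexD_alt[OF S, of x "x + z" t] True that by (simp add: algebra_simps)
      then have "(\<integral>\<^sup>+t. ennreal (indicator {0..1::real} t) * ennreal ((norm z)\<^sup>2 * (norm (g (x + t *\<^sub>R z)))\<^sup>2) \<partial>lborel)
        = (\<integral>\<^sup>+t. ennreal (indicator {0..1::real} t) * (ennreal ((norm z)\<^sup>2) * ?G (x + t *\<^sub>R z)) \<partial>lborel)"
        by (intro nn_integral_cong) (auto simp: indicator_def ennreal_mult)
      then show ?thesis
        using translation_estimate_pointwise[OF df cg, of x z] True by simp
    qed simp
  qed
  also have "\<dots> = (\<integral>\<^sup>+t. (\<integral>\<^sup>+x. ennreal (indicator {0..1::real} t) * (ennreal ((norm z)\<^sup>2) * ?G (x + t *\<^sub>R z)) \<partial>lborel) \<partial>lborel)"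
    by (rule lborel_pair.Fubini') measurable
  also have "\<dots> = (\<integral>\<^sup>+t. ennreal (indicator {0..1::real} t) * (ennreal ((norm z)\<^sup>2) * (\<integral>\<^sup>+x. ?G x \<partial>lborel)) \<partial>lborel)"
  proof (rule nn_integral_cong)
    fix t :: real
    have "(\<integral>\<^sup>+x. ?G (x + t *\<^sub>R z) \<partial>lborel) = (\<integral>\<^sup>+x. ?G x \<partial>lborel)"
      by (rule nn_integral_lborel_translate) measurable
    then show "(\<integral>\<^sup>+x. ennreal (indicator {0..1::real} t) * (ennreal ((norm z)\<^sup>2) * ?G (x + t *\<^sub>R z)) \<partial>lborel)
      = ennreal (indicator {0..1::real} t) * (ennreal ((norm z)\<^sup>2) * (\<integral>\<^sup>+x. ?G x \<partial>lborel))"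
      by (simp add: nn_integral_cmult)
  qed
  also have "\<dots> = ennreal ((norm z)\<^sup>2) * (\<integral>\<^sup>+x. ?G x \<partial>lborel)"
    by (subst nn_integral_multc) (auto simp: ennreal_indicator)
  finally show ?thesis .
qed

lemma translation_estimate_UNIV:
  fixes f :: "'a::euclidean_space \<Rightarrow> real"
  assumes "\<And>x. (f has_derivative (\<lambda>h. g x \<bullet> h)) (at x)" "continuous_on UNIV g"
  shows "(\<integral>\<^sup>+x. ennreal ((f (x + z) - f x)\<^sup>2) \<partial>lborel)
    \<le> ennreal ((norm z)\<^sup>2) * (\<integral>\<^sup>+x. ennreal ((norm (g x))\<^sup>2) \<partial>lborel)"
  using translation_estimate[OF assms, of UNIV z] by simp

section \<open>Means over balls\<close>

definition ball_unif :: "real \<Rightarrow> 'a::euclidean_space measure" where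
  "ball_unif h = uniform_measure lborel (ball 0 h)"

text \<open>Convolution with a normalised ball indicator. It is not smooth, but it maps L^2 into
  bounded functions, contracts L^2 and commutes with means of any other radius; these properties
  drive the L^4 estimates.\<close>

definition avg :: "real \<Rightarrow> ('a::euclidean_space \<Rightarrow> real) \<Rightarrow> 'a \<Rightarrow> real" where
  "avg h f x = (LINT z|ball_unif h. f (x + z))"

abbreviation ball_vol :: "'a::euclidean_space itself \<Rightarrow> real \<Rightarrow> real" where
  "ball_vol T h \<equiv> measure lborel (ball (0::'a) h)"

lemma sets_ball_unif [measurable_cong, simp]: "sets (ball_unif h) = sets borel"
  by (simp add: ball_unif_def)

lemma space_ball_unif [simp]: "space (ball_unif h) = UNIV"
  by (simp add: ball_unif_def)

lemma ball_vol_pos: "h > 0 \<Longrightarrow> ball_vol TYPE('a::euclidean_space) h > 0"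
  by (simp add: content_ball_pos)

lemma emeasure_ball_vol: "emeasure lborel (ball (0::'a::euclidean_space) h) = ennreal (ball_vol TYPE('a) h)"
  using emeasure_lborel_ball_finite[of "0::'a" h] by (intro emeasure_eq_ennreal_measure) auto

lemma emeasure_ball_unif:
  assumes "h > 0" shows "emeasure (ball_unif h) (UNIV::'a::euclidean_space set) = 1"
proof -
  have "emeasure (ball_unif h) (UNIV::'a set) = emeasure lborel (ball (0::'a) h) / emeasure lborel (ball (0::'a) h)"
    unfolding ball_unif_def by (subst emeasure_uniform_measure) auto
  then show ?thesis
    using ball_vol_pos[OF assms, where 'a='a] by (simp add: emeasure_ball_vol divide_ennreal)
qed

lemma nn_integral_ball_unif:
  fixes f :: "'a::euclidean_space \<Rightarrow> ennreal"
  assumes [measurable]: "f \<in> borel_measurable borel" and h: "h > 0"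
  shows "(\<integral>\<^sup>+z. f z \<partial>ball_unif h) \<le> ennreal (1 / ball_vol TYPE('a) h) * (\<integral>\<^sup>+z. f z \<partial>lborel)"
proof -
  have "(\<integral>\<^sup>+z. f z \<partial>ball_unif h) = (\<integral>\<^sup>+z. f z * indicator (ball 0 h) z \<partial>lborel) / emeasure lborel (ball (0::'a) h)"
    unfolding ball_unif_def by (rule nn_integral_uniform_measure) auto
  also have "emeasure lborel (ball (0::'a) h) = ennreal (ball_vol TYPE('a) h)"
    by (rule emeasure_ball_vol)
  also have "(\<integral>\<^sup>+z. f z * indicator (ball 0 h) z \<partial>lborel) / ennreal (ball_vol TYPE('a) h)
      \<le> (\<integral>\<^sup>+z. f z \<partial>lborel) / ennreal (ball_vol TYPE('a) h)"
    by (intro divide_right_mono_ennreal nn_integral_mono) (auto simp: indicator_def)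
  finally show ?thesis
    using ball_vol_pos[OF h, where 'a='a]
    by (simp add: divide_ennreal_def inverse_ennreal mult.commute inverse_eq_divide)
qed

lemma AE_ball_unif:
  assumes h: "h > 0" shows "AE z in ball_unif h. norm (z::'a::euclidean_space) < h"
  unfolding ball_unif_def by (rule AE_uniform_measureI) (auto simp: dist_norm)

lemma finite_measure_ball_unif:
  "h > 0 \<Longrightarrow> finite_measure (ball_unif h :: 'a::euclidean_space measure)"
  by standard (simp add: emeasure_ball_unif)

lemma measure_ball_unif: "h > 0 \<Longrightarrow> measure (ball_unif h) (UNIV::'a::euclidean_space set) = 1"
  by (simp add: measure_def emeasure_ball_unif)

lemma integrable_ball_unif:
  fixes f :: "'a::euclidean_space \<Rightarrow> real"
  assumes [measurable]: "f \<in> borel_measurable borel" and b: "\<And>x. \<bar>f x\<bar> \<le> B" and h: "h > 0"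
  shows "integrable (ball_unif h) (\<lambda>z. f (x + z))"
proof -
  interpret finite_measure "ball_unif h :: 'a measure" by (rule finite_measure_ball_unif[OF h])
  show ?thesis by (rule integrable_const_bound[of _ B]) (use b in auto)
qed

lemma measurable_avg [measurable]:
  fixes f :: "'a::euclidean_space \<Rightarrow> real"
  assumes [measurable]: "f \<in> borel_measurable borel" and h: "h > 0"
  shows "avg h f \<in> borel_measurable borel"
proof -
  interpret finite_measure "ball_unif h :: 'a measure" by (rule finite_measure_ball_unif[OF h])
  show ?thesis unfolding avg_def by measurable
qed

lemma avg_bounded:
  fixes f :: "'a::euclidean_space \<Rightarrow> real"
  assumes [measurable]: "f \<in> borel_measurable borel" and b: "\<And>x. \<bar>f x\<bar> \<le> B" and h: "h > 0"
  shows "\<bar>avg h f x\<bar> \<le> B"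
proof -
  interpret finite_measure "ball_unif h :: 'a measure" by (rule finite_measure_ball_unif[OF h])
  have i: "integrable (ball_unif h) (\<lambda>z. f (x + z))"
    by (rule integrable_ball_unif[OF assms])
  have "norm (avg h f x) \<le> (LINT z|ball_unif h. norm (f (x + z)))"
    unfolding avg_def by (rule Bochner_Integration.integral_norm_bound)
  also have "\<dots> \<le> (LINT z|(ball_unif h :: 'a measure). B)"
    by (intro integral_mono integrable_norm i) (use b in auto)
  finally have "norm (avg h f x) \<le> (LINT z|(ball_unif h :: 'a measure). B)" .
  then show ?thesis by (simp add: measure_ball_unif[OF h])
qed

lemma avg_diff:
  fixes f g :: "'a::euclidean_space \<Rightarrow> real"
  assumes "f \<in> borel_measurable borel" "\<And>x. \<bar>f x\<bar> \<le> B" "g \<in> borel_measurable borel" "\<And>x. \<bar>g x\<bar> \<le> B'" "h > 0"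
  shows "avg h (\<lambda>x. f x - g x) x = avg h f x - avg h g x"
  unfolding avg_def
  using integrable_ball_unif[OF assms(1,2,5)] integrable_ball_unif[OF assms(3,4,5)] by simp

lemma avg_commute:
  fixes f :: "'a::euclidean_space \<Rightarrow> real"
  assumes [measurable]: "f \<in> borel_measurable borel" and b: "\<And>x. \<bar>f x\<bar> \<le> B" and h: "h > 0" "k > 0"
  shows "avg h (avg k f) x = avg k (avg h f) x"
proof -
  interpret h: finite_measure "ball_unif h :: 'a measure" by (rule finite_measure_ball_unif[OF h(1)])
  interpret k: finite_measure "ball_unif k :: 'a measure" by (rule finite_measure_ball_unif[OF h(2)])
  interpret pair_sigma_finite "ball_unif h :: 'a measure" "ball_unif k :: 'a measure" ..
  interpret hk: finite_measure "ball_unif h \<Otimes>\<^sub>M ball_unif k :: ('a \<times> 'a) measure"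
    by (rule finite_measure_pair_measure) unfold_locales
  have "integrable (ball_unif h \<Otimes>\<^sub>M ball_unif k) (\<lambda>(y, z). f (x + y + z))"
    by (rule hk.integrable_const_bound[of _ B]) (use b in auto)
  from Fubini_integral[OF this]
  show ?thesis unfolding avg_def by (simp add: add_ac)
qed

lemma avg_square_le:
  fixes f :: "'a::euclidean_space \<Rightarrow> real"
  assumes [measurable]: "f \<in> borel_measurable borel" and h: "h > 0"
  shows "ennreal ((avg h f x)\<^sup>2) \<le> (\<integral>\<^sup>+z. ennreal ((f (x + z))\<^sup>2) \<partial>ball_unif h)"
  unfolding avg_def by (rule jensen_square) (simp_all add: emeasure_ball_unif h)

lemma avg_sup_le:
  fixes f :: "'a::euclidean_space \<Rightarrow> real"
  assumes [measurable]: "f \<in> borel_measurable borel" and h: "h > 0"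
  shows "ennreal ((avg h f x)\<^sup>2) \<le> ennreal (1 / ball_vol TYPE('a) h) * (\<integral>\<^sup>+z. ennreal ((f z)\<^sup>2) \<partial>lborel)"
proof -
  have "(\<integral>\<^sup>+z. ennreal ((f (z + x))\<^sup>2) \<partial>lborel) = (\<integral>\<^sup>+z. ennreal ((f z)\<^sup>2) \<partial>lborel)"
    by (rule nn_integral_lborel_translate) measurable
  then show ?thesis
    using order_trans[OF avg_square_le[OF assms] nn_integral_ball_unif[of "\<lambda>z. ennreal ((f (x + z))\<^sup>2)" h]] h
    by (simp add: add.commute)
qed

lemma avg_L2_le:
  fixes F :: "'a::euclidean_space \<Rightarrow> 'a \<Rightarrow> ennreal"
  assumes [measurable]: "case_prod F \<in> borel_measurable (borel \<Otimes>\<^sub>M borel)" and h: "h > 0"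
    and le: "\<And>z. norm z < h \<Longrightarrow> (\<integral>\<^sup>+x. F x z \<partial>lborel) \<le> C"
  shows "(\<integral>\<^sup>+x. (\<integral>\<^sup>+z. F x z \<partial>ball_unif h) \<partial>lborel) \<le> C"
proof -
  interpret h: finite_measure "ball_unif h :: 'a measure" by (rule finite_measure_ball_unif[OF h])
  interpret pair_sigma_finite "ball_unif h :: 'a measure" "lborel :: 'a measure" ..
  have "(\<integral>\<^sup>+x. (\<integral>\<^sup>+z. F x z \<partial>ball_unif h) \<partial>lborel) = (\<integral>\<^sup>+z. (\<integral>\<^sup>+x. F x z \<partial>lborel) \<partial>ball_unif h)"
    by (rule Fubini') measurable
  also have "\<dots> \<le> (\<integral>\<^sup>+z. C \<partial>(ball_unif h :: 'a measure))"
    by (rule nn_integral_mono_AE) (use AE_ball_unif[OF h] le in \<open>auto elim!: eventually_mono\<close>)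
  also have "\<dots> = C" by (simp add: emeasure_ball_unif[OF h])
  finally show ?thesis .
qed

lemma avg_contraction:
  fixes f :: "'a::euclidean_space \<Rightarrow> real"
  assumes [measurable]: "f \<in> borel_measurable borel" and h: "h > 0"
  shows "(\<integral>\<^sup>+x. ennreal ((avg h f x)\<^sup>2) \<partial>lborel) \<le> (\<integral>\<^sup>+x. ennreal ((f x)\<^sup>2) \<partial>lborel)"
proof -
  have "(\<integral>\<^sup>+x. ennreal ((avg h f x)\<^sup>2) \<partial>lborel) \<le> (\<integral>\<^sup>+x. (\<integral>\<^sup>+z. ennreal ((f (x + z))\<^sup>2) \<partial>ball_unif h) \<partial>lborel)"
    by (intro nn_integral_mono avg_square_le h) measurable
  also have "\<dots> \<le> (\<integral>\<^sup>+x. ennreal ((f x)\<^sup>2) \<partial>lborel)"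
    by (rule avg_L2_le[OF _ h]) (auto simp: nn_integral_lborel_translate[of "\<lambda>x. ennreal ((f x)\<^sup>2)"])
  finally show ?thesis .
qed

text \<open>Interpolation: of the two squared factors one is bounded uniformly by
  \<open>avg_sup_le\<close>, the other is integrated by \<open>avg_contraction\<close>.\<close>

lemma avg_L4_le:
  fixes f :: "'a::euclidean_space \<Rightarrow> real"
  assumes [measurable]: "f \<in> borel_measurable borel" and h: "h > 0"
  shows "(\<integral>\<^sup>+x. ennreal ((avg h f x)^4) \<partial>lborel)
    \<le> ennreal (1 / ball_vol TYPE('a) h) * (\<integral>\<^sup>+x. ennreal ((f x)\<^sup>2) \<partial>lborel)\<^sup>2"
proof -
  let ?K = "ennreal (1 / ball_vol TYPE('a) h)" and ?E = "\<integral>\<^sup>+x. ennreal ((f x)\<^sup>2) \<partial>lborel"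
  have "(\<integral>\<^sup>+x. ennreal ((avg h f x)^4) \<partial>lborel) \<le> (\<integral>\<^sup>+x. (?K * ?E) * ennreal ((avg h f x)\<^sup>2) \<partial>lborel)"
  proof (rule nn_integral_mono)
    fix x
    have "ennreal ((avg h f x)^4) = ennreal ((avg h f x)\<^sup>2) * ennreal ((avg h f x)\<^sup>2)"
      by (simp add: ennreal_mult[symmetric] power2_eq_square power4_eq_xxxx mult.assoc)
    also have "\<dots> \<le> (?K * ?E) * ennreal ((avg h f x)\<^sup>2)"
      by (intro mult_right_mono avg_sup_le h) auto
    finally show "ennreal ((avg h f x)^4) \<le> (?K * ?E) * ennreal ((avg h f x)\<^sup>2)" .
  qed
  also have "\<dots> = (?K * ?E) * (\<integral>\<^sup>+x. ennreal ((avg h f x)\<^sup>2) \<partial>lborel)"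
    using h by (intro nn_integral_cmult) measurable
  also have "\<dots> \<le> (?K * ?E) * ?E"
    by (intro mult_left_mono avg_contraction h) auto
  finally show ?thesis by (simp add: power2_eq_square mult.assoc)
qed

text \<open>f minus its mean is the mean of f(x) - f(x+z) over |z| < h, and each of these
  differences has L^2 norm at most h times that of the gradient.\<close>

lemma avg_L2_error:
  fixes f :: "'a::euclidean_space \<Rightarrow> real"
  assumes df: "\<And>x. (f has_derivative (\<lambda>h. g x \<bullet> h)) (at x)" and cg: "continuous_on UNIV g"
    and b: "\<And>x. \<bar>f x\<bar> \<le> B" and h: "h > 0"
  shows "(\<integral>\<^sup>+x. ennreal ((f x - avg h f x)\<^sup>2) \<partial>lborel) \<le> ennreal (h\<^sup>2) * (\<integral>\<^sup>+x. ennreal ((norm (g x))\<^sup>2) \<partial>lborel)"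
proof -
  have cf: "continuous_on UNIV f"
    using df by (meson continuous_at_imp_continuous_on has_derivative_continuous)
  then have [measurable]: "f \<in> borel_measurable borel"
    by (rule borel_measurable_continuous_onI)
  interpret h: finite_measure "ball_unif h :: 'a measure" by (rule finite_measure_ball_unif[OF h])
  have "f x - avg h f x = (LINT z|ball_unif h. f x - f (x + z))" for x
    unfolding avg_def using integrable_ball_unif[OF \<open>f \<in> borel_measurable borel\<close> b h] by (simp add: measure_ball_unif[OF h])
  moreover have "ennreal ((LINT z|ball_unif h. f x - f (x + z))\<^sup>2) \<le> (\<integral>\<^sup>+z. ennreal ((f x - f (x + z))\<^sup>2) \<partial>ball_unif h)" for x
    by (rule jensen_square) (simp_all add: emeasure_ball_unif h)
  ultimately have "(\<integral>\<^sup>+x. ennreal ((f x - avg h f x)\<^sup>2) \<partial>lborel)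
      \<le> (\<integral>\<^sup>+x. (\<integral>\<^sup>+z. ennreal ((f x - f (x + z))\<^sup>2) \<partial>ball_unif h) \<partial>lborel)"
    by (intro nn_integral_mono) simp
  also have "\<dots> \<le> ennreal (h\<^sup>2) * (\<integral>\<^sup>+x. ennreal ((norm (g x))\<^sup>2) \<partial>lborel)"
  proof (rule avg_L2_le[OF _ h])
    fix z :: 'a assume z: "norm z < h"
    have "(\<integral>\<^sup>+x. ennreal ((f x - f (x + z))\<^sup>2) \<partial>lborel) \<le> ennreal ((norm z)\<^sup>2) * (\<integral>\<^sup>+x. ennreal ((norm (g x))\<^sup>2) \<partial>lborel)"
      using translation_estimate_UNIV[OF df cg, of z] by (simp add: power2_commute)
    also have "\<dots> \<le> ennreal (h\<^sup>2) * (\<integral>\<^sup>+x. ennreal ((norm (g x))\<^sup>2) \<partial>lborel)"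
      using z by (intro mult_right_mono ennreal_leI power_mono) auto
    finally show "(\<integral>\<^sup>+x. ennreal ((f x - f (x + z))\<^sup>2) \<partial>lborel) \<le> \<dots>" .
  qed measurable
  finally show ?thesis .
qed

text \<open>The difference of two means is a single mean of a translation difference, so the uniform
  bound for means turns the L^2 translation estimate into a pointwise one. This supplies the
  equicontinuity for Arzela-Ascoli.\<close>

lemma avg_lipschitz:
  fixes f :: "'a::euclidean_space \<Rightarrow> real"
  assumes df: "\<And>x. (f has_derivative (\<lambda>h. g x \<bullet> h)) (at x)" and cg: "continuous_on UNIV g"
    and b: "\<And>x. \<bar>f x\<bar> \<le> B" and h: "h > 0"
  shows "ennreal ((avg h f x - avg h f y)\<^sup>2)
    \<le> ennreal (1 / ball_vol TYPE('a) h) * (ennreal ((norm (x - y))\<^sup>2) * (\<integral>\<^sup>+x. ennreal ((norm (g x))\<^sup>2) \<partial>lborel))"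
proof -
  have cf: "continuous_on UNIV f"
    using df by (meson continuous_at_imp_continuous_on has_derivative_continuous)
  then have [measurable]: "f \<in> borel_measurable borel"
    by (rule borel_measurable_continuous_onI)
  let ?F = "\<lambda>w. f (w + (x - y)) - f w"
  have "?F (y + z) = f (x + z) - f (y + z)" for z
    by (simp add: algebra_simps)
  then have "avg h f x - avg h f y = avg h ?F y"
    unfolding avg_def using integrable_ball_unif[OF \<open>f \<in> borel_measurable borel\<close> b h] by simp
  then have "ennreal ((avg h f x - avg h f y)\<^sup>2)
      \<le> ennreal (1 / ball_vol TYPE('a) h) * (\<integral>\<^sup>+z. ennreal ((?F z)\<^sup>2) \<partial>lborel)"
    using avg_sup_le[of ?F h y] h by simp
  also have "\<dots> \<le> ennreal (1 / ball_vol TYPE('a) h) * (ennreal ((norm (x - y))\<^sup>2) * (\<integral>\<^sup>+x. ennreal ((norm (g x))\<^sup>2) \<partial>lborel))"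
    by (intro mult_left_mono translation_estimate_UNIV df cg) auto
  finally show ?thesis .
qed

lemma power4_add_le: "((a::real) + b)^4 \<le> 8 * (a^4 + b^4)"
proof -
  have "(a + b)\<^sup>2 \<le> 2 * (a\<^sup>2 + b\<^sup>2)"
    using zero_le_power2[of "a - b"] by (simp add: power2_eq_square algebra_simps)
  then have "((a + b)\<^sup>2)\<^sup>2 \<le> (2 * (a\<^sup>2 + b\<^sup>2))\<^sup>2"
    by (intro power_mono) auto
  also have "\<dots> = 4 * (a\<^sup>2 + b\<^sup>2)\<^sup>2" by (subst power_mult_distrib) simp
  also have "\<dots> \<le> 4 * (2 * ((a\<^sup>2)\<^sup>2 + (b\<^sup>2)\<^sup>2))"
    using zero_le_power2[of "a\<^sup>2 - b\<^sup>2"] by (simp add: power2_eq_square algebra_simps)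
  finally show ?thesis by (simp flip: power_mult)
qed

text \<open>The difference splits into \<open>avg k\<close> of f - avg h f and \<open>avg h\<close>
  of avg k f - f. The functions under the means are of order h and k in L^2, and each mean lifts L^2
  to L^4 at the price of its own inverse ball volume; hence the crossed quotients h^4/vol(k) and
  k^4/vol(h).\<close>

lemma avg_L4_step:
  fixes f :: "'a::euclidean_space \<Rightarrow> real"
  assumes df: "\<And>x. (f has_derivative (\<lambda>h. g x \<bullet> h)) (at x)" and cg: "continuous_on UNIV g"
    and b: "\<And>x. \<bar>f x\<bar> \<le> B" and h: "h > 0" "k > 0"
    and E: "(\<integral>\<^sup>+x. ennreal ((norm (g x))\<^sup>2) \<partial>lborel) \<le> ennreal E" "E \<ge> 0"
  shows "(\<integral>\<^sup>+x. ennreal ((avg k f x - avg h f x)^4) \<partial>lborel)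
    \<le> ennreal (8 * (h^4 / ball_vol TYPE('a) k + k^4 / ball_vol TYPE('a) h) * E\<^sup>2)"
proof -
  have cf: "continuous_on UNIV f"
    using df by (meson continuous_at_imp_continuous_on has_derivative_continuous)
  then have [measurable]: "f \<in> borel_measurable borel"
    by (rule borel_measurable_continuous_onI)
  note m = measurable_avg[OF \<open>f \<in> borel_measurable borel\<close> h(1)] measurable_avg[OF \<open>f \<in> borel_measurable borel\<close> h(2)]
  note [measurable] = m
  note ba = avg_bounded[OF \<open>f \<in> borel_measurable borel\<close> b h(1)] avg_bounded[OF \<open>f \<in> borel_measurable borel\<close> b h(2)]
  define p where "p = avg k (\<lambda>x. f x - avg h f x)"
  define q where "q = avg h (\<lambda>x. avg k f x - f x)"
  have mp[measurable]: "p \<in> borel_measurable borel" "q \<in> borel_measurable borel"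
    unfolding p_def q_def by (intro measurable_avg h; measurable)+
  \<comment> \<open>the commuting averages make the mixed terms cancel\<close>
  have pq: "avg k f x - avg h f x = p x + q x" for x
    unfolding p_def q_def
    using avg_diff[of f B "avg h f" B k x] avg_diff[of "avg k f" B f B h x] avg_commute[of f B h k x] b ba m h
    by simp
  have L2: "(\<integral>\<^sup>+x. ennreal ((f x - avg r f x)\<^sup>2) \<partial>lborel) \<le> ennreal (r\<^sup>2 * E)" if "r > 0" for r
  proof -
    have "(\<integral>\<^sup>+x. ennreal ((f x - avg r f x)\<^sup>2) \<partial>lborel) \<le> ennreal (r\<^sup>2) * ennreal E"
      using avg_L2_error[OF df cg b that] mult_left_mono[OF E(1), of "ennreal (r\<^sup>2)"] by (meson order_trans zero_le)
    then show ?thesis using E(2) by (simp add: ennreal_mult)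
  qed
  have L4: "(\<integral>\<^sup>+x. ennreal ((avg s w x)^4) \<partial>lborel) \<le> ennreal (r^4 * E\<^sup>2 / ball_vol TYPE('a) s)"
    if "w \<in> borel_measurable borel" "(\<integral>\<^sup>+x. ennreal ((w x)\<^sup>2) \<partial>lborel) \<le> ennreal (r\<^sup>2 * E)" "s > 0" for w :: "'a \<Rightarrow> real" and r s
  proof -
    have "(\<integral>\<^sup>+x. ennreal ((avg s w x)^4) \<partial>lborel) \<le> ennreal (1 / ball_vol TYPE('a) s) * (\<integral>\<^sup>+x. ennreal ((w x)\<^sup>2) \<partial>lborel)\<^sup>2"
      by (rule avg_L4_le) (use that in auto)
    also have "\<dots> \<le> ennreal (1 / ball_vol TYPE('a) s) * (ennreal (r\<^sup>2 * E))\<^sup>2"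
      by (intro mult_left_mono power_mono that) auto
    also have "\<dots> = ennreal (r^4 * E\<^sup>2 / ball_vol TYPE('a) s)"
      using E(2) by (simp add: ennreal_power ennreal_mult[symmetric] power_mult_distrib flip: power_mult)
    finally show ?thesis .
  qed
  have P: "(\<integral>\<^sup>+x. ennreal ((p x)^4) \<partial>lborel) \<le> ennreal (h^4 * E\<^sup>2 / ball_vol TYPE('a) k)"
    unfolding p_def using L2[OF h(1)] by (intro L4 h) auto
  have Q: "(\<integral>\<^sup>+x. ennreal ((q x)^4) \<partial>lborel) \<le> ennreal (k^4 * E\<^sup>2 / ball_vol TYPE('a) h)"
    unfolding q_def using L2[OF h(2)] by (intro L4 h) (auto simp: power2_commute)
  have "(\<integral>\<^sup>+x. ennreal ((avg k f x - avg h f x)^4) \<partial>lborel)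
      \<le> (\<integral>\<^sup>+x. 8 * (ennreal ((p x)^4) + ennreal ((q x)^4)) \<partial>lborel)"
  proof (rule nn_integral_mono)
    fix x
    have "ennreal ((p x + q x)^4) \<le> ennreal (8 * ((p x)^4 + (q x)^4))"
      by (intro ennreal_leI power4_add_le)
    also have "\<dots> = 8 * (ennreal ((p x)^4) + ennreal ((q x)^4))"
      by (subst ennreal_mult) auto
    finally show "ennreal ((avg k f x - avg h f x)^4) \<le> 8 * (ennreal ((p x)^4) + ennreal ((q x)^4))"
      by (simp only: pq)
  qed
  also have "\<dots> = 8 * ((\<integral>\<^sup>+x. ennreal ((p x)^4) \<partial>lborel) + (\<integral>\<^sup>+x. ennreal ((q x)^4) \<partial>lborel))"
    by (simp add: nn_integral_cmult nn_integral_add)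
  also have "\<dots> \<le> 8 * (ennreal (h^4 * E\<^sup>2 / ball_vol TYPE('a) k) + ennreal (k^4 * E\<^sup>2 / ball_vol TYPE('a) h))"
    by (intro mult_left_mono add_mono P Q) auto
  also have "\<dots> = ennreal (8 * (h^4 * E\<^sup>2 / ball_vol TYPE('a) k + k^4 * E\<^sup>2 / ball_vol TYPE('a) h))"
    by (subst ennreal_mult) (use ball_vol_pos[OF h(1), where 'a='a] ball_vol_pos[OF h(2), where 'a='a] in auto)
  finally show ?thesis by (simp add: algebra_simps)
qed

section \<open>The $L^4$ norm and the Sobolev embedding\<close>

definition L4 :: "('a::euclidean_space \<Rightarrow> real) \<Rightarrow> bool" where
  "L4 f \<longleftrightarrow> f \<in> borel_measurable lebesgue \<and> integrable lebesgue (\<lambda>x. (f x)^4)"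

text \<open>As a Bochner integral this is 0 by default when the fourth power is not integrable, so
  norm laws such as the triangle inequality carry \<open>L4\<close> hypotheses.\<close>

definition N4 :: "('a::euclidean_space \<Rightarrow> real) \<Rightarrow> real" where
  "N4 f = root 4 (LINT x|lebesgue. (f x)^4)"

lemma N4_nonneg [simp]: "0 \<le> N4 f"
  by (simp add: N4_def)

lemma N4_power4: "(N4 f)^4 = (LINT x|lebesgue. (f x)^4)"
  by (simp add: N4_def)

lemma N4_leI: "(LINT x|lebesgue. (f x)^4) \<le> B^4 \<Longrightarrow> 0 \<le> B \<Longrightarrow> N4 f \<le> B"
  unfolding N4_def by (metis real_root_le_mono real_root_pos2 zero_less_numeral)

lemma L4_nnI:
  assumes f: "f \<in> borel_measurable lebesgue" and le: "(\<integral>\<^sup>+x. ennreal ((f x)^4) \<partial>lebesgue) \<le> ennreal (B^4)" and B: "0 \<le> B"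
  shows "L4 f" "N4 f \<le> B"
proof -
  have i: "integrable lebesgue (\<lambda>x. (f x)^4)"
    using f le by (intro integrableI_nonneg) (auto simp: le_less_trans[OF le])
  then show "L4 f" using f by (simp add: L4_def)
  have "ennreal (LINT x|lebesgue. (f x)^4) \<le> ennreal (B^4)"
    using nn_integral_eq_integral[OF i] le by simp
  then show "N4 f \<le> B"
    by (intro N4_leI B) (simp add: ennreal_le_iff)
qed

lemma L4_nnD: "L4 f \<Longrightarrow> (\<integral>\<^sup>+x. ennreal ((f x)^4) \<partial>lebesgue) = ennreal ((N4 f)^4)"
  unfolding N4_power4 L4_def by (intro nn_integral_eq_integral) auto

lemma L4_measurable [dest]: "L4 f \<Longrightarrow> f \<in> borel_measurable lebesgue"
  by (simp add: L4_def)

lemma L4_cmult: "L4 f \<Longrightarrow> L4 (\<lambda>x. c * f x)"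
  by (auto simp: L4_def power_mult_distrib intro: borel_measurable_times)

lemma L4_add:
  assumes "L4 f" "L4 g"
  shows "L4 (\<lambda>x. f x + g x)"
  unfolding L4_def
proof
  have [measurable]: "f \<in> borel_measurable lebesgue" "g \<in> borel_measurable lebesgue"
    using assms by auto
  show "(\<lambda>x. f x + g x) \<in> borel_measurable lebesgue" by measurable
  show "integrable lebesgue (\<lambda>x. (f x + g x)^4)"
    by (rule Bochner_Integration.integrable_bound[of _ "\<lambda>x. 8 * ((f x)^4 + (g x)^4)"])
      (use assms power4_add_le in \<open>auto simp: L4_def\<close>)
qed

lemma N4_cmult: "N4 (\<lambda>x. c * f x) = \<bar>c\<bar> * N4 f"
proof -
  have "root 4 (c^4) = \<bar>c\<bar>" using real_root_power_cancel[of 4 "\<bar>c\<bar>"] by simp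
  then show ?thesis by (simp add: N4_def power_mult_distrib real_root_mult)
qed

lemma N4_minus: "N4 (\<lambda>x. - f x) = N4 f"
  by (simp add: N4_def)

lemma N4_minus_commute: "N4 (\<lambda>x. f x - g x) = N4 (\<lambda>x. g x - f x)"
  using N4_minus[of "\<lambda>x. f x - g x"] by simp

text \<open>Convexity of t^4 at the points x/a and y/b with weights a/(a+b) and b/(a+b). With a and
  b close to the two norms, integration yields Minkowski's inequality.\<close>

lemma power4_convex_bound:
  fixes x y a b :: real
  assumes "a > 0" "b > 0"
  shows "(x + y)^4 \<le> (a + b)^3 * (x^4 / a^3 + y^4 / b^3)"
proof -
  have c: "convex_on UNIV (\<lambda>x::real. x^4)"
    by (rule convex_power_even) simp
  have s: "a / (a + b) + b / (a + b) = 1"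
    using assms by (simp add: add_divide_distrib[symmetric])
  have "(a / (a + b) * (x / a) + b / (a + b) * (y / b))^4
      \<le> a / (a + b) * (x / a)^4 + b / (a + b) * (y / b)^4"
  proof -
    have "1 - b / (a + b) = a / (a + b)" using s by linarith
    then show ?thesis
      using convex_onD[OF c, of "b / (a + b)" "x / a" "y / b"] assms by (simp only: real_scaleR_def) simp
  qed
  moreover have "a / (a + b) * (x / a) + b / (a + b) * (y / b) = (x + y) / (a + b)"
    using assms by (simp add: add_divide_distrib)
  moreover have "a / (a + b) * (x / a)^4 = x^4 / a^3 / (a + b)" "b / (a + b) * (y / b)^4 = y^4 / b^3 / (a + b)"
    using assms by (simp_all add: power_divide power3_eq_cube power4_eq_xxxx mult_ac)
  ultimately have "(x + y)^4 / (a + b)^4 \<le> (x^4 / a^3 + y^4 / b^3) / (a + b)"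
    by (simp add: add_divide_distrib[of "x^4 / a^3"] power_divide[symmetric])
  then have "(x + y)^4 / (a + b)^4 * (a + b)^4 \<le> (x^4 / a^3 + y^4 / b^3) / (a + b) * (a + b)^4"
    by (intro mult_right_mono) (use assms in auto)
  moreover have "w / (a + b) * (a + b)^4 = (a + b)^3 * w" for w
    using assms by (simp add: field_simps power3_eq_cube power4_eq_xxxx)
  ultimately show ?thesis
    using assms by simp
qed

lemma N4_triangle:
  assumes "L4 f" "L4 g"
  shows "N4 (\<lambda>x. f x + g x) \<le> N4 f + N4 g"
proof (rule field_le_epsilon)
  fix e :: real assume "e > 0"
  \<comment> \<open>The margin e/2 keeps the weights positive when one of the norms
    vanishes.\<close>
  define a where "a = N4 f + e/2"
  define b where "b = N4 g + e/2"
  have ab: "a > 0" "b > 0" using \<open>e > 0\<close> by (auto simp: a_def b_def intro: add_nonneg_pos)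
  have i: "integrable lebesgue (\<lambda>x. (f x)^4)" "integrable lebesgue (\<lambda>x. (g x)^4)"
    using assms by (auto simp: L4_def)
  have "(LINT x|lebesgue. (f x + g x)^4) \<le> (LINT x|lebesgue. (a + b)^3 * ((f x)^4 / a^3 + (g x)^4 / b^3))"
    using L4_add[OF assms] i ab by (intro integral_mono power4_convex_bound) (auto simp: L4_def)
  also have "\<dots> = (a + b)^3 * ((N4 f)^4 / a^3 + (N4 g)^4 / b^3)"
    using i by (simp add: N4_power4)
  also have "\<dots> \<le> (a + b)^3 * (a^4 / a^3 + b^4 / b^3)"
    using ab \<open>e > 0\<close> by (intro mult_left_mono add_mono divide_right_mono power_mono) (auto simp: a_def b_def)
  also have "\<dots> = (a + b)^4"
    using ab by (simp add: power3_eq_cube power4_eq_xxxx field_simps)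
  finally have "N4 (\<lambda>x. f x + g x) \<le> a + b"
    using ab by (intro N4_leI) auto
  then show "N4 (\<lambda>x. f x + g x) \<le> N4 f + N4 g + e"
    by (simp add: a_def b_def)
qed

lemma L4_fatou:
  assumes "\<And>n. L4 (f n)" "\<And>n. N4 (f n) \<le> B" "g \<in> borel_measurable lebesgue"
    and lim: "AE x in lebesgue. (\<lambda>n. f n x) \<longlonglongrightarrow> g x"
  shows "L4 g" "N4 g \<le> B"
proof -
  have B: "0 \<le> B" using assms(2)[of 0] N4_nonneg order_trans by blast
  have [measurable]: "f n \<in> borel_measurable lebesgue" for n using assms(1) by auto
  have "(\<integral>\<^sup>+x. ennreal ((g x)^4) \<partial>lebesgue) = (\<integral>\<^sup>+x. liminf (\<lambda>n. ennreal ((f n x)^4)) \<partial>lebesgue)"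
  proof (rule nn_integral_cong_AE, use lim in eventually_elim)
    case (elim x)
    then have "(\<lambda>n. ennreal ((f n x)^4)) \<longlonglongrightarrow> ennreal ((g x)^4)"
      by (intro tendsto_ennrealI tendsto_power)
    from lim_imp_Liminf[OF _ this] show ?case by simp
  qed
  also have "\<dots> \<le> liminf (\<lambda>n. \<integral>\<^sup>+x. ennreal ((f n x)^4) \<partial>lebesgue)"
    by (rule nn_integral_liminf) measurable
  also have "\<dots> \<le> ennreal (B^4)"
    by (intro Liminf_le eventuallyI) (auto simp: L4_nnD assms intro!: ennreal_leI power_mono)
  finally have *: "(\<integral>\<^sup>+x. ennreal ((g x)^4) \<partial>lebesgue) \<le> ennreal (B^4)" .
  show "L4 g" "N4 g \<le> B"
    using L4_nnI[OF assms(3) * B] by auto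
qed

section \<open>Approximation by means in L^4 and the Sobolev inequality for test functions\<close>

lemma avg_tendsto:
  fixes u :: "'a::euclidean_space \<Rightarrow> real"
  assumes cu: "continuous_on UNIV u" and b: "\<And>x. \<bar>u x\<bar> \<le> B" and h: "\<And>n. h n > 0" "h \<longlonglongrightarrow> 0"
  shows "(\<lambda>n. avg (h n) u x) \<longlonglongrightarrow> u x"
proof (rule LIMSEQ_I)
  fix e :: real assume e: "e > 0"
  have [measurable]: "u \<in> borel_measurable borel"
    by (rule borel_measurable_continuous_onI[OF cu])
  obtain d where d: "d > 0" "\<And>y. dist y x < d \<Longrightarrow> dist (u y) (u x) < e/2"
    using cu e unfolding continuous_on_iff by (metis UNIV_I half_gt_zero)
  obtain N where N: "\<And>n. n \<ge> N \<Longrightarrow> norm (h n - 0) < d"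
    using LIMSEQ_D[OF h(2) d(1)] by blast
  show "\<exists>N. \<forall>n\<ge>N. norm (avg (h n) u x - u x) < e"
  proof (intro exI allI impI)
    fix n assume "n \<ge> N"
    then have hn: "h n < d" using N by fastforce
    let ?M = "ball_unif (h n) :: 'a measure"
    interpret finite_measure ?M by (rule finite_measure_ball_unif[OF h(1)])
    have i: "integrable ?M (\<lambda>z. u (x + z))"
      by (rule integrable_ball_unif[OF _ b h(1)]) measurable
    have "avg (h n) u x - u x = (LINT z|?M. u (x + z) - u x)"
      unfolding avg_def using i by (simp add: measure_ball_unif[OF h(1)])
    also have "norm \<dots> \<le> (LINT z|?M. norm (u (x + z) - u x))"
      by (rule Bochner_Integration.integral_norm_bound)
    also have "\<dots> \<le> (LINT z|?M. e/2)"
    proof (intro integral_mono_AE integrable_norm)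
      show "AE z in ?M. norm (u (x + z) - u x) \<le> e/2"
        using AE_ball_unif[OF h(1), where 'a='a]
      proof eventually_elim
        case (elim z)
        then have "dist (x + z) x < d" using hn by (simp add: dist_norm)
        then show ?case using d(2) by (fastforce simp: dist_norm)
      qed
    qed (use i in auto)
    also have "\<dots> = e/2" by (simp add: measure_ball_unif[OF h(1)])
    finally show "norm (avg (h n) u x - u x) < e" using e by simp
  qed
qed

lemma test_fun_bounded:
  assumes "test_fun \<Omega> \<phi>"
  obtains B where "\<And>x. \<bar>\<phi> x\<bar> \<le> B"
proof -
  obtain K where K: "compact K" "\<And>x. x \<notin> K \<Longrightarrow> \<phi> x = 0"
    using test_fun_support_bounded[OF assms] by metis
  have "compact (\<phi> ` K)"
    by (intro compact_continuous_image K continuous_on_subset[OF test_fun_continuous[OF assms]]) auto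
  then obtain B where "\<And>x. x \<in> K \<Longrightarrow> \<bar>\<phi> x\<bar> \<le> B"
    by (metis (no_types, lifting) bounded_iff compact_imp_bounded image_eqI real_norm_def)
  then have "\<bar>\<phi> x\<bar> \<le> max B 0" for x
    using K(2)[of x] by (cases "x \<in> K") (auto simp: le_max_iff_disj)
  then show ?thesis by (rule that)
qed

text \<open>Volume bookkeeping for the step from radius h to h/16: the ratio of the ball volumes
  contributes 16^N, and (1/16)^4 is rounded up to 1.\<close>

definition sob_const :: "'a::euclidean_space itself \<Rightarrow> real" where
  "sob_const T = 8 * (16 ^ DIM('a) + 1) / ball_vol TYPE('a) 1"

lemma ball_vol_scale: "h > 0 \<Longrightarrow> ball_vol TYPE('a::euclidean_space) h = ball_vol TYPE('a) 1 * h ^ DIM('a)"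
  by (simp add: content_ball)

lemma sob_const_pos: "sob_const TYPE('a::euclidean_space) > 0"
  unfolding sob_const_def using ball_vol_pos[of 1, where 'a='a] by (intro divide_pos_pos) (auto simp: add_pos_pos)

context
  fixes u :: "'a::euclidean_space \<Rightarrow> real" and \<Omega> and E :: real
  assumes dim: "DIM('a) \<le> 3" and u: "test_fun \<Omega> u"
    and E: "(\<integral>\<^sup>+x. ennreal ((norm (grad u x))\<^sup>2) \<partial>lborel) \<le> ennreal E" "E \<ge> 0"
begin

lemma u_measurable [measurable]: "u \<in> borel_measurable borel"
  by (rule borel_measurable_continuous_onI[OF test_fun_continuous[OF u]])

lemma avg_u_measurable: "h > 0 \<Longrightarrow> avg h u \<in> borel_measurable lebesgue"
  using measurable_avg[OF u_measurable, of h] by (simp add: measurable_completion)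

text \<open>By volume scaling the fourth power of the norm is of order h^(4-N) E^2. Here N <= 3
  enters: with h <= 1 this is at most of order h E^2, and the fourth root of h = 16^-k is 2^-k. The
  ratio 16 is chosen for the sake of that root.\<close>

lemma avg_increment:
  fixes k :: nat
  defines "h \<equiv> (1/16)^k"
  shows "L4 (\<lambda>x. avg (h/16) u x - avg h u x)"
    "N4 (\<lambda>x. avg (h/16) u x - avg h u x) \<le> root 4 (sob_const TYPE('a)) * sqrt E * (1/2)^k"
proof -
  let ?B = "root 4 (sob_const TYPE('a)) * sqrt E * (1/2)^k"
  let ?n = "DIM('a)"
  have h: "h > 0" "h / 16 > 0" "h \<le> 1" unfolding h_def by (auto intro: power_le_one)
  obtain B where b: "\<And>x. \<bar>u x\<bar> \<le> B" using test_fun_bounded[OF u] by blast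
  define c where "c = ball_vol TYPE('a) 1"
  have c: "c > 0" unfolding c_def by (rule ball_vol_pos) simp
  have "8 * (h^4 / ball_vol TYPE('a) (h/16) + (h/16)^4 / ball_vol TYPE('a) h) * E\<^sup>2
      = (8 / c * (16 ^ ?n + (1/16)^4) * h^4 / h^?n) * E\<^sup>2"
    unfolding ball_vol_scale[OF h(1), where 'a='a] ball_vol_scale[OF h(2), where 'a='a] c_def[symmetric]
    using h c by (simp add: field_simps power_divide)
  also have "\<dots> = (8 / c * (16 ^ ?n + (1/16)^4) * (h^?n * h^(4 - ?n)) / h^?n) * E\<^sup>2"
    using dim by (simp flip: power_add)
  also have "(8 / c * (16 ^ ?n + (1/16)^4) * (h^?n * h^(4 - ?n)) / h^?n) * E\<^sup>2
      = 8 / c * (16 ^ ?n + (1/16)^4) * h^(4 - ?n) * E\<^sup>2"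
    using h by simp
  also have "\<dots> \<le> 8 / c * (16 ^ ?n + 1) * h^1 * E\<^sup>2"
  proof -
    have "h^(4 - ?n) \<le> h^1"
      using dim h by (intro power_decreasing) auto
    moreover have "8 / c * (16 ^ ?n + (1/16)^4) \<le> 8 / c * (16 ^ ?n + 1)"
      using c by (intro mult_left_mono) (auto simp: power_divide)
    ultimately show ?thesis
      using h c by (intro mult_right_mono mult_mono[of "8 / c * (16 ^ ?n + (1/16)^4)"]) auto
  qed
  also have "\<dots> = sob_const TYPE('a) * (1/16)^k * E\<^sup>2"
    by (simp add: sob_const_def h_def c_def)
  also have "\<dots> = ?B^4"
  proof -
    have "(sqrt E)^4 = E\<^sup>2" using E(2) by (simp add: power4_eq_xxxx power2_eq_square)
    moreover have "((1/2::real)^k)^4 = ((1/2)^4)^k" by (simp only: power_mult[symmetric] mult.commute)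
    then have "((1/2::real)^k)^4 = (1/16)^k" by (simp add: power_divide)
    ultimately show ?thesis using sob_const_pos[where 'a='a] by (simp add: power_mult_distrib)
  qed
  finally have le: "8 * (h^4 / ball_vol TYPE('a) (h/16) + (h/16)^4 / ball_vol TYPE('a) h) * E\<^sup>2 \<le> ?B^4" .
  have "(\<integral>\<^sup>+x. ennreal ((avg (h/16) u x - avg h u x)^4) \<partial>lebesgue) \<le> ennreal (?B^4)"
    using order_trans[OF avg_L4_step[OF test_fun_has_grad[OF u] test_fun_continuous_grad[OF u] b h(1,2) E] ennreal_leI[OF le]]
    by (simp add: nn_integral_completion)
  moreover have "(\<lambda>x. avg (h/16) u x - avg h u x) \<in> borel_measurable lebesgue"
    using avg_u_measurable[OF h(1)] avg_u_measurable[OF h(2)] by measurable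
  moreover have "0 \<le> ?B" using sob_const_pos[where 'a='a] E(2) by simp
  ultimately show "L4 (\<lambda>x. avg (h/16) u x - avg h u x)" "N4 (\<lambda>x. avg (h/16) u x - avg h u x) \<le> ?B"
    by (auto intro: L4_nnI)
qed

lemma avg_telescope:
  "L4 (\<lambda>x. avg ((1/16)^(k+n)) u x - avg ((1/16)^k) u x) \<and>
   N4 (\<lambda>x. avg ((1/16)^(k+n)) u x - avg ((1/16)^k) u x)
     \<le> root 4 (sob_const TYPE('a)) * sqrt E * (2 * (1/2)^k - 2 * (1/2)^(k+n))"
proof (induction n)
  case 0
  then show ?case by (simp add: L4_def N4_def)
next
  case (Suc n)
  let ?C = "root 4 (sob_const TYPE('a)) * sqrt E"
  let ?a = "\<lambda>n x. avg ((1/16)^n) u x"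
  have s: "L4 (\<lambda>x. ?a (Suc (k+n)) x - ?a (k+n) x)" "N4 (\<lambda>x. ?a (Suc (k+n)) x - ?a (k+n) x) \<le> ?C * (1/2)^(k+n)"
    using avg_increment[of "k+n"] by (simp_all add: mult.commute)
  have "L4 (\<lambda>x. ?a (k + Suc n) x - ?a k x)"
    using L4_add[OF s(1) conjunct1[OF Suc]] by simp
  moreover have "N4 (\<lambda>x. ?a (k + Suc n) x - ?a k x) \<le> ?C * (1/2)^(k+n) + ?C * (2 * (1/2)^k - 2 * (1/2)^(k+n))"
    using N4_triangle[OF s(1) conjunct1[OF Suc]] s(2) Suc by simp
  ultimately show ?case by (simp add: algebra_simps)
qed

text \<open>Let n tend to infinity in \<open>avg_telescope\<close>; Fatou transfers the bound
  because the means converge pointwise to u. The case k = 0 will give the embedding, large k the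
  compactness.\<close>

lemma avg_L4_error:
  "L4 (\<lambda>x. u x - avg ((1/16)^k) u x)"
  "N4 (\<lambda>x. u x - avg ((1/16)^k) u x) \<le> root 4 (sob_const TYPE('a)) * sqrt E * (2 * (1/2)^k)"
proof -
  let ?C = "root 4 (sob_const TYPE('a)) * sqrt E"
  let ?a = "\<lambda>n x. avg ((1/16)^n) u x"
  have C: "0 \<le> ?C" using sob_const_pos[where 'a='a] E(2) by simp
  obtain B where b: "\<And>x. \<bar>u x\<bar> \<le> B" using test_fun_bounded[OF u] by blast
  have "(\<lambda>n. (1/16::real)^(k+n)) \<longlonglongrightarrow> 0"
    using LIMSEQ_ignore_initial_segment[OF LIMSEQ_realpow_zero[of "1/16::real"], of k] by (simp add: add.commute)
  then have "(\<lambda>n. ?a (k+n) x) \<longlonglongrightarrow> u x" for x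
    by (intro avg_tendsto[OF test_fun_continuous[OF u] b]) auto
  then have lim: "AE x in lebesgue. (\<lambda>n. ?a (k+n) x - ?a k x) \<longlonglongrightarrow> u x - ?a k x"
    by (intro AE_I2 tendsto_diff tendsto_const)
  have bd: "N4 (\<lambda>x. ?a (k+n) x - ?a k x) \<le> ?C * (2 * (1/2)^k)" for n
  proof -
    have "?C * (2 * (1/2)^k - 2 * (1/2)^(k+n)) \<le> ?C * (2 * (1/2)^k)"
      by (intro mult_left_mono C) auto
    then show ?thesis using avg_telescope[of k n] by linarith
  qed
  have m: "(\<lambda>x. u x - ?a k x) \<in> borel_measurable lebesgue"
    using avg_u_measurable[of "(1/16)^k"] u_measurable by (intro borel_measurable_diff) (auto simp: measurable_completion)
  show "L4 (\<lambda>x. u x - ?a k x)" "N4 (\<lambda>x. u x - ?a k x) \<le> ?C * (2 * (1/2)^k)"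
    using L4_fatou[OF _ bd m lim] avg_telescope by auto
qed

lemma avg_L4:
  assumes F: "(\<integral>\<^sup>+x. ennreal ((u x)\<^sup>2) \<partial>lborel) \<le> ennreal F" "F \<ge> 0" and h: "h > 0"
  shows "L4 (avg h u)" "N4 (avg h u) \<le> root 4 (1 / ball_vol TYPE('a) h) * sqrt F"
proof -
  let ?B = "root 4 (1 / ball_vol TYPE('a) h) * sqrt F"
  note v = ball_vol_pos[OF h, where 'a='a]
  have "(\<integral>\<^sup>+x. ennreal ((avg h u x)^4) \<partial>lborel) \<le> ennreal (1 / ball_vol TYPE('a) h) * (ennreal F)\<^sup>2"
    by (rule order_trans[OF avg_L4_le[OF u_measurable h]]) (intro mult_left_mono power_mono F, auto)
  also have "\<dots> = ennreal (1 / ball_vol TYPE('a) h * F\<^sup>2)"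
    using F(2) v by (subst ennreal_mult) (auto simp: ennreal_power)
  also have "1 / ball_vol TYPE('a) h * F\<^sup>2 = ?B^4"
  proof -
    have "(sqrt F)^4 = F\<^sup>2" using F(2) by (simp add: power4_eq_xxxx power2_eq_square)
    moreover have "(root 4 (1 / ball_vol TYPE('a) h))^4 = 1 / ball_vol TYPE('a) h"
      using v by (intro real_root_pow_pos2) auto
    ultimately show ?thesis by (simp add: power_mult_distrib)
  qed
  finally have *: "(\<integral>\<^sup>+x. ennreal ((avg h u x)^4) \<partial>lebesgue) \<le> ennreal (?B^4)"
    by (simp add: nn_integral_completion)
  show "L4 (avg h u)" "N4 (avg h u) \<le> ?B"
    using L4_nnI[OF avg_u_measurable[OF h] *] v F(2) by auto
qed

end

definition sob_bound :: "'a::euclidean_space itself \<Rightarrow> real" where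
  "sob_bound T = root 4 (1 / ball_vol TYPE('a) 1) + 2 * root 4 (sob_const TYPE('a))"

lemma sob_bound_pos: "sob_bound TYPE('a::euclidean_space) > 0"
  unfolding sob_bound_def using ball_vol_pos[of 1, where 'a='a] sob_const_pos[where 'a='a]
  by (intro add_pos_pos) auto

definition el :: "('a::euclidean_space \<Rightarrow> real) \<Rightarrow> 'a h1" where
  "el \<phi> = (\<phi>, grad \<phi>)"

text \<open>Extended-valued, so that approximation in norm can be expressed before square
  integrability is known; \<open>nH\<close> is the real-valued counterpart.\<close>

definition nsq :: "'a::euclidean_space h1 \<Rightarrow> ennreal" where
  "nsq U = (\<integral>\<^sup>+x. ennreal ((fst U x)\<^sup>2 + (norm (snd U x))\<^sup>2) \<partial>lebesgue)"

lemma test_fun_nsq_components: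
  assumes "nsq (el u) \<le> ennreal c"
  shows "(\<integral>\<^sup>+x. ennreal ((u x)\<^sup>2) \<partial>lborel) \<le> ennreal c"
    "(\<integral>\<^sup>+x. ennreal ((norm (grad u x))\<^sup>2) \<partial>lborel) \<le> ennreal c"
proof -
  have "(\<integral>\<^sup>+x. ennreal ((u x)\<^sup>2) \<partial>lborel) \<le> nsq (el u)" "(\<integral>\<^sup>+x. ennreal ((norm (grad u x))\<^sup>2) \<partial>lborel) \<le> nsq (el u)"
    unfolding nsq_def el_def nn_integral_completion by (auto intro!: nn_integral_mono ennreal_leI)
  then show "(\<integral>\<^sup>+x. ennreal ((u x)\<^sup>2) \<partial>lborel) \<le> ennreal c"
    "(\<integral>\<^sup>+x. ennreal ((norm (grad u x))\<^sup>2) \<partial>lborel) \<le> ennreal c"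
    using assms order_trans by blast+
qed

text \<open>u is its unit mean plus the error of \<open>avg_L4_error\<close> at k = 0. The first is
  controlled by the L^2 norm, the second by the gradient, and the two constants add up to
  \<open>sob_bound\<close>.\<close>

lemma test_fun_sobolev:
  fixes u :: "'a::euclidean_space \<Rightarrow> real"
  assumes dim: "DIM('a) \<le> 3" and u: "test_fun \<Omega> u" and n: "nsq (el u) \<le> ennreal (M\<^sup>2)" and M: "M \<ge> 0"
  shows "L4 u" "N4 u \<le> sob_bound TYPE('a) * M"
proof -
  note c = test_fun_nsq_components[OF n]
  note e = avg_L4_error[OF dim u c(2), of 0] and a = avg_L4[OF dim u c(2) _ c(1), of 1]
  have 1: "L4 (\<lambda>x. u x - avg 1 u x)" "N4 (\<lambda>x. u x - avg 1 u x) \<le> root 4 (sob_const TYPE('a)) * M * 2"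
    using e M by auto
  have 2: "L4 (avg 1 u)" "N4 (avg 1 u) \<le> root 4 (1 / ball_vol TYPE('a) 1) * M"
    using a M by auto
  show "L4 u" using L4_add[OF 1(1) 2(1)] by simp
  show "N4 u \<le> sob_bound TYPE('a) * M"
    using N4_triangle[OF 1(1) 2(1)] 1(2) 2(2) by (simp add: sob_bound_def algebra_simps)
qed

section \<open>Compactness in L^4 for bounded families of test functions\<close>

lemma avg_support:
  fixes u :: "'a::euclidean_space \<Rightarrow> real"
  assumes h: "h > 0" and z: "\<And>y. norm y > R \<Longrightarrow> u y = 0" and x: "norm x > R + h"
  shows "avg h u x = 0"
proof -
  have "AE z in (ball_unif h :: 'a measure). u (x + z) = 0"
    using AE_ball_unif[OF h, where 'a='a]
  proof eventually_elim
    case (elim z)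
    have "norm x \<le> norm (x + z) + norm z" using norm_triangle_ineq4[of "x + z" z] by simp
    then show ?case using x elim by (intro z) linarith
  qed
  then show ?thesis unfolding avg_def by (rule integral_eq_zero_AE)
qed

text \<open>Arzela-Ascoli at a fixed radius: the means are bounded and Lipschitz uniformly in n, and
  they live on a common ball, so uniform closeness gives L^4 closeness. A tail is cut off so that
  all differences, not only late ones, are small.\<close>

lemma avg_compact:
  fixes u :: "nat \<Rightarrow> 'a::euclidean_space \<Rightarrow> real"
  assumes u: "\<And>n. test_fun \<Omega> (u n)" and n: "\<And>n. nsq (el (u n)) \<le> ennreal c" and c: "c \<ge> 0"
    and \<Omega>: "bounded \<Omega>" and h: "h > 0" and e: "e > 0"
  shows "\<exists>r :: nat \<Rightarrow> nat. strict_mono r \<and>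
    (\<forall>i j. L4 (\<lambda>x. avg h (u (r i)) x - avg h (u (r j)) x) \<and> N4 (\<lambda>x. avg h (u (r i)) x - avg h (u (r j)) x) \<le> e)"
proof -
  obtain R where R: "\<And>y. y \<in> \<Omega> \<Longrightarrow> norm y \<le> R" using \<Omega> by (auto simp: bounded_iff)
  have z: "u n y = 0" if "norm y > R" for n y
    using R[of y] that test_fun_outside(1)[OF u, of y n] by force
  \<comment> \<open>Every mean vanishes outside this ball, since u vanishes beyond R and the mean
    looks only a distance h away.\<close>
  define S where "S = cball (0::'a) (R + h)"
  define K where "K = 1 / ball_vol TYPE('a) h"
  have K: "K \<ge> 0" unfolding K_def by simp
  have m: "u n \<in> borel_measurable borel" for n
    by (rule borel_measurable_continuous_onI[OF test_fun_continuous[OF u]])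
  note comp = test_fun_nsq_components[OF n]
  have sup: "norm (avg h (u n) x) \<le> sqrt (K * c)" for n x
  proof -
    have "ennreal ((avg h (u n) x)\<^sup>2) \<le> ennreal K * ennreal c"
      using order_trans[OF avg_sup_le[OF m h] mult_left_mono[OF comp(1)]] by (simp add: K_def)
    then have "(avg h (u n) x)\<^sup>2 \<le> K * c"
      using K c by (simp add: ennreal_mult[symmetric] ennreal_le_iff)
    then show ?thesis using real_sqrt_le_mono by fastforce
  qed
  have lip: "norm (avg h (u n) x - avg h (u n) y) \<le> sqrt (K * c) * norm (x - y)" for n x y
  proof -
    obtain B where b: "\<And>x. \<bar>u n x\<bar> \<le> B" using test_fun_bounded[OF u] by blast
    have "ennreal ((avg h (u n) x - avg h (u n) y)\<^sup>2) \<le> ennreal K * (ennreal ((norm (x - y))\<^sup>2) * ennreal c)"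
      using order_trans[OF avg_lipschitz[OF test_fun_has_grad[OF u] test_fun_continuous_grad[OF u] b h]
          mult_left_mono[OF mult_left_mono[OF comp(2)]]] by (simp add: K_def)
    then have "(avg h (u n) x - avg h (u n) y)\<^sup>2 \<le> K * c * (norm (x - y))\<^sup>2"
      using K c by (simp add: ennreal_mult[symmetric] ennreal_le_iff mult_ac)
    then have "sqrt ((avg h (u n) x - avg h (u n) y)\<^sup>2) \<le> sqrt (K * c * (norm (x - y))\<^sup>2)"
      by (rule real_sqrt_le_mono)
    then show ?thesis by (simp add: real_sqrt_mult)
  qed
  obtain g k where k: "strict_mono (k :: nat \<Rightarrow> nat)"
    and g: "\<And>e. 0 < e \<Longrightarrow> \<exists>N. \<forall>n x. n \<ge> N \<and> x \<in> S \<longrightarrow> norm (avg h (u (k n)) x - g x) < e"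
  proof (rule Arzela_Ascoli[of S "\<lambda>n. avg h (u n)" "sqrt (K * c)"])
    show "compact S" by (simp add: S_def)
    show "\<exists>d>0. \<forall>n y. y \<in> S \<and> norm (x - y) < d \<longrightarrow> norm (avg h (u n) x - avg h (u n) y) < e" if "0 < e" for x e
    proof (intro exI conjI allI impI)
      show "0 < e / (sqrt (K * c) + 1)" using that K c by (intro divide_pos_pos add_nonneg_pos) auto
      fix n y assume y: "y \<in> S \<and> norm (x - y) < e / (sqrt (K * c) + 1)"
      have s: "0 < sqrt (K * c) + 1" using K c by (intro add_nonneg_pos) auto
      have "norm (avg h (u n) x - avg h (u n) y) \<le> (sqrt (K * c) + 1) * norm (x - y)"
        using lip[of n x y] by (simp add: distrib_right add_increasing2)
      also have "\<dots> < (sqrt (K * c) + 1) * (e / (sqrt (K * c) + 1))"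
        using y s by (intro mult_strict_left_mono) auto
      finally show "norm (avg h (u n) x - avg h (u n) y) < e" using s by simp
    qed
  qed (use sup in auto)
  define V where "V = measure lborel S"
  \<comment> \<open>Two errors d on a set of measure V give an L^4 norm of at most 2 d V^(1/4); the
    added 1 avoids division by zero.\<close>
  define d where "d = e / (2 * (root 4 V + 1))"
  have V: "V \<ge> 0" unfolding V_def by simp
  have d: "d > 0" using e V unfolding d_def by (intro divide_pos_pos) (auto intro: add_nonneg_pos)
  obtain N where N: "\<And>n x. n \<ge> N \<Longrightarrow> x \<in> S \<Longrightarrow> norm (avg h (u (k n)) x - g x) < d"
    using g[OF d] by blast
  show ?thesis
  proof (intro exI[of _ "\<lambda>i. k (i + N)"] conjI allI)
    show "strict_mono (\<lambda>i. k (i + N))" using k by (auto simp: strict_mono_def)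
    fix i j
    let ?w = "\<lambda>x. avg h (u (k (i + N))) x - avg h (u (k (j + N))) x"
    have w: "ennreal ((?w x)^4) \<le> ennreal ((2 * d)^4) * indicator S x" for x
    proof (cases "x \<in> S")
      case True
      have "\<bar>?w x\<bar> \<le> 2 * d"
        using N[of "i + N" x] N[of "j + N" x] True by (simp add: abs_if split: if_splits)
      then have "\<bar>?w x\<bar>^4 \<le> (2 * d)^4" by (intro power_mono) auto
      then show ?thesis using True by (auto intro: ennreal_leI)
    next
      case False
      then have "avg h (u n) x = 0" for n by (intro avg_support[OF h z]) (auto simp: S_def)
      then show ?thesis using False by simp
    qed
    have "(\<integral>\<^sup>+x. ennreal ((?w x)^4) \<partial>lebesgue) \<le> (\<integral>\<^sup>+x. ennreal ((2 * d)^4) * indicator S x \<partial>lborel)"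
      unfolding nn_integral_completion by (intro nn_integral_mono w)
    also have "\<dots> = ennreal ((2 * d)^4) * emeasure lborel S"
      by (rule nn_integral_cmult_indicator) (simp add: S_def)
    also have "emeasure lborel S = ennreal V"
      unfolding V_def S_def using emeasure_lborel_cball_finite[of "0::'a" "R + h"]
      by (intro emeasure_eq_ennreal_measure) auto
    also have "ennreal ((2 * d)^4) * ennreal V = ennreal ((2 * d * root 4 V)^4)"
      using V d by (simp add: ennreal_mult[symmetric] power_mult_distrib)
    also have "\<dots> \<le> ennreal (e^4)"
    proof (intro ennreal_leI power_mono)
      have "2 * d * root 4 V \<le> 2 * d * (root 4 V + 1)" using d by (intro mult_left_mono) auto
      also have "\<dots> = e"
      proof -
        have "root 4 V + 1 > 0" using V by (intro add_nonneg_pos) auto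
        then show ?thesis unfolding d_def by (simp add: field_simps)
      qed
      finally show "2 * d * root 4 V \<le> e" .
      show "0 \<le> 2 * d * root 4 V" using d V by simp
    qed
    finally have *: "(\<integral>\<^sup>+x. ennreal ((?w x)^4) \<partial>lebesgue) \<le> ennreal (e^4)" .
    have "?w \<in> borel_measurable lebesgue"
      using measurable_avg[OF m h] by (intro borel_measurable_diff) (auto simp: measurable_completion)
    then show "L4 ?w" "N4 ?w \<le> e" using L4_nnI[OF _ *] e by auto
  qed
qed

text \<open>Rellich's theorem by diagonalisation: for tolerance 1/(k+1) the functions are replaced
  by means at a radius where the error is small for all n at once, and \<open>avg_compact\<close>
  treats the means.\<close>

lemma test_fun_L4_compact:
  fixes u :: "nat \<Rightarrow> 'a::euclidean_space \<Rightarrow> real"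
  assumes dim: "DIM('a) \<le> 3" and u: "\<And>n. test_fun \<Omega> (u n)" and n: "\<And>n. nsq (el (u n)) \<le> ennreal (M\<^sup>2)" and M: "M \<ge> 0"
    and \<Omega>: "bounded \<Omega>"
  shows "\<exists>r :: nat \<Rightarrow> nat. strict_mono r \<and>
    (\<forall>e>0. \<exists>N. \<forall>i\<ge>N. \<forall>j\<ge>N. N4 (\<lambda>x. u (r i) x - u (r j) x) \<le> e)"
proof -
  define P where "P k s \<longleftrightarrow> (\<forall>i j. N4 (\<lambda>x. u (s i) x - u (s j) x) \<le> 1 / Suc k)" for k and s :: "nat \<Rightarrow> nat"
  have "\<exists>r. strict_mono r \<and> P k (s \<circ> r)" if s: "strict_mono s" for k and s :: "nat \<Rightarrow> nat"
  proof -
    define C where "C = root 4 (sob_const TYPE('a)) * M * 2"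
    have C: "C \<ge> 0" using M sob_const_pos[where 'a='a] by (simp add: C_def)
    \<comment> \<open>A third of the tolerance: two replacement errors and one difference of
      means.\<close>
    define e where "e = 1 / (3 * real (Suc k))"
    have e: "e > 0" by (simp add: e_def)
    obtain p :: nat where p: "(1/2)^p < e / (C + 1)"
      using real_arch_pow_inv[of "e / (C + 1)" "1/2"] e C by auto
    let ?a = "\<lambda>n. avg ((1/16)^p) (u n)"
    have er: "L4 (\<lambda>x. u n x - ?a n x)" "N4 (\<lambda>x. u n x - ?a n x) \<le> e" for n
    proof -
      note t = avg_L4_error[OF dim u test_fun_nsq_components(2)[OF n], of n p]
      show "L4 (\<lambda>x. u n x - ?a n x)" using t(1) by simp
      have "N4 (\<lambda>x. u n x - ?a n x) \<le> C * (1/2)^p" using t(2) M by (simp add: C_def mult_ac)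
      also have "\<dots> \<le> (C + 1) * (1/2)^p" by (intro mult_right_mono) auto
      also have "\<dots> \<le> (C + 1) * (e / (C + 1))" using p C by (intro mult_left_mono) auto
      finally show "N4 (\<lambda>x. u n x - ?a n x) \<le> e" using C by simp
    qed
    have us: "\<And>n. test_fun \<Omega> (u (s n))" and ns: "\<And>n. nsq (el (u (s n))) \<le> ennreal (M\<^sup>2)" using u n by auto
    have hp: "(1/16::real)^p > 0" by simp
    obtain r :: "nat \<Rightarrow> nat" where r0: "strict_mono r \<and> (\<forall>i j. L4 (\<lambda>x. ?a (s (r i)) x - ?a (s (r j)) x)
        \<and> N4 (\<lambda>x. ?a (s (r i)) x - ?a (s (r j)) x) \<le> e)"
      using avg_compact[where u = "\<lambda>n. u (s n)", OF us ns zero_le_power2 \<Omega> hp e] ..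
    then have r: "strict_mono r" "L4 (\<lambda>x. ?a (s (r i)) x - ?a (s (r j)) x)"
      "N4 (\<lambda>x. ?a (s (r i)) x - ?a (s (r j)) x) \<le> e" for i j
      by simp_all
    have "N4 (\<lambda>x. u (s (r i)) x - u (s (r j)) x) \<le> 1 / Suc k" for i j
    proof -
      let ?x = "\<lambda>x. u (s (r i)) x - ?a (s (r i)) x" and ?y = "\<lambda>x. ?a (s (r i)) x - ?a (s (r j)) x"
        and ?z = "\<lambda>x. ?a (s (r j)) x - u (s (r j)) x"
      have z: "L4 ?z" "N4 ?z \<le> e"
        using L4_cmult[OF er(1)[of "s (r j)"], of "-1"] er(2)[of "s (r j)"] N4_minus_commute[of "?a (s (r j))" "u (s (r j))"]
        by simp_all
      have xy: "L4 (\<lambda>x. ?x x + ?y x)" "N4 (\<lambda>x. ?x x + ?y x) \<le> e + e"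
        using L4_add[OF er(1)[of "s (r i)"] r(2)[of i j]] N4_triangle[OF er(1)[of "s (r i)"] r(2)[of i j]] er(2)[of "s (r i)"] r(3)[of i j]
        by linarith+
      have "N4 (\<lambda>x. (?x x + ?y x) + ?z x) \<le> e + e + e"
        using N4_triangle[OF xy(1) z(1)] xy(2) z(2) by linarith
      moreover have "e + e + e = 1 / Suc k" by (simp add: e_def field_simps)
      ultimately show ?thesis by simp
    qed
    then show ?thesis using r(1) by (auto simp: P_def)
  qed
  then interpret subseqs P by unfold_locales auto
  \<comment> \<open>From index k+1 on the diagonal sequence satisfies \<open>P k\<close>, because
    \<open>P k\<close> bounds all index pairs and is therefore inherited by subsequences.\<close>
  have H: "P k (diagseq \<circ> ((+) (Suc k)))" for k
    by (rule diagseq_holds) (auto simp: P_def)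
  show ?thesis
  proof (intro exI[of _ diagseq] conjI allI impI)
    show "strict_mono diagseq" by (rule subseq_diagseq)
    fix e :: real assume "e > 0"
    then obtain k where k: "1 / Suc k < e" using nat_approx_posE by blast
    have "N4 (\<lambda>x. u (diagseq i) x - u (diagseq j) x) \<le> e" if "i \<ge> Suc k" "j \<ge> Suc k" for i j
    proof -
      have "N4 (\<lambda>x. u (diagseq (Suc k + (i - Suc k))) x - u (diagseq (Suc k + (j - Suc k))) x) \<le> 1 / Suc k"
        using H[of k] unfolding P_def o_def by (elim allE)
      then show ?thesis using that k by simp
    qed
    then show "\<exists>N. \<forall>i\<ge>N. \<forall>j\<ge>N. N4 (\<lambda>x. u (diagseq i) x - u (diagseq j) x) \<le> e" by blast
  qed
qed

section \<open>Completeness of $L^2$ and the space $H^1_0$\<close>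

text \<open>Riesz-Fischer along a subsequence whose steps have squared norm at most 8^-k. Even
  weighted by 2^k these are summable, so almost everywhere the increments are dominated by a
  geometric series. Fatou then gives mean convergence of the full sequence.\<close>

lemma L2_complete:
  fixes F :: "nat \<Rightarrow> 'b \<Rightarrow> 'c::{banach, second_countable_topology}"
  assumes [measurable]: "\<And>n. F n \<in> borel_measurable M"
    and cauchy: "\<And>e. e > 0 \<Longrightarrow> \<exists>N. \<forall>m\<ge>N. \<forall>n\<ge>N. (\<integral>\<^sup>+x. ennreal ((norm (F m x - F n x))\<^sup>2) \<partial>M) \<le> ennreal e"
  obtains G where "G \<in> borel_measurable M" "(\<lambda>n. \<integral>\<^sup>+x. ennreal ((norm (F n x - G x))\<^sup>2) \<partial>M) \<longlonglongrightarrow> 0"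
proof -
  have "\<exists>N. \<forall>k. \<forall>m\<ge>N k. \<forall>n\<ge>N k. (\<integral>\<^sup>+x. ennreal ((norm (F m x - F n x))\<^sup>2) \<partial>M) \<le> ennreal ((1/8)^k)"
    by (intro choice allI cauchy) simp
  then obtain N :: "nat \<Rightarrow> nat" where N: "\<And>k m n. m \<ge> N k \<Longrightarrow> n \<ge> N k \<Longrightarrow> (\<integral>\<^sup>+x. ennreal ((norm (F m x - F n x))\<^sup>2) \<partial>M) \<le> ennreal ((1/8)^k)"
    by blast
  \<comment> \<open>A single formula for an index that is nondecreasing, beyond \<open>N k\<close>,
    and unbounded.\<close>
  define r where "r k = k + (\<Sum>j\<le>k. N j)" for k
  have rN: "N k \<le> r k" "r k \<le> r (Suc k)" "k \<le> r k" for k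
    unfolding r_def using member_le_sum[of k "{..k}" N] by auto
  define d where "d k x = F (r (Suc k)) x - F (r k) x" for k x
  have [measurable]: "d k \<in> borel_measurable M" for k unfolding d_def by measurable
  have "(\<integral>\<^sup>+x. (\<Sum>k. ennreal (2^k * (norm (d k x))\<^sup>2)) \<partial>M) = (\<Sum>k. \<integral>\<^sup>+x. ennreal (2^k * (norm (d k x))\<^sup>2) \<partial>M)"
    by (rule nn_integral_suminf) measurable
  also have "\<dots> \<le> (\<Sum>k. ennreal ((1/4)^k))"
  proof (rule suminf_le)
    fix k
    have "(\<integral>\<^sup>+x. ennreal (2^k * (norm (d k x))\<^sup>2) \<partial>M) = ennreal (2^k) * (\<integral>\<^sup>+x. ennreal ((norm (d k x))\<^sup>2) \<partial>M)"
      by (simp add: ennreal_mult nn_integral_cmult)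
    also have "\<dots> \<le> ennreal (2^k) * ennreal ((1/8)^k)"
      unfolding d_def using rN(1)[of k] rN(2)[of k] by (intro mult_left_mono N) auto
    also have "\<dots> = ennreal ((1/4)^k)"
      by (simp add: ennreal_mult[symmetric] power_mult_distrib[symmetric])
    finally show "(\<integral>\<^sup>+x. ennreal (2^k * (norm (d k x))\<^sup>2) \<partial>M) \<le> ennreal ((1/4)^k)" .
  qed auto
  also have "\<dots> = ennreal (\<Sum>k. (1/4)^k)"
    by (rule suminf_ennreal2) (auto intro: summable_geometric)
  finally have "(\<integral>\<^sup>+x. (\<Sum>k. ennreal (2^k * (norm (d k x))\<^sup>2)) \<partial>M) \<noteq> \<infinity>"
    by (metis ennreal_neq_top infinity_ennreal_def top_unique)
  then have "AE x in M. (\<Sum>k. ennreal (2^k * (norm (d k x))\<^sup>2)) \<noteq> \<infinity>"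
    by (intro nn_integral_noteq_infinite) auto
  then have conv: "AE x in M. convergent (\<lambda>n. F (r n) x)"
  proof eventually_elim
    case (elim x)
    define s where "s = enn2real (\<Sum>k. ennreal (2^k * (norm (d k x))\<^sup>2))"
    have s: "(\<Sum>k. ennreal (2^k * (norm (d k x))\<^sup>2)) = ennreal s" "s \<ge> 0"
      using elim by (auto simp: s_def top.not_eq_extremum)
    have bound: "norm (d k x) \<le> sqrt s * (sqrt (1/2))^k" for k
    proof -
      have "ennreal (2^k * (norm (d k x))\<^sup>2) \<le> ennreal s"
        using sum_le_suminf[of "\<lambda>k. ennreal (2^k * (norm (d k x))\<^sup>2)" "{k}"] s(1) by simp
      then have "2^k * (norm (d k x))\<^sup>2 \<le> s" using s(2) by (simp add: ennreal_le_iff)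
      then have "(norm (d k x))\<^sup>2 \<le> s * (1/2)^k" by (simp add: power_divide field_simps)
      then have "sqrt ((norm (d k x))\<^sup>2) \<le> sqrt (s * (1/2)^k)" by (rule real_sqrt_le_mono)
      then show ?thesis by (simp add: real_sqrt_mult real_sqrt_power)
    qed
    have "sqrt (1/2) < (1::real)" by simp
    then have "summable (\<lambda>k. sqrt s * (sqrt (1/2::real))^k)"
      by (intro summable_mult summable_geometric) auto
    then have "summable (\<lambda>k. d k x)"
      by (rule summable_comparison_test'[where N = 0]) (rule bound)
    then have "convergent (\<lambda>n. (\<Sum>k<n. d k x) + F (r 0) x)"
      by (intro convergent_add) (auto simp: summable_iff_convergent convergent_const)
    moreover have "(\<Sum>k<n. d k x) = F (r n) x - F (r 0) x" for n
      unfolding d_def by (rule sum_lessThan_telescope)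
    ultimately show ?case by simp
  qed
  define G where "G x = lim (\<lambda>n. F (r n) x)" for x
  have [measurable]: "G \<in> borel_measurable M" unfolding G_def by measurable
  have lim: "AE x in M. (\<lambda>n. F (r n) x) \<longlonglongrightarrow> G x"
    using conv by eventually_elim (simp add: G_def convergent_LIMSEQ_iff)
  have lim0: "(\<lambda>n. \<integral>\<^sup>+x. ennreal ((norm (F n x - G x))\<^sup>2) \<partial>M) \<longlonglongrightarrow> 0"
  proof (rule order_tendstoI)
    fix a :: ennreal assume "0 < a"
    then obtain b where b: "0 < b" "b < a" using dense by blast
    then obtain e where "b = ennreal e" "e \<ge> 0" by (cases b) auto
    then have e: "e > 0" "ennreal e < a" using b by auto
    obtain K where K: "\<And>m n. m \<ge> K \<Longrightarrow> n \<ge> K \<Longrightarrow> (\<integral>\<^sup>+x. ennreal ((norm (F m x - F n x))\<^sup>2) \<partial>M) \<le> ennreal e"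
      using cauchy[OF e(1)] by blast
    show "\<forall>\<^sub>F n in sequentially. (\<integral>\<^sup>+x. ennreal ((norm (F n x - G x))\<^sup>2) \<partial>M) < a"
      unfolding eventually_sequentially
    proof (intro exI allI impI)
      fix m assume m: "m \<ge> K"
      have "(\<integral>\<^sup>+x. ennreal ((norm (F m x - G x))\<^sup>2) \<partial>M) = (\<integral>\<^sup>+x. liminf (\<lambda>n. ennreal ((norm (F m x - F (r n) x))\<^sup>2)) \<partial>M)"
      proof (rule nn_integral_cong_AE, use lim in eventually_elim)
        case (elim x)
        then have "(\<lambda>n. ennreal ((norm (F m x - F (r n) x))\<^sup>2)) \<longlonglongrightarrow> ennreal ((norm (F m x - G x))\<^sup>2)"
          by (intro tendsto_ennrealI tendsto_intros)
        from lim_imp_Liminf[OF _ this] show ?case by simp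
      qed
      also have "\<dots> \<le> liminf (\<lambda>n. \<integral>\<^sup>+x. ennreal ((norm (F m x - F (r n) x))\<^sup>2) \<partial>M)"
        by (rule nn_integral_liminf) measurable
      also have "\<dots> \<le> ennreal e"
      proof (rule Liminf_le)
        show "\<forall>\<^sub>F n in sequentially. (\<integral>\<^sup>+x. ennreal ((norm (F m x - F (r n) x))\<^sup>2) \<partial>M) \<le> ennreal e"
          unfolding eventually_sequentially using K[OF m] rN(3) le_trans by blast
      qed simp
      finally show "(\<integral>\<^sup>+x. ennreal ((norm (F m x - G x))\<^sup>2) \<partial>M) < a" using e(2) by simp
    qed
  qed auto
  show ?thesis by (rule that[OF _ lim0]) measurable
qed

lemma L2_AE_subseq:
  fixes F :: "nat \<Rightarrow> 'b \<Rightarrow> 'c::{banach, second_countable_topology}"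
  assumes [measurable]: "\<And>n. F n \<in> borel_measurable M" "G \<in> borel_measurable M"
    and lim: "(\<lambda>n. \<integral>\<^sup>+x. ennreal ((norm (F n x - G x))\<^sup>2) \<partial>M) \<longlonglongrightarrow> 0"
  obtains r where "strict_mono (r :: nat \<Rightarrow> nat)" "AE x in M. (\<lambda>n. F (r n) x) \<longlonglongrightarrow> G x"
proof -
  have "\<forall>\<^sub>F n in sequentially. (\<integral>\<^sup>+x. ennreal ((norm (F n x - G x))\<^sup>2) \<partial>M) < 1"
    using lim by (rule order_tendstoD) simp
  \<comment> \<open>Only a tail is known to be at finite distance from G, so the L^1 argument runs
    on the indices from N on.\<close>
  then obtain N where N: "\<And>n. n \<ge> N \<Longrightarrow> (\<integral>\<^sup>+x. ennreal ((norm (F n x - G x))\<^sup>2) \<partial>M) < 1"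
    by (auto simp: eventually_sequentially)
  define w where "w n x = (norm (F (n + N) x - G x))\<^sup>2" for n x
  have w: "w n = (\<lambda>x. (norm (F (n + N) x - G x))\<^sup>2)" for n by (simp add: w_def fun_eq_iff)
  have [measurable]: "w n \<in> borel_measurable M" for n unfolding w by measurable
  have i: "integrable M (w n)" for n
  proof (rule integrableI_nonneg)
    show "(\<integral>\<^sup>+x. ennreal (w n x) \<partial>M) < \<infinity>"
      using N[of "n + N"] unfolding w_def by (simp add: less_trans[OF _ ennreal_one_less_top])
  qed (auto simp: w_def)
  have "(\<lambda>n. ennreal (LINT x|M. norm (w n x))) \<longlonglongrightarrow> ennreal 0"
  proof -
    have "ennreal (LINT x|M. norm (w n x)) = (\<integral>\<^sup>+x. ennreal ((norm (F (n + N) x - G x))\<^sup>2) \<partial>M)" for n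
      using nn_integral_eq_integral[OF i[of n]] by (simp add: w)
    then show ?thesis using LIMSEQ_ignore_initial_segment[OF lim, of N] by simp
  qed
  then have "(\<lambda>n. LINT x|M. norm (w n x)) \<longlonglongrightarrow> 0"
    by (subst (asm) tendsto_ennreal_iff) auto
  from tendsto_L1_AE_subseq[OF i this] obtain r where r: "strict_mono r" "AE x in M. (\<lambda>n. w (r n) x) \<longlonglongrightarrow> 0"
    by blast
  show ?thesis
  proof (rule that[of "\<lambda>n. r n + N"])
    show "strict_mono (\<lambda>n. r n + N)" using r(1) by (auto simp: strict_mono_def)
    show "AE x in M. (\<lambda>n. F (r n + N) x) \<longlonglongrightarrow> G x"
      using r(2)
    proof eventually_elim
      case (elim x)
      then have "(\<lambda>n. sqrt (w (r n) x)) \<longlonglongrightarrow> sqrt 0" by (rule tendsto_real_sqrt)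
      then have "(\<lambda>n. norm (F (r n + N) x - G x)) \<longlonglongrightarrow> 0" by (simp add: w_def)
      then show ?case by (simp add: tendsto_norm_zero_iff LIM_zero_iff)
    qed
  qed
qed

section \<open>Bilinear forms on pairs of a function and a gradient field\<close>

definition b0 :: "'a::euclidean_space h1 \<Rightarrow> 'a h1 \<Rightarrow> real" where
  "b0 U V = (LINT x|lebesgue. fst U x * fst V x)"

definition a1 :: "'a::euclidean_space h1 \<Rightarrow> 'a h1 \<Rightarrow> real" where
  "a1 U V = (LINT x|lebesgue. snd U x \<bullet> snd V x)"

definition nH :: "'a::euclidean_space h1 \<Rightarrow> real" where
  "nH U = b0 U U + a1 U U"

definition L2p :: "'a::euclidean_space h1 \<Rightarrow> bool" where
  "L2p U \<longleftrightarrow> fst U \<in> borel_measurable lebesgue \<and> snd U \<in> borel_measurable lebesgue \<and> nsq U < \<infinity>"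

lemma L2p_measurable: "L2p U \<Longrightarrow> fst U \<in> borel_measurable lebesgue" "L2p U \<Longrightarrow> snd U \<in> borel_measurable lebesgue"
  by (auto simp: L2p_def)

lemma L2p_square_integrable:
  assumes "L2p U"
  shows "integrable lebesgue (\<lambda>x. (fst U x)\<^sup>2)" "integrable lebesgue (\<lambda>x. (norm (snd U x))\<^sup>2)"
proof -
  note [measurable] = L2p_measurable[OF assms]
  have *: "nsq U < \<infinity>" using assms by (simp add: L2p_def)
  have le: "(\<integral>\<^sup>+x. ennreal ((fst U x)\<^sup>2) \<partial>lebesgue) \<le> nsq U" "(\<integral>\<^sup>+x. ennreal ((norm (snd U x))\<^sup>2) \<partial>lebesgue) \<le> nsq U"
    unfolding nsq_def by (auto intro!: nn_integral_mono ennreal_leI)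
  show "integrable lebesgue (\<lambda>x. (fst U x)\<^sup>2)"
    by (rule integrableI_nonneg) (use le_less_trans[OF le(1) *] in auto)
  show "integrable lebesgue (\<lambda>x. (norm (snd U x))\<^sup>2)"
    by (rule integrableI_nonneg) (use le_less_trans[OF le(2) *] in auto)
qed

lemma L2p_integrable:
  assumes U: "L2p U" and V: "L2p V"
  shows "integrable lebesgue (\<lambda>x. fst U x * fst V x)" "integrable lebesgue (\<lambda>x. snd U x \<bullet> snd V x)"
proof -
  note [measurable] = L2p_measurable[OF U] L2p_measurable[OF V]
  note i = L2p_square_integrable[OF U] L2p_square_integrable[OF V]
  have ab: "\<bar>a * b\<bar> \<le> a\<^sup>2 + b\<^sup>2" for a b :: real
  proof -
    have "2 * \<bar>a * b\<bar> \<le> a\<^sup>2 + b\<^sup>2"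
      using sum_squares_bound[of "\<bar>a\<bar>" "\<bar>b\<bar>"] by (simp add: abs_mult)
    then show ?thesis using abs_ge_zero[of "a * b"] by linarith
  qed
  show "integrable lebesgue (\<lambda>x. fst U x * fst V x)"
    by (rule Bochner_Integration.integrable_bound[of _ "\<lambda>x. (fst U x)\<^sup>2 + (fst V x)\<^sup>2"]) (use i ab in auto)
  have vw: "\<bar>v \<bullet> w\<bar> \<le> (norm v)\<^sup>2 + (norm w)\<^sup>2" for v w :: 'a
    using order_trans[OF Cauchy_Schwarz_ineq2[of v w]] ab[of "norm v" "norm w"] by simp
  show "integrable lebesgue (\<lambda>x. snd U x \<bullet> snd V x)"
    by (rule Bochner_Integration.integrable_bound[of _ "\<lambda>x. (norm (snd U x))\<^sup>2 + (norm (snd V x))\<^sup>2"])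
      (use i vw in \<open>simp_all add: abs_of_nonneg\<close>)
qed

lemma nsq_eq_nH:
  assumes "L2p U" shows "nsq U = ennreal (nH U)"
proof -
  note i = L2p_square_integrable[OF assms]
  have "nH U = (LINT x|lebesgue. (fst U x)\<^sup>2 + (norm (snd U x))\<^sup>2)"
    using i by (simp add: nH_def b0_def a1_def power2_eq_square dot_square_norm)
  then show ?thesis
    unfolding nsq_def using i by (subst nn_integral_eq_integral) auto
qed

lemma nH_nonneg [simp]: "nH U \<ge> 0"
  by (simp add: nH_def b0_def a1_def)

lemma b0_nonneg [simp]: "b0 U U \<ge> 0" and a1_nonneg [simp]: "a1 U U \<ge> 0"
  by (simp_all add: b0_def a1_def)


lemma nsq_cmult: "nsq (c *\<^sub>R U) = ennreal (c\<^sup>2) * nsq U" if "L2p U"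
proof -
  note [measurable] = L2p_measurable[OF that]
  have "nsq (c *\<^sub>R U) = (\<integral>\<^sup>+x. ennreal (c\<^sup>2) * ennreal ((fst U x)\<^sup>2 + (norm (snd U x))\<^sup>2) \<partial>lebesgue)"
    unfolding nsq_def by (intro nn_integral_cong) (simp add: power_mult_distrib ennreal_mult[symmetric] distrib_left del: ennreal_plus)
  then show ?thesis
    unfolding nsq_def by (subst (asm) nn_integral_cmult) auto
qed

lemma nsq_add_le:
  assumes "fst U \<in> borel_measurable lebesgue" "snd U \<in> borel_measurable lebesgue"
    "fst V \<in> borel_measurable lebesgue" "snd V \<in> borel_measurable lebesgue"
  shows "nsq (U + V) \<le> 2 * nsq U + 2 * nsq V"
proof -
  note [measurable] = assms
  have sq: "(a + b)\<^sup>2 \<le> 2 * a\<^sup>2 + 2 * b\<^sup>2" for a b :: real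
    using zero_le_power2[of "a - b"] by (simp add: power2_eq_square algebra_simps)
  have n: "(norm (v + w))\<^sup>2 \<le> 2 * (norm v)\<^sup>2 + 2 * (norm w)\<^sup>2" for v w :: 'a
    using order_trans[OF power_mono[OF norm_triangle_ineq[of v w] norm_ge_zero, of 2] sq] .
  let ?f = "\<lambda>U x. (fst U x)\<^sup>2 + (norm (snd U x))\<^sup>2 :: real"
  have le: "?f (U + V) x \<le> 2 * (?f U x + ?f V x)" for x
    using sq[of "fst U x" "fst V x"] n[of "snd U x" "snd V x"] by simp
  have "nsq (U + V) \<le> (\<integral>\<^sup>+x. 2 * (ennreal (?f U x) + ennreal (?f V x)) \<partial>lebesgue)"
    unfolding nsq_def
  proof (rule nn_integral_mono)
    fix x
    have "ennreal (?f (U + V) x) \<le> ennreal (2 * (?f U x + ?f V x))"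
      by (rule ennreal_leI[OF le])
    also have "\<dots> = 2 * (ennreal (?f U x) + ennreal (?f V x))"
      by (subst ennreal_mult) auto
    finally show "ennreal (?f (U + V) x) \<le> 2 * (ennreal (?f U x) + ennreal (?f V x))" .
  qed
  also have "\<dots> = 2 * (nsq U + nsq V)"
    unfolding nsq_def by (subst nn_integral_cmult, measurable, subst nn_integral_add, measurable)
  finally show ?thesis by (simp add: distrib_left)
qed

lemma L2p_cmult:
  assumes "L2p U" shows "L2p (c *\<^sub>R U)"
proof -
  note [measurable] = L2p_measurable[OF assms]
  have "nsq (c *\<^sub>R U) < \<infinity>"
    using assms unfolding nsq_cmult[OF assms] L2p_def by (simp add: ennreal_mult_less_top)
  moreover have "(\<lambda>x. c *\<^sub>R fst U x) \<in> borel_measurable lebesgue" "(\<lambda>x. c *\<^sub>R snd U x) \<in> borel_measurable lebesgue"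
    by measurable
  ultimately show ?thesis by (simp add: L2p_def scaleR_fun_def)
qed

lemma L2p_add:
  assumes "L2p U" "L2p V" shows "L2p (U + V)"
proof -
  note m[measurable] = L2p_measurable[OF assms(1)] L2p_measurable[OF assms(2)]
  have "2 * nsq U + 2 * nsq V < \<infinity>"
    using assms by (simp add: L2p_def ennreal_mult_less_top)
  with nsq_add_le[OF m] have "nsq (U + V) < \<infinity>" by (rule le_less_trans)
  moreover have "(\<lambda>x. fst U x + fst V x) \<in> borel_measurable lebesgue" "(\<lambda>x. snd U x + snd V x) \<in> borel_measurable lebesgue"
    by measurable
  ultimately show ?thesis by (simp add: L2p_def plus_fun_def)
qed

lemma L2p_diff: "L2p U \<Longrightarrow> L2p V \<Longrightarrow> L2p (U - V)"
  using L2p_add[of U "(-1) *\<^sub>R V"] L2p_cmult[of V "-1"] by simp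

lemma b0_commute: "b0 U V = b0 V U" and a1_commute: "a1 U V = a1 V U"
  by (simp_all add: b0_def a1_def mult.commute inner_commute)

lemma b0_add_left: "L2p U \<Longrightarrow> L2p V \<Longrightarrow> L2p W \<Longrightarrow> b0 (U + V) W = b0 U W + b0 V W"
  and a1_add_left: "L2p U \<Longrightarrow> L2p V \<Longrightarrow> L2p W \<Longrightarrow> a1 (U + V) W = a1 U W + a1 V W"
  using L2p_integrable[of U W] L2p_integrable[of V W]
  by (simp_all add: b0_def a1_def distrib_right inner_add_left)

lemma b0_scale_left: "b0 (c *\<^sub>R U) W = c * b0 U W" and a1_scale_left: "a1 (c *\<^sub>R U) W = c * a1 U W"
  by (simp_all add: b0_def a1_def mult.assoc)

text \<open>The quadratic forms below are positive semidefinite on a subspace of functions that are not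
  identified almost everywhere, so they are in general not definite.\<close>

locale psd_form =
  fixes S :: "'v::real_vector set" and B :: "'v \<Rightarrow> 'v \<Rightarrow> real"
  assumes sub: "subspace S"
    and sym: "x \<in> S \<Longrightarrow> y \<in> S \<Longrightarrow> B x y = B y x"
    and add_left: "x \<in> S \<Longrightarrow> y \<in> S \<Longrightarrow> z \<in> S \<Longrightarrow> B (x + y) z = B x z + B y z"
    and scale_left: "x \<in> S \<Longrightarrow> y \<in> S \<Longrightarrow> B (c *\<^sub>R x) y = c * B x y"
    and nonneg: "x \<in> S \<Longrightarrow> 0 \<le> B x x"
begin

lemmas mem = subspace_add[OF sub] subspace_scale[OF sub] subspace_diff[OF sub] subspace_0[OF sub]

lemma add_right: "x \<in> S \<Longrightarrow> y \<in> S \<Longrightarrow> z \<in> S \<Longrightarrow> B z (x + y) = B z x + B z y"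
  using sym[of z "x + y"] sym[of z x] sym[of z y] add_left[of x y z] mem by simp

lemma scale_right: "x \<in> S \<Longrightarrow> y \<in> S \<Longrightarrow> B x (c *\<^sub>R y) = c * B x y"
  using sym[of x "c *\<^sub>R y"] sym[of x y] scale_left[of y x c] mem by simp

lemma expand: "x \<in> S \<Longrightarrow> y \<in> S \<Longrightarrow> B (x + c *\<^sub>R y) (x + c *\<^sub>R y) = B x x + 2 * c * B x y + c\<^sup>2 * B y y"
  using sym[of y x] by (simp add: add_left add_right scale_left scale_right mem power2_eq_square algebra_simps)

lemma scale_both: "x \<in> S \<Longrightarrow> B (c *\<^sub>R x) (c *\<^sub>R x) = c\<^sup>2 * B x x"
  by (simp add: scale_left scale_right mem power2_eq_square)

lemma expand_add: "x \<in> S \<Longrightarrow> y \<in> S \<Longrightarrow> B (x + y) (x + y) = B x x + 2 * B x y + B y y"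
  using expand[of x y 1] by simp

lemma expand_diff: "x \<in> S \<Longrightarrow> y \<in> S \<Longrightarrow> B (x - y) (x - y) = B x x - 2 * B x y + B y y"
  using expand[of x y "-1"] by simp

lemma parallelogram: "x \<in> S \<Longrightarrow> y \<in> S \<Longrightarrow> B (x - y) (x - y) + B (x + y) (x + y) = 2 * B x x + 2 * B y y"
  by (simp add: expand_diff expand_add)

text \<open>In the degenerate case B y y = 0 the form along x + c y is affine in c and nonnegative,
  so its slope vanishes. Otherwise evaluate at the minimising c.\<close>

lemma cauchy_schwarz:
  assumes "x \<in> S" "y \<in> S" shows "(B x y)\<^sup>2 \<le> B x x * B y y"
proof (cases "B y y = 0")
  case True
  have *: "0 \<le> B x x + 2 * c * B x y" for c
    using nonneg[of "x + c *\<^sub>R y"] expand[OF assms, of c] assms mem True by simp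
  have "B x y = 0"
  proof (rule ccontr)
    assume "B x y \<noteq> 0"
    then have "2 * (- (B x x + 1) / (2 * B x y)) * B x y = - (B x x + 1)" by simp
    then show False using *[of "- (B x x + 1) / (2 * B x y)"] by linarith
  qed
  then show ?thesis using True by simp
next
  case False
  then have pos: "B y y > 0" using nonneg[OF assms(2)] by simp
  define c where "c = - B x y / B y y"
  have "0 \<le> B x x + 2 * c * B x y + c\<^sup>2 * B y y"
    using nonneg[of "x + c *\<^sub>R y"] expand[OF assms, of c] assms mem by simp
  also have "\<dots> = B x x - (B x y)\<^sup>2 / B y y"
    using pos by (simp add: c_def power2_eq_square)
  finally have "(B x y)\<^sup>2 / B y y \<le> B x x" by simp
  then show ?thesis using pos by (simp add: pos_divide_le_eq)
qed

lemma null: "x \<in> S \<Longrightarrow> y \<in> S \<Longrightarrow> B x x = 0 \<Longrightarrow> B x y = 0"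
  using cauchy_schwarz[of x y] by simp

lemma abs_le: "x \<in> S \<Longrightarrow> y \<in> S \<Longrightarrow> \<bar>B x y\<bar> \<le> sqrt (B x x) * sqrt (B y y)"
  using real_sqrt_le_mono[OF cauchy_schwarz[of x y]] by (simp add: real_sqrt_mult)

lemma diff_add_le: "x \<in> S \<Longrightarrow> y \<in> S \<Longrightarrow> B (x + y) (x + y) \<le> 2 * B x x + 2 * B y y"
  using parallelogram[of x y] nonneg[of "x - y"] mem by simp

lemma diff_triangle_le:
  assumes "x \<in> S" "y \<in> S" "z \<in> S"
  shows "B (x - z) (x - z) \<le> 2 * B (x - y) (x - y) + 2 * B (y - z) (y - z)"
  using diff_add_le[of "x - y" "y - z"] assms mem by simp

lemma sqrt_triangle:
  assumes "x \<in> S" "y \<in> S" shows "sqrt (B (x + y) (x + y)) \<le> sqrt (B x x) + sqrt (B y y)"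
proof (rule real_le_lsqrt)
  show "B (x + y) (x + y) \<le> (sqrt (B x x) + sqrt (B y y))\<^sup>2"
    using abs_le[OF assms] nonneg assms by (simp add: expand_add power2_sum)
qed (use nonneg assms in simp)

lemma tendsto_B:
  assumes "\<And>n. X n \<in> S" "x \<in> S" and lim: "(\<lambda>n. B (X n - x) (X n - x)) \<longlonglongrightarrow> 0"
  shows "(\<lambda>n. B (X n) (X n)) \<longlonglongrightarrow> B x x"
proof -
  have "(\<lambda>n. sqrt (B (X n - x) (X n - x)) * sqrt (B x x)) \<longlonglongrightarrow> sqrt 0 * sqrt (B x x)"
    by (intro tendsto_intros lim)
  then have l: "(\<lambda>n. sqrt (B (X n - x) (X n - x)) * sqrt (B x x)) \<longlonglongrightarrow> 0" by simp
  have "(\<lambda>n. B (X n - x) x) \<longlonglongrightarrow> 0"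
    by (rule Lim_null_comparison[OF always_eventually l]) (simp add: abs_le assms mem)
  then have "(\<lambda>n. B (X n - x) (X n - x) + 2 * B (X n - x) x + B x x) \<longlonglongrightarrow> 0 + 2 * 0 + B x x"
    by (intro tendsto_intros lim)
  moreover have "B (X n) (X n) = B (X n - x) (X n - x) + 2 * B (X n - x) x + B x x" for n
    using expand_add[of "X n - x" x] assms mem by simp
  ultimately show ?thesis by simp
qed

end

section \<open>The space \<open>H10\<close>: subspace property, approximation, completeness\<close>

lemma L2p_zero: "L2p 0"
  by (simp add: L2p_def nsq_def zero_fun_def)

lemma subspace_L2p: "subspace {U::'a::euclidean_space h1. L2p U}"
  using L2p_add L2p_cmult L2p_zero by (auto simp: subspace_def)

lemma H10_iff:
  "U \<in> H10 \<Omega> \<longleftrightarrow> fst U \<in> borel_measurable lebesgue \<and> snd U \<in> borel_measurable lebesgue \<and>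
     (\<exists>\<phi>. (\<forall>n. test_fun \<Omega> (\<phi> n)) \<and> (\<lambda>n. nsq (el (\<phi> n) - U)) \<longlonglongrightarrow> 0)"
  by (cases U) (simp add: H10_def nsq_def el_def)

lemma el_measurable:
  assumes "test_fun \<Omega> \<phi>"
  shows "fst (el \<phi>) \<in> borel_measurable lebesgue" "snd (el \<phi>) \<in> borel_measurable lebesgue"
  using borel_measurable_continuous_onI[OF test_fun_continuous[OF assms]]
    borel_measurable_continuous_onI[OF test_fun_continuous_grad[OF assms]]
  by (simp_all add: el_def measurable_completion)

lemma el_L2p:
  assumes "test_fun \<Omega> \<phi>" shows "L2p (el \<phi>)"
proof -
  obtain K where K: "compact K" "\<And>x. x \<notin> K \<Longrightarrow> \<phi> x = 0" "\<And>x. x \<notin> K \<Longrightarrow> grad \<phi> x = 0"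
    using test_fun_support_bounded[OF assms] by metis
  let ?f = "\<lambda>x. (\<phi> x)\<^sup>2 + (norm (grad \<phi> x))\<^sup>2"
  have cf: "continuous_on UNIV ?f"
    by (intro continuous_intros test_fun_continuous[OF assms] test_fun_continuous_grad[OF assms])
  have i: "integrable lborel (\<lambda>x. indicator K x *\<^sub>R ?f x)"
    by (rule borel_integrable_compact[OF K(1) continuous_on_subset[OF cf subset_UNIV]])
  have eq: "(\<lambda>x. indicator K x *\<^sub>R ?f x) = ?f" using K by (auto simp: fun_eq_iff indicator_def)
  have "nsq (el \<phi>) < \<infinity>"
    using nn_integral_eq_integral[OF i[unfolded eq]] by (simp add: nsq_def el_def nn_integral_completion)
  then show ?thesis using el_measurable[OF assms] by (simp add: L2p_def)
qed

lemma el_in_H10: "test_fun \<Omega> \<phi> \<Longrightarrow> el \<phi> \<in> H10 \<Omega>"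
  unfolding H10_iff by (intro conjI el_measurable exI[of _ "\<lambda>n. \<phi>"]) (auto simp: nsq_def)

lemma tendsto_0_le_ennreal:
  fixes f g :: "nat \<Rightarrow> ennreal"
  assumes "\<And>n. f n \<le> g n" "g \<longlonglongrightarrow> 0" shows "f \<longlonglongrightarrow> 0"
  by (rule tendsto_sandwich[OF _ _ tendsto_const assms(2)]) (auto simp: assms(1))

lemma tendsto_0_add_ennreal:
  fixes f g :: "nat \<Rightarrow> ennreal"
  assumes "f \<longlonglongrightarrow> 0" "g \<longlonglongrightarrow> 0" shows "(\<lambda>n. 2 * f n + 2 * g n) \<longlonglongrightarrow> 0"
proof -
  have "(\<lambda>n. 2 * f n + 2 * g n) \<longlonglongrightarrow> 2 * 0 + 2 * 0"
    by (intro tendsto_add ennreal_tendsto_cmult assms) auto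
  then show ?thesis by simp
qed

text \<open>The definition asks only for measurability and approximation. Finiteness of the norm
  follows because U is at finite distance from some test function.\<close>

lemma H10_L2p:
  assumes "U \<in> H10 \<Omega>" shows "L2p U"
proof -
  obtain \<phi> where \<phi>: "\<And>n. test_fun \<Omega> (\<phi> n)" "(\<lambda>n. nsq (el (\<phi> n) - U)) \<longlonglongrightarrow> 0"
    and m: "fst U \<in> borel_measurable lebesgue" "snd U \<in> borel_measurable lebesgue"
    using assms unfolding H10_iff by blast
  obtain n where "nsq (el (\<phi> n) - U) < 1"
    using order_tendstoD(2)[OF \<phi>(2), of 1] by (auto simp: eventually_sequentially)
  moreover have "nsq (el (\<phi> n) - U) = nsq (U - el (\<phi> n))"
    by (simp add: nsq_def power2_commute norm_minus_commute)
  ultimately have "nsq (U - el (\<phi> n)) < \<infinity>"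
    using less_trans[OF _ ennreal_one_less_top] by simp
  moreover have "(\<lambda>x. fst U x - fst (el (\<phi> n)) x) \<in> borel_measurable lebesgue"
    "(\<lambda>x. snd U x - snd (el (\<phi> n)) x) \<in> borel_measurable lebesgue"
    using m el_measurable[OF \<phi>(1)[of n]] by measurable
  ultimately have "L2p (U - el (\<phi> n))"
    by (simp add: L2p_def fun_diff_def)
  from L2p_add[OF this el_L2p[OF \<phi>(1)[of n]]] show ?thesis by simp
qed

lemma el_add: "test_fun \<Omega> \<phi> \<Longrightarrow> test_fun \<Omega> \<psi> \<Longrightarrow> el (\<lambda>x. \<phi> x + \<psi> x) = el \<phi> + el \<psi>"
  by (simp add: el_def grad_add fun_eq_iff prod_eq_iff)

lemma el_cmult: "test_fun \<Omega> \<phi> \<Longrightarrow> el (\<lambda>x. c * \<phi> x) = c *\<^sub>R el \<phi>"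
  by (simp add: el_def grad_cmult fun_eq_iff prod_eq_iff)

lemma subspace_H10: "subspace (H10 \<Omega> :: 'a::euclidean_space h1 set)"
proof (rule subspaceI)
  show "(0 :: 'a h1) \<in> H10 \<Omega>"
    unfolding H10_iff by (intro conjI exI[of _ "\<lambda>n x. 0"]) (auto simp: test_fun_zero nsq_def el_def grad_def zero_fun_def)
next
  fix U V :: "'a h1" assume U: "U \<in> H10 \<Omega>" and V: "V \<in> H10 \<Omega>"
  note m = L2p_measurable[OF H10_L2p[OF U]] L2p_measurable[OF H10_L2p[OF V]]
  obtain \<phi> \<psi> where \<phi>: "\<And>n. test_fun \<Omega> (\<phi> n)" "(\<lambda>n. nsq (el (\<phi> n) - U)) \<longlonglongrightarrow> 0"
    and \<psi>: "\<And>n. test_fun \<Omega> (\<psi> n)" "(\<lambda>n. nsq (el (\<psi> n) - V)) \<longlonglongrightarrow> 0"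
    using U V unfolding H10_iff by blast
  have "nsq (el (\<lambda>x. \<phi> n x + \<psi> n x) - (U + V)) \<le> 2 * nsq (el (\<phi> n) - U) + 2 * nsq (el (\<psi> n) - V)" for n
  proof -
    have eq: "el (\<lambda>x. \<phi> n x + \<psi> n x) - (U + V) = (el (\<phi> n) - U) + (el (\<psi> n) - V)"
      by (simp add: el_add[OF \<phi>(1) \<psi>(1)])
    have d: "L2p (el (\<phi> n) - U)" "L2p (el (\<psi> n) - V)"
      using L2p_diff el_L2p \<phi>(1) \<psi>(1) U V H10_L2p by blast+
    show ?thesis
      unfolding eq by (rule nsq_add_le[OF L2p_measurable[OF d(1)] L2p_measurable[OF d(2)]])
  qed
  note T = tendsto_0_le_ennreal[OF this tendsto_0_add_ennreal[OF \<phi>(2) \<psi>(2)]]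
  show "U + V \<in> H10 \<Omega>"
    unfolding H10_iff
    by (intro conjI L2p_measurable[OF L2p_add[OF H10_L2p[OF U] H10_L2p[OF V]]]
        exI[of _ "\<lambda>n x. \<phi> n x + \<psi> n x"] allI test_fun_add \<phi>(1) \<psi>(1) T)
next
  fix c and U :: "'a h1" assume U: "U \<in> H10 \<Omega>"
  obtain \<phi> where \<phi>: "\<And>n. test_fun \<Omega> (\<phi> n)" "(\<lambda>n. nsq (el (\<phi> n) - U)) \<longlonglongrightarrow> 0"
    using U unfolding H10_iff by blast
  have "nsq (el (\<lambda>x. c * \<phi> n x) - c *\<^sub>R U) = ennreal (c\<^sup>2) * nsq (el (\<phi> n) - U)" for n
    using nsq_cmult[OF L2p_diff[OF el_L2p[OF \<phi>(1)] H10_L2p[OF U]], of c n]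
    by (simp add: el_cmult[OF \<phi>(1)] scaleR_diff_right)
  moreover have "(\<lambda>n. ennreal (c\<^sup>2) * nsq (el (\<phi> n) - U)) \<longlonglongrightarrow> ennreal (c\<^sup>2) * 0"
    by (intro ennreal_tendsto_cmult \<phi>) auto
  ultimately have T: "(\<lambda>n. nsq (el (\<lambda>x. c * \<phi> n x) - c *\<^sub>R U)) \<longlonglongrightarrow> 0" by simp
  show "c *\<^sub>R U \<in> H10 \<Omega>"
    unfolding H10_iff
    by (intro conjI L2p_measurable[OF L2p_cmult[OF H10_L2p[OF U]]]
        exI[of _ "\<lambda>n x. c * \<phi> n x"] allI test_fun_cmult \<phi>(1) T)
qed

lemmas H10_mem = subspace_add[OF subspace_H10] subspace_scale[OF subspace_H10] subspace_diff[OF subspace_H10] subspace_0[OF subspace_H10]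

lemma b0_psd: "psd_form (H10 \<Omega>) b0"
  by (rule psd_form.intro[OF subspace_H10 b0_commute b0_add_left b0_scale_left b0_nonneg])
    (auto intro: H10_L2p[of _ \<Omega>])

lemma a1_psd: "psd_form (H10 \<Omega>) a1"
  by (rule psd_form.intro[OF subspace_H10 a1_commute a1_add_left a1_scale_left a1_nonneg])
    (auto intro: H10_L2p[of _ \<Omega>])

lemma psd_form_combine:
  assumes "psd_form S B" "psd_form S C" and "\<And>x. x \<in> S \<Longrightarrow> 0 \<le> B x x + c * C x x"
  shows "psd_form S (\<lambda>x y. B x y + c * C x y)"
proof -
  interpret B: psd_form S B by fact
  interpret C: psd_form S C by fact
  show ?thesis
    by (rule psd_form.intro)
      (use assms(3) in \<open>simp_all add: B.sub B.sym C.sym B.add_left C.add_left B.scale_left C.scale_left distrib_left mult.left_commute\<close>)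
qed

lemma nH_psd: "psd_form (H10 \<Omega>) (\<lambda>U V. b0 U V + a1 U V)"
  using psd_form_combine[OF b0_psd a1_psd, of \<Omega> 1] by simp

definition NN :: "'a::euclidean_space h1 \<Rightarrow> real" where
  "NN U = N4 (fst U)"

lemma NN_nonneg [simp]: "0 \<le> NN U" by (simp add: NN_def)

lemma NN_scale: "NN (c *\<^sub>R U) = \<bar>c\<bar> * NN U"
  by (simp add: NN_def scaleR_fun_def N4_cmult)

lemma NN_triangle: "L4 (fst U) \<Longrightarrow> L4 (fst V) \<Longrightarrow> NN (U + V) \<le> NN U + NN V"
  using N4_triangle[of "fst U" "fst V"] by (simp add: NN_def plus_fun_def)

text \<open>Function and gradient are treated as one vector-valued L^2 function, so that a single
  subsequence converges almost everywhere in both.\<close>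

lemma H10_approx:
  assumes U: "U \<in> H10 \<Omega>"
  shows "\<exists>\<phi>. (\<forall>n::nat. test_fun \<Omega> (\<phi> n)) \<and> (\<lambda>n. nH (el (\<phi> n) - U)) \<longlonglongrightarrow> 0 \<and>
    (AE x in lebesgue. (\<lambda>n. (\<phi> n x, grad (\<phi> n) x)) \<longlonglongrightarrow> (fst U x, snd U x))"
proof -
  obtain \<phi> where \<phi>: "\<And>n. test_fun \<Omega> (\<phi> n)" "(\<lambda>n. nsq (el (\<phi> n) - U)) \<longlonglongrightarrow> 0"
    using U unfolding H10_iff by blast
  have l: "(\<lambda>n. nH (el (\<phi> n) - U)) \<longlonglongrightarrow> 0"
  proof -
    have "nsq (el (\<phi> n) - U) = ennreal (nH (el (\<phi> n) - U))" for n
      by (rule nsq_eq_nH[OF L2p_diff[OF el_L2p[OF \<phi>(1)] H10_L2p[OF U]]])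
    then have "(\<lambda>n. ennreal (nH (el (\<phi> n) - U))) \<longlonglongrightarrow> ennreal 0" using \<phi>(2) by simp
    then show ?thesis by (subst (asm) tendsto_ennreal_iff) auto
  qed
  let ?F = "\<lambda>n x. (\<phi> n x, grad (\<phi> n) x)" and ?G = "\<lambda>x. (fst U x, snd U x)"
  have m: "?F n \<in> borel_measurable lebesgue" for n
    using el_measurable[OF \<phi>(1)[of n]] by (simp add: el_def)
  have mG: "?G \<in> borel_measurable lebesgue"
    using L2p_measurable[OF H10_L2p[OF U]] by simp
  have "(\<lambda>n. \<integral>\<^sup>+x. ennreal ((norm (?F n x - ?G x))\<^sup>2) \<partial>lebesgue) \<longlonglongrightarrow> 0"
    using \<phi>(2) by (simp add: nsq_def el_def norm_Pair)
  then obtain r :: "nat \<Rightarrow> nat" where r: "strict_mono r" "AE x in lebesgue. (\<lambda>n. ?F (r n) x) \<longlonglongrightarrow> ?G x"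
    using L2_AE_subseq[where F = ?F, OF m mG] by blast
  show ?thesis
    using \<phi>(1) r(2) LIMSEQ_subseq_LIMSEQ[OF l r(1)]
    by (intro exI[of _ "\<lambda>n. \<phi> (r n)"] conjI allI) (simp_all add: o_def)
qed

text \<open>The approximating test functions and their gradients vanish off \<Omega>, and so do
  their limits. This allows integrals over \<Omega> to be replaced by integrals over the whole
  space.\<close>

lemma H10_outside:
  assumes U: "U \<in> H10 \<Omega>"
  shows "AE x in lebesgue. x \<notin> \<Omega> \<longrightarrow> fst U x = 0 \<and> snd U x = 0"
proof -
  obtain \<phi> where \<phi>: "\<And>n. test_fun \<Omega> (\<phi> n)"
    and ae: "AE x in lebesgue. (\<lambda>n. (\<phi> n x, grad (\<phi> n) x)) \<longlonglongrightarrow> (fst U x, snd U x)"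
    using H10_approx[OF U] by blast
  show ?thesis
    using ae
  proof eventually_elim
    case (elim x)
    show ?case
    proof
      assume "x \<notin> \<Omega>"
      then have "(\<lambda>n. (\<phi> n x, grad (\<phi> n) x)) = (\<lambda>n. (0, 0))"
        using test_fun_outside[OF \<phi>] by simp
      then have "(fst U x, snd U x) = (0, 0)"
        using elim LIMSEQ_unique[OF tendsto_const, of "(0, 0)" "(fst U x, snd U x)"] by auto
      then show "fst U x = 0 \<and> snd U x = 0" by simp
    qed
  qed
qed

text \<open>\<open>L2_complete\<close> yields a limit pair; test functions within 1/(n+1) of
  \<open>U n\<close> converge to it as well, which puts it in \<open>H10\<close>.\<close>

lemma H10_complete:
  assumes U: "\<And>n. U n \<in> H10 \<Omega>"
    and c: "\<And>e. e > 0 \<Longrightarrow> \<exists>N. \<forall>m\<ge>N. \<forall>n\<ge>N. nH (U m - U n) \<le> e"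
  obtains V where "V \<in> H10 \<Omega>" "(\<lambda>n. nH (U n - V)) \<longlonglongrightarrow> 0"
proof -
  have "\<exists>\<phi>. \<forall>n. test_fun \<Omega> (\<phi> n) \<and> nH (el (\<phi> n) - U n) < 1 / Suc n"
  proof (intro choice allI)
    fix n
    obtain \<phi> where \<phi>: "\<And>n. test_fun \<Omega> (\<phi> n)" "(\<lambda>k. nH (el (\<phi> k) - U n)) \<longlonglongrightarrow> 0"
      using H10_approx[OF U[of n]] by blast
    then have "\<forall>\<^sub>F k in sequentially. nH (el (\<phi> k) - U n) < 1 / Suc n"
      by (intro order_tendstoD) auto
    then obtain k where "nH (el (\<phi> k) - U n) < 1 / Suc n"
      by (auto simp: eventually_sequentially)
    then show "\<exists>\<psi>. test_fun \<Omega> \<psi> \<and> nH (el \<psi> - U n) < 1 / Suc n" using \<phi>(1) by blast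
  qed
  then obtain \<phi> where \<phi>: "\<And>n. test_fun \<Omega> (\<phi> n)" "\<And>n. nH (el (\<phi> n) - U n) < 1 / Suc n" by blast
  let ?F = "\<lambda>n x. (fst (U n) x, snd (U n) x)"
  have m: "?F n \<in> borel_measurable lebesgue" for n
    using L2p_measurable[OF H10_L2p[OF U[of n]]] by simp
  have "\<exists>N. \<forall>m\<ge>N. \<forall>n\<ge>N. (\<integral>\<^sup>+x. ennreal ((norm (?F m x - ?F n x))\<^sup>2) \<partial>lebesgue) \<le> ennreal e" if "e > 0" for e
  proof -
    have "(\<integral>\<^sup>+x. ennreal ((norm (?F m x - ?F n x))\<^sup>2) \<partial>lebesgue) = ennreal (nH (U m - U n))" for m n
      using nsq_eq_nH[OF L2p_diff[OF H10_L2p[OF U[of m]] H10_L2p[OF U[of n]]]] by (simp add: nsq_def norm_Pair)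
    then show ?thesis using c[OF that] that by (auto simp: ennreal_leI)
  qed
  from L2_complete[where F = ?F, OF m this] obtain G where G: "G \<in> borel_measurable lebesgue"
    "(\<lambda>n. \<integral>\<^sup>+x. ennreal ((norm (?F n x - G x))\<^sup>2) \<partial>lebesgue) \<longlonglongrightarrow> 0" by blast
  define V where "V = (\<lambda>x. fst (G x), \<lambda>x. snd (G x))"
  have mV: "fst V \<in> borel_measurable lebesgue" "snd V \<in> borel_measurable lebesgue"
    using measurable_compose[OF G(1) borel_measurable_continuous_onI[OF continuous_on_fst[OF continuous_on_id]]]
      measurable_compose[OF G(1) borel_measurable_continuous_onI[OF continuous_on_snd[OF continuous_on_id]]]
    by (simp_all add: V_def)
  have "(norm (?F n x - G x))\<^sup>2 = (fst (U n - V) x)\<^sup>2 + (norm (snd (U n - V) x))\<^sup>2" for n x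
    by (cases "G x") (simp add: V_def norm_Pair)
  then have lim: "(\<lambda>n. nsq (U n - V)) \<longlonglongrightarrow> 0" using G(2) by (simp add: nsq_def)
  have sm: "fst (U n - V) \<in> borel_measurable lebesgue" "snd (U n - V) \<in> borel_measurable lebesgue" for n
    using L2p_measurable[OF H10_L2p[OF U[of n]]] mV by (auto simp: fun_diff_def intro: borel_measurable_diff)
  have lim2: "(\<lambda>n. nsq (el (\<phi> n) - U n)) \<longlonglongrightarrow> 0"
  proof (rule tendsto_0_le_ennreal)
    show "nsq (el (\<phi> n) - U n) \<le> ennreal (1 / Suc n)" for n
      using \<phi>(2)[of n] nsq_eq_nH[OF L2p_diff[OF el_L2p[OF \<phi>(1)] H10_L2p[OF U[of n]]], of n] by (simp add: ennreal_leI)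
    have "(\<lambda>n. ennreal (1 / Suc n)) \<longlonglongrightarrow> ennreal 0"
      by (intro tendsto_ennrealI LIMSEQ_Suc[OF lim_1_over_n])
    then show "(\<lambda>n. ennreal (1 / Suc n)) \<longlonglongrightarrow> 0" by simp
  qed
  have "nsq (el (\<phi> n) - V) \<le> 2 * nsq (el (\<phi> n) - U n) + 2 * nsq (U n - V)" for n
    using nsq_add_le[OF L2p_measurable[OF L2p_diff[OF el_L2p[OF \<phi>(1)[of n]] H10_L2p[OF U[of n]]]] sm[of n]] by simp
  note T = tendsto_0_le_ennreal[OF this tendsto_0_add_ennreal[OF lim2 lim]]
  have V: "V \<in> H10 \<Omega>"
    unfolding H10_iff by (intro conjI mV exI[of _ \<phi>] allI \<phi>(1) T)
  have "(\<lambda>n. nH (U n - V)) \<longlonglongrightarrow> 0"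
  proof -
    have "nsq (U n - V) = ennreal (nH (U n - V))" for n
      by (rule nsq_eq_nH[OF L2p_diff[OF H10_L2p[OF U] H10_L2p[OF V]]])
    then have "(\<lambda>n. ennreal (nH (U n - V))) \<longlonglongrightarrow> ennreal 0" using lim by simp
    then show ?thesis by (subst (asm) tendsto_ennreal_iff) auto
  qed
  with V show ?thesis by (rule that)
qed

section \<open>Embedding and compactness for \<open>H10\<close> on a bounded domain\<close>

locale sob_domain =
  fixes \<Omega> :: "'a::euclidean_space set"
  assumes dim: "DIM('a) \<le> 3" and open_dom: "open \<Omega>" and bounded_dom: "bounded \<Omega>"
begin

text \<open>Test functions within distance M of U have norm at most 2 M, whence the factor 2; Fatou
  carries their L^4 bound over to U. Positivity of M leaves room for the approximation.\<close>

lemma H10_sobolev_aux: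
  assumes U: "U \<in> H10 \<Omega>" and M: "M > 0" "nH U \<le> M\<^sup>2"
  shows "L4 (fst U)" "NN U \<le> 2 * sob_bound TYPE('a) * M"
proof -
  obtain \<phi> where \<phi>: "\<And>n. test_fun \<Omega> (\<phi> n)" "(\<lambda>n. nH (el (\<phi> n) - U)) \<longlonglongrightarrow> 0"
    and ae: "AE x in lebesgue. (\<lambda>n. (\<phi> n x, grad (\<phi> n) x)) \<longlonglongrightarrow> (fst U x, snd U x)"
    using H10_approx[OF U] by blast
  interpret n: psd_form "H10 \<Omega>" "\<lambda>U V. b0 U V + a1 U V" by (rule nH_psd)
  have "\<forall>\<^sub>F n in sequentially. nH (el (\<phi> n) - U) < M\<^sup>2"
    using \<phi>(2) M by (intro order_tendstoD) auto
  then obtain N where N: "\<And>n. n \<ge> N \<Longrightarrow> nH (el (\<phi> n) - U) < M\<^sup>2" by (auto simp: eventually_sequentially)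
  have "nsq (el (\<phi> (n + N))) \<le> ennreal ((2 * M)\<^sup>2)" for n
  proof -
    have "nH (el (\<phi> (n + N))) \<le> 2 * nH (el (\<phi> (n + N)) - U) + 2 * nH U"
      using n.diff_add_le[of "el (\<phi> (n + N)) - U" U] U el_in_H10[OF \<phi>(1)] n.mem by (simp add: nH_def)
    also have "\<dots> \<le> (2 * M)\<^sup>2" using N[of "n + N"] M(2) by (simp add: power_mult_distrib)
    finally show ?thesis using nsq_eq_nH[OF el_L2p[OF \<phi>(1)]] by (simp add: ennreal_leI)
  qed
  note s = test_fun_sobolev[OF dim \<phi>(1) this]
  have "N4 (\<phi> (n + N)) \<le> 2 * sob_bound TYPE('a) * M" for n using s(2)[of n] M(1) by (simp add: mult_ac)
  moreover have "L4 (\<phi> (n + N))" for n using s(1) M(1) by simp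
  moreover have "AE x in lebesgue. (\<lambda>n. \<phi> (n + N) x) \<longlonglongrightarrow> fst U x"
    using ae
  proof eventually_elim
    case (elim x)
    show ?case using LIMSEQ_ignore_initial_segment[OF tendsto_fst[OF elim], of N] by simp
  qed
  ultimately show "L4 (fst U)" "NN U \<le> 2 * sob_bound TYPE('a) * M"
    using L4_fatou[of "\<lambda>n. \<phi> (n + N)" "2 * sob_bound TYPE('a) * M" "fst U"] L2p_measurable(1)[OF H10_L2p[OF U]]
    unfolding NN_def by blast+
qed

lemma H10_L4: "U \<in> H10 \<Omega> \<Longrightarrow> L4 (fst U)"
  by (rule H10_sobolev_aux(1)[of U "nH U + 1"])
    (simp_all add: power2_eq_square algebra_simps add_nonneg_pos add_pos_nonneg)

lemma H10_sobolev:
  assumes U: "U \<in> H10 \<Omega>" shows "NN U \<le> 2 * sob_bound TYPE('a) * sqrt (nH U)"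
proof (rule field_le_epsilon)
  fix e :: real assume e: "e > 0"
  define d where "d = e / (2 * sob_bound TYPE('a))"
  have d: "d > 0" using e sob_bound_pos[where 'a='a] by (simp add: d_def)
  have "nH U = (sqrt (nH U))\<^sup>2" by simp
  also have "\<dots> \<le> (sqrt (nH U) + d)\<^sup>2" using d by (intro power_mono) auto
  finally have "NN U \<le> 2 * sob_bound TYPE('a) * (sqrt (nH U) + d)"
    using d by (intro H10_sobolev_aux U) (auto intro: add_nonneg_pos)
  also have "\<dots> = 2 * sob_bound TYPE('a) * sqrt (nH U) + e"
    using sob_bound_pos[where 'a='a] by (simp add: d_def distrib_left)
  finally show "NN U \<le> 2 * sob_bound TYPE('a) * sqrt (nH U) + e" .
qed

lemma NN_add_le: "U \<in> H10 \<Omega> \<Longrightarrow> V \<in> H10 \<Omega> \<Longrightarrow> NN (U + V) \<le> NN U + NN V"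
  by (intro NN_triangle H10_L4)

lemma NN_diff_commute: "NN (U - V) = NN (V - U)"
  using NN_scale[of "-1" "U - V"] by simp

text \<open>Each \<open>U n\<close> is shadowed by a test function at distance below 1/(n+1). The
  embedding makes the shadows close in L^4 too, and \<open>test_fun_L4_compact\<close> applies to
  them.\<close>

lemma H10_compact:
  assumes U: "\<And>n. U n \<in> H10 \<Omega>" and M: "\<And>n. nH (U n) \<le> M"
  shows "\<exists>r :: nat \<Rightarrow> nat. strict_mono r \<and>
    (\<forall>e>0. \<exists>N. \<forall>i\<ge>N. \<forall>j\<ge>N. NN (U (r i) - U (r j)) \<le> e)"
proof -
  interpret n: psd_form "H10 \<Omega>" "\<lambda>U V. b0 U V + a1 U V" by (rule nH_psd)
  have "\<exists>\<phi>. \<forall>n. test_fun \<Omega> (\<phi> n) \<and> nH (el (\<phi> n) - U n) < (1 / Suc n)\<^sup>2"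
  proof (intro choice allI)
    fix n
    obtain \<phi> where \<phi>: "\<And>n. test_fun \<Omega> (\<phi> n)" "(\<lambda>k. nH (el (\<phi> k) - U n)) \<longlonglongrightarrow> 0"
      using H10_approx[OF U[of n]] by blast
    then have "\<forall>\<^sub>F k in sequentially. nH (el (\<phi> k) - U n) < (1 / Suc n)\<^sup>2"
      by (intro order_tendstoD) auto
    then obtain k where "nH (el (\<phi> k) - U n) < (1 / Suc n)\<^sup>2"
      by (auto simp: eventually_sequentially)
    then show "\<exists>\<psi>. test_fun \<Omega> \<psi> \<and> nH (el \<psi> - U n) < (1 / Suc n)\<^sup>2" using \<phi>(1) by blast
  qed
  then obtain \<phi> where \<phi>: "\<And>n. test_fun \<Omega> (\<phi> n)" "\<And>n. nH (el (\<phi> n) - U n) < (1 / Suc n)\<^sup>2" by blast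
  have E: "el (\<phi> n) \<in> H10 \<Omega>" for n by (rule el_in_H10[OF \<phi>(1)])
  define C where "C = 2 * sob_bound TYPE('a)"
  have C: "C > 0" using sob_bound_pos[where 'a='a] by (simp add: C_def)
  have close: "NN (el (\<phi> n) - U n) \<le> C / Suc n" for n
  proof -
    have "sqrt (nH (el (\<phi> n) - U n)) \<le> sqrt ((1 / Suc n)\<^sup>2)"
      using \<phi>(2)[of n] by (intro real_sqrt_le_mono) simp
    then have "sqrt (nH (el (\<phi> n) - U n)) \<le> 1 / Suc n" by simp
    then have "C * sqrt (nH (el (\<phi> n) - U n)) \<le> C * (1 / Suc n)"
      using C by (intro mult_left_mono) auto
    then show ?thesis using H10_sobolev[of "el (\<phi> n) - U n"] n.mem(3)[OF E U, of n n] by (simp add: C_def)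
  qed
  have M0: "M \<ge> 0" using M[of 0] nH_nonneg order_trans by blast
  have "nsq (el (\<phi> n)) \<le> ennreal ((sqrt (2 + 2 * M))\<^sup>2)" for n
  proof -
    have "(1 / real (Suc n))\<^sup>2 \<le> 1" by (simp add: power_le_one)
    moreover have "nH (el (\<phi> n)) \<le> 2 * nH (el (\<phi> n) - U n) + 2 * nH (U n)"
      using n.diff_add_le[of "el (\<phi> n) - U n" "U n"] U E n.mem by (simp add: nH_def)
    ultimately have "nH (el (\<phi> n)) \<le> 2 + 2 * M" using \<phi>(2)[of n] M[of n] by linarith
    then show ?thesis
      unfolding nsq_eq_nH[OF el_L2p[OF \<phi>(1)]] using M0 by (intro ennreal_leI) simp
  qed
  from test_fun_L4_compact[where u = \<phi>, OF dim \<phi>(1) this _ bounded_dom] M0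
  obtain r :: "nat \<Rightarrow> nat" where r: "strict_mono r"
    "\<And>e. e > 0 \<Longrightarrow> \<exists>N. \<forall>i\<ge>N. \<forall>j\<ge>N. N4 (\<lambda>x. \<phi> (r i) x - \<phi> (r j) x) \<le> e"
    by auto
  have "\<exists>N. \<forall>i\<ge>N. \<forall>j\<ge>N. NN (U (r i) - U (r j)) \<le> e" if "e > 0" for e
  proof -
    have e3: "e / 3 > 0" using that by simp
    obtain N where N: "\<And>i j. i \<ge> N \<Longrightarrow> j \<ge> N \<Longrightarrow> N4 (\<lambda>x. \<phi> (r i) x - \<phi> (r j) x) \<le> e / 3"
      using r(2)[OF e3] by blast
    obtain K :: nat where K: "3 * C / e < K" using reals_Archimedean2 by blast
    have small: "NN (el (\<phi> (r i)) - U (r i)) \<le> e / 3" if "i \<ge> K" for i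
    proof -
      have "real K \<le> real (Suc (r i))" using that seq_suble[OF r(1), of i] by simp
      then have "3 * C / e \<le> real (Suc (r i))" using K by linarith
      then have "C / Suc (r i) \<le> e / 3" using \<open>e > 0\<close> by (simp add: field_simps)
      then show ?thesis using close[of "r i"] by linarith
    qed
    have "NN (U (r i) - U (r j)) \<le> e" if "i \<ge> max N K" "j \<ge> max N K" for i j
    proof -
      let ?p = "U (r i) - el (\<phi> (r i))" and ?q = "el (\<phi> (r i)) - el (\<phi> (r j))" and ?s = "el (\<phi> (r j)) - U (r j)"
      have m: "?p \<in> H10 \<Omega>" "?q \<in> H10 \<Omega>" "?s \<in> H10 \<Omega>" by (intro n.mem(3) U E)+
      have "NN (?p + ?q + ?s) \<le> NN ?p + NN ?q + NN ?s"
        using NN_add_le[OF m(1,2)] NN_add_le[OF n.mem(1)[OF m(1,2)] m(3)] by linarith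
      moreover have "NN ?q = N4 (\<lambda>x. \<phi> (r i) x - \<phi> (r j) x)" by (simp add: NN_def el_def fun_diff_def)
      ultimately show ?thesis
        using N[of i j] small[of i] small[of j] that NN_diff_commute[of "U (r i)" "el (\<phi> (r i))"] by simp
    qed
    then show ?thesis by blast
  qed
  with r(1) show ?thesis by blast
qed

lemma integrable_const_dom: "integrable lebesgue (\<lambda>x. c * indicator \<Omega> x :: real)"
  using lmeasurable_open[OF bounded_dom open_dom]
  by (intro integrable_mult_right integrable_real_indicator) (auto simp: fmeasurable_def)

definition vol :: real where "vol = measure lebesgue \<Omega>"

text \<open>Pointwise t^2 <= d^2 + t^4/d^2 on \<Omega>, integrated. This does the work of Hoelder's
  inequality; d is only an upper bound for the L^4 norm, so it can be kept positive.\<close>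

lemma b0_le_NN:
  assumes U: "U \<in> H10 \<Omega>" and d: "d > 0" "NN U \<le> d"
  shows "b0 U U \<le> (vol + 1) * d\<^sup>2"
proof -
  let ?u = "fst U"
  have i: "integrable lebesgue (\<lambda>x. (?u x)^4)" using H10_L4[OF U] by (simp add: L4_def)
  have "b0 U U = (LINT x|lebesgue. (?u x)\<^sup>2)" by (simp add: b0_def power2_eq_square)
  also have "\<dots> \<le> (LINT x|lebesgue. d\<^sup>2 * indicator \<Omega> x + (?u x)^4 / d\<^sup>2)"
  proof (rule integral_mono_AE)
    show "integrable lebesgue (\<lambda>x. (?u x)\<^sup>2)" by (rule L2p_square_integrable[OF H10_L2p[OF U]])
    show "integrable lebesgue (\<lambda>x. d\<^sup>2 * indicator \<Omega> x + (?u x)^4 / d\<^sup>2)"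
      using i integrable_const_dom by auto
    show "AE x in lebesgue. (?u x)\<^sup>2 \<le> d\<^sup>2 * indicator \<Omega> x + (?u x)^4 / d\<^sup>2"
      using H10_outside[OF U]
    proof eventually_elim
      case (elim x)
      have "s \<le> d\<^sup>2 + s\<^sup>2 / d\<^sup>2" if "s \<ge> 0" for s :: real
      proof (cases "s \<le> d\<^sup>2")
        case False
        then have "s * d\<^sup>2 \<le> s * s" using that by (intro mult_left_mono) auto
        then have "s \<le> s\<^sup>2 / d\<^sup>2" using d by (simp add: field_simps power2_eq_square)
        then show ?thesis by (simp add: add_increasing)
      qed (use that in \<open>simp add: add_increasing2\<close>)
      from this[of "(?u x)\<^sup>2"] have "(?u x)\<^sup>2 \<le> d\<^sup>2 + (?u x)^4 / d\<^sup>2" by (simp flip: power_mult)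
      then show ?case using elim by (cases "x \<in> \<Omega>") auto
    qed
  qed
  also have "\<dots> = d\<^sup>2 * vol + (NN U)^4 / d\<^sup>2"
    using i integrable_const_dom[of "d\<^sup>2"] by (simp add: vol_def NN_def N4_power4)
  also have "(NN U)^4 / d\<^sup>2 \<le> d^4 / d\<^sup>2"
    using d by (intro divide_right_mono power_mono) auto
  also have "d^4 / d\<^sup>2 = d\<^sup>2" using d by (simp add: power2_eq_square power4_eq_xxxx)
  finally show ?thesis by (simp add: algebra_simps)
qed

lemma integ_eq:
  assumes [measurable]: "f \<in> borel_measurable lebesgue" and "AE x in lebesgue. x \<notin> \<Omega> \<longrightarrow> f x = 0"
  shows "integ \<Omega> f = (LINT x|lebesgue. f x)"
proof -
  have [measurable]: "\<Omega> \<in> sets lebesgue" using open_dom by auto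
  have "AE x in lebesgue. indicator \<Omega> x *\<^sub>R f x = f x"
    using assms(2) by eventually_elim (auto simp: indicator_def)
  then show ?thesis
    unfolding integ_def set_lebesgue_integral_def by (intro integral_cong_AE) measurable
qed

end

section \<open>Minimising a quadratic form over the unit sphere of a seminorm\<close>

text \<open>Besides seminorms, p may be a squared quantity such as \<open>nH\<close> or the diagonal
  of a quadratic form.\<close>

definition sn_cauchy :: "('v::real_vector \<Rightarrow> real) \<Rightarrow> (nat \<Rightarrow> 'v) \<Rightarrow> bool" where
  "sn_cauchy p X \<longleftrightarrow> (\<forall>e>0. \<exists>N. \<forall>i\<ge>N. \<forall>j\<ge>N. p (X i - X j) \<le> e)"

lemma sn_cauchy_subseq: "sn_cauchy p X \<Longrightarrow> strict_mono r \<Longrightarrow> sn_cauchy p (X \<circ> r)"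
  unfolding sn_cauchy_def o_def by (meson le_trans seq_suble)

text \<open>The direct method for an abstract seminorm p: with p the L^2 norm it gives the first
  eigenvalue, with p the L^4 distance to the eigenspace the ground state. The completeness
  hypothesis may pass to a subsequence, because in the second case representatives along the line
  have to be chosen first.\<close>

lemma (in psd_form) minimizer_exists:
  fixes p :: "'v \<Rightarrow> real"
  assumes p0: "\<And>x. x \<in> S \<Longrightarrow> 0 \<le> p x"
    and tri: "\<And>x y. x \<in> S \<Longrightarrow> y \<in> S \<Longrightarrow> p (x + y) \<le> p x + p y"
    and hom: "\<And>x c. x \<in> S \<Longrightarrow> p (c *\<^sub>R x) = \<bar>c\<bar> * p x"
    and nontriv: "x0 \<in> S" "p x0 \<noteq> 0"
    and compact: "\<And>X M. (\<And>n. X n \<in> S) \<Longrightarrow> (\<And>n. B (X n) (X n) \<le> M) \<Longrightarrow> (\<And>n. p (X n) \<le> M)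
        \<Longrightarrow> \<exists>r :: nat \<Rightarrow> nat. strict_mono r \<and> sn_cauchy p (X \<circ> r)"
    and complete: "\<And>X M. (\<And>n. X n \<in> S) \<Longrightarrow> (\<And>n. B (X n) (X n) \<le> M) \<Longrightarrow> (\<And>n. p (X n) \<le> M)
        \<Longrightarrow> sn_cauchy p X \<Longrightarrow> sn_cauchy (\<lambda>x. B x x) X
        \<Longrightarrow> \<exists>x\<in>S. \<exists>r :: nat \<Rightarrow> nat. strict_mono r \<and> (\<lambda>n. B (X (r n) - x) (X (r n) - x)) \<longlonglongrightarrow> 0
              \<and> (\<lambda>n. p (X (r n) - x)) \<longlonglongrightarrow> 0"
  shows "\<exists>x\<in>S. p x = 1 \<and> (\<forall>y\<in>S. B x x * (p y)\<^sup>2 \<le> B y y)"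
proof -
  define A where "A = {B y y |y. y \<in> S \<and> p y = 1}"
  define \<kappa> where "\<kappa> = Inf A"
  have low: "0 \<le> a" if "a \<in> A" for a using that nonneg by (auto simp: A_def)
  have bdd: "bdd_below A" using low by (rule bdd_belowI)
  have px0: "p x0 > 0" using p0[OF nontriv(1)] nontriv(2) by simp
  have "p ((1 / p x0) *\<^sub>R x0) = 1" using hom[OF nontriv(1)] px0 by simp
  then have ne: "A \<noteq> {}" unfolding A_def using mem(2)[OF nontriv(1)] by blast
  have \<kappa>0: "\<kappa> \<ge> 0" unfolding \<kappa>_def by (rule cInf_greatest[OF ne]) (rule low)
  have \<kappa>: "\<kappa> * (p y)\<^sup>2 \<le> B y y" if y: "y \<in> S" for y
  proof (cases "p y = 0")
    case False
    then have py: "p y > 0" using p0[OF y] by simp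
    have "p ((1 / p y) *\<^sub>R y) = 1" using hom[OF y] py by simp
    then have "B ((1 / p y) *\<^sub>R y) ((1 / p y) *\<^sub>R y) \<in> A" unfolding A_def using mem(2)[OF y] by blast
    then have "\<kappa> \<le> B ((1 / p y) *\<^sub>R y) ((1 / p y) *\<^sub>R y)" unfolding \<kappa>_def by (rule cInf_lower[OF _ bdd])
    then have "\<kappa> \<le> B y y / (p y)\<^sup>2" by (simp add: scale_both[OF y] power_divide)
    then show ?thesis using py by (simp add: pos_le_divide_eq)
  qed (use nonneg[OF y] in simp)
  have "\<exists>X. \<forall>n. X n \<in> S \<and> p (X n) = 1 \<and> B (X n) (X n) < \<kappa> + 1 / Suc n"
  proof (intro choice allI)
    fix n
    have "\<kappa> < \<kappa> + 1 / Suc n" by simp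
    then obtain a where "a \<in> A" "a < \<kappa> + 1 / Suc n" unfolding \<kappa>_def using cInf_lessD[OF ne] by blast
    then show "\<exists>x. x \<in> S \<and> p x = 1 \<and> B x x < \<kappa> + 1 / Suc n" by (auto simp: A_def)
  qed
  then obtain X where X: "\<And>n. X n \<in> S" "\<And>n. p (X n) = 1" "\<And>n. B (X n) (X n) < \<kappa> + 1 / Suc n" by blast
  define M where "M = \<kappa> + 1"
  have BM: "B (X n) (X n) \<le> M" for n
  proof -
    have "1 / real (Suc n) \<le> 1" by simp
    then show ?thesis using X(3)[of n] unfolding M_def by linarith
  qed
  have pM: "p (X n) \<le> M" for n using X(2) \<kappa>0 by (simp add: M_def)
  obtain r :: "nat \<Rightarrow> nat" where r: "strict_mono r" and pc: "sn_cauchy p (X \<circ> r)"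
    using compact[of X M, OF X(1) BM pM] by blast
  let ?Y = "X \<circ> r"
  have small: "B (?Y n) (?Y n) \<le> \<kappa> + 1 / Suc n" for n
  proof -
    have "1 / real (Suc (r n)) \<le> 1 / real (Suc n)"
      using seq_suble[OF r, of n] by (intro divide_left_mono) auto
    then show ?thesis using X(3)[of "r n"] by simp
  qed
  have "sn_cauchy (\<lambda>x. B x x) ?Y"
    unfolding sn_cauchy_def
  proof (intro allI impI)
    fix e :: real assume e: "e > 0"
    \<comment> \<open>The tolerance e is shared by the two excesses 1/(i+1) and 1/(j+1), a quarter
      each, and by the loss 4 \<kappa> d, which takes the remaining half.\<close>
    define d where "d = e / (8 * (\<kappa> + 1))"
    have d: "d > 0" using e \<kappa>0 by (simp add: d_def)
    obtain N where N: "\<And>i j. i \<ge> N \<Longrightarrow> j \<ge> N \<Longrightarrow> p (?Y i - ?Y j) \<le> d"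
      using pc d unfolding sn_cauchy_def by blast
    obtain K :: nat where K: "8 / e < K" using reals_Archimedean2 by blast
    have inv: "1 / Suc i \<le> e / 8" if "i \<ge> K" for i
    proof -
      have "8 / e \<le> real (Suc i)" using K that by linarith
      then show ?thesis using e by (simp add: field_simps)
    qed
    show "\<exists>N. \<forall>i\<ge>N. \<forall>j\<ge>N. B (?Y i - ?Y j) (?Y i - ?Y j) \<le> e"
    proof (intro exI allI impI)
      fix i j assume ij: "i \<ge> max N K" "j \<ge> max N K"
      let ?s = "?Y i + ?Y j" and ?t = "?Y i - ?Y j"
      have YS: "?Y i \<in> S" "?Y j \<in> S" "?s \<in> S" "?t \<in> S" using X(1) mem by simp_all
      \<comment> \<open>The sum and the difference add up to twice a unit element. As p of the
        difference is small, p of the sum is nearly 2 and B of the sum nearly at least 4 \<kappa>,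
        which leaves almost nothing for B of the difference.\<close>
      have "2 = p (?s + ?t)"
      proof -
        have "?s + ?t = 2 *\<^sub>R ?Y i" by (simp add: scaleR_2)
        then show ?thesis using hom[OF YS(1), of 2] X(2) by simp
      qed
      then have "2 - p ?t \<le> p ?s" using tri[OF YS(3,4)] by linarith
      moreover have "p ?t \<le> d" using N ij by simp
      ultimately have ps: "2 - d \<le> p ?s" by linarith
      have "4 - 4 * d \<le> (p ?s)\<^sup>2"
      proof (cases "d \<le> 2")
        case True
        then have "(2 - d)\<^sup>2 \<le> (p ?s)\<^sup>2" using ps by (intro power_mono) auto
        moreover have "(2 - d)\<^sup>2 = 4 - 4 * d + d\<^sup>2" by (simp add: power2_eq_square algebra_simps)
        ultimately show ?thesis using zero_le_power2[of d] by linarith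
      next
        case False
        then show ?thesis using zero_le_power2[of "p ?s"] by linarith
      qed
      then have "\<kappa> * (4 - 4 * d) \<le> B ?s ?s"
        using \<kappa>[OF YS(3)] \<kappa>0 by (meson mult_left_mono order_trans)
      moreover have "t + s = 2 * a + 2 * b \<Longrightarrow> w \<le> s \<Longrightarrow> a \<le> a' \<Longrightarrow> b \<le> b' \<Longrightarrow> t \<le> 2 * a' + 2 * b' - w"
        for t s a b a' b' w :: real by linarith
      ultimately have "B ?t ?t \<le> 2 * (\<kappa> + 1 / Suc i) + 2 * (\<kappa> + 1 / Suc j) - \<kappa> * (4 - 4 * d)"
        using parallelogram[OF YS(1,2)] small[of i] small[of j] by blast
      also have "\<dots> = 2 * (1 / Suc i) + 2 * (1 / Suc j) + 4 * (\<kappa> * d)" by (simp add: algebra_simps)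
      also have "\<kappa> * d \<le> e / 8"
      proof -
        have "\<kappa> * d \<le> (\<kappa> + 1) * d" using d by (simp add: distrib_right)
        also have "\<dots> = e / 8" using \<kappa>0 by (simp add: d_def field_simps)
        finally show ?thesis .
      qed
      finally show "B ?t ?t \<le> e" using inv[of i] inv[of j] ij by simp
    qed
  qed
  then obtain x s where x: "x \<in> S" and l: "(\<lambda>n. B (?Y (s n) - x) (?Y (s n) - x)) \<longlonglongrightarrow> 0"
    "(\<lambda>n. p (?Y (s n) - x)) \<longlonglongrightarrow> 0" and s: "strict_mono (s :: nat \<Rightarrow> nat)"
    using complete[of ?Y M] X(1) BM pM pc by auto
  have "p x = 1"
  proof -
    have "norm (1 - p x) \<le> p (?Y (s n) - x)" for n
    proof -
      let ?y = "?Y (s n)"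
      have y: "?y \<in> S" "?y - x \<in> S" "x - ?y \<in> S" using X(1) x mem by simp_all
      have "p (x - ?y) = p (?y - x)" using hom[OF y(2), of "-1"] by simp
      then show ?thesis using tri[OF y(2) x] tri[OF y(3) y(1)] X(2)[of "r (s n)"] by simp
    qed
    then have "(\<lambda>n. 1 - p x) \<longlonglongrightarrow> 0" by (intro Lim_null_comparison[OF always_eventually l(2)]) simp
    then show ?thesis using LIMSEQ_unique[OF tendsto_const, of "1 - p x" 0] by simp
  qed
  moreover have "B x x \<le> \<kappa>"
  proof (rule LIMSEQ_le)
    show "(\<lambda>n. B (?Y (s n)) (?Y (s n))) \<longlonglongrightarrow> B x x"
      by (rule tendsto_B[OF _ x l(1)]) (simp add: X(1))
    have "(\<lambda>n. \<kappa> + 1 / Suc (s n)) \<longlonglongrightarrow> \<kappa> + 0"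
      using LIMSEQ_subseq_LIMSEQ[OF LIMSEQ_Suc[OF lim_1_over_n] s] by (intro tendsto_add tendsto_const) (simp add: o_def)
    then show "(\<lambda>n. \<kappa> + 1 / Suc (s n)) \<longlonglongrightarrow> \<kappa>" by simp
    show "\<exists>N. \<forall>n\<ge>N. B (?Y (s n)) (?Y (s n)) \<le> \<kappa> + 1 / Suc (s n)" using small by blast
  qed
  then have "\<forall>y\<in>S. B x x * (p y)\<^sup>2 \<le> B y y"
    using \<kappa> by (meson mult_right_mono order_trans zero_le_power2)
  ultimately show ?thesis using x by blast
qed

section \<open>The principal eigenvalue\<close>

text \<open>Stated on \<open>L2p\<close> rather than \<open>H10\<close>, since it is applied to the
  modulus of a function before that modulus is known to agree with an element of
  \<open>H10\<close>.\<close>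

lemma b0_psd_L2p: "psd_form {U. L2p U} b0"
  by (rule psd_form.intro[OF subspace_L2p b0_commute b0_add_left b0_scale_left b0_nonneg]) auto

lemma b0_zero_AE:
  assumes "L2p U" "b0 U U = 0"
  shows "AE x in lebesgue. fst U x = 0"
proof -
  have "(LINT x|lebesgue. (fst U x)\<^sup>2) = 0" using assms(2) by (simp add: b0_def power2_eq_square)
  then have "AE x in lebesgue. (fst U x)\<^sup>2 = 0"
    using integral_nonneg_eq_0_iff_AE[OF L2p_square_integrable(1)[OF assms(1)]] by auto
  then show ?thesis by simp
qed

context sob_domain
begin

lemma integ_b0: "U \<in> H10 \<Omega> \<Longrightarrow> V \<in> H10 \<Omega> \<Longrightarrow> integ \<Omega> (\<lambda>x. fst U x * fst V x) = b0 U V"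
  unfolding b0_def using H10_outside[of U \<Omega>] L2p_integrable(1)[OF H10_L2p H10_L2p, of U \<Omega> V \<Omega>]
  by (intro integ_eq borel_measurable_integrable) (auto elim!: eventually_mono)

lemma integ_a1: "U \<in> H10 \<Omega> \<Longrightarrow> V \<in> H10 \<Omega> \<Longrightarrow> integ \<Omega> (\<lambda>x. snd U x \<bullet> snd V x) = a1 U V"
  unfolding a1_def using H10_outside[of U \<Omega>] L2p_integrable(2)[OF H10_L2p H10_L2p, of U \<Omega> V \<Omega>]
  by (intro integ_eq borel_measurable_integrable) (auto elim!: eventually_mono)

lemma dirichlet_eigen_iff:
  "dirichlet_eigen \<Omega> lam U \<longleftrightarrow> U \<in> H10 \<Omega> \<and> b0 U U \<noteq> 0 \<and> (\<forall>V\<in>H10 \<Omega>. a1 U V = lam * b0 U V)"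
proof -
  have "(AE x in lebesgue. x \<in> \<Omega> \<longrightarrow> fst U x = 0) \<longleftrightarrow> b0 U U = 0" if U: "U \<in> H10 \<Omega>"
  proof
    assume "AE x in lebesgue. x \<in> \<Omega> \<longrightarrow> fst U x = 0"
    then have "AE x in lebesgue. fst U x * fst U x = 0"
      using H10_outside[OF U] by eventually_elim auto
    then show "b0 U U = 0" unfolding b0_def by (rule integral_eq_zero_AE)
  next
    assume "b0 U U = 0"
    from b0_zero_AE[OF H10_L2p[OF U] this] show "AE x in lebesgue. x \<in> \<Omega> \<longrightarrow> fst U x = 0"
      by eventually_elim auto
  qed
  then show ?thesis
    by (cases "U \<in> H10 \<Omega>") (simp_all add: dirichlet_eigen_def integ_b0 integ_a1 cong: ball_cong)
qed

lemma sqrt_b0_cauchy: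
  assumes X: "\<And>n. X n \<in> H10 \<Omega>" and c: "sn_cauchy NN X"
  shows "sn_cauchy (\<lambda>U. sqrt (b0 U U)) X"
  unfolding sn_cauchy_def
proof (intro allI impI)
  fix e :: real assume e: "e > 0"
  have v: "vol \<ge> 0" by (simp add: vol_def)
  define d where "d = e / sqrt (vol + 1)"
  have d: "d > 0" using e v by (simp add: d_def)
  obtain N where N: "\<And>i j. i \<ge> N \<Longrightarrow> j \<ge> N \<Longrightarrow> NN (X i - X j) \<le> d"
    using c d unfolding sn_cauchy_def by blast
  have "sqrt (b0 (X i - X j) (X i - X j)) \<le> e" if "i \<ge> N" "j \<ge> N" for i j
  proof -
    have "b0 (X i - X j) (X i - X j) \<le> (vol + 1) * d\<^sup>2"
      using N that d X by (intro b0_le_NN H10_mem) auto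
    also have "\<dots> = e\<^sup>2" using v by (simp add: d_def power_divide)
    finally have "sqrt (b0 (X i - X j) (X i - X j)) \<le> sqrt (e\<^sup>2)" by (rule real_sqrt_le_mono)
    then show ?thesis using e by simp
  qed
  then show "\<exists>N. \<forall>i\<ge>N. \<forall>j\<ge>N. sqrt (b0 (X i - X j) (X i - X j)) \<le> e" by blast
qed

lemma nH_cauchyI:
  assumes b: "sn_cauchy (\<lambda>U. sqrt (b0 U U)) X" and a: "sn_cauchy (\<lambda>U. a1 U U) X"
  shows "sn_cauchy nH X"
  unfolding sn_cauchy_def
proof (intro allI impI)
  fix e :: real assume e: "e > 0"
  then have e2: "sqrt (e / 2) > 0" "e / 2 > 0" by auto
  obtain N where N: "\<And>i j. i \<ge> N \<Longrightarrow> j \<ge> N \<Longrightarrow> sqrt (b0 (X i - X j) (X i - X j)) \<le> sqrt (e / 2)"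
    using b e2 unfolding sn_cauchy_def by blast
  obtain K where K: "\<And>i j. i \<ge> K \<Longrightarrow> j \<ge> K \<Longrightarrow> a1 (X i - X j) (X i - X j) \<le> e / 2"
    using a e2 unfolding sn_cauchy_def by blast
  have "nH (X i - X j) \<le> e" if "i \<ge> max N K" "j \<ge> max N K" for i j
  proof -
    have "b0 (X i - X j) (X i - X j) \<le> e / 2" using N[of i j] that by simp
    moreover have "a1 (X i - X j) (X i - X j) \<le> e / 2" using K[of i j] that by simp
    ultimately have "nH (X i - X j) \<le> e / 2 + e / 2" unfolding nH_def by (rule add_mono)
    then show ?thesis by simp
  qed
  then show "\<exists>N. \<forall>i\<ge>N. \<forall>j\<ge>N. nH (X i - X j) \<le> e" by blast
qed

lemma H10_complete': "(\<And>n. X n \<in> H10 \<Omega>) \<Longrightarrow> sn_cauchy nH X \<Longrightarrow> \<exists>V\<in>H10 \<Omega>. (\<lambda>n. nH (X n - V)) \<longlonglongrightarrow> 0"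
  using H10_complete[of X \<Omega>] unfolding sn_cauchy_def by blast

lemma H10_compact': "(\<And>n. X n \<in> H10 \<Omega>) \<Longrightarrow> (\<And>n. nH (X n) \<le> M) \<Longrightarrow> \<exists>r :: nat \<Rightarrow> nat. strict_mono r \<and> sn_cauchy NN (X \<circ> r)"
  unfolding sn_cauchy_def o_def by (rule H10_compact)

text \<open>The eigenvalue equation for the minimiser U comes from Cauchy-Schwarz: the form a1 -
  a1(U,U) b0 is positive semidefinite and vanishes at U, hence it vanishes at U against every
  V.\<close>

lemma rayleigh_minimizer:
  assumes U0: "U0 \<in> H10 \<Omega>" "b0 U0 U0 \<noteq> 0"
  shows "\<exists>U. dirichlet_eigen \<Omega> (a1 U U) U \<and> (\<forall>V\<in>H10 \<Omega>. a1 U U * b0 V V \<le> a1 V V)"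
proof -
  interpret b: psd_form "H10 \<Omega>" b0 by (rule b0_psd)
  interpret a: psd_form "H10 \<Omega>" a1 by (rule a1_psd)
  have "\<exists>x\<in>H10 \<Omega>. sqrt (b0 x x) = 1 \<and> (\<forall>y\<in>H10 \<Omega>. a1 x x * (sqrt (b0 y y))\<^sup>2 \<le> a1 y y)"
  proof (rule a.minimizer_exists[where p = "\<lambda>U. sqrt (b0 U U)", OF _ b.sqrt_triangle _ U0(1)])
    show "sqrt (b0 U0 U0) \<noteq> 0" using U0(2) by simp
    show "sqrt (b0 (c *\<^sub>R x) (c *\<^sub>R x)) = \<bar>c\<bar> * sqrt (b0 x x)" if "x \<in> H10 \<Omega>" for x c
      using b.scale_both[OF that] by (simp add: real_sqrt_mult)
  next
    fix X :: "nat \<Rightarrow> 'a h1" and M assume X: "\<And>n. X n \<in> H10 \<Omega>" "\<And>n. a1 (X n) (X n) \<le> M" "\<And>n. sqrt (b0 (X n) (X n)) \<le> M"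
    have "nH (X n) \<le> M\<^sup>2 + M" for n
      using X(2)[of n] power_mono[OF X(3)[of n], of 2] by (simp add: nH_def)
    from H10_compact'[of X, OF X(1) this] obtain r :: "nat \<Rightarrow> nat" where r: "strict_mono r" "sn_cauchy NN (X \<circ> r)" by blast
    have "sn_cauchy (\<lambda>U. sqrt (b0 U U)) (X \<circ> r)"
      by (rule sqrt_b0_cauchy[OF _ r(2)]) (simp add: X(1))
    with r(1) show "\<exists>r :: nat \<Rightarrow> nat. strict_mono r \<and> sn_cauchy (\<lambda>U. sqrt (b0 U U)) (X \<circ> r)"
      by blast
    assume c: "sn_cauchy (\<lambda>U. sqrt (b0 U U)) X" "sn_cauchy (\<lambda>x. a1 x x) X"
    obtain V where V: "V \<in> H10 \<Omega>" "(\<lambda>n. nH (X n - V)) \<longlonglongrightarrow> 0"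
      using H10_complete'[of X, OF X(1) nH_cauchyI[OF c]] by blast
    have "(\<lambda>n. a1 (X n - V) (X n - V)) \<longlonglongrightarrow> 0"
      by (rule tendsto_sandwich[OF _ _ tendsto_const V(2)]) (auto simp: nH_def)
    moreover have "(\<lambda>n. b0 (X n - V) (X n - V)) \<longlonglongrightarrow> 0"
      by (rule tendsto_sandwich[OF _ _ tendsto_const V(2)]) (auto simp: nH_def)
    from tendsto_real_sqrt[OF this] have "(\<lambda>n. sqrt (b0 (X n - V) (X n - V))) \<longlonglongrightarrow> 0" by simp
    ultimately show "\<exists>x\<in>H10 \<Omega>. \<exists>r :: nat \<Rightarrow> nat. strict_mono r \<and> (\<lambda>n. a1 (X (r n) - x) (X (r n) - x)) \<longlonglongrightarrow> 0 \<and>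
        (\<lambda>n. sqrt (b0 (X (r n) - x) (X (r n) - x))) \<longlonglongrightarrow> 0"
      using V(1) by (intro bexI[of _ V] exI[of _ "\<lambda>n. n"]) (auto simp: strict_mono_def)
  qed auto
  then obtain U where U: "U \<in> H10 \<Omega>" "b0 U U = 1" and min: "\<And>V. V \<in> H10 \<Omega> \<Longrightarrow> a1 U U * b0 V V \<le> a1 V V"
    by auto
  interpret C: psd_form "H10 \<Omega>" "\<lambda>V W. a1 V W + (- a1 U U) * b0 V W"
    by (rule psd_form_combine[OF a1_psd b0_psd]) (use min in auto)
  have e: "a1 U V = a1 U U * b0 U V" if "V \<in> H10 \<Omega>" for V
    using C.null[OF U(1) that] U(2) by simp
  have "dirichlet_eigen \<Omega> (a1 U U) U"
    unfolding dirichlet_eigen_iff by (intro conjI ballI U(1) e) (simp add: U(2))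
  with min show ?thesis by blast
qed

end

section \<open>The form \<open>Q\<close> and the modulus of its null functions\<close>

locale eigen_domain = sob_domain \<Omega> for \<Omega> :: "'a::euclidean_space set" +
  fixes lam :: real and \<phi>1 :: "'a h1"
  assumes conn: "connected \<Omega>" and pe: "principal_eigen \<Omega> lam \<phi>1"
begin

definition Q :: "'a h1 \<Rightarrow> 'a h1 \<Rightarrow> real" where
  "Q U V = a1 U V + (- lam) * b0 U V"

lemma phi: "\<phi>1 \<in> H10 \<Omega>" "b0 \<phi>1 \<phi>1 \<noteq> 0" "V \<in> H10 \<Omega> \<Longrightarrow> Q \<phi>1 V = 0"
  using pe unfolding principal_eigen_def dirichlet_eigen_iff Q_def by auto

text \<open>\<open>principal_eigen\<close> only compares eigenvalues with each other. The minimum of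
  the Rayleigh quotient is itself an eigenvalue, so \<open>lam\<close> lies below it.\<close>

lemma Q_psd: "psd_form (H10 \<Omega>) Q"
proof -
  obtain U where U: "dirichlet_eigen \<Omega> (a1 U U) U" and min: "\<And>V. V \<in> H10 \<Omega> \<Longrightarrow> a1 U U * b0 V V \<le> a1 V V"
    using rayleigh_minimizer[OF phi(1,2)] by blast
  have le: "lam \<le> a1 U U" using pe U unfolding principal_eigen_def by blast
  have "0 \<le> a1 V V + (- lam) * b0 V V" if "V \<in> H10 \<Omega>" for V
    using min[OF that] mult_right_mono[OF le b0_nonneg[of V]] by simp
  then show ?thesis unfolding Q_def[abs_def] by (rule psd_form_combine[OF a1_psd b0_psd])
qed

sublocale Q: psd_form "H10 \<Omega>" Q by (rule Q_psd)

lemma lam_nonneg: "lam \<ge> 0"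
proof -
  have "lam * b0 \<phi>1 \<phi>1 = a1 \<phi>1 \<phi>1" using phi(3)[OF phi(1)] by (simp add: Q_def)
  then have "0 \<le> lam * b0 \<phi>1 \<phi>1" by simp
  then show ?thesis using phi(2) b0_nonneg[of \<phi>1] by (simp add: zero_le_mult_iff)
qed

lemma Q_le_nH: "Q U U \<le> nH U"
  using lam_nonneg mult_nonneg_nonneg[OF lam_nonneg b0_nonneg[of U]] b0_nonneg[of U] unfolding Q_def nH_def by linarith

text \<open>With f = sqrt(\<phi>^2 + \<epsilon>^2) - \<epsilon> the modulus is approximated by
  nonnegative test functions whose gradients are no longer than those of \<phi>, so \<open>Q\<close>
  tends to 0 along them. The parallelogram law then makes them Cauchy in H^1. They are kept in the
  conclusion because the logarithmic estimate needs nonnegative smooth approximants.\<close>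

lemma eigen_abs:
  assumes U: "U \<in> H10 \<Omega>" "Q U U = 0"
  shows "\<exists>V f. V \<in> H10 \<Omega> \<and> Q V V = 0 \<and> (AE x in lebesgue. fst V x = \<bar>fst U x\<bar>) \<and>
    (\<forall>n::nat. test_fun \<Omega> (f n) \<and> (\<forall>x. f n x \<ge> 0)) \<and> (\<lambda>n. nH (el (f n) - V)) \<longlonglongrightarrow> 0"
proof -
  interpret b: psd_form "{U. L2p U}" b0 by (rule b0_psd_L2p)
  interpret a: psd_form "H10 \<Omega>" a1 by (rule a1_psd)
  obtain \<phi> where \<phi>: "\<And>n::nat. test_fun \<Omega> (\<phi> n)" "(\<lambda>n. nH (el (\<phi> n) - U)) \<longlonglongrightarrow> 0"
    using H10_approx[OF U(1)] by blast
  define \<epsilon> :: "nat \<Rightarrow> real" where "\<epsilon> n = 1 / Suc n" for n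
  have \<epsilon>: "\<epsilon> n > 0" for n by (simp add: \<epsilon>_def)
  define s where "s n x = sqrt ((\<phi> n x)\<^sup>2 + (\<epsilon> n)\<^sup>2)" for n x
  define f where "f n x = s n x - \<epsilon> n" for n x
  have pos: "(\<phi> n x)\<^sup>2 + (\<epsilon> n)\<^sup>2 > 0" for n x using \<epsilon>[of n] by (simp add: add_nonneg_pos)
  have spos: "s n x > 0" for n x unfolding s_def using pos by simp
  have f0: "f n x \<ge> 0" for n x
    unfolding f_def s_def using \<epsilon>[of n] by (simp add: real_le_rsqrt)
  have fle: "f n x \<le> \<bar>\<phi> n x\<bar>" for n x
  proof -
    have "s n x \<le> \<bar>\<phi> n x\<bar> + \<epsilon> n"
      unfolding s_def using \<epsilon>[of n] by (intro real_le_lsqrt) (auto simp: power2_sum)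
    then show ?thesis by (simp add: f_def)
  qed
  have fge: "\<bar>\<phi> n x\<bar> - \<epsilon> n \<le> f n x" for n x
    unfolding f_def s_def by (simp add: real_le_rsqrt)
  have sm: "Ck_on k UNIV (s n)" for k n
  proof -
    have "Ck_on k UNIV (\<lambda>x. \<phi> n x * \<phi> n x + (\<epsilon> n)\<^sup>2)"
      by (intro Ck_add Ck_mult Ck_const test_fun_smooth[OF \<phi>(1)])
    then show ?thesis
      unfolding s_def using pos by (intro Ck_sqrt) (auto simp: power2_eq_square)
  qed
  have tf: "test_fun \<Omega> (f n)" for n
  proof (rule test_fun_supportI[OF \<phi>(1)[of n]])
    show "Ck_on k UNIV (f n)" for k
      using Ck_add[OF sm[of k n] Ck_const[of k "- \<epsilon> n"]] by (simp add: f_def[abs_def])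
    show "\<phi> n x \<noteq> 0" if "f n x \<noteq> 0" for x
      using fle[of n x] f0[of n x] that by auto
  qed
  have g: "norm (grad (f n) x) \<le> norm (grad (\<phi> n) x)" for n x
  proof -
    note t = test_fun_has_grad[OF \<phi>(1)[of n], of x]
    from has_derivative_add[OF has_derivative_mult[OF t t] has_derivative_const[of "(\<epsilon> n)\<^sup>2"]]
    have "((\<lambda>x. (\<phi> n x)\<^sup>2 + (\<epsilon> n)\<^sup>2) has_derivative
        (\<lambda>h. \<phi> n x * (grad (\<phi> n) x \<bullet> h) + (grad (\<phi> n) x \<bullet> h) * \<phi> n x)) (at x)"
      by (simp add: power2_eq_square)
    from has_derivative_real_sqrt[OF pos this]
    have "((\<lambda>x. f n x) has_derivative (\<lambda>h. ((\<phi> n x / s n x) *\<^sub>R grad (\<phi> n) x) \<bullet> h)) (at x)"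
      unfolding f_def s_def
      by (intro has_derivative_eq_rhs[OF has_derivative_diff[OF _ has_derivative_const]]) (auto simp: fun_eq_iff field_simps)
    then have "grad (f n) x = (\<phi> n x / s n x) *\<^sub>R grad (\<phi> n) x" by (intro grad_eqI)
    moreover have "\<bar>\<phi> n x\<bar> \<le> s n x" unfolding s_def by (intro real_le_rsqrt) simp
    then have "\<bar>\<phi> n x / s n x\<bar> \<le> 1" using spos[of n x] by (simp add: abs_divide)
    from mult_right_mono[OF this norm_ge_zero[of "grad (\<phi> n) x"]]
    have "norm ((\<phi> n x / s n x) *\<^sub>R grad (\<phi> n) x) \<le> norm (grad (\<phi> n) x)" by simp
    ultimately show ?thesis by simp
  qed
  have E: "el (\<phi> n) \<in> H10 \<Omega>" "el (f n) \<in> H10 \<Omega>" for n by (auto intro: el_in_H10 \<phi>(1) tf)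
  have ale: "a1 (el (f n)) (el (f n)) \<le> a1 (el (\<phi> n)) (el (\<phi> n))" for n
    unfolding a1_def
  proof (rule integral_mono)
    show "integrable lebesgue (\<lambda>x. snd (el (f n)) x \<bullet> snd (el (f n)) x)" "integrable lebesgue (\<lambda>x. snd (el (\<phi> n)) x \<bullet> snd (el (\<phi> n)) x)"
      by (rule L2p_integrable[OF H10_L2p H10_L2p]; rule E)+
    show "snd (el (f n)) x \<bullet> snd (el (f n)) x \<le> snd (el (\<phi> n)) x \<bullet> snd (el (\<phi> n)) x" for x
      using power_mono[OF g[of n x] norm_ge_zero, of 2] by (simp add: el_def power2_norm_eq_inner)
  qed
  \<comment> \<open>Only the function component is used; the gradient slot is filled with 0, and no
    weak gradient of the modulus is ever computed.\<close>
  define A where "A = (\<lambda>x. \<bar>fst U x\<bar>, \<lambda>x::'a. 0::'a)"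
  note LU = H10_L2p[OF U(1)]
  have LA: "L2p A"
  proof -
    have "nsq A \<le> nsq U" unfolding nsq_def A_def by (auto intro!: nn_integral_mono ennreal_leI)
    then have "nsq A < \<infinity>" using LU by (auto simp: L2p_def elim: le_less_trans)
    then show ?thesis using L2p_measurable[OF LU] by (simp add: L2p_def A_def)
  qed
  have bAA: "b0 A A = b0 U U" by (simp add: b0_def A_def)
  have Lf: "L2p (el (f n))" "L2p (el (\<phi> n))" for n by (auto intro: H10_L2p E)
  have bd: "b0 (el (f n) - A) (el (f n) - A) \<le> 2 * nH (el (\<phi> n) - U) + 2 * (\<epsilon> n)\<^sup>2 * vol" for n
  proof -
    have i: "integrable lebesgue (\<lambda>x. (fst (el (\<phi> n) - U) x)\<^sup>2)" "integrable lebesgue (\<lambda>x. (fst (el (f n) - A) x)\<^sup>2)"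
      by (intro L2p_square_integrable L2p_diff Lf LU LA)+
    have "b0 (el (f n) - A) (el (f n) - A) = (LINT x|lebesgue. (fst (el (f n) - A) x)\<^sup>2)"
      by (simp add: b0_def power2_eq_square)
    also have "\<dots> \<le> (LINT x|lebesgue. 2 * (fst (el (\<phi> n) - U) x)\<^sup>2 + 2 * (\<epsilon> n)\<^sup>2 * indicator \<Omega> x)"
    proof (rule integral_mono_AE)
      show "integrable lebesgue (\<lambda>x. (fst (el (f n) - A) x)\<^sup>2)" by (rule i)
      show "integrable lebesgue (\<lambda>x. 2 * (fst (el (\<phi> n) - U) x)\<^sup>2 + 2 * (\<epsilon> n)\<^sup>2 * indicator \<Omega> x)"
        using i(1) integrable_const_dom by (intro Bochner_Integration.integrable_add integrable_mult_right) auto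
      show "AE x in lebesgue. (fst (el (f n) - A) x)\<^sup>2 \<le> 2 * (fst (el (\<phi> n) - U) x)\<^sup>2 + 2 * (\<epsilon> n)\<^sup>2 * indicator \<Omega> x"
        using H10_outside[OF U(1)]
      proof eventually_elim
        case (elim x)
        show ?case
        proof (cases "x \<in> \<Omega>")
          case True
          have "\<bar>f n x - \<bar>fst U x\<bar>\<bar> \<le> \<bar>\<phi> n x - fst U x\<bar> + \<epsilon> n"
            using fle[of n x] fge[of n x] by linarith
          then have "(f n x - \<bar>fst U x\<bar>)\<^sup>2 \<le> (\<bar>\<phi> n x - fst U x\<bar> + \<epsilon> n)\<^sup>2"
            by (metis abs_ge_zero power2_abs power_mono)
          also have "\<dots> \<le> 2 * (\<phi> n x - fst U x)\<^sup>2 + 2 * (\<epsilon> n)\<^sup>2"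
            using sum_squares_bound[of "\<bar>\<phi> n x - fst U x\<bar>" "\<epsilon> n"] by (simp add: power2_sum)
          finally show ?thesis using True by (simp add: el_def A_def)
        next
          case False
          then show ?thesis using elim test_fun_outside(1)[OF tf] by (simp add: el_def A_def)
        qed
      qed
    qed
    also have "\<dots> = 2 * b0 (el (\<phi> n) - U) (el (\<phi> n) - U) + 2 * (\<epsilon> n)\<^sup>2 * vol"
      using i(1) integrable_const_dom[of "2 * (\<epsilon> n)\<^sup>2"] by (simp add: b0_def vol_def power2_eq_square)
    also have "\<dots> \<le> 2 * nH (el (\<phi> n) - U) + 2 * (\<epsilon> n)\<^sup>2 * vol" by (simp add: nH_def)
    finally show ?thesis .
  qed
  have \<epsilon>0: "\<epsilon> \<longlonglongrightarrow> 0" unfolding \<epsilon>_def by (rule LIMSEQ_Suc[OF lim_1_over_n])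
  have bl: "(\<lambda>n. b0 (el (f n) - A) (el (f n) - A)) \<longlonglongrightarrow> 0"
  proof (rule tendsto_sandwich[OF _ _ tendsto_const])
    have "(\<lambda>n. 2 * nH (el (\<phi> n) - U) + 2 * (\<epsilon> n)\<^sup>2 * vol) \<longlonglongrightarrow> 2 * 0 + 2 * 0\<^sup>2 * vol"
      by (intro tendsto_intros \<phi>(2) \<epsilon>0)
    then show "(\<lambda>n. 2 * nH (el (\<phi> n) - U) + 2 * (\<epsilon> n)\<^sup>2 * vol) \<longlonglongrightarrow> 0" by simp
  qed (auto simp: bd)
  have "(\<lambda>n. b0 (el (f n)) (el (f n))) \<longlonglongrightarrow> b0 A A"
    by (rule b.tendsto_B[OF _ _ bl]) (auto simp: Lf LA)
  moreover have "(\<lambda>n. a1 (el (\<phi> n) - U) (el (\<phi> n) - U)) \<longlonglongrightarrow> 0"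
    by (rule tendsto_sandwich[OF _ _ tendsto_const \<phi>(2)]) (auto simp: nH_def)
  then have "(\<lambda>n. a1 (el (\<phi> n)) (el (\<phi> n))) \<longlonglongrightarrow> a1 U U"
    by (rule a.tendsto_B[OF E(1) U(1)])
  ultimately have "(\<lambda>n. a1 (el (\<phi> n)) (el (\<phi> n)) + (- lam) * b0 (el (f n)) (el (f n))) \<longlonglongrightarrow> a1 U U + (- lam) * b0 A A"
    by (intro tendsto_intros)
  then have ub: "(\<lambda>n. a1 (el (\<phi> n)) (el (\<phi> n)) + (- lam) * b0 (el (f n)) (el (f n))) \<longlonglongrightarrow> 0"
    using U(2) by (simp add: bAA Q_def)
  have Ql: "(\<lambda>n. Q (el (f n)) (el (f n))) \<longlonglongrightarrow> 0"
    by (rule tendsto_sandwich[OF _ _ tendsto_const ub]) (use ale Q.nonneg E in \<open>auto simp: Q_def\<close>)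
  have "sn_cauchy nH (\<lambda>n. el (f n))"
    unfolding sn_cauchy_def
  proof (intro allI impI)
    fix e :: real assume e: "e > 0"
    \<comment> \<open>nH is Q + (1 + lam) b0, so nH of the difference of the members i and j is at
      most ?g i + ?g j.\<close>
    let ?g = "\<lambda>n. 2 * Q (el (f n)) (el (f n)) + (1 + lam) * (2 * b0 (el (f n) - A) (el (f n) - A))"
    have "?g \<longlonglongrightarrow> 2 * 0 + (1 + lam) * (2 * 0)" by (intro tendsto_intros Ql bl)
    then have "\<forall>\<^sub>F n in sequentially. ?g n < e / 2" using e by (intro order_tendstoD) auto
    then obtain N where N: "\<And>n. n \<ge> N \<Longrightarrow> ?g n < e / 2" by (auto simp: eventually_sequentially)
    have "nH (el (f i) - el (f j)) \<le> e" if "i \<ge> N" "j \<ge> N" for i j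
    proof -
      let ?d = "el (f i) - el (f j)"
      have "Q ?d ?d \<le> 2 * Q (el (f i)) (el (f i)) + 2 * Q (el (f j)) (el (f j))"
        using Q.parallelogram[OF E(2)[of i] E(2)[of j]] Q.nonneg[OF Q.mem(1)[OF E(2)[of i] E(2)[of j]]] by linarith
      moreover have "b0 ?d ?d \<le> 2 * b0 (el (f i) - A) (el (f i) - A) + 2 * b0 (el (f j) - A) (el (f j) - A)"
      proof -
        have "b0 (A - el (f j)) (A - el (f j)) = b0 (el (f j) - A) (el (f j) - A)"
          by (simp add: b0_def algebra_simps)
        then show ?thesis using b.diff_triangle_le[of "el (f i)" A "el (f j)"] Lf LA by simp
      qed
      then have "(1 + lam) * b0 ?d ?d \<le> (1 + lam) * (2 * b0 (el (f i) - A) (el (f i) - A) + 2 * b0 (el (f j) - A) (el (f j) - A))"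
        using lam_nonneg by (intro mult_left_mono) auto
      moreover have "nH ?d = Q ?d ?d + (1 + lam) * b0 ?d ?d" by (simp add: nH_def Q_def algebra_simps)
      ultimately show ?thesis using N[OF that(1)] N[OF that(2)] by (simp add: distrib_left)
    qed
    then show "\<exists>N. \<forall>i\<ge>N. \<forall>j\<ge>N. nH (el (f i) - el (f j)) \<le> e" by blast
  qed
  then obtain V where V: "V \<in> H10 \<Omega>" "(\<lambda>n. nH (el (f n) - V)) \<longlonglongrightarrow> 0"
    using H10_complete'[of "\<lambda>n. el (f n)"] E(2) by blast
  have "(\<lambda>n. Q (el (f n) - V) (el (f n) - V)) \<longlonglongrightarrow> 0"
    by (rule tendsto_sandwich[OF _ _ tendsto_const V(2)]) (auto simp: Q_le_nH Q.nonneg Q.mem E V(1))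
  then have "(\<lambda>n. Q (el (f n)) (el (f n))) \<longlonglongrightarrow> Q V V"
    by (rule Q.tendsto_B[OF E(2) V(1)])
  then have QV: "Q V V = 0" using LIMSEQ_unique Ql by blast
  have "b0 (V - A) (V - A) \<le> 0"
  proof (rule LIMSEQ_le_const)
    have "(\<lambda>n. 2 * nH (el (f n) - V) + 2 * b0 (el (f n) - A) (el (f n) - A)) \<longlonglongrightarrow> 2 * 0 + 2 * 0"
      by (intro tendsto_intros V bl)
    then show "(\<lambda>n. 2 * nH (el (f n) - V) + 2 * b0 (el (f n) - A) (el (f n) - A)) \<longlonglongrightarrow> 0" by simp
    have "b0 (V - A) (V - A) \<le> 2 * nH (el (f n) - V) + 2 * b0 (el (f n) - A) (el (f n) - A)" for n
    proof -
      have "b0 (V - el (f n)) (V - el (f n)) = b0 (el (f n) - V) (el (f n) - V)"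
        by (simp add: b0_def algebra_simps)
      then have "b0 (V - A) (V - A) \<le> 2 * b0 (el (f n) - V) (el (f n) - V) + 2 * b0 (el (f n) - A) (el (f n) - A)"
        using b.diff_triangle_le[of V "el (f n)" A] Lf LA H10_L2p[OF V(1)] by simp
      moreover have "x \<le> 2 * b + 2 * c \<Longrightarrow> 0 \<le> a \<Longrightarrow> x \<le> 2 * (b + a) + 2 * c" for x a b c :: real
        by (simp add: distrib_left)
      ultimately show ?thesis unfolding nH_def using a1_nonneg by blast
    qed
    then show "\<exists>N. \<forall>n\<ge>N. b0 (V - A) (V - A) \<le> 2 * nH (el (f n) - V) + 2 * b0 (el (f n) - A) (el (f n) - A)" by blast
  qed
  then have "b0 (V - A) (V - A) = 0" by (simp add: order_antisym)
  from b0_zero_AE[OF L2p_diff[OF H10_L2p[OF V(1)] LA] this]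
  have "AE x in lebesgue. fst V x = \<bar>fst U x\<bar>" by eventually_elim (simp add: A_def)
  then show ?thesis using V QV tf f0 by blast
qed

end

section \<open>Strong maximum principle\<close>

lemma integrable_compact_support:
  fixes g :: "'a::euclidean_space \<Rightarrow> real"
  assumes "continuous_on UNIV g" "compact K" "\<And>x. x \<notin> K \<Longrightarrow> g x = 0"
  shows "integrable lebesgue g"
proof -
  have i: "integrable lborel (\<lambda>x. indicator K x *\<^sub>R g x)"
    by (rule borel_integrable_compact[OF assms(2) continuous_on_subset[OF assms(1) subset_UNIV]])
  have eq: "(\<lambda>x. indicator K x *\<^sub>R g x) = g" using assms(3) by (auto simp: fun_eq_iff indicator_def)
  have "g \<in> borel_measurable lborel" using borel_measurable_continuous_onI[OF assms(1)] by simp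
  then show ?thesis using i[unfolded eq] by (simp add: integrable_completion)
qed

lemma AE_lborel_translate:
  fixes z :: "'a::euclidean_space"
  assumes "AE x in lborel. P x" shows "AE x in lborel. P (x + z)"
proof -
  obtain N where N: "N \<in> null_sets lborel" "{x. \<not> P x} \<subseteq> N"
    using assms unfolding eventually_ae_filter by auto
  have [measurable]: "N \<in> sets borel" using N(1) by auto
  let ?M = "{x. x + z \<in> N}"
  have m: "?M \<in> sets borel" by measurable
  have "emeasure lborel ?M = (\<integral>\<^sup>+x. indicator ?M x \<partial>lborel)"
    using m by (intro nn_integral_indicator[symmetric]) simp
  also have "\<dots> = (\<integral>\<^sup>+x. indicator N (x + z) \<partial>lborel)"
    by (intro nn_integral_cong) (simp add: indicator_def)
  also have "\<dots> = (\<integral>\<^sup>+x. indicator N x \<partial>lborel)"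
    by (rule nn_integral_lborel_translate) measurable
  also have "\<dots> = 0" using N(1) by (simp add: null_setsD1)
  finally have "?M \<in> null_sets lborel" using m by (simp add: null_setsI)
  then show ?thesis by (rule AE_I') (use N(2) in blast)
qed

section \<open>Logarithmic differences and the size of zero sets\<close>

context
  fixes S :: "'a::euclidean_space set" and f :: "nat \<Rightarrow> 'a \<Rightarrow> real" and g :: "nat \<Rightarrow> 'a \<Rightarrow> 'a" and v :: "'a \<Rightarrow> real" and C :: real
  assumes S: "convex S" "open S"
    and f0: "\<And>n x. f n x \<ge> 0" and df: "\<And>n x. (f n has_derivative (\<lambda>h. g n x \<bullet> h)) (at x)"
    and cg: "\<And>n. continuous_on UNIV (g n)"
    and v[measurable]: "v \<in> borel_measurable borel" and lim: "AE x in lborel. (\<lambda>n. f n x) \<longlonglongrightarrow> v x"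
    and bound: "\<And>\<delta>. \<delta> > 0 \<Longrightarrow> \<forall>\<^sub>F n in sequentially.
      (\<integral>\<^sup>+x. indicator S x * ennreal ((norm ((1 / (f n x + \<delta>)) *\<^sub>R g n x))\<^sup>2) \<partial>lborel) \<le> ennreal C"
begin

text \<open>Apply \<open>translation_estimate\<close> to ln(f n + \<delta>) and use Fatou in n. What
  matters is that the resulting bound is free of \<delta>.\<close>

lemma log_translate_bound:
  assumes \<delta>: "\<delta> > 0"
  shows "(\<integral>\<^sup>+x. indicator {x. x \<in> S \<and> x + z \<in> S} x * ennreal ((ln (v (x + z) + \<delta>) - ln (v x + \<delta>))\<^sup>2) \<partial>lborel)
    \<le> ennreal ((norm z)\<^sup>2) * ennreal C"
proof -
  let ?D = "{x. x \<in> S \<and> x + z \<in> S}"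
  have Sb[measurable]: "S \<in> sets borel" using S(2) by auto
  have D[measurable]: "?D \<in> sets borel" by measurable
  let ?L = "\<lambda>n x. ln (f n x + \<delta>)"
  have pos: "f n x + \<delta> > 0" for n x using f0[of n x] \<delta> by linarith
  have cf: "continuous_on UNIV (f n)" for n
    using df by (meson continuous_at_imp_continuous_on has_derivative_continuous)
  have fm[measurable]: "f n \<in> borel_measurable borel" for n by (rule borel_measurable_continuous_onI[OF cf])
  have dL: "(?L n has_derivative (\<lambda>h. ((1 / (f n x + \<delta>)) *\<^sub>R g n x) \<bullet> h)) (at x)" for n x
  proof -
    have "((\<lambda>x. f n x + \<delta>) has_derivative (\<lambda>h. g n x \<bullet> h)) (at x)"
      using has_derivative_add[OF df has_derivative_const[of \<delta>]] by simp
    from has_derivative_ln[OF pos this] show ?thesis by (simp add: divide_inverse mult.commute)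
  qed
  have cL: "continuous_on UNIV (\<lambda>x. (1 / (f n x + \<delta>)) *\<^sub>R g n x)" for n
    using pos by (intro continuous_intros cf cg) (auto simp: less_imp_neq[THEN not_sym])
  have "AE x in lborel. (\<lambda>n. f n x) \<longlonglongrightarrow> v x \<and> (\<lambda>n. f n (x + z)) \<longlonglongrightarrow> v (x + z)"
    using lim AE_lborel_translate[OF lim, of z] by eventually_elim simp
  then have ae: "AE x in lborel. ennreal ((ln (v (x + z) + \<delta>) - ln (v x + \<delta>))\<^sup>2) = liminf (\<lambda>n. ennreal ((?L n (x + z) - ?L n x)\<^sup>2))"
  proof eventually_elim
    case (elim x)
    have p: "v y + \<delta> > 0" if "(\<lambda>n. f n y) \<longlonglongrightarrow> v y" for y
      using LIMSEQ_le_const[OF that, of 0] f0 \<delta> by (simp add: add_nonneg_pos)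
    have "(\<lambda>n. (?L n (x + z) - ?L n x)\<^sup>2) \<longlonglongrightarrow> (ln (v (x + z) + \<delta>) - ln (v x + \<delta>))\<^sup>2"
      using elim p[of x] p[of "x + z"] by (intro tendsto_intros) auto
    from lim_imp_Liminf[OF _ tendsto_ennrealI[OF this]] show ?case by simp
  qed
  have "(\<integral>\<^sup>+x. indicator ?D x * ennreal ((ln (v (x + z) + \<delta>) - ln (v x + \<delta>))\<^sup>2) \<partial>lborel)
      = (\<integral>\<^sup>+x. liminf (\<lambda>n. indicator ?D x * ennreal ((?L n (x + z) - ?L n x)\<^sup>2)) \<partial>lborel)"
    by (rule nn_integral_cong_AE, use ae in eventually_elim) (auto simp: indicator_def Liminf_const)
  also have "\<dots> \<le> liminf (\<lambda>n. \<integral>\<^sup>+x. indicator ?D x * ennreal ((?L n (x + z) - ?L n x)\<^sup>2) \<partial>lborel)"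
    by (rule nn_integral_liminf) measurable
  also have "\<dots> \<le> ennreal ((norm z)\<^sup>2) * ennreal C"
  proof (rule Liminf_le)
    show "\<forall>\<^sub>F n in sequentially. (\<integral>\<^sup>+x. indicator ?D x * ennreal ((?L n (x + z) - ?L n x)\<^sup>2) \<partial>lborel) \<le> ennreal ((norm z)\<^sup>2) * ennreal C"
      using bound[OF \<delta>]
    proof eventually_elim
      case (elim n)
      show ?case
        using order_trans[OF translation_estimate[OF dL[of n] cL[of n] S(1) Sb, of z] mult_left_mono[OF elim zero_le]] .
    qed
  qed simp
  finally show ?thesis .
qed

text \<open>Where v x = 0 < v (x + z), the logarithmic difference is unbounded as \<delta> tends to
  0, while the integral of its square stays below |z|^2 C. So such points form a null set.\<close>

lemma zero_positive_translate:
  "emeasure lborel {x. x \<in> S \<and> x + z \<in> S \<and> v x = 0 \<and> v (x + z) > 0} = 0"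
proof -
  let ?D = "{x. x \<in> S \<and> x + z \<in> S}" and ?E = "{x. x \<in> S \<and> x + z \<in> S \<and> v x = 0 \<and> v (x + z) > 0}"
  have Sb[measurable]: "S \<in> sets borel" using S(2) by auto
  have E[measurable]: "?E \<in> sets borel" by measurable
  have D[measurable]: "?D \<in> sets borel" by measurable
  define \<delta> :: "nat \<Rightarrow> real" where "\<delta> k = 1 / Suc k" for k
  have \<delta>: "\<delta> k > 0" for k by (simp add: \<delta>_def)
  let ?h = "\<lambda>k x. (ln (v (x + z) + \<delta> k) - ln (v x + \<delta> k))\<^sup>2"
  have top: "top * indicator ?E x \<le> liminf (\<lambda>k. indicator ?D x * ennreal (?h k x))" for x
  proof (cases "x \<in> ?E")
    case True
    define c where "c = v (x + z)"
    have c: "c > 0" using True by (simp add: c_def)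
    have "filterlim (\<lambda>k. ln c + ln (real (Suc k))) at_top sequentially"
      by (intro filterlim_tendsto_add_at_top[OF tendsto_const] filterlim_compose[OF ln_at_top]
          filterlim_compose[OF filterlim_real_sequentially] filterlim_Suc)
    moreover have "ln c + ln (real (Suc k)) \<le> ln (c + \<delta> k) - ln (0 + \<delta> k)" for k
    proof -
      have "ln c \<le> ln (c + \<delta> k)" using c \<delta>[of k] by simp
      moreover have "ln (\<delta> k) = - ln (real (Suc k))" unfolding \<delta>_def by (subst ln_div) auto
      ultimately show ?thesis by simp
    qed
    ultimately have l: "filterlim (\<lambda>k. ln (c + \<delta> k) - ln (0 + \<delta> k)) at_top sequentially"
      by (intro filterlim_at_top_mono[where g = "\<lambda>k. ln (c + \<delta> k) - ln (0 + \<delta> k)"]) auto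
    have "filterlim (\<lambda>k. ?h k x) at_top sequentially"
      using filterlim_at_top_mult_at_top[OF l l] True by (simp add: c_def power2_eq_square)
    then have "(\<lambda>k. ennreal (?h k x)) \<longlonglongrightarrow> top" by (simp add: ennreal_tendsto_top_eq_at_top)
    from lim_imp_Liminf[OF _ this] show ?thesis using True by simp
  qed simp
  have "top * emeasure lborel ?E = (\<integral>\<^sup>+x. top * indicator ?E x \<partial>lborel)"
    by (rule nn_integral_cmult_indicator[symmetric]) simp
  also have "\<dots> \<le> (\<integral>\<^sup>+x. liminf (\<lambda>k. indicator ?D x * ennreal (?h k x)) \<partial>lborel)"
    by (intro nn_integral_mono top)
  also have "\<dots> \<le> liminf (\<lambda>k. \<integral>\<^sup>+x. indicator ?D x * ennreal (?h k x) \<partial>lborel)"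
    by (rule nn_integral_liminf) measurable
  also have "\<dots> \<le> ennreal ((norm z)\<^sup>2) * ennreal C"
    by (rule Liminf_le) (auto intro!: always_eventually log_translate_bound \<delta>)
  also have "\<dots> < top" by (simp add: ennreal_mult_less_top)
  finally show ?thesis by (simp add: ennreal_mult_less_top)
qed

text \<open>Integrating \<open>zero_positive_translate\<close> over all z gives the product of the
  measures of the zero set and of the positive set in S. It is 0, so one of the two sets is
  null.\<close>

lemma zero_or_nonzero:
  "(AE x in lborel. x \<in> S \<longrightarrow> v x = 0) \<or> (AE x in lborel. x \<in> S \<longrightarrow> v x \<noteq> 0)"
proof -
  have Sb[measurable]: "S \<in> sets borel" using S(2) by auto
  define Z where "Z = {x. x \<in> S \<and> v x = 0}"
  define P where "P = {x. x \<in> S \<and> v x > 0}"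
  have [measurable]: "Z \<in> sets borel" "P \<in> sets borel" unfolding Z_def P_def by measurable
  have z: "(\<integral>\<^sup>+x. indicator Z x * indicator P (x + z) \<partial>lborel) = 0" for z
  proof -
    have "(\<integral>\<^sup>+x. indicator Z x * indicator P (x + z) \<partial>lborel)
        = (\<integral>\<^sup>+x. indicator {x. x \<in> S \<and> x + z \<in> S \<and> v x = 0 \<and> v (x + z) > 0} x \<partial>lborel)"
      by (intro nn_integral_cong) (auto simp: indicator_def Z_def P_def)
    also have "\<dots> = 0" using zero_positive_translate[of z] by (subst nn_integral_indicator) auto
    finally show ?thesis .
  qed
  have "emeasure lborel Z * emeasure lborel P = (\<integral>\<^sup>+x. indicator Z x * emeasure lborel P \<partial>lborel)"
    by (simp add: nn_integral_multc)
  also have "\<dots> = (\<integral>\<^sup>+x. (\<integral>\<^sup>+z. indicator Z x * indicator P (x + z) \<partial>lborel) \<partial>lborel)"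
  proof (rule nn_integral_cong)
    fix x
    have "(\<integral>\<^sup>+z. indicator P (z + x) \<partial>lborel) = (\<integral>\<^sup>+z. indicator P z \<partial>lborel)"
      by (rule nn_integral_lborel_translate) measurable
    then show "indicator Z x * emeasure lborel P = (\<integral>\<^sup>+z. indicator Z x * indicator P (x + z) \<partial>lborel)"
      by (simp add: nn_integral_cmult add.commute)
  qed
  also have "\<dots> = (\<integral>\<^sup>+z. (\<integral>\<^sup>+x. indicator Z x * indicator P (x + z) \<partial>lborel) \<partial>lborel)"
    by (rule lborel_pair.Fubini') measurable
  also have "\<dots> = 0" by (simp add: z)
  finally consider "emeasure lborel Z = 0" | "emeasure lborel P = 0" by auto
  then show ?thesis
  proof cases
    case 1
    then have "Z \<in> null_sets lborel" by auto
    then have "AE x in lborel. x \<notin> Z" by (rule AE_not_in)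
    then show ?thesis by (intro disjI2) (auto simp: Z_def elim!: eventually_mono)
  next
    case 2
    then have "P \<in> null_sets lborel" by auto
    then have "AE x in lborel. x \<notin> P" by (rule AE_not_in)
    moreover have "AE x in lborel. v x \<ge> 0"
      using lim by eventually_elim (rule LIMSEQ_le_const, auto simp: f0)
    ultimately have "AE x in lborel. x \<in> S \<longrightarrow> v x = 0"
      by eventually_elim (auto simp: P_def)
    then show ?thesis ..
  qed
qed

end

text \<open>This differentiates \<psi>^2/(f + \<delta>), the test function of the logarithmic
  estimate.\<close>

lemma has_derivative_square_quotient:
  fixes \<psi> f :: "'a::euclidean_space \<Rightarrow> real"
  assumes \<psi>: "(\<psi> has_derivative (\<lambda>h. p \<bullet> h)) (at x)" and f: "(f has_derivative (\<lambda>h. q \<bullet> h)) (at x)" and nz: "f x + \<delta> \<noteq> 0"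
  defines "i \<equiv> inverse (f x + \<delta>)"
  shows "((\<lambda>x. \<psi> x * (\<psi> x * inverse (f x + \<delta>))) has_derivative
    (\<lambda>h. ((2 * \<psi> x * i) *\<^sub>R p - ((\<psi> x)\<^sup>2 * i\<^sup>2) *\<^sub>R q) \<bullet> h)) (at x)"
proof -
  have "((\<lambda>x. f x + \<delta>) has_derivative (\<lambda>h. q \<bullet> h)) (at x)"
    using has_derivative_add[OF f has_derivative_const[of \<delta>]] by simp
  from has_derivative_mult[OF \<psi> has_derivative_mult[OF \<psi> Deriv.has_derivative_inverse[OF nz this]]]
  show ?thesis
    by (rule has_derivative_eq_rhs)
      (simp add: fun_eq_iff i_def inner_diff_left power2_eq_square algebra_simps)
qed

context eigen_domain
begin

text \<open>A Caccioppoli estimate for the logarithm: the equation for V is tested with \<psi>^2/(f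
  n + \<delta>), and its zero-order side is nonnegative because V is. Replacing V by the smooth
  \<open>f n\<close> costs an error that tends to 0 for fixed \<delta>, hence the bound holds only
  eventually in n; its constant does not depend on \<delta>.\<close>

lemma log_gradient_bound:
  assumes V: "V \<in> H10 \<Omega>" "Q V V = 0" "AE x in lebesgue. fst V x \<ge> 0"
    and f: "\<And>n. test_fun \<Omega> (f n)" "\<And>n x. f n x \<ge> 0" "(\<lambda>n. nH (el (f n) - V)) \<longlonglongrightarrow> 0"
    and ball: "cball a \<rho> \<subseteq> \<Omega>" "\<rho> > 0"
  shows "\<exists>C. \<forall>\<delta>>0. \<forall>\<^sub>F n in sequentially.
      (\<integral>\<^sup>+x. indicator (ball a (\<rho>/2)) x * ennreal ((norm ((1 / (f n x + \<delta>)) *\<^sub>R grad (f n) x))\<^sup>2) \<partial>lborel) \<le> ennreal C"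
proof -
  interpret a: psd_form "H10 \<Omega>" a1 by (rule a1_psd)
  obtain \<psi> where \<psi>: "test_fun \<Omega> \<psi>" and \<psi>pos: "\<And>x. x \<in> ball a \<rho> \<Longrightarrow> \<psi> x > 0"
    using cball_cutoff[OF ball(1) open_dom ball(2)] by blast
  have c\<psi>: "continuous_on UNIV \<psi>" by (rule test_fun_continuous[OF \<psi>])
  obtain y where y: "y \<in> cball a (\<rho>/2)" "\<And>x. x \<in> cball a (\<rho>/2) \<Longrightarrow> \<psi> y \<le> \<psi> x"
    using continuous_attains_inf[of "cball a (\<rho>/2)" \<psi>] ball(2) continuous_on_subset[OF c\<psi>] by auto
  define c where "c = \<psi> y"
  have c: "c > 0" unfolding c_def using y(1) ball(2) by (intro \<psi>pos) auto
  obtain B where B: "\<And>x. \<bar>\<psi> x\<bar> \<le> B" using test_fun_bounded[OF \<psi>] by blast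
  obtain K where K: "compact K" "\<And>x. x \<notin> K \<Longrightarrow> \<psi> x = 0"
    using test_fun_support_bounded[OF \<psi>] by metis
  define A where "A = a1 (el \<psi>) (el \<psi>)"
  have E: "el (f n) \<in> H10 \<Omega>" "el \<psi> \<in> H10 \<Omega>" for n
    by (rule el_in_H10[OF f(1)], rule el_in_H10[OF \<psi>])
  have al: "(\<lambda>n. a1 (el (f n) - V) (el (f n) - V)) \<longlonglongrightarrow> 0"
    by (rule tendsto_sandwich[OF _ _ tendsto_const f(3)]) (auto simp: nH_def)
  then have "(\<lambda>n. a1 (el (f n)) (el (f n))) \<longlonglongrightarrow> a1 V V"
    by (rule a.tendsto_B[OF E(1) V(1)])
  then have "Bseq (\<lambda>n. a1 (el (f n)) (el (f n)))"
    by (rule convergent_imp_Bseq[OF convergentI])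
  then obtain M where M': "\<forall>n. norm (a1 (el (f n)) (el (f n))) \<le> M" by (rule BseqE)
  have M: "a1 (el (f n)) (el (f n)) \<le> M" for n using M'[rule_format, of n] by simp
  \<comment> \<open>c is the minimum of \<psi> on the closed half ball, 4 A comes from the gradient
    of \<psi>, and the 1 absorbs the approximation error.\<close>
  define C where "C = (4 * A + 1) / c\<^sup>2"
  have "\<forall>\<^sub>F n in sequentially.
      (\<integral>\<^sup>+x. indicator (ball a (\<rho>/2)) x * ennreal ((norm ((1 / (f n x + \<delta>)) *\<^sub>R grad (f n) x))\<^sup>2) \<partial>lborel) \<le> ennreal C"
    if \<delta>: "\<delta> > 0" for \<delta>
  proof -
    have pos: "f n x + \<delta> > 0" for n x using f(2)[of n x] \<delta> by linarith
    then have nz: "f n x + \<delta> \<noteq> 0" for n x by (metis less_irrefl)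
    define i where "i n x = inverse (f n x + \<delta>)" for n x
    have i0: "i n x \<ge> 0" for n x unfolding i_def using pos[of n x] by simp
    have ile: "i n x \<le> 1 / \<delta>" for n x
      unfolding i_def using f(2)[of n x] \<delta> by (simp add: divide_inverse le_imp_inverse_le)
    have isq: "(i n x)\<^sup>2 \<le> 1 / \<delta>\<^sup>2" for n x
      using power_mono[OF ile i0, of n x 2] by (simp add: power_divide)
    define h where "h n x = \<psi> x * (\<psi> x * inverse (f n x + \<delta>))" for n x
    have sm: "Ck_on k UNIV (\<lambda>x. \<psi> x * inverse (f n x + \<delta>))" for k n
      by (intro Ck_mult Ck_inverse nz Ck_add Ck_const test_fun_smooth[OF \<psi>] test_fun_smooth[OF f(1)])
    have th: "test_fun \<Omega> (h n)" for n
      unfolding h_def by (rule test_fun_mult[OF \<psi> sm])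
    have gh: "grad (h n) x = (2 * \<psi> x * i n x) *\<^sub>R grad \<psi> x - ((\<psi> x)\<^sup>2 * (i n x)\<^sup>2) *\<^sub>R grad (f n) x" for n x
      unfolding h_def i_def
      by (rule grad_eqI, rule has_derivative_square_quotient[OF test_fun_has_grad[OF \<psi>] test_fun_has_grad[OF f(1)] nz])
    have Eh: "el (h n) \<in> H10 \<Omega>" for n by (rule el_in_H10[OF th])
    \<comment> \<open>A bound for the Dirichlet integral of the test functions. It blows up as
      \<delta> tends to 0, but for fixed \<delta> its root is multiplied by the root of a1 at f n -
      V, which tends to 0.\<close>
    define D where "D = 8 * B\<^sup>2 / \<delta>\<^sup>2 * A + 2 * B^4 / \<delta>^4 * M"
    have \<psi>2: "(\<psi> x)\<^sup>2 \<le> B\<^sup>2" for x using power_mono[OF B[of x], of 2] by simp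
    have sq: "(norm (v - w))\<^sup>2 \<le> 2 * (norm v)\<^sup>2 + 2 * (norm w)\<^sup>2" for v w :: 'a
    proof -
      have "0 \<le> (norm (v + w))\<^sup>2" by simp
      then show ?thesis by (simp add: power2_norm_eq_inner inner_add_left inner_add_right inner_diff_left inner_diff_right inner_commute)
    qed
    have ah: "a1 (el (h n)) (el (h n)) \<le> D" for n
    proof -
      have "a1 (el (h n)) (el (h n)) = (LINT x|lebesgue. (norm (grad (h n) x))\<^sup>2)"
        by (simp add: a1_def el_def power2_norm_eq_inner)
      also have "\<dots> \<le> (LINT x|lebesgue. 8 * B\<^sup>2 / \<delta>\<^sup>2 * (norm (grad \<psi> x))\<^sup>2 + 2 * B^4 / \<delta>^4 * (norm (grad (f n) x))\<^sup>2)"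
      proof (rule integral_mono)
        show "integrable lebesgue (\<lambda>x. (norm (grad (h n) x))\<^sup>2)"
          using L2p_square_integrable(2)[OF el_L2p[OF th[of n]]] by (simp add: el_def)
        show "integrable lebesgue (\<lambda>x. 8 * B\<^sup>2 / \<delta>\<^sup>2 * (norm (grad \<psi> x))\<^sup>2 + 2 * B^4 / \<delta>^4 * (norm (grad (f n) x))\<^sup>2)"
          using L2p_square_integrable(2)[OF el_L2p[OF \<psi>]] L2p_square_integrable(2)[OF el_L2p[OF f(1)[of n]]]
          by (simp add: el_def)
        fix x
        have "(norm (grad (h n) x))\<^sup>2 \<le> 2 * (norm ((2 * \<psi> x * i n x) *\<^sub>R grad \<psi> x))\<^sup>2 + 2 * (norm (((\<psi> x)\<^sup>2 * (i n x)\<^sup>2) *\<^sub>R grad (f n) x))\<^sup>2"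
          unfolding gh by (rule sq)
        also have "\<dots> = 8 * ((\<psi> x)\<^sup>2 * (i n x)\<^sup>2) * (norm (grad \<psi> x))\<^sup>2 + 2 * ((\<psi> x)\<^sup>2 * (i n x)\<^sup>2)\<^sup>2 * (norm (grad (f n) x))\<^sup>2"
          by (simp add: power_mult_distrib)
        also have "\<dots> \<le> 8 * (B\<^sup>2 * (1 / \<delta>\<^sup>2)) * (norm (grad \<psi> x))\<^sup>2 + 2 * (B\<^sup>2 * (1 / \<delta>\<^sup>2))\<^sup>2 * (norm (grad (f n) x))\<^sup>2"
          by (intro add_mono mult_right_mono mult_left_mono power_mono mult_mono \<psi>2 isq) auto
        also have "\<dots> = 8 * B\<^sup>2 / \<delta>\<^sup>2 * (norm (grad \<psi> x))\<^sup>2 + 2 * B^4 / \<delta>^4 * (norm (grad (f n) x))\<^sup>2"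
          by (simp add: power_divide power_mult_distrib flip: power_mult)
        finally show "(norm (grad (h n) x))\<^sup>2 \<le> \<dots>" .
      qed
      also have "\<dots> = 8 * B\<^sup>2 / \<delta>\<^sup>2 * A + 2 * B^4 / \<delta>^4 * a1 (el (f n)) (el (f n))"
        using L2p_square_integrable(2)[OF el_L2p[OF \<psi>]] L2p_square_integrable(2)[OF el_L2p[OF f(1)[of n]]]
        by (simp add: el_def A_def a1_def power2_norm_eq_inner)
      also have "\<dots> \<le> D" unfolding D_def by (intro add_mono mult_left_mono M) auto
      finally show ?thesis .
    qed
    define J where "J n = (LINT x|lebesgue. (\<psi> x)\<^sup>2 * (i n x)\<^sup>2 * (norm (grad (f n) x))\<^sup>2)" for n
    have ci: "continuous_on UNIV (i n)" for n
      unfolding i_def using nz by (intro continuous_intros test_fun_continuous[OF f(1)]) auto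
    have iJ: "integrable lebesgue (\<lambda>x. (\<psi> x)\<^sup>2 * (i n x)\<^sup>2 * (norm (grad (f n) x))\<^sup>2)" for n
      by (rule integrable_compact_support[OF _ K(1)])
        (use K(2) in \<open>auto intro!: continuous_intros c\<psi> ci test_fun_continuous_grad[OF f(1)]\<close>)
    have J0: "J n \<le> 4 * A + 2 * (sqrt (a1 (el (f n) - V) (el (f n) - V)) * sqrt D)" for n
    proof -
      have "0 \<le> lam * b0 V (el (h n))"
      proof (intro mult_nonneg_nonneg lam_nonneg)
        show "0 \<le> b0 V (el (h n))"
          unfolding b0_def
        proof (rule integral_nonneg_AE, use V(3) in eventually_elim)
          case (elim x)
          have "h n x = (\<psi> x)\<^sup>2 * i n x" by (simp add: h_def i_def power2_eq_square)
          then show ?case using elim i0[of n x] by (simp add: el_def)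
        qed
      qed
      also have "lam * b0 V (el (h n)) = a1 V (el (h n))"
        using Q.null[OF V(1) Eh V(2), of n] by (simp add: Q_def)
      also have "\<dots> = a1 (el (f n)) (el (h n)) - a1 (el (f n) - V) (el (h n))"
        using a.add_left[of "el (f n) - V" V "el (h n)"] E Eh V(1) a.mem by simp
      finally have 1: "a1 (el (f n) - V) (el (h n)) \<le> a1 (el (f n)) (el (h n))" by simp
      have "\<bar>a1 (el (f n) - V) (el (h n))\<bar> \<le> sqrt (a1 (el (f n) - V) (el (f n) - V)) * sqrt (a1 (el (h n)) (el (h n)))"
        by (rule a.abs_le) (auto intro: a.mem E Eh V(1))
      also have "\<dots> \<le> sqrt (a1 (el (f n) - V) (el (f n) - V)) * sqrt D"
        by (intro mult_left_mono real_sqrt_le_mono ah) auto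
      finally have 2: "- (sqrt (a1 (el (f n) - V) (el (f n) - V)) * sqrt D) \<le> a1 (el (f n) - V) (el (h n))"
        by (simp add: abs_le_iff)
      have "a1 (el (f n)) (el (h n)) \<le> (LINT x|lebesgue. 2 * (norm (grad \<psi> x))\<^sup>2 - 1/2 * ((\<psi> x)\<^sup>2 * (i n x)\<^sup>2 * (norm (grad (f n) x))\<^sup>2))"
        unfolding a1_def
      proof (rule integral_mono)
        show "integrable lebesgue (\<lambda>x. snd (el (f n)) x \<bullet> snd (el (h n)) x)"
          by (rule L2p_integrable(2)[OF H10_L2p[OF E(1)] H10_L2p[OF Eh]])
        show "integrable lebesgue (\<lambda>x. 2 * (norm (grad \<psi> x))\<^sup>2 - 1/2 * ((\<psi> x)\<^sup>2 * (i n x)\<^sup>2 * (norm (grad (f n) x))\<^sup>2))"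
          using L2p_square_integrable(2)[OF el_L2p[OF \<psi>]] iJ[of n]
          by (intro Bochner_Integration.integrable_diff integrable_mult_right) (simp_all add: el_def)
        fix x
        define p where "p = grad \<psi> x"
        define q where "q = i n x *\<^sub>R grad (f n) x"
        \<comment> \<open>Completing the square absorbs the mixed term; half of the quadratic term
          in q survives.\<close>
        have "0 \<le> (norm (2 *\<^sub>R p - \<psi> x *\<^sub>R q))\<^sup>2" by simp
        also have "\<dots> = 4 * (norm p)\<^sup>2 - 4 * (\<psi> x * (p \<bullet> q)) + (\<psi> x)\<^sup>2 * (norm q)\<^sup>2"
          unfolding power2_norm_eq_inner
          by (simp add: inner_diff_left inner_diff_right inner_commute power2_eq_square algebra_simps)
        finally have le: "2 * \<psi> x * (p \<bullet> q) - (\<psi> x)\<^sup>2 * (norm q)\<^sup>2 \<le> 2 * (norm p)\<^sup>2 - 1/2 * ((\<psi> x)\<^sup>2 * (norm q)\<^sup>2)"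
          by simp
        have "grad (f n) x \<bullet> grad (h n) x = 2 * \<psi> x * (p \<bullet> q) - (\<psi> x)\<^sup>2 * (norm q)\<^sup>2"
          unfolding gh p_def q_def power2_norm_eq_inner
          by (simp add: inner_diff_right inner_commute power2_eq_square algebra_simps)
        moreover have "(norm q)\<^sup>2 = (i n x)\<^sup>2 * (norm (grad (f n) x))\<^sup>2" by (simp add: q_def power_mult_distrib)
        ultimately show "snd (el (f n)) x \<bullet> snd (el (h n)) x \<le> 2 * (norm (grad \<psi> x))\<^sup>2 - 1/2 * ((\<psi> x)\<^sup>2 * (i n x)\<^sup>2 * (norm (grad (f n) x))\<^sup>2)"
          using le by (simp add: el_def p_def mult.assoc)
      qed
      also have "\<dots> = 2 * A - 1/2 * J n"
        using L2p_square_integrable(2)[OF el_L2p[OF \<psi>]] iJ[of n]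
        by (simp add: el_def A_def a1_def J_def power2_norm_eq_inner)
      finally have 3: "a1 (el (f n)) (el (h n)) \<le> 2 * A - 1/2 * J n" .
      have "- s \<le> t \<Longrightarrow> t \<le> u \<Longrightarrow> u \<le> 2 * A - 1/2 * j \<Longrightarrow> j \<le> 4 * A + 2 * s" for s t u j :: real by linarith
      from this[OF 2 1 3] show ?thesis .
    qed
    have "(\<lambda>n. 2 * (sqrt (a1 (el (f n) - V) (el (f n) - V)) * sqrt D)) \<longlonglongrightarrow> 2 * (sqrt 0 * sqrt D)"
      by (intro tendsto_intros al)
    from order_tendstoD(2)[OF this, of 1]
    have "\<forall>\<^sub>F n in sequentially. 2 * (sqrt (a1 (el (f n) - V) (el (f n) - V)) * sqrt D) < 1"
      by simp
    then show ?thesis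
    proof eventually_elim
      case (elim n)
      have "j \<le> 4 * A + x \<Longrightarrow> x < 1 \<Longrightarrow> j \<le> 4 * A + 1" for j x by simp
      from this[OF J0[of n] elim] have Jn: "J n \<le> 4 * A + 1" .
      have "(\<integral>\<^sup>+x. indicator (ball a (\<rho>/2)) x * ennreal ((norm ((1 / (f n x + \<delta>)) *\<^sub>R grad (f n) x))\<^sup>2) \<partial>lborel)
          \<le> (\<integral>\<^sup>+x. ennreal (1 / c\<^sup>2 * ((\<psi> x)\<^sup>2 * (i n x)\<^sup>2 * (norm (grad (f n) x))\<^sup>2)) \<partial>lborel)"
      proof (rule nn_integral_mono)
        fix x
        show "indicator (ball a (\<rho>/2)) x * ennreal ((norm ((1 / (f n x + \<delta>)) *\<^sub>R grad (f n) x))\<^sup>2)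
          \<le> ennreal (1 / c\<^sup>2 * ((\<psi> x)\<^sup>2 * (i n x)\<^sup>2 * (norm (grad (f n) x))\<^sup>2))"
        proof (cases "x \<in> ball a (\<rho>/2)")
          case True
          then have "c \<le> \<psi> x" unfolding c_def by (intro y(2)) auto
          then have "1 \<le> 1 / c\<^sup>2 * (\<psi> x)\<^sup>2" using c by (simp add: power_mono)
          then have "1 * ((i n x)\<^sup>2 * (norm (grad (f n) x))\<^sup>2) \<le> 1 / c\<^sup>2 * (\<psi> x)\<^sup>2 * ((i n x)\<^sup>2 * (norm (grad (f n) x))\<^sup>2)"
            by (intro mult_right_mono) auto
          moreover have "(norm ((1 / (f n x + \<delta>)) *\<^sub>R grad (f n) x))\<^sup>2 = (i n x)\<^sup>2 * (norm (grad (f n) x))\<^sup>2"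
            by (simp add: i_def power_mult_distrib power_divide divide_inverse power_inverse)
          ultimately show ?thesis using True by (auto intro!: ennreal_leI simp: mult.assoc)
        qed simp
      qed
      also have "\<dots> = ennreal (1 / c\<^sup>2 * J n)"
        using nn_integral_eq_integral[OF integrable_mult_right[OF iJ[of n], of "1 / c\<^sup>2"]]
        by (simp add: nn_integral_completion J_def)
      also have "\<dots> \<le> ennreal C"
        unfolding C_def using Jn c by (intro ennreal_leI) (simp add: divide_right_mono)
      finally show ?case .
    qed
  qed
  then show ?thesis by blast
qed

text \<open>The dichotomy is proved for a Borel version v of the modulus, which is the limit of
  nonnegative test functions, and transferred back because v and U have almost the same zero
  set.\<close>

lemma strong_max_ball:
  assumes U: "U \<in> H10 \<Omega>" "Q U U = 0" and ball: "cball a \<rho> \<subseteq> \<Omega>" "\<rho> > 0"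
  shows "(AE x in lebesgue. x \<in> ball a (\<rho>/2) \<longrightarrow> fst U x = 0) \<or> (AE x in lebesgue. x \<in> ball a (\<rho>/2) \<longrightarrow> fst U x \<noteq> 0)"
proof -
  obtain V f where V: "V \<in> H10 \<Omega>" "Q V V = 0" "AE x in lebesgue. fst V x = \<bar>fst U x\<bar>"
    and f: "\<And>n::nat. test_fun \<Omega> (f n)" "\<And>n x. f n x \<ge> 0" "(\<lambda>n. nH (el (f n) - V)) \<longlonglongrightarrow> 0"
    using eigen_abs[OF U] by blast
  have V0: "AE x in lebesgue. fst V x \<ge> 0" using V(3) by eventually_elim simp
  obtain v where v: "v \<in> borel_measurable lborel" "AE x in lborel. fst V x = v x"
    using completion_ex_borel_measurable_real[OF L2p_measurable(1)[OF H10_L2p[OF V(1)]]] by blast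
  have lim: "(\<lambda>n. \<integral>\<^sup>+x. ennreal ((norm (f n x - fst V x))\<^sup>2) \<partial>lebesgue) \<longlonglongrightarrow> 0"
  proof (rule tendsto_0_le_ennreal)
    show "(\<integral>\<^sup>+x. ennreal ((norm (f n x - fst V x))\<^sup>2) \<partial>lebesgue) \<le> ennreal (nH (el (f n) - V))" for n
      unfolding nsq_eq_nH[OF L2p_diff[OF el_L2p[OF f(1)] H10_L2p[OF V(1)]], symmetric] nsq_def
      by (intro nn_integral_mono ennreal_leI) (simp add: el_def)
    show "(\<lambda>n. ennreal (nH (el (f n) - V))) \<longlonglongrightarrow> 0" using tendsto_ennrealI[OF f(3)] by simp
  qed
  have fm: "f n \<in> borel_measurable lebesgue" for n using el_measurable(1)[OF f(1)[of n]] by (simp add: el_def)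
  obtain r :: "nat \<Rightarrow> nat" where r: "strict_mono r" "AE x in lebesgue. (\<lambda>n. f (r n) x) \<longlonglongrightarrow> fst V x"
    using L2_AE_subseq[of f lebesgue "fst V", OF fm L2p_measurable(1)[OF H10_L2p[OF V(1)]] lim] by blast
  have "AE x in lborel. (\<lambda>n. f (r n) x) \<longlonglongrightarrow> fst V x" using r(2) by (simp add: AE_completion_iff)
  then have r': "AE x in lborel. (\<lambda>n. f (r n) x) \<longlonglongrightarrow> v x" using v(2) by eventually_elim simp
  have fr: "(\<lambda>n. nH (el (f (r n)) - V)) \<longlonglongrightarrow> 0"
    using LIMSEQ_subseq_LIMSEQ[OF f(3) r(1)] by (simp add: o_def)
  obtain C where C: "\<And>\<delta>. \<delta> > 0 \<Longrightarrow> \<forall>\<^sub>F n in sequentially.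
      (\<integral>\<^sup>+x. indicator (ball a (\<rho>/2)) x * ennreal ((norm ((1 / (f (r n) x + \<delta>)) *\<^sub>R grad (f (r n)) x))\<^sup>2) \<partial>lborel) \<le> ennreal C"
    using log_gradient_bound[where f = "\<lambda>n. f (r n)", OF V(1,2) V0 f(1) f(2) fr ball] by blast
  have z: "(AE x in lborel. x \<in> ball a (\<rho>/2) \<longrightarrow> v x = 0) \<or> (AE x in lborel. x \<in> ball a (\<rho>/2) \<longrightarrow> v x \<noteq> 0)"
    by (rule zero_or_nonzero[where f = "\<lambda>n. f (r n)" and g = "\<lambda>n. grad (f (r n))",
          OF convex_ball open_ball f(2) test_fun_has_grad[OF f(1)] test_fun_continuous_grad[OF f(1)] _ r' C])
      (use v(1) in auto)
  have eq: "AE x in lborel. (v x = 0) = (fst U x = 0)"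
  proof -
    have "AE x in lborel. fst V x = \<bar>fst U x\<bar>" using V(3) by (simp add: AE_completion_iff)
    then show ?thesis using v(2) by eventually_elim auto
  qed
  have "(AE x in lborel. x \<in> ball a (\<rho>/2) \<longrightarrow> fst U x = 0)" if "AE x in lborel. x \<in> ball a (\<rho>/2) \<longrightarrow> v x = 0"
    using that eq by eventually_elim simp
  moreover have "(AE x in lborel. x \<in> ball a (\<rho>/2) \<longrightarrow> fst U x \<noteq> 0)" if "AE x in lborel. x \<in> ball a (\<rho>/2) \<longrightarrow> v x \<noteq> 0"
    using that eq by eventually_elim simp
  ultimately show ?thesis
    unfolding AE_completion_iff using z by blast
qed

section \<open>Globalisation on a connected domain: sign and simplicity\<close>

lemma AE_locally:
  assumes "\<And>x. x \<in> \<Omega> \<Longrightarrow> \<exists>e>0. AE y in lebesgue. y \<in> ball x e \<longrightarrow> P y"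
  shows "AE y in lebesgue. y \<in> \<Omega> \<longrightarrow> P y"
proof -
  obtain e where e: "\<And>x. x \<in> \<Omega> \<Longrightarrow> e x > 0" "\<And>x. x \<in> \<Omega> \<Longrightarrow> AE y in lebesgue. y \<in> ball x (e x) \<longrightarrow> P y"
    using assms by metis
  obtain F where F: "F \<subseteq> (\<lambda>x. ball x (e x)) ` \<Omega>" "countable F" "\<Union>F = \<Union>((\<lambda>x. ball x (e x)) ` \<Omega>)"
    using Lindelof[of "(\<lambda>x. ball x (e x)) ` \<Omega>"] by blast
  have "AE y in lebesgue. \<forall>B\<in>F. y \<in> B \<longrightarrow> P y"
    unfolding AE_ball_countable[OF F(2)] using F(1) e(2) by blast
  then show ?thesis
  proof eventually_elim
    case (elim y)
    show ?case
    proof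
      assume "y \<in> \<Omega>"
      then have "y \<in> \<Union>F" unfolding F(3) using e(1) by force
      then show "P y" using elim by blast
    qed
  qed
qed

lemma not_AE_ball_False:
  assumes "e > 0" shows "\<not> (AE y in lebesgue. y \<notin> ball (x::'a) e)"
proof
  assume "AE y in lebesgue. y \<notin> ball x e"
  then have "AE y in lborel. y \<notin> ball x e" by (simp add: AE_completion_iff)
  then have "ball x e \<in> null_sets lborel" by (simp add: AE_iff_null_sets)
  then have "measure lborel (ball x e) = 0" by (simp add: measure_eq_0_null_sets)
  then show False using content_ball_pos[OF assms, of x] by simp
qed

text \<open>Points near which U vanishes almost everywhere, and points near which it is almost
  everywhere nonzero, form two disjoint open sets that cover \<Omega>; connectedness leaves only one
  of them.\<close>

lemma strong_max:
  assumes U: "U \<in> H10 \<Omega>" "Q U U = 0"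
  shows "(AE x in lebesgue. x \<in> \<Omega> \<longrightarrow> fst U x = 0) \<or> (AE x in lebesgue. x \<in> \<Omega> \<longrightarrow> fst U x \<noteq> 0)"
proof -
  define A where "A T = {x\<in>\<Omega>. \<exists>e>0. ball x e \<subseteq> \<Omega> \<and> (AE y in lebesgue. y \<in> ball x e \<longrightarrow> (fst U y = 0) = T)}" for T
  have AD: "\<exists>e. e > 0 \<and> ball x e \<subseteq> \<Omega> \<and> (AE y in lebesgue. y \<in> ball x e \<longrightarrow> (fst U y = 0) = T)" if "x \<in> A T" for x T
    using that unfolding A_def by (elim CollectE conjE)
  have cov: "\<Omega> \<subseteq> A True \<union> A False"
  proof
    fix x assume x: "x \<in> \<Omega>"
    obtain \<rho> where \<rho>: "\<rho> > 0" "cball x \<rho> \<subseteq> \<Omega>" using open_contains_cball open_dom x by blast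
    have sub: "ball x (\<rho>/2) \<subseteq> \<Omega>" using \<rho> by (auto simp: subset_iff)
    have h: "\<rho> / 2 > 0" using \<rho> by simp
    show "x \<in> A True \<union> A False"
      using strong_max_ball[OF U \<rho>(2,1)]
    proof
      assume "AE y in lebesgue. y \<in> ball x (\<rho>/2) \<longrightarrow> fst U y = 0"
      then have "x \<in> A True" unfolding A_def using x sub h by (intro CollectI conjI exI[of _ "\<rho>/2"]) simp_all
      then show ?thesis ..
    next
      assume "AE y in lebesgue. y \<in> ball x (\<rho>/2) \<longrightarrow> fst U y \<noteq> 0"
      then have "x \<in> A False" unfolding A_def using x sub h by (intro CollectI conjI exI[of _ "\<rho>/2"]) simp_all
      then show ?thesis ..
    qed
  qed
  have op: "open (A T)" for T
    unfolding open_contains_ball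
  proof
    fix x assume "x \<in> A T"
    from AD[OF this] obtain e where e: "e > 0" "ball x e \<subseteq> \<Omega>" "AE y in lebesgue. y \<in> ball x e \<longrightarrow> (fst U y = 0) = T"
      by (elim exE conjE)
    have "ball x (e/2) \<subseteq> A T"
    proof
      fix y assume y: "y \<in> ball x (e/2)"
      have sub: "ball y (e/2) \<subseteq> ball x e"
      proof
        fix w assume "w \<in> ball y (e/2)"
        then show "w \<in> ball x e" using y dist_triangle[of x w y] by simp
      qed
      have "AE w in lebesgue. w \<in> ball y (e/2) \<longrightarrow> (fst U w = 0) = T"
        using e(3) by eventually_elim (use sub in blast)
      moreover have "y \<in> \<Omega>" using y e(1,2) by (auto simp: subset_iff)
      moreover have "ball y (e/2) \<subseteq> \<Omega>" using sub e(2) by (rule order_trans)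
      moreover have "0 < e/2" using e(1) by simp
      ultimately show "y \<in> A T" unfolding A_def by (intro CollectI conjI exI[of _ "e/2"])
    qed
    moreover have "0 < e/2" using e(1) by simp
    ultimately show "\<exists>e>0. ball x e \<subseteq> A T" by (intro exI[of _ "e/2"] conjI)
  qed
  have dis: "A True \<inter> A False = {}"
  proof (rule ccontr)
    assume "A True \<inter> A False \<noteq> {}"
    then obtain x where x: "x \<in> A True" "x \<in> A False" by blast
    from AD[OF x(1)] obtain e where e: "e > 0" "AE y in lebesgue. y \<in> ball x e \<longrightarrow> (fst U y = 0) = True"
      by (elim exE conjE)
    from AD[OF x(2)] obtain d where d: "d > 0" "AE y in lebesgue. y \<in> ball x d \<longrightarrow> (fst U y = 0) = False"
      by (elim exE conjE)
    have "AE y in lebesgue. y \<notin> ball x (min e d)"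
      using e(2) d(2) by eventually_elim auto
    then show False using not_AE_ball_False[of "min e d" x] e(1) d(1) by simp
  qed
  have "A True \<inter> \<Omega> = {} \<or> A False \<inter> \<Omega> = {}"
    using connectedD[OF conn op[of True] op[of False]] cov dis by blast
  then consider "\<Omega> \<subseteq> A True" | "\<Omega> \<subseteq> A False" using cov by blast
  then show ?thesis
  proof cases
    case 1
    have "AE y in lebesgue. y \<in> \<Omega> \<longrightarrow> (fst U y = 0) = True"
    proof (rule AE_locally)
      fix x assume "x \<in> \<Omega>"
      then have "x \<in> A True" using 1 by (rule subsetD[rotated])
      from AD[OF this] show "\<exists>e>0. AE y in lebesgue. y \<in> ball x e \<longrightarrow> (fst U y = 0) = True"
        by (elim exE conjE) (intro exI conjI)
    qed
    then show ?thesis by simp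
  next
    case 2
    have "AE y in lebesgue. y \<in> \<Omega> \<longrightarrow> (fst U y = 0) = False"
    proof (rule AE_locally)
      fix x assume "x \<in> \<Omega>"
      then have "x \<in> A False" using 2 by (rule subsetD[rotated])
      from AD[OF this] show "\<exists>e>0. AE y in lebesgue. y \<in> ball x e \<longrightarrow> (fst U y = 0) = False"
        by (elim exE conjE) (intro exI conjI)
    qed
    then show ?thesis by simp
  qed
qed

text \<open>U and U + |U| are both null for \<open>Q\<close>, and the latter is twice the positive
  part. The strong maximum principle for each of them leaves three cases.\<close>

lemma eigen_sign:
  assumes U: "U \<in> H10 \<Omega>" "Q U U = 0"
  shows "(AE x in lebesgue. x \<in> \<Omega> \<longrightarrow> fst U x = 0) \<or> (AE x in lebesgue. x \<in> \<Omega> \<longrightarrow> fst U x > 0)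
    \<or> (AE x in lebesgue. x \<in> \<Omega> \<longrightarrow> fst U x < 0)"
proof -
  obtain V where V: "V \<in> H10 \<Omega>" "Q V V = 0" "AE x in lebesgue. fst V x = \<bar>fst U x\<bar>"
    using eigen_abs[OF U] by blast
  have W: "U + V \<in> H10 \<Omega>" by (rule H10_mem(1)[OF U(1) V(1)])
  have "Q (U + V) (U + V) = 0"
    using Q.expand_add[OF U(1) V(1)] Q.null[OF U(1) V(1) U(2)] U(2) V(2) by simp
  from strong_max[OF W this] strong_max[OF U]
  consider "AE x in lebesgue. x \<in> \<Omega> \<longrightarrow> fst U x = 0"
    | "AE x in lebesgue. x \<in> \<Omega> \<longrightarrow> fst U x \<noteq> 0" "AE x in lebesgue. x \<in> \<Omega> \<longrightarrow> fst (U + V) x = 0"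
    | "AE x in lebesgue. x \<in> \<Omega> \<longrightarrow> fst (U + V) x \<noteq> 0" by blast
  then show ?thesis
  proof cases
    case 2
    have "AE x in lebesgue. x \<in> \<Omega> \<longrightarrow> fst U x < 0"
      using 2 V(3) by eventually_elim (auto simp: abs_if split: if_splits)
    then show ?thesis by blast
  next
    case 3
    have "AE x in lebesgue. x \<in> \<Omega> \<longrightarrow> fst U x > 0"
      using 3 V(3) by eventually_elim (auto simp: abs_if split: if_splits)
    then show ?thesis by blast
  qed blast
qed

lemma phi_nonzero: "AE x in lebesgue. x \<in> \<Omega> \<longrightarrow> fst \<phi>1 x \<noteq> 0"
proof -
  have "\<not> (AE x in lebesgue. x \<in> \<Omega> \<longrightarrow> fst \<phi>1 x = 0)"
    using pe unfolding principal_eigen_def dirichlet_eigen_def by blast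
  then show ?thesis using strong_max[OF phi(1) phi(3)[OF phi(1)]] by blast
qed

lemma eigen_integrable:
  assumes "U \<in> H10 \<Omega>" shows "integrable lebesgue (fst U)"
proof (rule Bochner_Integration.integrable_bound)
  show "integrable lebesgue (\<lambda>x. 1 * indicator \<Omega> x + (fst U x)\<^sup>2)"
    by (intro Bochner_Integration.integrable_add integrable_const_dom L2p_square_integrable(1) H10_L2p[OF assms])
  show "AE x in lebesgue. norm (fst U x) \<le> norm (1 * indicator \<Omega> x + (fst U x)\<^sup>2)"
    using H10_outside[OF assms]
  proof eventually_elim
    case (elim x)
    have "\<bar>t\<bar> \<le> 1 + t\<^sup>2" for t :: real
      using sum_squares_bound[of 1 "\<bar>t\<bar>"] by simp
    from this[of "fst U x"] show ?case using elim by (cases "x \<in> \<Omega>") auto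
  qed
qed (rule L2p_measurable(1)[OF H10_L2p[OF assms]])

text \<open>Subtract the multiple of the eigenfunction with the same integral: the rest has constant
  sign and zero integral, so it vanishes. Its gradient then vanishes too, because \<open>Q\<close>
  and \<open>b0\<close> are both 0 on it.\<close>

lemma eigen_simple:
  assumes U: "U \<in> H10 \<Omega>" "Q U U = 0"
  shows "\<exists>t. AE x in lebesgue. fst U x = t * fst \<phi>1 x \<and> snd U x = t *\<^sub>R snd \<phi>1 x"
proof -
  have zero: "AE x in lebesgue. fst W x = 0"
    if W: "W \<in> H10 \<Omega>" "Q W W = 0" and i0: "(LINT x|lebesgue. fst W x) = 0" for W
  proof -
    note i = eigen_integrable[OF W(1)] and o = H10_outside[OF W(1)]
    have pos: "AE x in lebesgue. fst W x = 0" if "AE x in lebesgue. x \<in> \<Omega> \<longrightarrow> s * fst W x > 0" for s :: real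
    proof -
      have "AE x in lebesgue. 0 \<le> s * fst W x" using that o by eventually_elim force
      moreover have "(LINT x|lebesgue. s * fst W x) = 0" using i0 by simp
      ultimately have "AE x in lebesgue. s * fst W x = 0"
        using integral_nonneg_eq_0_iff_AE[of lebesgue "\<lambda>x. s * fst W x"] i by auto
      then show ?thesis using that o by eventually_elim force
    qed
    show ?thesis
      using eigen_sign[OF W]
    proof (elim disjE)
      assume "AE x in lebesgue. x \<in> \<Omega> \<longrightarrow> fst W x = 0"
      then show ?thesis using o by eventually_elim blast
    next
      assume "AE x in lebesgue. x \<in> \<Omega> \<longrightarrow> fst W x > 0"
      then show ?thesis using pos[of 1] by simp
    next
      assume "AE x in lebesgue. x \<in> \<Omega> \<longrightarrow> fst W x < 0"
      then show ?thesis using pos[of "-1"] by simp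
    qed
  qed
  have p0: "(LINT x|lebesgue. fst \<phi>1 x) \<noteq> 0"
  proof
    assume "(LINT x|lebesgue. fst \<phi>1 x) = 0"
    from zero[OF phi(1) phi(3)[OF phi(1)] this] have "AE x in lebesgue. fst \<phi>1 x * fst \<phi>1 x = 0"
      by eventually_elim simp
    then have "b0 \<phi>1 \<phi>1 = 0" unfolding b0_def by (rule integral_eq_zero_AE)
    then show False using phi(2) by simp
  qed
  define t where "t = (LINT x|lebesgue. fst U x) / (LINT x|lebesgue. fst \<phi>1 x)"
  define W where "W = U + (- t) *\<^sub>R \<phi>1"
  have W: "W \<in> H10 \<Omega>" unfolding W_def by (intro H10_mem U(1) phi(1))
  have QW: "Q W W = 0"
    unfolding W_def using Q.expand[OF U(1) phi(1), of "-t"] Q.null[OF U(1) phi(1) U(2)] U(2) phi(3)[OF phi(1)] by simp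
  have "(LINT x|lebesgue. fst W x) = 0"
    using eigen_integrable[OF U(1)] eigen_integrable[OF phi(1)] p0 by (simp add: W_def t_def)
  from zero[OF W QW this] have w0: "AE x in lebesgue. fst W x = 0" .
  then have "AE x in lebesgue. fst W x * fst W x = 0" by eventually_elim simp
  then have "b0 W W = 0" unfolding b0_def by (rule integral_eq_zero_AE)
  then have "a1 W W = 0" using QW by (simp add: Q_def)
  then have "(LINT x|lebesgue. (norm (snd W x))\<^sup>2) = 0" by (simp add: a1_def power2_norm_eq_inner)
  then have "AE x in lebesgue. (norm (snd W x))\<^sup>2 = 0"
    using integral_nonneg_eq_0_iff_AE[OF L2p_square_integrable(2)[OF H10_L2p[OF W]]] by auto
  then have "AE x in lebesgue. fst U x = t * fst \<phi>1 x \<and> snd U x = t *\<^sub>R snd \<phi>1 x"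
    using w0 by eventually_elim (simp add: W_def)
  then show ?thesis ..
qed

end

section \<open>The scalar minimisation problem\<close>

lemma L4_integrable4:
  assumes "L4 a" "L4 b" "L4 c" "L4 d"
  shows "integrable lebesgue (\<lambda>x. a x * b x * c x * d x)"
proof -
  have [measurable]: "a \<in> borel_measurable lebesgue" "b \<in> borel_measurable lebesgue"
    "c \<in> borel_measurable lebesgue" "d \<in> borel_measurable lebesgue"
    using assms by auto
  have pr: "\<bar>s * t\<bar> \<le> s\<^sup>2 + t\<^sup>2" for s t :: real
  proof -
    have "2 * \<bar>s * t\<bar> \<le> s\<^sup>2 + t\<^sup>2"
      using sum_squares_bound[of "\<bar>s\<bar>" "\<bar>t\<bar>"] by (simp add: abs_mult)
    then show ?thesis using abs_ge_zero[of "s * t"] by linarith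
  qed
  have le: "\<bar>p * q * r * s\<bar> \<le> p^4 + q^4 + r^4 + s^4" for p q r s :: real
  proof -
    have "\<bar>(p * q) * (r * s)\<bar> \<le> (p * q)\<^sup>2 + (r * s)\<^sup>2" by (rule pr)
    also have "\<dots> \<le> (p\<^sup>2)\<^sup>2 + (q\<^sup>2)\<^sup>2 + ((r\<^sup>2)\<^sup>2 + (s\<^sup>2)\<^sup>2)"
      using pr[of "p\<^sup>2" "q\<^sup>2"] pr[of "r\<^sup>2" "s\<^sup>2"] by (intro add_mono) (simp_all add: power_mult_distrib abs_mult)
    finally show ?thesis by (simp add: mult.assoc flip: power_mult)
  qed
  have nn: "0 \<le> (a x)^4 + (b x)^4 + (c x)^4 + (d x)^4" for x by (intro add_nonneg_nonneg) auto
  show ?thesis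
    by (rule Bochner_Integration.integrable_bound[of _ "\<lambda>x. (a x)^4 + (b x)^4 + (c x)^4 + (d x)^4"])
      (use assms le nn in \<open>simp_all add: L4_def abs_of_nonneg\<close>)
qed

lemma NN_power4: "(NN U)^4 = (LINT x|lebesgue. (fst U x)^4)"
  by (simp add: NN_def N4_power4)

text \<open>A quarter of the derivative of \<open>(NN U)^4\<close> in the direction V.\<close>

definition cub :: "'a::euclidean_space h1 \<Rightarrow> 'a h1 \<Rightarrow> real" where
  "cub U V = (LINT x|lebesgue. (fst U x)^3 * fst V x)"

definition sq2 :: "'a::euclidean_space h1 \<Rightarrow> 'a h1 \<Rightarrow> real" where
  "sq2 U V = (LINT x|lebesgue. (fst U x)\<^sup>2 * (fst V x)\<^sup>2)"

lemma cub_integrable: "L4 (fst U) \<Longrightarrow> L4 (fst V) \<Longrightarrow> integrable lebesgue (\<lambda>x. (fst U x)^3 * fst V x)"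
  using L4_integrable4[of "fst U" "fst U" "fst U" "fst V"] by (simp add: power3_eq_cube)

lemma sq2_integrable: "L4 (fst U) \<Longrightarrow> L4 (fst V) \<Longrightarrow> integrable lebesgue (\<lambda>x. (fst U x)\<^sup>2 * (fst V x)\<^sup>2)"
  using L4_integrable4[of "fst U" "fst U" "fst V" "fst V"] by (simp add: power2_eq_square mult.assoc)

lemma L4_power4_integrable: "L4 f \<Longrightarrow> integrable lebesgue (\<lambda>x. (f x)^4)"
  by (simp add: L4_def)

lemma NN_power4_line:
  assumes "L4 (fst U)" "L4 (fst V)"
  shows "(NN (U + s *\<^sub>R V))^4 = (NN U)^4 + 4 * s * cub U V + 6 * s\<^sup>2 * sq2 U V + 4 * s^3 * cub V U + s^4 * (NN V)^4"
proof -
  note i = L4_power4_integrable[OF assms(1)] L4_power4_integrable[OF assms(2)]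
    cub_integrable[OF assms] cub_integrable[OF assms(2,1)] sq2_integrable[OF assms]
  have "(p + s * q)^4 = p^4 + (4 * s) * (p^3 * q) + (6 * s\<^sup>2) * (p\<^sup>2 * q\<^sup>2) + (4 * s^3) * (q^3 * p) + s^4 * q^4" for p q :: real
    by (simp add: power2_eq_square power3_eq_cube power4_eq_xxxx algebra_simps)
  then have "(NN (U + s *\<^sub>R V))^4 = (LINT x|lebesgue. (fst U x)^4 + (4 * s) * ((fst U x)^3 * fst V x)
      + (6 * s\<^sup>2) * ((fst U x)\<^sup>2 * (fst V x)\<^sup>2) + (4 * s^3) * ((fst V x)^3 * fst U x) + s^4 * (fst V x)^4)"
    by (simp add: NN_power4)
  also have "\<dots> = (NN U)^4 + 4 * s * cub U V + 6 * s\<^sup>2 * sq2 U V + 4 * s^3 * cub V U + s^4 * (NN V)^4"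
    using i by (simp add: NN_power4 cub_def sq2_def)
  finally show ?thesis .
qed

text \<open>The tangent inequality of a convex functional; pointwise the remainder is q^2 ((q +
  2p)^2 + 2p^2).\<close>

lemma NN_power4_convex:
  assumes "L4 (fst U)" "L4 (fst V)"
  shows "(NN U)^4 + 4 * cub U V \<le> (NN (U + V))^4"
proof -
  note i = L4_power4_integrable[OF assms(1)] L4_power4_integrable[OF L4_add[OF assms]] cub_integrable[OF assms]
  have c: "p^4 + 4 * (p^3 * q) \<le> (p + q)^4" for p q :: real
  proof -
    have "(p + q)^4 - (p^4 + 4 * (p^3 * q)) = q\<^sup>2 * ((q + 2 * p)\<^sup>2 + 2 * p\<^sup>2)"
      by (simp add: power2_eq_square power3_eq_cube power4_eq_xxxx algebra_simps)
    moreover have "0 \<le> q\<^sup>2 * ((q + 2 * p)\<^sup>2 + 2 * p\<^sup>2)" by simp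
    ultimately show ?thesis by linarith
  qed
  have "(NN U)^4 + 4 * cub U V = (LINT x|lebesgue. (fst U x)^4 + 4 * ((fst U x)^3 * fst V x))"
    using i by (simp add: NN_power4 cub_def)
  also have "\<dots> \<le> (LINT x|lebesgue. (fst U x + fst V x)^4)"
    using i c by (intro integral_mono) auto
  finally show ?thesis by (simp add: NN_power4)
qed

lemma NN_zero_AE:
  assumes "L4 (fst U)" "NN U = 0" shows "AE x in lebesgue. fst U x = 0"
proof -
  have "(LINT x|lebesgue. (fst U x)^4) = 0" using assms(2) NN_power4[of U] by simp
  then have "AE x in lebesgue. (fst U x)^4 = 0"
    using integral_nonneg_eq_0_iff_AE[OF L4_power4_integrable[OF assms(1)]] by auto
  then show ?thesis by simp
qed

lemma NN_eq_0I: "AE x in lebesgue. fst U x = 0 \<Longrightarrow> NN U = 0"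
proof -
  assume a: "AE x in lebesgue. fst U x = 0"
  have "(LINT x|lebesgue. (fst U x)^4) = 0"
    by (rule integral_eq_zero_AE, use a in eventually_elim) simp
  then have "(NN U)^4 = 0" using NN_power4[of U] by simp
  then show ?thesis by simp
qed

lemma deriv_zero_at_min:
  fixes g :: "real \<Rightarrow> real"
  assumes "(g has_real_derivative l) (at 0)" "\<And>s. g 0 \<le> g s"
  shows "l = 0"
  using DERIV_local_min[OF assms(1), of 1] assms(2) by simp

context eigen_domain
begin

section \<open>Minimal L^4 representatives modulo the eigenfunction\<close>

lemma L4H: "U \<in> H10 \<Omega> \<Longrightarrow> L4 (fst U)" by (rule H10_L4)

lemma NN_phi_pos: "NN \<phi>1 > 0"
proof -
  have "NN \<phi>1 \<noteq> 0"
  proof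
    assume "NN \<phi>1 = 0"
    from NN_zero_AE[OF L4H[OF phi(1)] this] have "AE x in lebesgue. fst \<phi>1 x * fst \<phi>1 x = 0"
      by eventually_elim simp
    then have "b0 \<phi>1 \<phi>1 = 0" unfolding b0_def by (rule integral_eq_zero_AE)
    then show False using phi(2) by simp
  qed
  then show ?thesis by (simp add: less_le)
qed

text \<open>U is the L^4-minimal representative of its coset modulo the eigenspace; \<open>Q\<close>
  does not see which representative is taken.\<close>

definition L4min :: "'a h1 \<Rightarrow> bool" where
  "L4min U \<longleftrightarrow> U \<in> H10 \<Omega> \<and> (\<forall>r. NN U \<le> NN (U + r *\<^sub>R \<phi>1))"

lemma L4min_H10: "L4min U \<Longrightarrow> U \<in> H10 \<Omega>"
  by (simp add: L4min_def)

lemma phi_mem: "U \<in> H10 \<Omega> \<Longrightarrow> U + r *\<^sub>R \<phi>1 \<in> H10 \<Omega>"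
  by (intro H10_mem phi(1))

text \<open>Along the line the norm is Lipschitz and grows like |s| NN \<phi>1. Beyond |s| = 2 NN U
  / NN \<phi>1 it exceeds its value at 0, so a minimum over that compact interval is global.\<close>

lemma L4min_exists:
  assumes U: "U \<in> H10 \<Omega>"
  shows "\<exists>s. L4min (U + s *\<^sub>R \<phi>1)"
proof -
  let ?g = "\<lambda>s. NN (U + s *\<^sub>R \<phi>1)"
  define N where "N = NN \<phi>1"
  have N: "N > 0" unfolding N_def by (rule NN_phi_pos)
  have "?g s \<le> ?g r + \<bar>s - r\<bar> * N" for s r
  proof -
    have "NN ((U + r *\<^sub>R \<phi>1) + (s - r) *\<^sub>R \<phi>1) \<le> ?g r + NN ((s - r) *\<^sub>R \<phi>1)"
      by (intro NN_add_le H10_mem phi(1) U)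
    moreover have "(U + r *\<^sub>R \<phi>1) + (s - r) *\<^sub>R \<phi>1 = U + s *\<^sub>R \<phi>1" by (simp add: scaleR_diff_left)
    ultimately show ?thesis by (simp only: NN_scale N_def)
  qed
  note lip = this
  have "continuous_on UNIV ?g"
    unfolding continuous_on_iff
  proof (intro ballI allI impI)
    fix s e :: real assume e: "e > 0"
    show "\<exists>d>0. \<forall>r\<in>UNIV. dist r s < d \<longrightarrow> dist (?g r) (?g s) < e"
    proof (intro exI conjI ballI impI)
      show "e / N > 0" using e N by simp
      fix r assume "dist r s < e / N"
      then have "\<bar>r - s\<bar> * N < e" using N by (simp add: dist_real_def pos_less_divide_eq)
      then show "dist (?g r) (?g s) < e"
        using lip[of r s] lip[of s r] by (simp add: dist_real_def abs_minus_commute)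
    qed
  qed
  then have cg: "continuous_on {- (2 * NN U / N) .. 2 * NN U / N} ?g"
    by (rule continuous_on_subset) simp
  have R: "0 \<le> 2 * NN U / N" using N by simp
  then obtain s where s: "s \<in> {- (2 * NN U / N) .. 2 * NN U / N}"
    "\<And>r. r \<in> {- (2 * NN U / N) .. 2 * NN U / N} \<Longrightarrow> ?g s \<le> ?g r"
    using continuous_attains_inf[OF compact_Icc _ cg] by auto
  have all: "?g s \<le> ?g r" for r
  proof (cases "\<bar>r\<bar> \<le> 2 * NN U / N")
    case True
    then show ?thesis by (intro s(2)) (simp add: abs_le_iff)
  next
    case False
    then have "2 * NN U < \<bar>r\<bar> * N" using N by (simp add: pos_divide_less_eq not_le)
    moreover have "NN ((U + r *\<^sub>R \<phi>1) - U) \<le> ?g r + NN U"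
      using NN_add_le[OF phi_mem[OF U, of r] H10_mem(2)[OF U, of "-1"]] NN_scale[of "-1" U] by simp
    then have "\<bar>r\<bar> * N \<le> ?g r + NN U" by (simp add: NN_scale N_def)
    moreover have "?g s \<le> NN U" using s(2)[of 0] R by simp
    ultimately show ?thesis by linarith
  qed
  have "L4min (U + s *\<^sub>R \<phi>1)"
    unfolding L4min_def
  proof (intro conjI allI phi_mem[OF U])
    fix r
    have e: "(U + s *\<^sub>R \<phi>1) + r *\<^sub>R \<phi>1 = U + (s + r) *\<^sub>R \<phi>1" by (simp add: scaleR_add_left)
    show "NN (U + s *\<^sub>R \<phi>1) \<le> NN ((U + s *\<^sub>R \<phi>1) + r *\<^sub>R \<phi>1)" unfolding e by (rule all)
  qed
  then show ?thesis ..
qed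

definition shift :: "'a h1 \<Rightarrow> real" where
  "shift U = (SOME s. L4min (U + s *\<^sub>R \<phi>1))"

definition repr :: "'a h1 \<Rightarrow> 'a h1" where
  "repr U = U + shift U *\<^sub>R \<phi>1"

text \<open>The $L^4$ distance to the eigenspace.\<close>

definition pn :: "'a h1 \<Rightarrow> real" where
  "pn U = NN (repr U)"

lemma repr_L4min: "U \<in> H10 \<Omega> \<Longrightarrow> L4min (repr U)"
  unfolding repr_def shift_def by (rule someI_ex[OF L4min_exists])

lemma pn_le:
  assumes "U \<in> H10 \<Omega>" shows "pn U \<le> NN (U + r *\<^sub>R \<phi>1)"
proof -
  have "repr U + (r - shift U) *\<^sub>R \<phi>1 = U + r *\<^sub>R \<phi>1" by (simp add: repr_def scaleR_diff_left)
  then show ?thesis using repr_L4min[OF assms] unfolding L4min_def pn_def by metis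
qed

lemma pn_le_NN: "U \<in> H10 \<Omega> \<Longrightarrow> pn U \<le> NN U"
  using pn_le[of U 0] by simp

lemma pn_nonneg: "0 \<le> pn U"
  by (simp add: pn_def)

lemma pn_L4min:
  assumes "L4min U" shows "pn U = NN U"
  using assms pn_le_NN[OF L4min_H10[OF assms]] by (simp add: pn_def repr_def L4min_def order_antisym)

lemma pn_triangle:
  assumes "U \<in> H10 \<Omega>" "V \<in> H10 \<Omega>" shows "pn (U + V) \<le> pn U + pn V"
proof -
  have "pn (U + V) \<le> NN (U + V + (shift U + shift V) *\<^sub>R \<phi>1)"
    by (intro pn_le H10_mem assms)
  also have "U + V + (shift U + shift V) *\<^sub>R \<phi>1 = repr U + repr V" by (simp add: repr_def scaleR_add_left)
  also have "NN (repr U + repr V) \<le> NN (repr U) + NN (repr V)"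
    by (intro NN_add_le L4min_H10 repr_L4min assms)
  finally show ?thesis by (simp add: pn_def)
qed

lemma pn_scale_le: "U \<in> H10 \<Omega> \<Longrightarrow> pn (c *\<^sub>R U) \<le> \<bar>c\<bar> * pn U"
proof -
  assume U: "U \<in> H10 \<Omega>"
  have "pn (c *\<^sub>R U) \<le> NN (c *\<^sub>R U + (c * shift U) *\<^sub>R \<phi>1)" by (intro pn_le H10_mem U)
  also have "c *\<^sub>R U + (c * shift U) *\<^sub>R \<phi>1 = c *\<^sub>R repr U" by (simp add: repr_def scaleR_add_right)
  finally show ?thesis by (simp add: NN_scale pn_def)
qed

lemma pn_scale:
  assumes U: "U \<in> H10 \<Omega>" shows "pn (c *\<^sub>R U) = \<bar>c\<bar> * pn U"
proof (cases "c = 0")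
  case True
  then show ?thesis using pn_scale_le[OF U, of 0] pn_nonneg[of 0] by simp
next
  case False
  have "pn ((1 / c) *\<^sub>R (c *\<^sub>R U)) \<le> \<bar>1 / c\<bar> * pn (c *\<^sub>R U)" by (intro pn_scale_le H10_mem U)
  then have "pn U \<le> pn (c *\<^sub>R U) / \<bar>c\<bar>" using False by (simp add: abs_divide)
  then have "\<bar>c\<bar> * pn U \<le> pn (c *\<^sub>R U)" using False by (simp add: pos_le_divide_eq mult.commute)
  then show ?thesis using pn_scale_le[OF U, of c] by simp
qed

lemma cub_phi_zero:
  assumes U: "L4min U" shows "cub U \<phi>1 = 0"
proof -
  note m = L4H[OF L4min_H10[OF U]] L4H[OF phi(1)]
  let ?g = "\<lambda>s. (NN U)^4 + 4 * s * cub U \<phi>1 + 6 * s\<^sup>2 * sq2 U \<phi>1 + 4 * s^3 * cub \<phi>1 U + s^4 * (NN \<phi>1)^4"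
  have "(?g has_real_derivative 4 * cub U \<phi>1) (at 0)"
    by (auto intro!: derivative_eq_intros)
  moreover have "?g 0 \<le> ?g s" for s
  proof -
    have "(NN U)^4 \<le> (NN (U + s *\<^sub>R \<phi>1))^4" using U by (intro power_mono) (auto simp: L4min_def)
    then show ?thesis unfolding NN_power4_line[OF m] by simp
  qed
  ultimately have "4 * cub U \<phi>1 = 0" by (rule deriv_zero_at_min)
  then show ?thesis by simp
qed

lemma cub_add_right: "U \<in> H10 \<Omega> \<Longrightarrow> V \<in> H10 \<Omega> \<Longrightarrow> W \<in> H10 \<Omega> \<Longrightarrow> cub U (V + W) = cub U V + cub U W"
  using cub_integrable[of U V] cub_integrable[of U W] L4H by (simp add: cub_def distrib_left)

lemma cub_scale_right: "cub U (c *\<^sub>R V) = c * cub U V"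
  by (simp add: cub_def mult.left_commute)

text \<open>Converse of \<open>cub_phi_zero\<close>: by convexity a stationary point along the line
  is a minimum. Stationarity is the form that can be checked for multiples and for parts with
  disjoint supports.\<close>

lemma L4minI:
  assumes U: "U \<in> H10 \<Omega>" "cub U \<phi>1 = 0" shows "L4min U"
  unfolding L4min_def
proof (intro conjI allI U(1))
  fix r
  have "(NN U)^4 + 4 * cub U (r *\<^sub>R \<phi>1) \<le> (NN (U + r *\<^sub>R \<phi>1))^4"
    by (intro NN_power4_convex L4H H10_mem U(1) phi(1))
  then have "(NN U)^4 \<le> (NN (U + r *\<^sub>R \<phi>1))^4" by (simp add: cub_scale_right U(2))
  then show "NN U \<le> NN (U + r *\<^sub>R \<phi>1)" by (rule power_le_imp_le_base[where n = 3, simplified]) simp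
qed

text \<open>The tangent inequality at U does not notice shifts, because \<open>cub U \<phi>1\<close>
  vanishes, so it survives the unknown optimal shift of U + V.\<close>

lemma pn_power4_lower:
  assumes U: "L4min U" and V: "V \<in> H10 \<Omega>"
  shows "(NN U)^4 + 4 * cub U V \<le> (pn (U + V))^4"
proof -
  define r where "r = shift (U + V)"
  note UH = L4min_H10[OF U]
  have "(NN U)^4 + 4 * cub U (V + r *\<^sub>R \<phi>1) \<le> (NN (U + (V + r *\<^sub>R \<phi>1)))^4"
    by (intro NN_power4_convex L4H H10_mem UH V phi(1))
  then show ?thesis
    by (simp add: cub_add_right UH V phi(1) H10_mem cub_scale_right cub_phi_zero[OF U] pn_def repr_def r_def add.assoc)
qed

lemma Q_shift: "U \<in> H10 \<Omega> \<Longrightarrow> Q (U + r *\<^sub>R \<phi>1) (U + r *\<^sub>R \<phi>1) = Q U U"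
  using Q.expand[of U \<phi>1 r] Q.null[OF phi(1), of U] Q.sym[of U \<phi>1] phi by simp

text \<open>What \<open>Q\<close> misses of the H^1 norm is a multiple of the L^2 part, which the
  L^4 norm controls on a bounded domain.\<close>

lemma nH_le_Q:
  assumes "U \<in> H10 \<Omega>" "NN U \<le> M"
  shows "nH U \<le> Q U U + (1 + lam) * ((vol + 1) * (M + 1)\<^sup>2)"
proof -
  have M: "M \<ge> 0" using assms(2) NN_nonneg[of U] by linarith
  have "b0 U U \<le> (vol + 1) * (M + 1)\<^sup>2" using assms M by (intro b0_le_NN) auto
  then have "(1 + lam) * b0 U U \<le> (1 + lam) * ((vol + 1) * (M + 1)\<^sup>2)"
    using lam_nonneg by (intro mult_left_mono) auto
  then show ?thesis by (simp add: nH_def Q_def algebra_simps)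
qed

text \<open>Take a bump in one of two disjoint balls. Were it a multiple of the eigenfunction,
  \<open>phi_nonzero\<close> on the other ball would force the multiplier to be 0, and the bump
  would vanish.\<close>

lemma pn_nontrivial: "\<exists>U\<in>H10 \<Omega>. pn U \<noteq> 0"
proof -
  have "\<Omega> \<noteq> {}"
  proof
    assume "\<Omega> = {}"
    with H10_outside[OF phi(1)] have "AE x in lebesgue. fst \<phi>1 x * fst \<phi>1 x = 0" by simp
    then have "b0 \<phi>1 \<phi>1 = 0" unfolding b0_def by (rule integral_eq_zero_AE)
    then show False using phi(2) by simp
  qed
  then obtain a where "a \<in> \<Omega>" by blast
  then obtain r where r: "r > 0" "cball a r \<subseteq> \<Omega>" using open_contains_cball open_dom by blast
  obtain u :: 'a where u: "norm u = 1" using vector_choose_size[of 1] by auto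
  \<comment> \<open>The centres are r/2 apart, so the balls of radius r/4 are disjoint and stay
    within distance r of a.\<close>
  define b where "b = a + (r/2) *\<^sub>R u"
  have dab: "dist a b = r/2" using r u by (simp add: b_def dist_norm)
  have sub: "ball a (r/4) \<subseteq> \<Omega>" "ball b (r/4) \<subseteq> \<Omega>"
  proof -
    have "ball b (r/4) \<subseteq> cball a r"
    proof
      fix x assume "x \<in> ball b (r/4)"
      then show "x \<in> cball a r" using dab dist_triangle[of a x b] r by simp
    qed
    then show "ball b (r/4) \<subseteq> \<Omega>" using r(2) by (rule order_trans)
    have "ball a (r/4) \<subseteq> cball a r" using r(1) by (auto simp: subset_iff)
    then show "ball a (r/4) \<subseteq> \<Omega>" using r(2) by (rule order_trans)
  qed
  have "cball a (r/8) \<subseteq> ball a (r/4)" using r(1) by (auto simp: subset_iff)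
  then obtain \<psi> where \<psi>: "test_fun (ball a (r/4)) \<psi>" "\<And>x. x \<in> ball a (r/8) \<Longrightarrow> \<psi> x > 0"
    using cball_cutoff[of a "r/8" "ball a (r/4)"] r(1) by auto
  have t\<psi>: "test_fun \<Omega> \<psi>" using \<psi>(1) sub(1) unfolding test_fun_def by blast
  let ?E = "el \<psi>"
  have E: "?E \<in> H10 \<Omega>" by (rule el_in_H10[OF t\<psi>])
  have "pn ?E \<noteq> 0"
  proof
    assume "pn ?E = 0"
    then have "AE x in lebesgue. fst (repr ?E) x = 0"
      unfolding pn_def by (intro NN_zero_AE L4H L4min_H10 repr_L4min E)
    then have ae: "AE x in lebesgue. \<psi> x + shift ?E * fst \<phi>1 x = 0"
      by (simp add: repr_def el_def)
    have "shift ?E = 0"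
    proof (rule ccontr)
      assume s: "shift ?E \<noteq> 0"
      have "AE x in lebesgue. x \<notin> ball b (r/4)"
        using ae phi_nonzero
      proof eventually_elim
        case (elim x)
        show ?case
        proof
          assume x: "x \<in> ball b (r/4)"
          then have "x \<notin> ball a (r/4)" using dab dist_triangle[of a b x] by (simp add: dist_commute)
          then have "\<psi> x = 0" by (rule test_fun_outside(1)[OF \<psi>(1)])
          moreover have "x \<in> \<Omega>" using sub(2) x by blast
          ultimately show False using elim s by simp
        qed
      qed
      then show False using not_AE_ball_False[of "r/4" b] r(1) by simp
    qed
    then have "AE x in lebesgue. x \<notin> ball a (r/8)"
      using ae \<psi>(2) by (auto elim!: eventually_mono simp del: mem_ball) fastforce
    then show False using not_AE_ball_False[of "r/8" a] r(1) by simp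
  qed
  then show ?thesis using E by blast
qed

section \<open>Existence of the scalar ground state and its equation\<close>

lemma reprs:
  assumes X: "\<And>n::nat. X n \<in> H10 \<Omega>"
  defines "Y \<equiv> \<lambda>n. repr (X n)"
  shows "Y n \<in> H10 \<Omega>" "Q (Y n) (Y n) = Q (X n) (X n)" "NN (Y n) = pn (X n)"
    "V \<in> H10 \<Omega> \<Longrightarrow> Q (Y n - V) (Y n - V) = Q (X n - V) (X n - V)"
    "V \<in> H10 \<Omega> \<Longrightarrow> pn (X n - V) \<le> NN (Y n - V)"
    "pn (X n - X m) \<le> NN (Y n - Y m)" "Q (Y n - Y m) (Y n - Y m) = Q (X n - X m) (X n - X m)"
proof -
  show Y: "Y n \<in> H10 \<Omega>" for n unfolding Y_def by (intro L4min_H10 repr_L4min X)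
  show "Q (Y n) (Y n) = Q (X n) (X n)" unfolding Y_def repr_def by (rule Q_shift[OF X])
  show "NN (Y n) = pn (X n)" by (simp add: Y_def pn_def)
  have e: "Y n - V = (X n - V) + shift (X n) *\<^sub>R \<phi>1" for n V by (simp add: Y_def repr_def)
  show "Q (Y n - V) (Y n - V) = Q (X n - V) (X n - V)" if "V \<in> H10 \<Omega>" for V
    unfolding e by (intro Q_shift H10_mem X that)
  show "pn (X n - V) \<le> NN (Y n - V)" if "V \<in> H10 \<Omega>" for V
    unfolding e by (intro pn_le H10_mem X that)
  have e2: "Y n - Y m = (X n - X m) + (shift (X n) - shift (X m)) *\<^sub>R \<phi>1"
    by (simp add: Y_def repr_def scaleR_diff_left)
  show "pn (X n - X m) \<le> NN (Y n - Y m)" unfolding e2 by (intro pn_le H10_mem X)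
  show "Q (Y n - Y m) (Y n - Y m) = Q (X n - X m) (X n - X m)" unfolding e2 by (intro Q_shift H10_mem X)
qed

text \<open>A minimising sequence is bounded only modulo the line. Passing to the L^4-minimal
  representatives changes neither \<open>Q\<close> nor \<open>pn\<close> and bounds the H^1 norm, so
  compactness and completeness are applied to them.\<close>

lemma scalar_minimizer_exists:
  "\<exists>W\<in>H10 \<Omega>. pn W = 1 \<and> (\<forall>V\<in>H10 \<Omega>. Q W W * (pn V)\<^sup>2 \<le> Q V V)"
proof -
  obtain U0 where U0: "U0 \<in> H10 \<Omega>" "pn U0 \<noteq> 0" using pn_nontrivial by blast
  have sub: "\<exists>r :: nat \<Rightarrow> nat. strict_mono r \<and> sn_cauchy NN ((\<lambda>n. repr (X n)) \<circ> r)"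
    if X: "\<And>n. X n \<in> H10 \<Omega>" "\<And>n. Q (X n) (X n) \<le> M" "\<And>n. pn (X n) \<le> M" for X :: "nat \<Rightarrow> 'a h1" and M
  proof -
    note R = reprs[of X, OF X(1)]
    have "nH (repr (X n)) \<le> M + (1 + lam) * ((vol + 1) * (M + 1)\<^sup>2)" for n
    proof -
      have "NN (repr (X n)) \<le> M" using R(3)[of n] X(3)[of n] by simp
      from nH_le_Q[OF R(1)[of n] this] show ?thesis using R(2)[of n] X(2)[of n] by simp
    qed
    then show ?thesis by (intro H10_compact' R(1))
  qed
  show ?thesis
  proof (rule Q.minimizer_exists[where p = pn, OF pn_nonneg pn_triangle pn_scale U0])
    fix X :: "nat \<Rightarrow> 'a h1" and M assume X: "\<And>n. X n \<in> H10 \<Omega>" "\<And>n. Q (X n) (X n) \<le> M" "\<And>n. pn (X n) \<le> M"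
    note R = reprs[of X, OF X(1)]
    obtain r :: "nat \<Rightarrow> nat" where r: "strict_mono r" "sn_cauchy NN ((\<lambda>n. repr (X n)) \<circ> r)"
      using sub[of X M, OF X] by blast
    have "sn_cauchy pn (X \<circ> r)"
      using r(2) R(6) unfolding sn_cauchy_def o_def by (meson order_trans)
    with r(1) show "\<exists>r :: nat \<Rightarrow> nat. strict_mono r \<and> sn_cauchy pn (X \<circ> r)" by blast
    assume "sn_cauchy pn X" and qc: "sn_cauchy (\<lambda>x. Q x x) X"
    let ?Z = "(\<lambda>n. repr (X n)) \<circ> r"
    have Z: "?Z n \<in> H10 \<Omega>" for n using R(1) by simp
    have bc: "sn_cauchy (\<lambda>U. sqrt (b0 U U)) ?Z" by (rule sqrt_b0_cauchy[OF Z r(2)])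
    have "sn_cauchy (\<lambda>x. a1 x x) ?Z"
      unfolding sn_cauchy_def
    proof (intro allI impI)
      fix e :: real assume e: "e > 0"
      define d where "d = e / (2 * (lam + 1))"
      have d: "d > 0" using e lam_nonneg by (simp add: d_def)
      have e2: "e / 2 > 0" using e by simp
      obtain N where N: "\<And>i j. i \<ge> N \<Longrightarrow> j \<ge> N \<Longrightarrow> Q (X (r i) - X (r j)) (X (r i) - X (r j)) \<le> e / 2"
        using sn_cauchy_subseq[OF qc r(1)] e2 unfolding sn_cauchy_def o_def by blast
      have sd: "sqrt d > 0" using d by simp
      obtain K where K: "\<And>i j. i \<ge> K \<Longrightarrow> j \<ge> K \<Longrightarrow> sqrt (b0 (?Z i - ?Z j) (?Z i - ?Z j)) \<le> sqrt d"
        using bc sd unfolding sn_cauchy_def by blast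
      have "a1 (?Z i - ?Z j) (?Z i - ?Z j) \<le> e" if "i \<ge> max N K" "j \<ge> max N K" for i j
      proof -
        have q: "Q (?Z i - ?Z j) (?Z i - ?Z j) \<le> e / 2"
          using N[of i j] that R(7)[of "r i" "r j"] by simp
        have "b0 (?Z i - ?Z j) (?Z i - ?Z j) \<le> d" using K[of i j] that by simp
        then have "lam * b0 (?Z i - ?Z j) (?Z i - ?Z j) \<le> lam * d" using lam_nonneg by (rule mult_left_mono)
        also have "lam * d \<le> (lam + 1) * d" using d by (intro mult_right_mono) auto
        also have "\<dots> = e / 2" using lam_nonneg by (simp add: d_def field_simps)
        finally have "lam * b0 (?Z i - ?Z j) (?Z i - ?Z j) \<le> e / 2" .
        with q have "Q (?Z i - ?Z j) (?Z i - ?Z j) + lam * b0 (?Z i - ?Z j) (?Z i - ?Z j) \<le> e / 2 + e / 2"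
          by (rule add_mono)
        then show ?thesis by (simp add: Q_def)
      qed
      then show "\<exists>N. \<forall>i\<ge>N. \<forall>j\<ge>N. a1 (?Z i - ?Z j) (?Z i - ?Z j) \<le> e" by blast
    qed
    from H10_complete'[of ?Z, OF Z nH_cauchyI[OF bc this]]
    obtain V where V: "V \<in> H10 \<Omega>" "(\<lambda>n. nH (?Z n - V)) \<longlonglongrightarrow> 0" by blast
    have "(\<lambda>n. Q (X (r n) - V) (X (r n) - V)) \<longlonglongrightarrow> 0"
    proof (rule tendsto_sandwich[OF _ _ tendsto_const V(2)])
      show "\<forall>\<^sub>F n in sequentially. 0 \<le> Q (X (r n) - V) (X (r n) - V)"
        by (intro always_eventually allI Q.nonneg H10_mem X(1) V(1))
      show "\<forall>\<^sub>F n in sequentially. Q (X (r n) - V) (X (r n) - V) \<le> nH (?Z n - V)"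
        using Q_le_nH R(4)[OF V(1)] by (intro always_eventually allI) (metis o_apply)
    qed
    moreover have "(\<lambda>n. pn (X (r n) - V)) \<longlonglongrightarrow> 0"
    proof (rule tendsto_sandwich[OF _ _ tendsto_const])
      have "(\<lambda>n. 2 * sob_bound TYPE('a) * sqrt (nH (?Z n - V))) \<longlonglongrightarrow> 2 * sob_bound TYPE('a) * sqrt 0"
        by (intro tendsto_intros V(2))
      then show "(\<lambda>n. 2 * sob_bound TYPE('a) * sqrt (nH (?Z n - V))) \<longlonglongrightarrow> 0" by simp
      have "pn (X (r n) - V) \<le> 2 * sob_bound TYPE('a) * sqrt (nH (?Z n - V))" for n
        using order_trans[OF R(5)[OF V(1), of "r n"] H10_sobolev[OF H10_mem(3)[OF R(1) V(1)]]] by simp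
      then show "\<forall>\<^sub>F n in sequentially. pn (X (r n) - V) \<le> 2 * sob_bound TYPE('a) * sqrt (nH (?Z n - V))"
        by (intro always_eventually allI)
    qed (intro always_eventually allI pn_nonneg)
    ultimately show "\<exists>x\<in>H10 \<Omega>. \<exists>r :: nat \<Rightarrow> nat. strict_mono r \<and> (\<lambda>n. Q (X (r n) - x) (X (r n) - x)) \<longlonglongrightarrow> 0
        \<and> (\<lambda>n. pn (X (r n) - x)) \<longlonglongrightarrow> 0"
      using V(1) r(1) by blast
  qed
qed

text \<open>\<kappa> is positive because a null element of \<open>Q\<close> is a multiple of \<phi>1
  and so has distance 0 from the line. The Euler equation is obtained without differentiating
  \<open>pn\<close>: by \<open>pn_power4_lower\<close> its fourth power lies above an affine
  function that it touches at s = 0.\<close>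

lemma scalar_ground_state:
  "\<exists>W \<kappa>. L4min W \<and> NN W = 1 \<and> \<kappa> > 0 \<and> Q W W = \<kappa> \<and> (\<forall>V\<in>H10 \<Omega>. \<kappa> * (pn V)\<^sup>2 \<le> Q V V) \<and>
     (\<forall>V\<in>H10 \<Omega>. Q W V = \<kappa> * cub W V)"
proof -
  obtain W0 where W0: "W0 \<in> H10 \<Omega>" "pn W0 = 1" and min0: "\<And>V. V \<in> H10 \<Omega> \<Longrightarrow> Q W0 W0 * (pn V)\<^sup>2 \<le> Q V V"
    using scalar_minimizer_exists by blast
  define W where "W = repr W0"
  define \<kappa> where "\<kappa> = Q W W"
  have W: "L4min W" unfolding W_def by (rule repr_L4min[OF W0(1)])
  note WH = L4min_H10[OF W]
  have NW: "NN W = 1" using W0(2) by (simp add: W_def pn_def)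
  have \<kappa>W0: "\<kappa> = Q W0 W0" unfolding \<kappa>_def W_def repr_def by (rule Q_shift[OF W0(1)])
  have min: "\<kappa> * (pn V)\<^sup>2 \<le> Q V V" if "V \<in> H10 \<Omega>" for V using min0[OF that] \<kappa>W0 by simp
  have "\<kappa> \<noteq> 0"
  proof
    assume "\<kappa> = 0"
    then obtain t where "AE x in lebesgue. fst W x = t * fst \<phi>1 x \<and> snd W x = t *\<^sub>R snd \<phi>1 x"
      using eigen_simple[OF WH] by (auto simp: \<kappa>_def)
    then have "AE x in lebesgue. fst (W + (- t) *\<^sub>R \<phi>1) x = 0" by eventually_elim simp
    then have "NN (W + (- t) *\<^sub>R \<phi>1) = 0" by (rule NN_eq_0I)
    then show False using W NW unfolding L4min_def by (metis not_one_le_zero)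
  qed
  then have \<kappa>: "\<kappa> > 0" using Q.nonneg[OF WH] by (simp add: \<kappa>_def)
  have "Q W V = \<kappa> * cub W V" if V: "V \<in> H10 \<Omega>" for V
  proof -
    let ?F = "\<lambda>s. \<kappa> + 2 * s * Q W V + s\<^sup>2 * Q V V"
    \<comment> \<open>The quadratic form is squared because the lower bound concerns the fourth
      power of \<open>pn\<close>; then g has its minimum, 0, at s = 0.\<close>
    let ?g = "\<lambda>s. (?F s)\<^sup>2 - \<kappa>\<^sup>2 * (1 + 4 * s * cub W V)"
    have "(?g has_real_derivative 4 * \<kappa> * Q W V - 4 * \<kappa>\<^sup>2 * cub W V) (at 0)"
      by (auto intro!: derivative_eq_intros)
    moreover have "?g 0 \<le> ?g s" for s
    proof -
      have "1 + 4 * s * cub W V \<le> (pn (W + s *\<^sub>R V))^4"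
        using pn_power4_lower[OF W H10_mem(2)[OF V, of s]] NW by (simp add: cub_scale_right)
      then have "\<kappa>\<^sup>2 * (1 + 4 * s * cub W V) \<le> \<kappa>\<^sup>2 * (pn (W + s *\<^sub>R V))^4"
        by (intro mult_left_mono) auto
      also have "\<dots> = (\<kappa> * (pn (W + s *\<^sub>R V))\<^sup>2)\<^sup>2" by (simp add: power_mult_distrib flip: power_mult)
      also have "\<dots> \<le> (Q (W + s *\<^sub>R V) (W + s *\<^sub>R V))\<^sup>2"
        using \<kappa> by (intro power_mono min H10_mem WH V) auto
      also have "Q (W + s *\<^sub>R V) (W + s *\<^sub>R V) = ?F s" using Q.expand[OF WH V, of s] by (simp add: \<kappa>_def)
      finally show ?thesis by simp
    qed
    ultimately have "4 * \<kappa> * Q W V - 4 * \<kappa>\<^sup>2 * cub W V = 0" by (rule deriv_zero_at_min)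
    then have "(4 * \<kappa>) * (Q W V - \<kappa> * cub W V) = 0" by (simp add: power2_eq_square algebra_simps)
    then show ?thesis using \<kappa> by simp
  qed
  then show ?thesis using W NW \<kappa> min by (intro exI[of _ W] exI[of _ \<kappa>]) (simp add: \<kappa>_def)
qed

end

section \<open>Two components\<close>

text \<open>Limits and derivatives of the coupling term reduce to those of \<open>NN\<close> through
  this polarisation of the quartic.\<close>

lemma sq2_polarize:
  assumes "L4 (fst U)" "L4 (fst V)"
  shows "12 * sq2 U V = (NN (U + V))^4 + (NN (U - V))^4 - 2 * (NN U)^4 - 2 * (NN V)^4"
  using NN_power4_line[OF assms, of 1] NN_power4_line[OF assms, of "-1"] by simp

text \<open>Cauchy-Schwarz for the squared functions, from the integral of a square with the squared
  norms as weights. A vanishing norm makes the product zero almost everywhere and is treated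
  apart.\<close>

lemma sq2_le:
  assumes "L4 (fst U)" "L4 (fst V)"
  shows "sq2 U V \<le> (NN U)\<^sup>2 * (NN V)\<^sup>2"
proof -
  note i = L4_power4_integrable[OF assms(1)] L4_power4_integrable[OF assms(2)] sq2_integrable[OF assms]
  have "0 \<le> (LINT x|lebesgue. (((NN V)\<^sup>2 * (fst U x)\<^sup>2) - ((NN U)\<^sup>2 * (fst V x)\<^sup>2))\<^sup>2)" by simp
  also have "\<dots> = (LINT x|lebesgue. (NN V)^4 * (fst U x)^4 - (2 * (NN V)\<^sup>2 * (NN U)\<^sup>2) * ((fst U x)\<^sup>2 * (fst V x)\<^sup>2) + (NN U)^4 * (fst V x)^4)"
    by (simp add: power2_eq_square power4_eq_xxxx algebra_simps)
  also have "\<dots> = 2 * ((NN U)^4 * (NN V)^4) - 2 * (NN V)\<^sup>2 * (NN U)\<^sup>2 * sq2 U V"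
    using i by (simp add: NN_power4[symmetric] sq2_def[symmetric])
  finally have le: "((NN U)\<^sup>2 * (NN V)\<^sup>2) * sq2 U V \<le> ((NN U)\<^sup>2 * (NN V)\<^sup>2) * ((NN U)\<^sup>2 * (NN V)\<^sup>2)"
    by (simp add: power2_eq_square power4_eq_xxxx algebra_simps)
  show ?thesis
  proof (cases "NN U = 0 \<or> NN V = 0")
    case True
    have "AE x in lebesgue. (fst U x)\<^sup>2 * (fst V x)\<^sup>2 = 0"
      using True
    proof
      assume "NN U = 0"
      from NN_zero_AE[OF assms(1) this] show ?thesis by eventually_elim simp
    next
      assume "NN V = 0"
      from NN_zero_AE[OF assms(2) this] show ?thesis by eventually_elim simp
    qed
    then have "sq2 U V = 0" unfolding sq2_def by (rule integral_eq_zero_AE)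
    then show ?thesis by simp
  next
    case False
    then have "(NN U)\<^sup>2 * (NN V)\<^sup>2 > 0" by simp
    then show ?thesis using le by (simp only: mult_le_cancel_left_pos)
  qed
qed

lemma NN_scale_power4: "(NN (c *\<^sub>R U))^4 = c^4 * (NN U)^4"
  by (simp add: NN_scale power_mult_distrib)

lemma sq2_scale: "sq2 (a *\<^sub>R U) (b *\<^sub>R V) = a\<^sup>2 * b\<^sup>2 * sq2 U V"
proof -
  have "sq2 (a *\<^sub>R U) (b *\<^sub>R V) = (LINT x|lebesgue. (a\<^sup>2 * b\<^sup>2) * ((fst U x)\<^sup>2 * (fst V x)\<^sup>2))"
    by (simp add: sq2_def power_mult_distrib mult_ac)
  then show ?thesis by (simp add: sq2_def)
qed

lemma sq2_nonneg: "0 \<le> sq2 U V"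
  by (simp add: sq2_def)

lemma cub_scale_left: "cub (c *\<^sub>R U) V = c^3 * cub U V"
  by (simp add: cub_def power_mult_distrib mult.assoc)

context eigen_domain
begin

section \<open>Continuity of the L^4 quantities\<close>

lemma NN_tendsto:
  assumes X: "\<And>n::nat. X n \<in> H10 \<Omega>" "x \<in> H10 \<Omega>" and l: "(\<lambda>n. NN (X n - x)) \<longlonglongrightarrow> 0"
  shows "(\<lambda>n. NN (X n)) \<longlonglongrightarrow> NN x"
proof -
  have "norm (NN (X n) - NN x) \<le> NN (X n - x)" for n
  proof -
    have "NN ((X n - x) + x) \<le> NN (X n - x) + NN x" by (intro NN_add_le H10_mem X)
    moreover have "NN ((x - X n) + X n) \<le> NN (x - X n) + NN (X n)" by (intro NN_add_le H10_mem X)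
    moreover have "a \<le> d + b \<Longrightarrow> b \<le> d + a \<Longrightarrow> norm (a - b) \<le> d" for a b d :: real by simp
    ultimately show ?thesis by (simp add: NN_diff_commute[of x])
  qed
  then have "(\<lambda>n. NN (X n) - NN x) \<longlonglongrightarrow> 0" by (intro Lim_null_comparison[OF always_eventually l]) simp
  then show ?thesis by (simp add: LIM_zero_iff)
qed

lemma NN_tendsto_0:
  assumes X: "\<And>n::nat. X n \<in> H10 \<Omega>" "x \<in> H10 \<Omega>" and l: "(\<lambda>n. nH (X n - x)) \<longlonglongrightarrow> 0"
  shows "(\<lambda>n. NN (X n - x)) \<longlonglongrightarrow> 0"
proof (rule tendsto_sandwich[OF _ _ tendsto_const])
  have "(\<lambda>n. 2 * sob_bound TYPE('a) * sqrt (nH (X n - x))) \<longlonglongrightarrow> 2 * sob_bound TYPE('a) * sqrt 0"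
    by (intro tendsto_intros l)
  then show "(\<lambda>n. 2 * sob_bound TYPE('a) * sqrt (nH (X n - x))) \<longlonglongrightarrow> 0" by simp
  show "\<forall>\<^sub>F n in sequentially. NN (X n - x) \<le> 2 * sob_bound TYPE('a) * sqrt (nH (X n - x))"
    by (intro always_eventually allI H10_sobolev H10_mem X)
qed simp

lemma L4min_tendsto:
  assumes X: "\<And>n::nat. L4min (X n)" "x \<in> H10 \<Omega>" and l: "(\<lambda>n. NN (X n - x)) \<longlonglongrightarrow> 0"
  shows "L4min x"
  unfolding L4min_def
proof (intro conjI allI X(2))
  fix r
  have XH: "X n \<in> H10 \<Omega>" for n by (rule L4min_H10[OF X(1)])
  have 1: "(\<lambda>n. NN (X n + r *\<^sub>R \<phi>1)) \<longlonglongrightarrow> NN (x + r *\<^sub>R \<phi>1)"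
    by (rule NN_tendsto) (simp_all add: l phi_mem XH X(2))
  show "NN x \<le> NN (x + r *\<^sub>R \<phi>1)"
    by (rule LIMSEQ_le[OF NN_tendsto[OF XH X(2) l] 1]) (use X(1) in \<open>simp add: L4min_def\<close>)
qed

lemma sq2_tendsto:
  assumes X: "\<And>n::nat. X n \<in> H10 \<Omega>" "x \<in> H10 \<Omega>" and Y: "\<And>n::nat. Y n \<in> H10 \<Omega>" "y \<in> H10 \<Omega>"
    and l: "(\<lambda>n. NN (X n - x)) \<longlonglongrightarrow> 0" "(\<lambda>n. NN (Y n - y)) \<longlonglongrightarrow> 0"
  shows "(\<lambda>n. sq2 (X n) (Y n)) \<longlonglongrightarrow> sq2 x y"
proof -
  have s: "(\<lambda>n. NN (X n - x) + NN (Y n - y)) \<longlonglongrightarrow> 0" using tendsto_add[OF l] by simp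
  have p: "(\<lambda>n. NN ((X n + Y n) - (x + y))) \<longlonglongrightarrow> 0"
  proof (rule tendsto_sandwich[OF _ _ tendsto_const s])
    have e: "(X n + Y n) - (x + y) = (X n - x) + (Y n - y)" for n by simp
    show "\<forall>\<^sub>F n in sequentially. NN ((X n + Y n) - (x + y)) \<le> NN (X n - x) + NN (Y n - y)"
      unfolding e by (intro always_eventually allI NN_add_le H10_mem X Y)
  qed simp
  have m: "(\<lambda>n. NN ((X n - Y n) - (x - y))) \<longlonglongrightarrow> 0"
  proof (rule tendsto_sandwich[OF _ _ tendsto_const s])
    have "NN ((X n - Y n) - (x - y)) \<le> NN (X n - x) + NN (Y n - y)" for n
    proof -
      have e: "(X n - Y n) - (x - y) = (X n - x) + (y - Y n)" by simp
      show ?thesis unfolding e NN_diff_commute[of "Y n" y] by (intro NN_add_le H10_mem X Y)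
    qed
    then show "\<forall>\<^sub>F n in sequentially. NN ((X n - Y n) - (x - y)) \<le> NN (X n - x) + NN (Y n - y)"
      by (intro always_eventually allI)
  qed simp
  have "(\<lambda>n. ((NN (X n + Y n))^4 + (NN (X n - Y n))^4 - 2 * (NN (X n))^4 - 2 * (NN (Y n))^4) / 12)
      \<longlonglongrightarrow> ((NN (x + y))^4 + (NN (x - y))^4 - 2 * (NN x)^4 - 2 * (NN y)^4) / 12"
    by (intro tendsto_intros NN_tendsto[OF X l(1)] NN_tendsto[OF Y l(2)] NN_tendsto[OF _ _ p] NN_tendsto[OF _ _ m] H10_mem X Y) simp
  moreover have e: "sq2 U V = ((NN (U + V))^4 + (NN (U - V))^4 - 2 * (NN U)^4 - 2 * (NN V)^4) / 12"
    if "U \<in> H10 \<Omega>" "V \<in> H10 \<Omega>" for U V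
    using sq2_polarize[OF L4H[OF that(1)] L4H[OF that(2)]] by simp
  ultimately show ?thesis unfolding e[OF X(1) Y(1)] e[OF X(2) Y(2)] by simp
qed

section \<open>The uniform gain from independent shifts\<close>

context
  fixes \<kappa> :: real
  assumes \<kappa>: "\<kappa> > 0" and min: "\<And>V. V \<in> H10 \<Omega> \<Longrightarrow> \<kappa> * (pn V)\<^sup>2 \<le> Q V V"
begin

lemma L4min_bound: "L4min P \<Longrightarrow> \<kappa> * (NN P)\<^sup>2 \<le> Q P P"
  using min[OF L4min_H10, of P] pn_L4min[of P] by simp

text \<open>A minimising sequence of the scalar problem converges strongly: its parallelogram defect is
  controlled by the $L^4$ distance of its members.\<close>

lemma minimizing_converges:
  assumes X: "\<And>n::nat. L4min (X n)" and c: "sn_cauchy NN X"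
    and q: "(\<lambda>n. Q (X n) (X n)) \<longlonglongrightarrow> 1" and m: "(\<lambda>n. \<kappa> * (NN (X n))\<^sup>2) \<longlonglongrightarrow> 1"
  shows "\<exists>x\<in>H10 \<Omega>. (\<lambda>n. nH (X n - x)) \<longlonglongrightarrow> 0"
proof -
  have XH: "X n \<in> H10 \<Omega>" for n by (rule L4min_H10[OF X])
  have "Bseq (\<lambda>n. \<kappa> * (NN (X n))\<^sup>2)" by (rule convergent_imp_Bseq[OF convergentI[OF m]])
  then obtain M where M: "\<forall>n. norm (\<kappa> * (NN (X n))\<^sup>2) \<le> M" by (rule BseqE)
  define b where "b = sqrt (M / \<kappa>)"
  have b: "NN (X n) \<le> b" for n
  proof -
    have "(NN (X n))\<^sup>2 \<le> M / \<kappa>" using M[rule_format, of n] \<kappa> by (simp add: field_simps abs_mult)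
    then show ?thesis unfolding b_def by (rule real_le_rsqrt)
  qed
  have b0: "b \<ge> 0" using b[of 0] NN_nonneg[of "X 0"] by linarith
  have "sn_cauchy (\<lambda>U. sqrt (b0 U U)) X" by (rule sqrt_b0_cauchy[OF XH c])
  moreover have "sn_cauchy (\<lambda>U. a1 U U) X"
    unfolding sn_cauchy_def
  proof (intro allI impI)
    fix e :: real assume e: "e > 0"
    define d where "d = e / (16 * (\<kappa> * b + 1))"
    have pos: "\<kappa> * b + 1 > 0" using \<kappa> b0 by (simp add: add_nonneg_pos)
    have d: "d > 0" using e pos by (simp add: d_def)
    obtain N1 where N1: "\<And>i j. i \<ge> N1 \<Longrightarrow> j \<ge> N1 \<Longrightarrow> NN (X i - X j) \<le> d"
      using c d unfolding sn_cauchy_def by blast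
    have "\<forall>\<^sub>F n in sequentially. Q (X n) (X n) < 1 + e / 32" using e by (intro order_tendstoD(2)[OF q]) simp
    then obtain N2 where N2: "\<And>n. n \<ge> N2 \<Longrightarrow> Q (X n) (X n) < 1 + e / 32" by (auto simp: eventually_sequentially)
    have "\<forall>\<^sub>F n in sequentially. 1 - e / 32 < \<kappa> * (NN (X n))\<^sup>2" using e by (intro order_tendstoD(1)[OF m]) simp
    then obtain N3 where N3: "\<And>n. n \<ge> N3 \<Longrightarrow> 1 - e / 32 < \<kappa> * (NN (X n))\<^sup>2" by (auto simp: eventually_sequentially)
    define \<eta> where "\<eta> = sqrt (e / (2 * (lam + 1)))"
    have \<eta>: "\<eta> > 0" using e lam_nonneg by (simp add: \<eta>_def)
    have bc: "sn_cauchy (\<lambda>U. sqrt (b0 U U)) X" by (rule sqrt_b0_cauchy[OF XH c])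
    obtain N4 where N4: "\<And>i j. i \<ge> N4 \<Longrightarrow> j \<ge> N4 \<Longrightarrow> sqrt (b0 (X i - X j) (X i - X j)) \<le> \<eta>"
      using bc \<eta> unfolding sn_cauchy_def by blast
    have "a1 (X i - X j) (X i - X j) \<le> e" if ij: "i \<ge> max (max N1 N2) (max N3 N4)" "j \<ge> max (max N1 N2) (max N3 N4)" for i j
    proof -
      let ?p = "pn (X i + X j)" and ?m = "NN (X i)"
      have "2 * ?m \<le> ?p + d"
      proof -
        have e2: "2 *\<^sub>R X i = (X i + X j) + (X i - X j)" by (simp add: scaleR_2)
        have "pn (2 *\<^sub>R X i) \<le> pn (X i + X j) + pn (X i - X j)"
          unfolding e2 by (intro pn_triangle H10_mem XH)
        moreover have "pn (2 *\<^sub>R X i) = 2 * ?m" using pn_scale[OF XH, of 2 i] pn_L4min[OF X] by simp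
        moreover have "pn (X i - X j) \<le> d" using order_trans[OF pn_le_NN[OF H10_mem(3)[OF XH XH]] N1[of i j]] ij by simp
        ultimately show ?thesis by simp
      qed
      then have "4 * ?m\<^sup>2 - 4 * ?m * d \<le> ?p\<^sup>2"
      proof (cases "d \<le> 2 * ?m")
        case True
        assume "2 * ?m \<le> ?p + d"
        then have "(2 * ?m - d)\<^sup>2 \<le> ?p\<^sup>2" using True by (intro power_mono) auto
        moreover have "(2 * ?m - d)\<^sup>2 = 4 * ?m\<^sup>2 - 4 * ?m * d + d\<^sup>2" by (simp add: power2_eq_square algebra_simps)
        moreover have "x + d\<^sup>2 \<le> z \<Longrightarrow> x \<le> z" for x z using zero_le_power2[of d] by linarith
        ultimately show ?thesis by simp
      next
        case False
        then have "(2 * ?m) * (2 * ?m) \<le> (2 * ?m) * (2 * d)" using d by (intro mult_left_mono) auto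
        then have "4 * ?m\<^sup>2 - 4 * ?m * d \<le> 0" by (simp add: power2_eq_square)
        then show ?thesis using zero_le_power2[of ?p] by (rule order_trans)
      qed
      then have "\<kappa> * (4 * ?m\<^sup>2 - 4 * ?m * d) \<le> \<kappa> * ?p\<^sup>2" using \<kappa> by (intro mult_left_mono) auto
      also have "\<dots> \<le> Q (X i + X j) (X i + X j)" by (intro min H10_mem XH)
      finally have lo: "4 * (\<kappa> * ?m\<^sup>2) - 4 * (\<kappa> * ?m * d) \<le> Q (X i + X j) (X i + X j)"
        by (simp add: algebra_simps)
      have "\<kappa> * ?m * d \<le> (\<kappa> * b + 1) * d"
        using b[of i] \<kappa> d by (intro mult_right_mono) (simp_all add: add_increasing2)
      also have "\<dots> = e / 16" using pos by (simp add: d_def field_simps)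
      finally have dd: "\<kappa> * ?m * d \<le> e / 16" .
      have par: "Q (X i - X j) (X i - X j) + Q (X i + X j) (X i + X j) = 2 * Q (X i) (X i) + 2 * Q (X j) (X j)"
        by (rule Q.parallelogram[OF XH XH])
      \<comment> \<open>The budget: 2x + 2y exceeds 4 by at most e/8, 4k falls short of 4 by at most
        e/8, and 4l is at most e/4.\<close>
      have "t + s = 2 * x + 2 * y \<Longrightarrow> 4 * k - 4 * l \<le> s \<Longrightarrow> l \<le> e / 16 \<Longrightarrow> 1 - e / 32 < k \<Longrightarrow> x < 1 + e / 32
          \<Longrightarrow> y < 1 + e / 32 \<Longrightarrow> t \<le> e / 2" for t s x y k l by linarith
      from this[OF par lo dd N3[of i] N2[of i] N2[of j]] have q2: "Q (X i - X j) (X i - X j) \<le> e / 2" using ij by simp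
      have "(sqrt (b0 (X i - X j) (X i - X j)))\<^sup>2 \<le> \<eta>\<^sup>2" using N4[of i j] ij by (intro power_mono) auto
      then have "b0 (X i - X j) (X i - X j) \<le> e / (2 * (lam + 1))" using e lam_nonneg by (simp add: \<eta>_def)
      then have "(lam + 1) * b0 (X i - X j) (X i - X j) \<le> (lam + 1) * (e / (2 * (lam + 1)))"
        using lam_nonneg by (intro mult_left_mono) auto
      also have "\<dots> = e / 2"
      proof -
        have "l * (e / (2 * l)) = e / 2" if "l > 0" for l using that by simp
        from this[of "lam + 1"] show ?thesis using lam_nonneg by linarith
      qed
      finally have bb: "lam * b0 (X i - X j) (X i - X j) + b0 (X i - X j) (X i - X j) \<le> e / 2"
        by (simp add: distrib_right)
      have "a + - l \<le> e / 2 \<Longrightarrow> l + z \<le> e / 2 \<Longrightarrow> 0 \<le> z \<Longrightarrow> a \<le> e" for a l z by linarith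
      from this[OF q2[unfolded Q_def mult_minus_left] bb b0_nonneg] show ?thesis .
    qed
    then show "\<exists>N. \<forall>i\<ge>N. \<forall>j\<ge>N. a1 (X i - X j) (X i - X j) \<le> e" by blast
  qed
  ultimately show ?thesis by (intro H10_complete' XH nH_cauchyI)
qed

text \<open>The hypothesis at s = t = 0 is the equality case of Cauchy-Schwarz, so p^2 = r^2 almost
  everywhere. Then (p+r)/2 and (p-r)/2 have disjoint supports and are L^4-minimal themselves. With A
  and B their values of \<kappa> NN^2, A + B <= 1 and A^2 + B^2 = 1 force one of them to vanish, so
  r = \<sigma> p with \<sigma> = 1 or -1. Shifting p by s and r by -\<sigma> s lowers the coupling
  at order s^2 unless p \<phi>1 = 0, and this is excluded since \<phi>1 is nonzero almost everywhere
  on \<Omega>.\<close>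

lemma rigidity:
  assumes p: "L4min p" "Q p p = 1" "\<kappa>\<^sup>2 * (NN p)^4 = 1" and r: "L4min r" "Q r r = 1" "\<kappa>\<^sup>2 * (NN r)^4 = 1"
    and low: "\<And>s t. \<bar>s\<bar> \<le> 1 \<Longrightarrow> \<bar>t\<bar> \<le> 1 \<Longrightarrow> 1 \<le> \<kappa>\<^sup>2 * sq2 (p + s *\<^sub>R \<phi>1) (r + t *\<^sub>R \<phi>1)"
  shows False
proof -
  note pH = L4min_H10[OF p(1)] and rH = L4min_H10[OF r(1)]
  note Lp = L4H[OF pH] and Lr = L4H[OF rH] and Lf = L4H[OF phi(1)]
  note ip = L4_power4_integrable[OF Lp] and ir = L4_power4_integrable[OF Lr] and ipr = sq2_integrable[OF Lp Lr]
  have \<kappa>2: "\<kappa>\<^sup>2 > 0" using \<kappa> by simp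
  have int: "integrable lebesgue (\<lambda>x. ((fst p x)\<^sup>2 - (fst r x)\<^sup>2)\<^sup>2)"
    and val: "(LINT x|lebesgue. ((fst p x)\<^sup>2 - (fst r x)\<^sup>2)\<^sup>2) = (NN p)^4 - 2 * sq2 p r + (NN r)^4"
  proof -
    have e: "(\<lambda>x. ((fst p x)\<^sup>2 - (fst r x)\<^sup>2)\<^sup>2) = (\<lambda>x. (fst p x)^4 - 2 * ((fst p x)\<^sup>2 * (fst r x)\<^sup>2) + (fst r x)^4)"
      by (simp add: fun_eq_iff power2_eq_square power4_eq_xxxx algebra_simps)
    show "integrable lebesgue (\<lambda>x. ((fst p x)\<^sup>2 - (fst r x)\<^sup>2)\<^sup>2)" unfolding e using ip ir ipr by simp
    show "(LINT x|lebesgue. ((fst p x)\<^sup>2 - (fst r x)\<^sup>2)\<^sup>2) = (NN p)^4 - 2 * sq2 p r + (NN r)^4"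
      unfolding e using ip ir ipr by (simp add: NN_power4 sq2_def)
  qed
  have "\<kappa>\<^sup>2 * (LINT x|lebesgue. ((fst p x)\<^sup>2 - (fst r x)\<^sup>2)\<^sup>2) \<le> 0"
    unfolding val using low[of 0 0] p(3) r(3) by (simp add: algebra_simps)
  then have "(LINT x|lebesgue. ((fst p x)\<^sup>2 - (fst r x)\<^sup>2)\<^sup>2) = 0"
    using \<kappa>2 by (simp add: mult_le_0_iff order_antisym)
  then have "AE x in lebesgue. ((fst p x)\<^sup>2 - (fst r x)\<^sup>2)\<^sup>2 = 0"
    using integral_nonneg_eq_0_iff_AE[OF int] by simp
  then have sq: "AE x in lebesgue. (fst p x)\<^sup>2 = (fst r x)\<^sup>2" by eventually_elim simp
  define z where "z = (1/2) *\<^sub>R (p + r)"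
  define y where "y = (1/2) *\<^sub>R (p - r)"
  have zH: "z \<in> H10 \<Omega>" and yH: "y \<in> H10 \<Omega>" unfolding z_def y_def by (intro H10_mem pH rH)+
  note Lz = L4H[OF zH] and Ly = L4H[OF yH]
  have pzy: "p = z + y" "r = z - y"
    by (simp_all add: z_def y_def flip: scaleR_add_right scaleR_diff_right)
  have zy: "AE x in lebesgue. fst z x * fst y x = 0"
    using sq by eventually_elim (simp add: z_def y_def algebra_simps power2_eq_square)
  \<comment> \<open>Disjoint supports make cubes and fourth powers additive; thus the stationarity
    of p and r passes to z and y.\<close>
  have c3: "(u + v)^3 = u^3 + v^3" and c4: "(u + v)^4 = u^4 + v^4" if "u * v = 0" for u v :: real
    using that by auto
  have cub_split: "cub (z + c *\<^sub>R y) \<phi>1 = cub z \<phi>1 + c^3 * cub y \<phi>1" for c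
  proof -
    have "cub (z + c *\<^sub>R y) \<phi>1 = (LINT x|lebesgue. (fst z x)^3 * fst \<phi>1 x + c^3 * ((fst y x)^3 * fst \<phi>1 x))"
      unfolding cub_def
    proof (rule integral_cong_AE)
      show "(\<lambda>x. (fst (z + c *\<^sub>R y) x)^3 * fst \<phi>1 x) \<in> borel_measurable lebesgue"
        by (rule borel_measurable_integrable[OF cub_integrable[OF L4H[OF H10_mem(1)[OF zH H10_mem(2)[OF yH]]] Lf]])
      show "(\<lambda>x. (fst z x)^3 * fst \<phi>1 x + c^3 * ((fst y x)^3 * fst \<phi>1 x)) \<in> borel_measurable lebesgue"
        using cub_integrable[OF Lz Lf] cub_integrable[OF Ly Lf]
        by (intro borel_measurable_integrable Bochner_Integration.integrable_add integrable_mult_right)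
      show "AE x in lebesgue. (fst (z + c *\<^sub>R y) x)^3 * fst \<phi>1 x = (fst z x)^3 * fst \<phi>1 x + c^3 * ((fst y x)^3 * fst \<phi>1 x)"
        using zy
      proof eventually_elim
        case (elim x)
        have "(fst z x + c * fst y x)^3 = (fst z x)^3 + (c * fst y x)^3" using elim by (intro c3) auto
        then show ?case by (simp add: power_mult_distrib distrib_right)
      qed
    qed
    also have "\<dots> = cub z \<phi>1 + c^3 * cub y \<phi>1"
      using cub_integrable[OF Lz Lf] cub_integrable[OF Ly Lf] by (simp add: cub_def)
    finally show ?thesis .
  qed
  have "cub z \<phi>1 + cub y \<phi>1 = 0" using cub_split[of 1] cub_phi_zero[OF p(1)] pzy(1) by simp
  moreover have "cub z \<phi>1 - cub y \<phi>1 = 0" using cub_split[of "-1"] cub_phi_zero[OF r(1)] pzy(2) by simp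
  ultimately have "cub z \<phi>1 = 0" "cub y \<phi>1 = 0" by simp_all
  then have zmin: "L4min z" and ymin: "L4min y" by (auto intro: L4minI zH yH)
  have N4zy: "(NN p)^4 = (NN z)^4 + (NN y)^4"
  proof -
    have "(NN p)^4 = (LINT x|lebesgue. (fst z x)^4 + (fst y x)^4)"
      unfolding NN_power4
    proof (rule integral_cong_AE)
      show "(\<lambda>x. (fst p x)^4) \<in> borel_measurable lebesgue" by (rule borel_measurable_integrable[OF ip])
      show "(\<lambda>x. (fst z x)^4 + (fst y x)^4) \<in> borel_measurable lebesgue"
        by (intro borel_measurable_integrable Bochner_Integration.integrable_add L4_power4_integrable Lz Ly)
      show "AE x in lebesgue. (fst p x)^4 = (fst z x)^4 + (fst y x)^4"
        using zy by eventually_elim (simp add: pzy(1) c4)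
    qed
    also have "\<dots> = (NN z)^4 + (NN y)^4"
      using L4_power4_integrable[OF Lz] L4_power4_integrable[OF Ly] by (simp add: NN_power4)
    finally show ?thesis .
  qed
  define A where "A = \<kappa> * (NN z)\<^sup>2"
  define B where "B = \<kappa> * (NN y)\<^sup>2"
  have AB0: "A \<ge> 0" "B \<ge> 0" using \<kappa> by (simp_all add: A_def B_def)
  have "A \<le> Q z z" "B \<le> Q y y" unfolding A_def B_def by (rule L4min_bound[OF zmin], rule L4min_bound[OF ymin])
  moreover have "Q z z = Q (p + r) (p + r) / 4" "Q y y = Q (p - r) (p - r) / 4"
    unfolding z_def y_def Q.scale_both[OF H10_mem(1)[OF pH rH]] Q.scale_both[OF H10_mem(3)[OF pH rH]]
    by (simp_all add: power_divide)
  moreover have "Q (p - r) (p - r) + Q (p + r) (p + r) = 4" using Q.parallelogram[OF pH rH] p(2) r(2) by simp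
  moreover have "a \<le> u / 4 \<Longrightarrow> b \<le> v / 4 \<Longrightarrow> v + u = 4 \<Longrightarrow> a + b \<le> 1" for a b u v :: real by linarith
  ultimately have AB1: "A + B \<le> 1" by simp
  have AB2: "A\<^sup>2 + B\<^sup>2 = 1"
  proof -
    have "A\<^sup>2 + B\<^sup>2 = \<kappa>\<^sup>2 * (NN p)^4" unfolding A_def B_def N4zy
      by (simp add: power_mult_distrib distrib_left flip: power_mult)
    then show ?thesis using p(3) by simp
  qed
  have "(A + B)\<^sup>2 \<le> 1\<^sup>2" using AB1 AB0 by (intro power_mono) auto
  then have "A * B \<le> 0" using AB2 by (simp add: power2_sum)
  then have "A * B = 0" using mult_nonneg_nonneg[OF AB0] by (rule order_antisym)
  then have "NN z = 0 \<or> NN y = 0" using \<kappa> by (simp add: A_def B_def)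
  then obtain \<sigma> :: real where \<sigma>: "\<sigma>\<^sup>2 = 1" "\<bar>\<sigma>\<bar> = 1" and rp: "AE x in lebesgue. fst r x = \<sigma> * fst p x"
  proof
    assume "NN z = 0"
    from NN_zero_AE[OF Lz this] have "AE x in lebesgue. fst r x = (-1) * fst p x"
      by eventually_elim (simp add: pzy)
    then show ?thesis by (intro that[of "-1"]) auto
  next
    assume "NN y = 0"
    from NN_zero_AE[OF Ly this] have "AE x in lebesgue. fst r x = 1 * fst p x"
      by eventually_elim (simp add: pzy)
    then show ?thesis by (intro that[of 1]) auto
  qed
  define S where "S = sq2 p \<phi>1"
  define F where "F = (NN \<phi>1)^4"
  have F: "F \<ge> 0" unfolding F_def by simp
  note i3 = sq2_integrable[OF Lp Lf] and i4 = L4_power4_integrable[OF Lf]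
  \<comment> \<open>Opposite shifts turn the product of the squares into (p^2 - s^2 \<phi>1^2)^2;
    after integration the coefficient of s^2 is -2 S.\<close>
  have sS: "2 * S \<le> s\<^sup>2 * F" if s: "0 < s" "s \<le> 1" for s
  proof -
    have "sq2 (p + s *\<^sub>R \<phi>1) (r + (- \<sigma> * s) *\<^sub>R \<phi>1)
        = (LINT x|lebesgue. (fst p x)^4 - (2 * s\<^sup>2) * ((fst p x)\<^sup>2 * (fst \<phi>1 x)\<^sup>2) + s^4 * (fst \<phi>1 x)^4)"
      unfolding sq2_def
    proof (rule integral_cong_AE)
      show "(\<lambda>x. (fst (p + s *\<^sub>R \<phi>1) x)\<^sup>2 * (fst (r + (- \<sigma> * s) *\<^sub>R \<phi>1) x)\<^sup>2) \<in> borel_measurable lebesgue"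
        by (rule borel_measurable_integrable[OF sq2_integrable[OF L4H[OF phi_mem[OF pH]] L4H[OF phi_mem[OF rH]]]])
      show "(\<lambda>x. (fst p x)^4 - (2 * s\<^sup>2) * ((fst p x)\<^sup>2 * (fst \<phi>1 x)\<^sup>2) + s^4 * (fst \<phi>1 x)^4) \<in> borel_measurable lebesgue"
        using ip i3 i4 by (intro borel_measurable_integrable Bochner_Integration.integrable_add Bochner_Integration.integrable_diff integrable_mult_right)
      show "AE x in lebesgue. (fst (p + s *\<^sub>R \<phi>1) x)\<^sup>2 * (fst (r + (- \<sigma> * s) *\<^sub>R \<phi>1) x)\<^sup>2
          = (fst p x)^4 - (2 * s\<^sup>2) * ((fst p x)\<^sup>2 * (fst \<phi>1 x)\<^sup>2) + s^4 * (fst \<phi>1 x)^4"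
        using rp
      proof eventually_elim
        case (elim x)
        let ?p = "fst p x" and ?f = "fst \<phi>1 x"
        have "fst (r + (- \<sigma> * s) *\<^sub>R \<phi>1) x = \<sigma> * (?p - s * ?f)" using elim by (simp add: algebra_simps)
        then have "(fst (r + (- \<sigma> * s) *\<^sub>R \<phi>1) x)\<^sup>2 = (?p - s * ?f)\<^sup>2" using \<sigma>(1) by (simp add: power_mult_distrib)
        moreover have "(?p + s * ?f)\<^sup>2 * (?p - s * ?f)\<^sup>2 = ?p^4 - (2 * s\<^sup>2) * (?p\<^sup>2 * ?f\<^sup>2) + s^4 * ?f^4"
          by (simp add: power2_eq_square power4_eq_xxxx algebra_simps)
        ultimately show ?case by simp
      qed
    qed
    also have "\<dots> = (NN p)^4 - 2 * s\<^sup>2 * S + s^4 * F"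
      using ip i3 i4 by (simp add: NN_power4 S_def F_def sq2_def)
    finally have e: "sq2 (p + s *\<^sub>R \<phi>1) (r + (- \<sigma> * s) *\<^sub>R \<phi>1) = (NN p)^4 - 2 * s\<^sup>2 * S + s^4 * F" .
    have "1 \<le> \<kappa>\<^sup>2 * sq2 (p + s *\<^sub>R \<phi>1) (r + (- \<sigma> * s) *\<^sub>R \<phi>1)"
      using s \<sigma>(2) by (intro low) (simp_all add: abs_mult)
    then have "0 \<le> \<kappa>\<^sup>2 * (s^4 * F - 2 * s\<^sup>2 * S)" unfolding e using p(3) by (simp add: algebra_simps)
    then have "0 \<le> s^4 * F - 2 * s\<^sup>2 * S" using \<kappa>2 by (simp only: zero_le_mult_iff) linarith
    also have "s^4 * F - 2 * s\<^sup>2 * S = s\<^sup>2 * (s\<^sup>2 * F - 2 * S)" by (simp add: power2_eq_square power4_eq_xxxx algebra_simps)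
    finally show ?thesis using s by (simp add: zero_le_mult_iff)
  qed
  have "S \<le> 0"
  proof (rule ccontr)
    assume "\<not> S \<le> 0"
    then have S: "S > 0" by simp
    \<comment> \<open>Small enough for s^2 F <= S, which contradicts 2 S <= s^2 F when S >
      0.\<close>
    define s where "s = min 1 (sqrt (S / (F + 1)))"
    have F1: "F + 1 > 0" using F by simp
    have s: "0 < s" "s \<le> 1" using S F1 by (simp_all add: s_def)
    have "s\<^sup>2 \<le> (sqrt (S / (F + 1)))\<^sup>2" using s(1) by (intro power_mono) (simp_all add: s_def)
    also have "\<dots> = S / (F + 1)" using S F1 by simp
    finally have "s\<^sup>2 * F \<le> S / (F + 1) * F" using F by (rule mult_right_mono)
    also have "\<dots> \<le> S" using S F F1 by (simp add: field_simps)
    finally show False using sS[OF s] S by linarith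
  qed
  then have "S = 0" using sq2_nonneg[of p \<phi>1] by (simp add: S_def order_antisym)
  then have "AE x in lebesgue. (fst p x)\<^sup>2 * (fst \<phi>1 x)\<^sup>2 = 0"
    unfolding S_def sq2_def using integral_nonneg_eq_0_iff_AE[OF i3] by simp
  then have "AE x in lebesgue. fst p x = 0"
    using phi_nonzero H10_outside[OF pH] by eventually_elim (metis mult_eq_0_iff zero_eq_power2)
  then have "NN p = 0" by (rule NN_eq_0I)
  then show False using p(3) by simp
qed

text \<open>By contradiction and compactness. For total quadratic energy 2 the chain \<kappa>^2 sq2
  <= x w <= a b <= 1 makes a, b, x and w all tend to 1 along pairs with vanishing gain. Both
  components are then minimising for the scalar problem and converge strongly, and their limits
  contradict \<open>rigidity\<close>.\<close>

lemma coupling_gap: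
  "\<exists>\<delta>>0. \<forall>P R. L4min P \<longrightarrow> L4min R \<longrightarrow> Q P P + Q R R = 2 \<longrightarrow>
     (\<exists>s t. \<bar>s\<bar> \<le> 1 \<and> \<bar>t\<bar> \<le> 1 \<and> \<kappa>\<^sup>2 * sq2 (P + s *\<^sub>R \<phi>1) (R + t *\<^sub>R \<phi>1) \<le> 1 - \<delta>)"
proof (rule ccontr)
  assume neg: "\<not> ?thesis"
  define \<epsilon> :: "nat \<Rightarrow> real" where "\<epsilon> n = 1 / Suc n" for n
  have \<epsilon>: "0 < \<epsilon> n" "\<epsilon> n \<le> 1" for n by (simp_all add: \<epsilon>_def)
  have \<epsilon>l: "\<epsilon> \<longlonglongrightarrow> 0" unfolding \<epsilon>_def by (rule LIMSEQ_Suc[OF lim_1_over_n])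
  have "\<forall>n. \<exists>PR. L4min (fst PR) \<and> L4min (snd PR) \<and> Q (fst PR) (fst PR) + Q (snd PR) (snd PR) = 2 \<and>
      (\<forall>s t. \<bar>s\<bar> \<le> 1 \<longrightarrow> \<bar>t\<bar> \<le> 1 \<longrightarrow> 1 - \<epsilon> n < \<kappa>\<^sup>2 * sq2 (fst PR + s *\<^sub>R \<phi>1) (snd PR + t *\<^sub>R \<phi>1))"
  proof
    fix n
    obtain P R where "L4min P" "L4min R" "Q P P + Q R R = 2"
      "\<And>s t. \<bar>s\<bar> \<le> 1 \<Longrightarrow> \<bar>t\<bar> \<le> 1 \<Longrightarrow> \<not> \<kappa>\<^sup>2 * sq2 (P + s *\<^sub>R \<phi>1) (R + t *\<^sub>R \<phi>1) \<le> 1 - \<epsilon> n"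
      using neg \<epsilon>(1)[of n] by metis
    then show "\<exists>PR. L4min (fst PR) \<and> L4min (snd PR) \<and> Q (fst PR) (fst PR) + Q (snd PR) (snd PR) = 2 \<and>
      (\<forall>s t. \<bar>s\<bar> \<le> 1 \<longrightarrow> \<bar>t\<bar> \<le> 1 \<longrightarrow> 1 - \<epsilon> n < \<kappa>\<^sup>2 * sq2 (fst PR + s *\<^sub>R \<phi>1) (snd PR + t *\<^sub>R \<phi>1))"
      by (intro exI[of _ "(P, R)"]) (simp add: not_le)
  qed
  from choice[OF this] obtain PR where PR: "\<And>n. L4min (fst (PR n))" "\<And>n. L4min (snd (PR n))"
    "\<And>n. Q (fst (PR n)) (fst (PR n)) + Q (snd (PR n)) (snd (PR n)) = 2"
    "\<And>n s t. \<bar>s\<bar> \<le> 1 \<Longrightarrow> \<bar>t\<bar> \<le> 1 \<Longrightarrow> 1 - \<epsilon> n < \<kappa>\<^sup>2 * sq2 (fst (PR n) + s *\<^sub>R \<phi>1) (snd (PR n) + t *\<^sub>R \<phi>1)"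
    by blast
  define P where "P n = fst (PR n)" for n
  define R where "R n = snd (PR n)" for n
  note P = PR(1)[folded P_def] and R = PR(2)[folded R_def] and sum2 = PR(3)[folded P_def R_def]
    and low = PR(4)[folded P_def R_def]
  have PH: "P n \<in> H10 \<Omega>" and RH: "R n \<in> H10 \<Omega>" for n by (rule L4min_H10[OF P], rule L4min_H10[OF R])
  define a where "a n = Q (P n) (P n)" for n
  define b where "b n = Q (R n) (R n)" for n
  define x where "x n = \<kappa> * (NN (P n))\<^sup>2" for n
  define w where "w n = \<kappa> * (NN (R n))\<^sup>2" for n
  have ab: "a n + b n = 2" for n unfolding a_def b_def by (rule sum2)
  have xa: "x n \<le> a n" and wb: "w n \<le> b n" for n
    unfolding x_def a_def w_def b_def by (rule L4min_bound[OF P], rule L4min_bound[OF R])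
  have x0: "0 \<le> x n" and w0: "0 \<le> w n" for n using \<kappa> by (simp_all add: x_def w_def)
  have a0: "0 \<le> a n" and b0: "0 \<le> b n" for n using xa[of n] x0[of n] wb[of n] w0[of n] by linarith+
  have xw: "1 - \<epsilon> n < x n * w n" for n
  proof -
    have "1 - \<epsilon> n < \<kappa>\<^sup>2 * sq2 (P n) (R n)" using low[of 0 0 n] by simp
    also have "\<dots> \<le> \<kappa>\<^sup>2 * ((NN (P n))\<^sup>2 * (NN (R n))\<^sup>2)"
      by (intro mult_left_mono sq2_le L4H PH RH) auto
    also have "\<dots> = x n * w n" by (simp add: x_def w_def power2_eq_square)
    finally show ?thesis .
  qed
  have xb: "1 - \<epsilon> n \<le> x n * b n" and aw: "1 - \<epsilon> n \<le> w n * a n" and abl: "1 - \<epsilon> n < a n * b n" for n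
  proof -
    have "x n * w n \<le> x n * b n" "x n * w n \<le> a n * w n" by (intro mult_left_mono mult_right_mono wb xa x0 w0)+
    moreover have "x n * b n \<le> a n * b n" by (intro mult_right_mono xa b0)
    ultimately show "1 - \<epsilon> n \<le> x n * b n" "1 - \<epsilon> n \<le> w n * a n" "1 - \<epsilon> n < a n * b n"
      using xw[of n] by (simp_all add: mult.commute)
  qed
  have apos: "0 < a n" and bpos: "0 < b n" for n
  proof -
    have "0 < a n * b n" using abl[of n] \<epsilon>(2)[of n] by linarith
    then show "0 < a n" "0 < b n" using a0[of n] b0[of n] by (auto simp: zero_less_mult_iff)
  qed
  have al: "a \<longlonglongrightarrow> 1"
  proof -
    have le: "norm (a n - 1) \<le> sqrt (\<epsilon> n)" for n
    proof -
      have b: "b n = 2 - a n" using ab[of n] by simp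
      \<comment> \<open>As a + b = 2, the defect 1 - a b is a perfect square, so the energies
        equalise.\<close>
      have "(a n - 1)\<^sup>2 = 1 - a n * b n" unfolding b by (simp add: power2_eq_square algebra_simps)
      then have "(a n - 1)\<^sup>2 \<le> \<epsilon> n" using abl[of n] by simp
      then show ?thesis using real_sqrt_le_mono by fastforce
    qed
    have "(\<lambda>n. sqrt (\<epsilon> n)) \<longlonglongrightarrow> 0" using tendsto_real_sqrt[OF \<epsilon>l] by simp
    then have "(\<lambda>n. a n - 1) \<longlonglongrightarrow> 0"
      by (rule Lim_null_comparison[OF always_eventually, rotated]) (intro allI le)
    then show ?thesis by (simp add: LIM_zero_iff)
  qed
  have bl: "b \<longlonglongrightarrow> 1"
  proof -
    have "b n = 2 - a n" for n using ab[of n] by simp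
    then have "b = (\<lambda>n. 2 - a n)" by (rule ext)
    moreover have "(\<lambda>n. 2 - a n) \<longlonglongrightarrow> 2 - 1" by (intro tendsto_intros al)
    ultimately show ?thesis by simp
  qed
  have \<epsilon>1: "(\<lambda>n. 1 - \<epsilon> n) \<longlonglongrightarrow> 1" using tendsto_diff[OF tendsto_const \<epsilon>l, of 1] by simp
  have xl: "x \<longlonglongrightarrow> 1"
  proof (rule tendsto_sandwich[OF _ _ _ al])
    show "(\<lambda>n. (1 - \<epsilon> n) / b n) \<longlonglongrightarrow> 1" using tendsto_divide[OF \<epsilon>1 bl] by simp
    show "\<forall>\<^sub>F n in sequentially. (1 - \<epsilon> n) / b n \<le> x n"
      using xb bpos by (intro always_eventually allI) (simp add: pos_divide_le_eq)
  qed (use xa in \<open>simp add: always_eventually\<close>)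
  have wl: "w \<longlonglongrightarrow> 1"
  proof (rule tendsto_sandwich[OF _ _ _ bl])
    show "(\<lambda>n. (1 - \<epsilon> n) / a n) \<longlonglongrightarrow> 1" using tendsto_divide[OF \<epsilon>1 al] by simp
    show "\<forall>\<^sub>F n in sequentially. (1 - \<epsilon> n) / a n \<le> w n"
      using aw apos by (intro always_eventually allI) (simp add: pos_divide_le_eq)
  qed (use wb in \<open>simp add: always_eventually\<close>)
  have cpt: "\<exists>r :: nat \<Rightarrow> nat. strict_mono r \<and> sn_cauchy NN (X \<circ> r)"
    if X: "\<And>n. L4min (X n)" "\<And>n. Q (X n) (X n) \<le> 2" for X :: "nat \<Rightarrow> 'a h1"
  proof -
    have "nH (X n) \<le> 2 + (1 + lam) * ((vol + 1) * (sqrt (2 / \<kappa>) + 1)\<^sup>2)" for n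
    proof -
      have "\<kappa> * (NN (X n))\<^sup>2 \<le> 2" using L4min_bound[OF X(1)[of n]] X(2)[of n] by linarith
      then have "(NN (X n))\<^sup>2 \<le> 2 / \<kappa>" using \<kappa> by (simp add: field_simps)
      then have "NN (X n) \<le> sqrt (2 / \<kappa>)" by (rule real_le_rsqrt)
      from nH_le_Q[OF L4min_H10[OF X(1)] this] show ?thesis using X(2)[of n] by linarith
    qed
    then show ?thesis by (intro H10_compact' L4min_H10 X(1))
  qed
  have a2: "Q (P n) (P n) \<le> 2" and b2: "Q (R n) (R n) \<le> 2" for n
    using ab[of n] a0[of n] b0[of n] by (simp_all add: a_def b_def)
  obtain r1 :: "nat \<Rightarrow> nat" where r1: "strict_mono r1" "sn_cauchy NN (P \<circ> r1)" using cpt[of P, OF P a2] by blast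
  obtain r2 :: "nat \<Rightarrow> nat" where r2: "strict_mono r2" "sn_cauchy NN ((R \<circ> r1) \<circ> r2)"
    using cpt[of "R \<circ> r1"] R b2 by auto
  define r where "r = r1 \<circ> r2"
  have r: "strict_mono r" unfolding r_def by (rule strict_mono_o[OF r1(1) r2(1)])
  have Pc: "sn_cauchy NN (P \<circ> r)" using sn_cauchy_subseq[OF r1(2) r2(1)] by (simp add: r_def o_assoc)
  have Rc: "sn_cauchy NN (R \<circ> r)" using r2(2) by (simp add: r_def o_assoc)
  have conv: "\<exists>y\<in>H10 \<Omega>. L4min y \<and> Q y y = 1 \<and> \<kappa>\<^sup>2 * (NN y)^4 = 1 \<and> (\<lambda>n. NN (X (r n) - y)) \<longlonglongrightarrow> 0"
    if X: "\<And>n. L4min (X n)" "sn_cauchy NN (X \<circ> r)" "(\<lambda>n. Q (X n) (X n)) \<longlonglongrightarrow> 1" "(\<lambda>n. \<kappa> * (NN (X n))\<^sup>2) \<longlonglongrightarrow> 1"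
    for X :: "nat \<Rightarrow> 'a h1"
  proof -
    have q: "(\<lambda>n. Q (X (r n)) (X (r n))) \<longlonglongrightarrow> 1" and m: "(\<lambda>n. \<kappa> * (NN (X (r n)))\<^sup>2) \<longlonglongrightarrow> 1"
      using LIMSEQ_subseq_LIMSEQ[OF X(3) r] LIMSEQ_subseq_LIMSEQ[OF X(4) r] by (simp_all add: o_def)
    have XL: "L4min (X (r n))" for n by (rule X(1))
    note XH = L4min_H10[OF XL]
    obtain y where y: "y \<in> H10 \<Omega>" "(\<lambda>n. nH (X (r n) - y)) \<longlonglongrightarrow> 0"
      using minimizing_converges[of "\<lambda>n. X (r n)", OF XL X(2)[unfolded o_def] q m] by blast
    have l: "(\<lambda>n. NN (X (r n) - y)) \<longlonglongrightarrow> 0" by (rule NN_tendsto_0[of "\<lambda>n. X (r n)", OF XH y])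
    have "(\<lambda>n. Q (X (r n) - y) (X (r n) - y)) \<longlonglongrightarrow> 0"
      by (rule tendsto_sandwich[OF _ _ tendsto_const y(2)])
        (intro always_eventually allI Q_le_nH Q.nonneg H10_mem XH y(1))+
    then have "(\<lambda>n. Q (X (r n)) (X (r n))) \<longlonglongrightarrow> Q y y" by (rule Q.tendsto_B[of "\<lambda>n. X (r n)", OF XH y(1)])
    then have "Q y y = 1" using q LIMSEQ_unique by blast
    moreover have "(\<lambda>n. \<kappa> * (NN (X (r n)))\<^sup>2) \<longlonglongrightarrow> \<kappa> * (NN y)\<^sup>2"
      by (intro tendsto_intros NN_tendsto[of "\<lambda>n. X (r n)", OF XH y(1) l])
    then have "\<kappa> * (NN y)\<^sup>2 = 1" using m LIMSEQ_unique by blast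
    then have "(\<kappa> * (NN y)\<^sup>2)\<^sup>2 = 1" by simp
    then have "\<kappa>\<^sup>2 * (NN y)^4 = 1" by (simp add: power_mult_distrib flip: power_mult)
    moreover have "L4min y" by (rule L4min_tendsto[of "\<lambda>n. X (r n)", OF XL y(1) l])
    ultimately show ?thesis using y(1) l by blast
  qed
  obtain p where p: "p \<in> H10 \<Omega>" "L4min p" "Q p p = 1" "\<kappa>\<^sup>2 * (NN p)^4 = 1" "(\<lambda>n. NN (P (r n) - p)) \<longlonglongrightarrow> 0"
    using conv[of P, OF P Pc al[unfolded a_def] xl[unfolded x_def]] by blast
  obtain q where q: "q \<in> H10 \<Omega>" "L4min q" "Q q q = 1" "\<kappa>\<^sup>2 * (NN q)^4 = 1" "(\<lambda>n. NN (R (r n) - q)) \<longlonglongrightarrow> 0"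
    using conv[of R, OF R Rc bl[unfolded b_def] wl[unfolded w_def]] by blast
  show False
  proof (rule rigidity[OF p(2-4) q(2-4)])
    fix s t :: real assume st: "\<bar>s\<bar> \<le> 1" "\<bar>t\<bar> \<le> 1"
    have l: "(\<lambda>n. sq2 (P (r n) + s *\<^sub>R \<phi>1) (R (r n) + t *\<^sub>R \<phi>1)) \<longlonglongrightarrow> sq2 (p + s *\<^sub>R \<phi>1) (q + t *\<^sub>R \<phi>1)"
      by (rule sq2_tendsto) (simp_all add: phi_mem PH RH p q)
    show "1 \<le> \<kappa>\<^sup>2 * sq2 (p + s *\<^sub>R \<phi>1) (q + t *\<^sub>R \<phi>1)"
    proof (rule LIMSEQ_le)
      show "(\<lambda>n. 1 - \<epsilon> (r n)) \<longlonglongrightarrow> 1" using LIMSEQ_subseq_LIMSEQ[OF \<epsilon>1 r] by (simp add: o_def)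
      show "(\<lambda>n. \<kappa>\<^sup>2 * sq2 (P (r n) + s *\<^sub>R \<phi>1) (R (r n) + t *\<^sub>R \<phi>1)) \<longlonglongrightarrow> \<kappa>\<^sup>2 * sq2 (p + s *\<^sub>R \<phi>1) (q + t *\<^sub>R \<phi>1)"
        by (intro tendsto_intros l)
      show "\<exists>N. \<forall>n\<ge>N. 1 - \<epsilon> (r n) \<le> \<kappa>\<^sup>2 * sq2 (P (r n) + s *\<^sub>R \<phi>1) (R (r n) + t *\<^sub>R \<phi>1)"
        using low[OF st] by (intro exI[of _ 0] allI impI less_imp_le)
    qed
  qed
qed

end

end

section \<open>Comparison of the levels\<close>

lemma hadd_eq: "hadd U V = U + V"
  by (simp add: hadd_def prod_eq_iff plus_fun_def)

lemma hscale_eq: "hscale t U = t *\<^sub>R U"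
  by (simp add: hscale_def prod_eq_iff scaleR_fun_def)

lemma tvec_eq: "tvec \<phi> s t = (s *\<^sub>R \<phi>, t *\<^sub>R \<phi>)"
  by (simp add: tvec_def prod_eq_iff scaleR_fun_def)

context eigen_domain
begin

section \<open>The energy in terms of \<open>Q\<close>, \<open>NN\<close> and
  \<open>sq2\<close>\<close>

lemma integ_Q:
  assumes "U \<in> H10 \<Omega>"
  shows "integ \<Omega> (\<lambda>x. (norm (snd U x))\<^sup>2 - lam * (fst U x)\<^sup>2) = Q U U"
proof -
  note i = L2p_square_integrable[OF H10_L2p[OF assms]]
  have "integ \<Omega> (\<lambda>x. (norm (snd U x))\<^sup>2 - lam * (fst U x)\<^sup>2) = (LINT x|lebesgue. (norm (snd U x))\<^sup>2 - lam * (fst U x)\<^sup>2)"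
  proof (rule integ_eq)
    show "(\<lambda>x. (norm (snd U x))\<^sup>2 - lam * (fst U x)\<^sup>2) \<in> borel_measurable lebesgue"
      using i by (intro borel_measurable_integrable Bochner_Integration.integrable_diff integrable_mult_right)
    show "AE x in lebesgue. x \<notin> \<Omega> \<longrightarrow> (norm (snd U x))\<^sup>2 - lam * (fst U x)\<^sup>2 = 0"
      using H10_outside[OF assms] by eventually_elim simp
  qed
  also have "\<dots> = (LINT x|lebesgue. (norm (snd U x))\<^sup>2) - lam * (LINT x|lebesgue. (fst U x)\<^sup>2)" using i by simp
  also have "(LINT x|lebesgue. (norm (snd U x))\<^sup>2) = a1 U U" by (simp add: a1_def power2_norm_eq_inner)
  also have "(LINT x|lebesgue. (fst U x)\<^sup>2) = b0 U U" by (simp add: b0_def power2_eq_square)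
  also have "a1 U U - lam * b0 U U = Q U U" by (simp add: Q_def)
  finally show ?thesis .
qed

lemma energy_eq:
  assumes U: "U \<in> H10 \<Omega>" and V: "V \<in> H10 \<Omega>"
  shows "energy \<Omega> lam \<mu>1 \<mu>2 \<beta> (U, V) = 1/2 * (Q U U + Q V V)
    - 1/4 * (\<mu>1 * (NN U)^4 + \<mu>2 * (NN V)^4 + 2 * \<beta> * sq2 U V)"
proof -
  note i = L4_power4_integrable[OF L4H[OF U]] L4_power4_integrable[OF L4H[OF V]] sq2_integrable[OF L4H[OF U] L4H[OF V]]
  let ?q = "\<lambda>x. \<mu>1 * (fst U x)^4 + \<mu>2 * (fst V x)^4 + 2 * \<beta> * (fst U x)\<^sup>2 * (fst V x)\<^sup>2"
  have e: "?q = (\<lambda>x. \<mu>1 * (fst U x)^4 + \<mu>2 * (fst V x)^4 + (2 * \<beta>) * ((fst U x)\<^sup>2 * (fst V x)\<^sup>2))"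
    by (simp add: fun_eq_iff)
  have "integ \<Omega> ?q = (LINT x|lebesgue. ?q x)"
  proof (rule integ_eq)
    show "?q \<in> borel_measurable lebesgue"
      unfolding e using i by (intro borel_measurable_integrable Bochner_Integration.integrable_add integrable_mult_right)
    show "AE x in lebesgue. x \<notin> \<Omega> \<longrightarrow> ?q x = 0"
      using H10_outside[OF U] H10_outside[OF V] by eventually_elim simp
  qed
  also have "\<dots> = \<mu>1 * (NN U)^4 + \<mu>2 * (NN V)^4 + 2 * \<beta> * sq2 U V"
    unfolding e using i by (simp add: NN_power4 sq2_def)
  finally show ?thesis by (simp add: energy_def integ_Q U V)
qed

lemma in_Ht_iff:
  "in_Ht \<Omega> \<phi>1 (U, V) \<longleftrightarrow> (\<exists>s t. AE x in lebesgue. x \<in> \<Omega> \<longrightarrow>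
    fst U x = s * fst \<phi>1 x \<and> snd U x = s *\<^sub>R snd \<phi>1 x \<and> fst V x = t * fst \<phi>1 x \<and> snd V x = t *\<^sub>R snd \<phi>1 x)"
  by (simp add: in_Ht_def tvec_def)

text \<open>Simplicity of the eigenvalue: if \<open>Q\<close> vanished in both components, the pair
  would lie in the eigenspace.\<close>

lemma not_in_Ht_Q_pos:
  assumes U: "U \<in> H10 \<Omega>" and V: "V \<in> H10 \<Omega>" and n: "\<not> in_Ht \<Omega> \<phi>1 (U, V)"
  shows "Q U U + Q V V > 0"
proof (rule ccontr)
  assume "\<not> ?thesis"
  then have "Q U U = 0" "Q V V = 0" using Q.nonneg[OF U] Q.nonneg[OF V] by linarith+
  then obtain s t where "AE x in lebesgue. fst U x = s * fst \<phi>1 x \<and> snd U x = s *\<^sub>R snd \<phi>1 x"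
    "AE x in lebesgue. fst V x = t * fst \<phi>1 x \<and> snd V x = t *\<^sub>R snd \<phi>1 x"
    using eigen_simple[OF U] eigen_simple[OF V] by blast
  then have "AE x in lebesgue. x \<in> \<Omega> \<longrightarrow>
    fst U x = s * fst \<phi>1 x \<and> snd U x = s *\<^sub>R snd \<phi>1 x \<and> fst V x = t * fst \<phi>1 x \<and> snd V x = t *\<^sub>R snd \<phi>1 x"
    by eventually_elim simp
  then show False using n unfolding in_Ht_iff by blast
qed

text \<open>U itself and the pairs \<open>tvec\<close> are among the test directions in
  \<open>HH\<close>. This inclusion is the inequality between the first two levels.\<close>

lemma CritK_subset_NehariN: "CritK \<Omega> lam \<phi>1 \<mu>1 \<mu>2 \<beta> \<subseteq> NehariN \<Omega> lam \<phi>1 \<mu>1 \<mu>2 \<beta>"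
proof -
  have "tvec \<phi>1 s t \<in> HH \<Omega>" for s t
    unfolding tvec_eq HH_def by (intro SigmaI H10_mem phi(1))
  then show ?thesis unfolding CritK_def NehariN_def by blast
qed

section \<open>Upper bound for the critical level by synchronized pairs\<close>

context
  fixes \<kappa> :: real and W :: "'a h1"
  assumes \<kappa>: "\<kappa> > 0" and W: "L4min W" "NN W = 1" "Q W W = \<kappa>"
    and weak: "\<And>V. V \<in> H10 \<Omega> \<Longrightarrow> Q W V = \<kappa> * cub W V"
begin

text \<open>The amplitude equations reduce both component equations to the scalar one. The coupling
  term is differentiated through \<open>sq2_polarize\<close>, so only fourth powers of norms along
  lines need derivatives.\<close>

lemma synchronized_critical:
  assumes ab: "a > 0" "\<mu>1 * a\<^sup>2 + \<beta> * b\<^sup>2 = \<kappa>" "\<mu>2 * b\<^sup>2 + \<beta> * a\<^sup>2 = \<kappa>"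
  shows "(a *\<^sub>R W, b *\<^sub>R W) \<in> CritK \<Omega> lam \<phi>1 \<mu>1 \<mu>2 \<beta>"
    and "energy \<Omega> lam \<mu>1 \<mu>2 \<beta> (a *\<^sub>R W, b *\<^sub>R W) = 1/4 * \<kappa> * (a\<^sup>2 + b\<^sup>2)"
proof -
  note WH = L4min_H10[OF W(1)]
  have aW: "c *\<^sub>R W \<in> H10 \<Omega>" for c by (rule H10_mem(2)[OF WH])
  have WW: "sq2 W W = 1"
  proof -
    have "sq2 W W = (NN W)^4" unfolding NN_power4 sq2_def by (simp flip: power_add)
    then show ?thesis using W(2) by simp
  qed
  have "energy \<Omega> lam \<mu>1 \<mu>2 \<beta> (a *\<^sub>R W, b *\<^sub>R W)
      = 1/2 * (a\<^sup>2 * \<kappa> + b\<^sup>2 * \<kappa>) - 1/4 * (\<mu>1 * a^4 + \<mu>2 * b^4 + 2 * \<beta> * (a\<^sup>2 * b\<^sup>2))"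
    by (simp add: energy_eq aW Q.scale_both WH W NN_scale_power4 sq2_scale WW)
  also have "\<mu>1 * a^4 + \<mu>2 * b^4 + 2 * \<beta> * (a\<^sup>2 * b\<^sup>2) = a\<^sup>2 * (\<mu>1 * a\<^sup>2 + \<beta> * b\<^sup>2) + b\<^sup>2 * (\<mu>2 * b\<^sup>2 + \<beta> * a\<^sup>2)"
    by (simp add: power2_eq_square power4_eq_xxxx algebra_simps)
  finally show "energy \<Omega> lam \<mu>1 \<mu>2 \<beta> (a *\<^sub>R W, b *\<^sub>R W) = 1/4 * \<kappa> * (a\<^sup>2 + b\<^sup>2)"
    unfolding ab by (simp add: algebra_simps)
  have "\<not> in_Ht \<Omega> \<phi>1 (a *\<^sub>R W, b *\<^sub>R W)"
  proof
    assume "in_Ht \<Omega> \<phi>1 (a *\<^sub>R W, b *\<^sub>R W)"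
    then obtain s t where "AE x in lebesgue. x \<in> \<Omega> \<longrightarrow> fst (a *\<^sub>R W) x = s * fst \<phi>1 x \<and> snd (a *\<^sub>R W) x = s *\<^sub>R snd \<phi>1 x \<and>
        fst (b *\<^sub>R W) x = t * fst \<phi>1 x \<and> snd (b *\<^sub>R W) x = t *\<^sub>R snd \<phi>1 x"
      unfolding in_Ht_iff by blast
    then have "AE x in lebesgue. fst (W + (- (s / a)) *\<^sub>R \<phi>1) x = 0"
      using H10_outside[OF WH] H10_outside[OF phi(1)]
      by eventually_elim (use ab(1) in \<open>auto simp: field_simps\<close>)
    then have "NN (W + (- (s / a)) *\<^sub>R \<phi>1) = 0" by (rule NN_eq_0I)
    moreover have "NN W \<le> NN (W + (- (s / a)) *\<^sub>R \<phi>1)" using W(1) unfolding L4min_def by blast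
    ultimately show False using W(2) by simp
  qed
  moreover have "dI \<Omega> lam \<mu>1 \<mu>2 \<beta> (a *\<^sub>R W, b *\<^sub>R W) V 0" if V: "V \<in> HH \<Omega>" for V
  proof -
    obtain X Y where XY: "V = (X, Y)" "X \<in> H10 \<Omega>" "Y \<in> H10 \<Omega>" using V by (auto simp: HH_def)
    define x where "x = cub W X"
    define y where "y = cub W Y"
    let ?U = "\<lambda>s. a *\<^sub>R W + s *\<^sub>R X" and ?V = "\<lambda>s. b *\<^sub>R W + s *\<^sub>R Y"
    have UV: "?U s \<in> H10 \<Omega>" "?V s \<in> H10 \<Omega>" for s by (intro H10_mem WH XY)+
    have QU: "Q (?U s) (?U s) = a\<^sup>2 * \<kappa> + 2 * s * (a * \<kappa> * x) + s\<^sup>2 * Q X X" for s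
      using Q.expand[OF aW XY(2), of a s] Q.scale_both[OF WH, of a] Q.scale_left[OF WH XY(2), of a] weak[OF XY(2)] W(3)
      by (simp add: x_def)
    have QV: "Q (?V s) (?V s) = b\<^sup>2 * \<kappa> + 2 * s * (b * \<kappa> * y) + s\<^sup>2 * Q Y Y" for s
      using Q.expand[OF aW XY(3), of b s] Q.scale_both[OF WH, of b] Q.scale_left[OF WH XY(3), of b] weak[OF XY(3)] W(3)
      by (simp add: y_def)
    have line: "((\<lambda>s. (NN (c *\<^sub>R W + s *\<^sub>R Z))^4) has_real_derivative 4 * c^3 * cub W Z) (at 0)" if Z: "Z \<in> H10 \<Omega>" for c Z
      unfolding NN_power4_line[OF L4H[OF aW] L4H[OF Z]]
      by (auto intro!: derivative_eq_intros simp: cub_scale_left)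
    have sq: "sq2 (?U s) (?V s) = ((NN ((a + b) *\<^sub>R W + s *\<^sub>R (X + Y)))^4 + (NN ((a - b) *\<^sub>R W + s *\<^sub>R (X - Y)))^4
        - 2 * (NN (?U s))^4 - 2 * (NN (?V s))^4) / 12" for s
    proof -
      have "?U s + ?V s = (a + b) *\<^sub>R W + s *\<^sub>R (X + Y)" "?U s - ?V s = (a - b) *\<^sub>R W + s *\<^sub>R (X - Y)"
        by (simp_all add: scaleR_add_left scaleR_diff_left scaleR_add_right scaleR_diff_right)
      then show ?thesis using sq2_polarize[OF L4H[OF UV(1)] L4H[OF UV(2)], of s s] by simp
    qed
    have cXY: "cub W (X + Y) = x + y" "cub W (X - Y) = x - y"
      using cub_add_right[OF WH XY(2,3)] cub_add_right[OF WH XY(2) H10_mem(2)[OF XY(3), of "-1"]] cub_scale_right[of W "-1" Y]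
      by (simp_all add: x_def y_def)
    note dU = line[OF XY(2), of a, folded x_def] and dV = line[OF XY(3), of b, folded y_def]
      and dP = line[OF H10_mem(1)[OF XY(2,3)], of "a + b", unfolded cXY] and dM = line[OF H10_mem(3)[OF XY(2,3)], of "a - b", unfolded cXY]
    have ds: "((\<lambda>s. sq2 (?U s) (?V s)) has_real_derivative 2 * a * b\<^sup>2 * x + 2 * a\<^sup>2 * b * y) (at 0)"
    proof -
      have "((\<lambda>s. sq2 (?U s) (?V s)) has_real_derivative
          (4 * (a + b)^3 * (x + y) + 4 * (a - b)^3 * (x - y) - 2 * (4 * a^3 * x) - 2 * (4 * b^3 * y)) / 12) (at 0)"
        unfolding sq by (intro DERIV_cdivide DERIV_diff DERIV_add DERIV_cmult dP dM dU dV)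
      also have "(4 * (a + b)^3 * (x + y) + 4 * (a - b)^3 * (x - y) - 2 * (4 * a^3 * x) - 2 * (4 * b^3 * y)) / 12
          = 2 * a * b\<^sup>2 * x + 2 * a\<^sup>2 * b * y"
        by (simp add: power2_eq_square power3_eq_cube algebra_simps)
      finally show ?thesis .
    qed
    have dQ: "((\<lambda>s. Q (?U s) (?U s) + Q (?V s) (?V s)) has_real_derivative 2 * (a * \<kappa> * x) + 2 * (b * \<kappa> * y)) (at 0)"
      unfolding QU QV by (auto intro!: derivative_eq_intros)
    have "((\<lambda>s. energy \<Omega> lam \<mu>1 \<mu>2 \<beta> (?U s, ?V s)) has_real_derivative
        1/2 * (2 * (a * \<kappa> * x) + 2 * (b * \<kappa> * y))
        - 1/4 * (\<mu>1 * (4 * a^3 * x) + \<mu>2 * (4 * b^3 * y) + 2 * \<beta> * (2 * a * b\<^sup>2 * x + 2 * a\<^sup>2 * b * y))) (at 0)"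
      unfolding energy_eq[OF UV] by (intro DERIV_diff DERIV_cmult DERIV_add dQ dU dV ds)
    also have "1/2 * (2 * (a * \<kappa> * x) + 2 * (b * \<kappa> * y))
        - 1/4 * (\<mu>1 * (4 * a^3 * x) + \<mu>2 * (4 * b^3 * y) + 2 * \<beta> * (2 * a * b\<^sup>2 * x + 2 * a\<^sup>2 * b * y))
      = a * x * (\<kappa> - (\<mu>1 * a\<^sup>2 + \<beta> * b\<^sup>2)) + b * y * (\<kappa> - (\<mu>2 * b\<^sup>2 + \<beta> * a\<^sup>2))"
      by (simp add: power2_eq_square power3_eq_cube algebra_simps)
    also have "\<dots> = 0" unfolding ab by simp
    finally show ?thesis unfolding dI_def hadd_eq hscale_eq XY(1) by simp
  qed
  ultimately show "(a *\<^sub>R W, b *\<^sub>R W) \<in> CritK \<Omega> lam \<phi>1 \<mu>1 \<mu>2 \<beta>"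
    unfolding CritK_def HH_def using aW by simp
qed

lemma crit_level_le:
  assumes \<mu>: "\<mu>1 > 0" "\<mu>2 > 0" and \<beta>: "\<beta> > \<mu>1" "\<beta> > \<mu>2"
  shows "inf_level \<Omega> lam \<mu>1 \<mu>2 \<beta> (CritK \<Omega> lam \<phi>1 \<mu>1 \<mu>2 \<beta>)
    \<le> ereal (1/4 * \<kappa>\<^sup>2 * ((2 * \<beta> - \<mu>1 - \<mu>2) / (\<beta>\<^sup>2 - \<mu>1 * \<mu>2)))"
proof -
  define D where "D = \<beta>\<^sup>2 - \<mu>1 * \<mu>2"
  have "\<mu>1 * \<mu>2 < \<beta> * \<beta>" using \<mu> \<beta> by (intro mult_strict_mono) auto
  then have D: "D > 0" by (simp add: D_def power2_eq_square)
  \<comment> \<open>Cramer's rule for the squared amplitudes A = a^2 and B = b^2; since \<beta>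
    exceeds \<mu>1 and \<mu>2, numerators and determinant are positive.\<close>
  define A where "A = \<kappa> * (\<beta> - \<mu>2) / D"
  define B where "B = \<kappa> * (\<beta> - \<mu>1) / D"
  have AB: "A > 0" "B > 0" using \<kappa> \<beta> D by (simp_all add: A_def B_def)
  have sq: "(sqrt A)\<^sup>2 = A" "(sqrt B)\<^sup>2 = B" using AB by simp_all
  have "\<mu>1 * A + \<beta> * B = \<kappa> * (\<mu>1 * (\<beta> - \<mu>2) + \<beta> * (\<beta> - \<mu>1)) / D"
    by (simp add: A_def B_def add_divide_distrib distrib_left mult_ac)
  also have "\<mu>1 * (\<beta> - \<mu>2) + \<beta> * (\<beta> - \<mu>1) = D" by (simp add: D_def power2_eq_square algebra_simps)
  finally have 1: "\<mu>1 * (sqrt A)\<^sup>2 + \<beta> * (sqrt B)\<^sup>2 = \<kappa>" unfolding sq using D by simp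
  have "\<mu>2 * B + \<beta> * A = \<kappa> * (\<mu>2 * (\<beta> - \<mu>1) + \<beta> * (\<beta> - \<mu>2)) / D"
    by (simp add: A_def B_def add_divide_distrib distrib_left mult_ac)
  also have "\<mu>2 * (\<beta> - \<mu>1) + \<beta> * (\<beta> - \<mu>2) = D" by (simp add: D_def power2_eq_square algebra_simps)
  finally have 2: "\<mu>2 * (sqrt B)\<^sup>2 + \<beta> * (sqrt A)\<^sup>2 = \<kappa>" unfolding sq using D by simp
  have pos: "sqrt A > 0" using AB by simp
  have e: "energy \<Omega> lam \<mu>1 \<mu>2 \<beta> (sqrt A *\<^sub>R W, sqrt B *\<^sub>R W) = 1/4 * \<kappa>\<^sup>2 * ((2 * \<beta> - \<mu>1 - \<mu>2) / D)"
  proof -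
    have "A + B = \<kappa> * (2 * \<beta> - \<mu>1 - \<mu>2) / D" by (simp add: A_def B_def add_divide_distrib[symmetric] algebra_simps)
    then show ?thesis using synchronized_critical(2)[OF pos 1 2, unfolded sq] by (simp add: power2_eq_square)
  qed
  have "(INF U\<in>CritK \<Omega> lam \<phi>1 \<mu>1 \<mu>2 \<beta>. ereal (energy \<Omega> lam \<mu>1 \<mu>2 \<beta> U)) \<le> ereal (energy \<Omega> lam \<mu>1 \<mu>2 \<beta> (sqrt A *\<^sub>R W, sqrt B *\<^sub>R W))"
    by (rule INF_lower[OF synchronized_critical(1)[OF pos 1 2]])
  then show ?thesis unfolding inf_level_def e D_def .
qed

end

section \<open>Lower bound for the level of maximisers\<close>

lemma L4min_scale:
  assumes "L4min U" shows "L4min (c *\<^sub>R U)"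
  using L4min_H10[OF assms] cub_phi_zero[OF assms] by (intro L4minI H10_mem) (simp_all add: cub_scale_left)

text \<open>The energy of Z dominates that of every nonnegative multiple plus any shift, so one good
  competitor suffices. It is built from the L^4-minimal representatives of both components, scaled
  by a common factor to total quadratic energy 2, shifted by the s and t of the gap, and dilated by
  \<tau>. Its energy is \<tau>^2 - \<tau>^4/4 times a quartic term that is at most G.\<close>

lemma NehariN'_level_ge:
  assumes \<kappa>: "\<kappa> > 0" and min: "\<And>V. V \<in> H10 \<Omega> \<Longrightarrow> \<kappa> * (pn V)\<^sup>2 \<le> Q V V"
    and gap: "\<And>P R. L4min P \<Longrightarrow> L4min R \<Longrightarrow> Q P P + Q R R = 2 \<Longrightarrow>
       \<exists>s t. \<bar>s\<bar> \<le> 1 \<and> \<bar>t\<bar> \<le> 1 \<and> \<kappa>\<^sup>2 * sq2 (P + s *\<^sub>R \<phi>1) (R + t *\<^sub>R \<phi>1) \<le> 1 - \<delta>"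
    and \<mu>: "\<mu>1 > 0" "\<mu>2 > 0" and \<beta>: "\<beta> > 0"
  defines "G \<equiv> (\<mu>1 + \<mu>2) * (sqrt (2 / \<kappa>) + NN \<phi>1)^4 + 2 * \<beta> * (1 - \<delta>) / \<kappa>\<^sup>2"
  assumes G: "G > 0"
  shows "ereal (1 / G) \<le> inf_level \<Omega> lam \<mu>1 \<mu>2 \<beta> (NehariN' \<Omega> lam \<phi>1 \<mu>1 \<mu>2 \<beta>)"
  unfolding inf_level_def
proof (rule INF_greatest)
  fix Z assume Z: "Z \<in> NehariN' \<Omega> lam \<phi>1 \<mu>1 \<mu>2 \<beta>"
  obtain U V where UV: "Z = (U, V)" by (cases Z)
  have U: "U \<in> H10 \<Omega>" and V: "V \<in> H10 \<Omega>" and n: "\<not> in_Ht \<Omega> \<phi>1 (U, V)"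
    and max: "\<And>t s1 s2. t \<ge> 0 \<Longrightarrow> energy \<Omega> lam \<mu>1 \<mu>2 \<beta> (hadd (hscale t (U, V)) (tvec \<phi>1 s1 s2)) \<le> energy \<Omega> lam \<mu>1 \<mu>2 \<beta> (U, V)"
    using Z unfolding NehariN'_def UV HH_def by auto
  define q where "q = Q U U + Q V V"
  have q: "q > 0" unfolding q_def by (rule not_in_Ht_Q_pos[OF U V n])
  define c where "c = sqrt (2 / q)"
  have c: "c > 0" "c\<^sup>2 = 2 / q" using q by (simp_all add: c_def)
  define P where "P = c *\<^sub>R repr U"
  define R where "R = c *\<^sub>R repr V"
  have P: "L4min P" and R: "L4min R" unfolding P_def R_def by (intro L4min_scale repr_L4min U V)+
  note PH = L4min_H10[OF P] and RH = L4min_H10[OF R]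
  have QP: "Q P P = c\<^sup>2 * Q U U" "Q R R = c\<^sup>2 * Q V V"
    unfolding P_def R_def using Q.scale_both[OF L4min_H10[OF repr_L4min[OF U]]] Q.scale_both[OF L4min_H10[OF repr_L4min[OF V]]]
      Q_shift[OF U] Q_shift[OF V] by (simp_all add: repr_def)
  have "Q P P + Q R R = c\<^sup>2 * q" unfolding QP q_def by (simp add: distrib_left)
  then have sum: "Q P P + Q R R = 2" using q c(2) by simp
  obtain s t where st: "\<bar>s\<bar> \<le> 1" "\<bar>t\<bar> \<le> 1" "\<kappa>\<^sup>2 * sq2 (P + s *\<^sub>R \<phi>1) (R + t *\<^sub>R \<phi>1) \<le> 1 - \<delta>"
    using gap[OF P R sum] by blast
  let ?P = "P + s *\<^sub>R \<phi>1" and ?R = "R + t *\<^sub>R \<phi>1"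
  have bound: "(NN (X + u *\<^sub>R \<phi>1))^4 \<le> (sqrt (2 / \<kappa>) + NN \<phi>1)^4" if X: "L4min X" "Q X X \<le> 2" "\<bar>u\<bar> \<le> 1" for X u
  proof -
    have "\<kappa> * (NN X)\<^sup>2 \<le> 2" using min[OF L4min_H10[OF X(1)]] pn_L4min[OF X(1)] X(2) by simp
    then have "(NN X)\<^sup>2 \<le> 2 / \<kappa>" using \<kappa> by (simp add: field_simps)
    then have "NN X \<le> sqrt (2 / \<kappa>)" by (rule real_le_rsqrt)
    moreover have "NN (u *\<^sub>R \<phi>1) \<le> NN \<phi>1" using X(3) by (simp add: NN_scale mult_left_le_one_le)
    moreover have "NN (X + u *\<^sub>R \<phi>1) \<le> NN X + NN (u *\<^sub>R \<phi>1)" by (intro NN_add_le H10_mem L4min_H10 X(1) phi(1))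
    ultimately show ?thesis by (intro power_mono) simp_all
  qed
  have "Q P P \<le> 2" "Q R R \<le> 2" using sum Q.nonneg[OF PH] Q.nonneg[OF RH] by linarith+
  then have b: "(NN ?P)^4 \<le> (sqrt (2 / \<kappa>) + NN \<phi>1)^4" "(NN ?R)^4 \<le> (sqrt (2 / \<kappa>) + NN \<phi>1)^4"
    using bound P R st by blast+
  have "sq2 ?P ?R \<le> (1 - \<delta>) / \<kappa>\<^sup>2" using st(3) \<kappa> by (simp add: pos_le_divide_eq mult.commute)
  then have "2 * \<beta> * sq2 ?P ?R \<le> 2 * \<beta> * ((1 - \<delta>) / \<kappa>\<^sup>2)" using \<beta> by (intro mult_left_mono) auto
  moreover have "\<mu>1 * (NN ?P)^4 \<le> \<mu>1 * (sqrt (2 / \<kappa>) + NN \<phi>1)^4" "\<mu>2 * (NN ?R)^4 \<le> \<mu>2 * (sqrt (2 / \<kappa>) + NN \<phi>1)^4"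
    using \<mu> b by (auto intro: mult_left_mono)
  ultimately have quart: "\<mu>1 * (NN ?P)^4 + \<mu>2 * (NN ?R)^4 + 2 * \<beta> * sq2 ?P ?R \<le> G"
    unfolding G_def by (simp add: distrib_right)
  \<comment> \<open>This \<tau> maximises \<tau>^2 - \<tau>^4 G/4, and the maximum is 1/G.\<close>
  define \<tau> where "\<tau> = sqrt (2 / G)"
  have \<tau>: "\<tau> > 0" "\<tau>\<^sup>2 = 2 / G" using G by (simp_all add: \<tau>_def)
  have "1 / G = \<tau>\<^sup>2 - 1/4 * (\<tau>\<^sup>2)\<^sup>2 * G" unfolding \<tau>(2) using G by (simp add: power2_eq_square field_simps)
  also have "\<dots> \<le> \<tau>\<^sup>2 - 1/4 * (\<tau>\<^sup>2)\<^sup>2 * (\<mu>1 * (NN ?P)^4 + \<mu>2 * (NN ?R)^4 + 2 * \<beta> * sq2 ?P ?R)"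
    using quart by (intro diff_left_mono mult_left_mono) auto
  also have "\<dots> = energy \<Omega> lam \<mu>1 \<mu>2 \<beta> (\<tau> *\<^sub>R ?P, \<tau> *\<^sub>R ?R)"
  proof -
    have "Q (\<tau> *\<^sub>R ?P) (\<tau> *\<^sub>R ?P) + Q (\<tau> *\<^sub>R ?R) (\<tau> *\<^sub>R ?R) = 2 * \<tau>\<^sup>2"
      unfolding Q.scale_both[OF phi_mem[OF PH]] Q.scale_both[OF phi_mem[OF RH]] Q_shift[OF PH] Q_shift[OF RH]
      using sum by (simp flip: distrib_left)
    then show ?thesis
      unfolding energy_eq[OF H10_mem(2)[OF phi_mem[OF PH]] H10_mem(2)[OF phi_mem[OF RH]]] NN_scale_power4 sq2_scale
      by (simp add: power2_eq_square power4_eq_xxxx algebra_simps)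
  qed
  also have "(\<tau> *\<^sub>R ?P, \<tau> *\<^sub>R ?R) = hadd (hscale (\<tau> * c) (U, V)) (tvec \<phi>1 (\<tau> * (c * shift U + s)) (\<tau> * (c * shift V + t)))"
    by (simp add: hadd_eq hscale_eq tvec_eq P_def R_def repr_def scaleR_add_right scaleR_add_left distrib_left)
  also have "energy \<Omega> lam \<mu>1 \<mu>2 \<beta> \<dots> \<le> energy \<Omega> lam \<mu>1 \<mu>2 \<beta> (U, V)"
    using \<tau> c by (intro max) simp
  finally show "ereal (1 / G) \<le> ereal (energy \<Omega> lam \<mu>1 \<mu>2 \<beta> Z)" unfolding UV by simp
qed

text \<open>After clearing denominators both sides have leading order \<beta>^2, with coefficients 1
  - \<delta> and 1. What remains is \<beta>^2 \<delta> against a term linear in \<beta> and the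
  constant \<mu>1 \<mu>2, and the threshold is chosen so that \<beta> \<delta> exceeds \<kappa>^2
  m/2 + \<mu>1 \<mu>2.\<close>

lemma level_comparison:
  fixes \<kappa> \<delta> m \<beta> \<mu>1 \<mu>2 :: real
  assumes "\<kappa> > 0" "\<delta> > 0" "m \<ge> 0" "\<mu>1 > 0" "\<mu>2 > 0"
    and \<beta>: "\<beta> > (\<kappa>\<^sup>2 * m / 2 + \<mu>1 * \<mu>2) / \<delta> + \<mu>1 + \<mu>2 + 1" and G: "m + 2 * \<beta> * (1 - \<delta>) / \<kappa>\<^sup>2 > 0"
  shows "1/4 * \<kappa>\<^sup>2 * ((2 * \<beta> - \<mu>1 - \<mu>2) / (\<beta>\<^sup>2 - \<mu>1 * \<mu>2)) < 1 / (m + 2 * \<beta> * (1 - \<delta>) / \<kappa>\<^sup>2)"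
proof -
  let ?G = "m + 2 * \<beta> * (1 - \<delta>) / \<kappa>\<^sup>2"
  have k: "\<kappa>\<^sup>2 > 0" using assms(1) by simp
  have f: "(\<kappa>\<^sup>2 * m / 2 + \<mu>1 * \<mu>2) / \<delta> \<ge> 0" using assms by simp
  then have b1: "\<beta> > 1" "\<beta> > \<mu>1" "\<beta> > \<mu>2" using assms by linarith+
  have "(\<kappa>\<^sup>2 * m / 2 + \<mu>1 * \<mu>2) / \<delta> < \<beta>" using assms f by linarith
  then have "\<kappa>\<^sup>2 * m / 2 + \<mu>1 * \<mu>2 < \<beta> * \<delta>" using assms(2) by (simp add: pos_divide_less_eq)
  then have "\<mu>1 * \<mu>2 < \<beta> * \<delta> - \<kappa>\<^sup>2 * m / 2" by simp
  moreover have "\<mu>1 * \<mu>2 > 0" using assms by simp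
  \<comment> \<open>Multiplying the right-hand side by \<beta> > 1 yields the inequality that is
    quadratic in \<beta>.\<close>
  ultimately have "1 * (\<mu>1 * \<mu>2) < \<beta> * (\<beta> * \<delta> - \<kappa>\<^sup>2 * m / 2)"
    using b1(1) by (intro mult_strict_mono) auto
  then have key: "\<mu>1 * \<mu>2 < \<beta>\<^sup>2 * \<delta> - \<beta> * (\<kappa>\<^sup>2 * m / 2)" by (simp add: power2_eq_square algebra_simps)
  have "\<mu>1 * \<mu>2 < \<beta> * \<beta>" using assms b1 by (intro mult_strict_mono) auto
  then have D: "\<beta>\<^sup>2 - \<mu>1 * \<mu>2 > 0" by (simp add: power2_eq_square)
  have "1/4 * \<kappa>\<^sup>2 * (2 * \<beta> - \<mu>1 - \<mu>2) * ?G \<le> 1/4 * \<kappa>\<^sup>2 * (2 * \<beta>) * ?G"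
    using assms k by (intro mult_right_mono mult_left_mono) auto
  also have "\<dots> = \<beta> * (\<kappa>\<^sup>2 * m / 2) + \<beta>\<^sup>2 * (1 - \<delta>)"
  proof -
    have "1/4 * l * (2 * \<beta>) * (m + y / l) = \<beta> * (l * m / 2) + \<beta> * y / 2" if "l > 0" for l y
      using that by (simp add: field_simps)
    from this[OF k] show ?thesis by (simp add: power2_eq_square[of \<beta>] mult.assoc)
  qed
  also have "\<dots> < \<beta>\<^sup>2 - \<mu>1 * \<mu>2" using key by (simp add: algebra_simps)
  finally have "1/4 * \<kappa>\<^sup>2 * (2 * \<beta> - \<mu>1 - \<mu>2) < (\<beta>\<^sup>2 - \<mu>1 * \<mu>2) / ?G"
    using G by (simp add: pos_less_divide_eq)
  then show ?thesis using D G by (simp add: divide_simps mult_ac)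
qed

lemma levels:
  assumes \<mu>: "\<mu>1 > 0" "\<mu>2 > 0"
  shows "\<exists>\<beta>0>0. \<forall>\<beta>>\<beta>0.
     inf_level \<Omega> lam \<mu>1 \<mu>2 \<beta> (NehariN \<Omega> lam \<phi>1 \<mu>1 \<mu>2 \<beta>)
       \<le> inf_level \<Omega> lam \<mu>1 \<mu>2 \<beta> (CritK \<Omega> lam \<phi>1 \<mu>1 \<mu>2 \<beta>)
   \<and> inf_level \<Omega> lam \<mu>1 \<mu>2 \<beta> (CritK \<Omega> lam \<phi>1 \<mu>1 \<mu>2 \<beta>)
       < inf_level \<Omega> lam \<mu>1 \<mu>2 \<beta> (NehariN' \<Omega> lam \<phi>1 \<mu>1 \<mu>2 \<beta>)"
proof -
  obtain W \<kappa> where W: "L4min W" "NN W = 1" "Q W W = \<kappa>" and \<kappa>: "\<kappa> > 0"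
    and min: "\<And>V. V \<in> H10 \<Omega> \<Longrightarrow> \<kappa> * (pn V)\<^sup>2 \<le> Q V V" and weak: "\<And>V. V \<in> H10 \<Omega> \<Longrightarrow> Q W V = \<kappa> * cub W V"
    using scalar_ground_state by blast
  from coupling_gap[OF \<kappa> min] obtain \<delta>0 where \<delta>0: "\<delta>0 > 0" and gap0: "\<And>P R. L4min P \<Longrightarrow> L4min R \<Longrightarrow> Q P P + Q R R = 2 \<Longrightarrow>
      \<exists>s t. \<bar>s\<bar> \<le> 1 \<and> \<bar>t\<bar> \<le> 1 \<and> \<kappa>\<^sup>2 * sq2 (P + s *\<^sub>R \<phi>1) (R + t *\<^sub>R \<phi>1) \<le> 1 - \<delta>0"
    by blast
  \<comment> \<open>Capped at 1/2 to keep 1 - \<delta>, and with it G, positive; the smaller value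
    is still a valid gap.\<close>
  define \<delta> where "\<delta> = min \<delta>0 (1/2)"
  have \<delta>: "\<delta> > 0" "\<delta> \<le> \<delta>0" "\<delta> < 1" using \<delta>0 by (simp_all add: \<delta>_def)
  have gap: "\<exists>s t. \<bar>s\<bar> \<le> 1 \<and> \<bar>t\<bar> \<le> 1 \<and> \<kappa>\<^sup>2 * sq2 (P + s *\<^sub>R \<phi>1) (R + t *\<^sub>R \<phi>1) \<le> 1 - \<delta>"
    if PR: "L4min P" "L4min R" "Q P P + Q R R = 2" for P R
  proof -
    obtain s t where st: "\<bar>s\<bar> \<le> 1" "\<bar>t\<bar> \<le> 1" "\<kappa>\<^sup>2 * sq2 (P + s *\<^sub>R \<phi>1) (R + t *\<^sub>R \<phi>1) \<le> 1 - \<delta>0"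
      using gap0[OF PR] by blast
    have "1 - \<delta>0 \<le> 1 - \<delta>" using \<delta>(2) by simp
    with st show ?thesis using order_trans by blast
  qed
  define m where "m = (\<mu>1 + \<mu>2) * (sqrt (2 / \<kappa>) + NN \<phi>1)^4"
  have m: "m \<ge> 0" using \<mu> by (simp add: m_def)
  define \<beta>0 where "\<beta>0 = (\<kappa>\<^sup>2 * m / 2 + \<mu>1 * \<mu>2) / \<delta> + \<mu>1 + \<mu>2 + 1"
  have f: "(\<kappa>\<^sup>2 * m / 2 + \<mu>1 * \<mu>2) / \<delta> \<ge> 0" using \<mu> m \<delta>(1) by simp
  have \<beta>0: "\<beta>0 > 0" "\<beta>0 > \<mu>1" "\<beta>0 > \<mu>2" unfolding \<beta>0_def using f \<mu> by linarith+
  show ?thesis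
  proof (intro exI[of _ \<beta>0] conjI allI impI \<beta>0(1))
    fix \<beta> assume \<beta>: "\<beta> > \<beta>0"
    then have b: "\<beta> > 0" "\<beta> > \<mu>1" "\<beta> > \<mu>2" using \<beta>0 by linarith+
    show "inf_level \<Omega> lam \<mu>1 \<mu>2 \<beta> (NehariN \<Omega> lam \<phi>1 \<mu>1 \<mu>2 \<beta>)
       \<le> inf_level \<Omega> lam \<mu>1 \<mu>2 \<beta> (CritK \<Omega> lam \<phi>1 \<mu>1 \<mu>2 \<beta>)"
      unfolding inf_level_def by (rule INF_superset_mono[OF CritK_subset_NehariN order_refl])
    have G: "m + 2 * \<beta> * (1 - \<delta>) / \<kappa>\<^sup>2 > 0" using m b(1) \<delta>(3) \<kappa> by (intro add_nonneg_pos) simp_all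
    note crit_level_le[OF \<kappa> W weak \<mu> b(2,3)]
    also have "ereal (1/4 * \<kappa>\<^sup>2 * ((2 * \<beta> - \<mu>1 - \<mu>2) / (\<beta>\<^sup>2 - \<mu>1 * \<mu>2))) < ereal (1 / (m + 2 * \<beta> * (1 - \<delta>) / \<kappa>\<^sup>2))"
      using level_comparison[OF \<kappa> \<delta>(1) m \<mu> \<beta>[unfolded \<beta>0_def] G] by simp
    also have "\<dots> \<le> inf_level \<Omega> lam \<mu>1 \<mu>2 \<beta> (NehariN' \<Omega> lam \<phi>1 \<mu>1 \<mu>2 \<beta>)"
      using NehariN'_level_ge[OF \<kappa> min gap \<mu> b(1)] G unfolding m_def by blast
    finally show "inf_level \<Omega> lam \<mu>1 \<mu>2 \<beta> (CritK \<Omega> lam \<phi>1 \<mu>1 \<mu>2 \<beta>)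
       < inf_level \<Omega> lam \<mu>1 \<mu>2 \<beta> (NehariN' \<Omega> lam \<phi>1 \<mu>1 \<mu>2 \<beta>)" .
  qed
qed

end

theorem theorem1p5:
  fixes \<Omega> :: "'a::euclidean_space set" and lam1 \<mu>1 \<mu>2 :: real and \<phi>1 :: "'a h1"
  assumes "DIM('a) \<le> 3"
    and "smooth_bounded_domain \<Omega>"
    and "\<mu>1 > 0" and "\<mu>2 > 0"
    and "principal_eigen \<Omega> lam1 \<phi>1"
  shows "\<exists>\<beta>0>0. \<forall>\<beta>>\<beta>0.
     inf_level \<Omega> lam1 \<mu>1 \<mu>2 \<beta> (NehariN \<Omega> lam1 \<phi>1 \<mu>1 \<mu>2 \<beta>)
       \<le> inf_level \<Omega> lam1 \<mu>1 \<mu>2 \<beta> (CritK \<Omega> lam1 \<phi>1 \<mu>1 \<mu>2 \<beta>)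
   \<and> inf_level \<Omega> lam1 \<mu>1 \<mu>2 \<beta> (CritK \<Omega> lam1 \<phi>1 \<mu>1 \<mu>2 \<beta>)
       < inf_level \<Omega> lam1 \<mu>1 \<mu>2 \<beta> (NehariN' \<Omega> lam1 \<phi>1 \<mu>1 \<mu>2 \<beta>)"
proof -
  interpret eigen_domain \<Omega> lam1 \<phi>1
    by unfold_locales (use assms in \<open>simp_all add: smooth_bounded_domain_def\<close>)
  show ?thesis by (rule levels[OF assms(3,4)])
qed

end
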